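(* Let $k$ be an algebraically closed field of characteristic zero, $n$ a positive integer with $4\mid n$, $q\in k$ a primitive $n^2$-th root of unity, and $A=\mathrm{Qu}_q(\mathfrak{sl}_2)$. Let $f_{2m,j}\in\mathbb Z[g,x]$ ($0\le m\le\frac{n^2}{2}-1$, $j=0,1$) be the polynomials defined in the context, and let $I$ be the ideal of the polynomial ring $\mathbb Z[g,x]$ generated by $g^2-1$ and $f_{n^2-2,0}\,x-2f_{n^2-2,1}-f_{n^2-4,0}-2$. Then the Grothendieck ring $K_0$ of $A$ is isomorphic to the quotient ring $\mathbb Z[g,x]/I$.
   Context: Let $\mathfrak q:=q^n$. The associative unital $k$-algebra $A=\mathrm{Qu}_q(\mathfrak{sl}_2)$ is generated by $\kappa,\hat\kappa,E,F$ with relations $\kappa^n=1$, $\hat\kappa^n=\kappa^{-2}$, $\kappa\hat\kappa=\hat\kappa\kappa$, $\kappa E\kappa^{-1}=\mathfrak qE$, $\kappa F\kappa^{-1}=\mathfrak q^{-1}F$, $\hat\kappa E\hat\kappa^{-1}=\mathfrak q q^{-2}E$, $\hat\kappa F\hat\kappa^{-1}=\mathfrak q^{-1}q^2F$, $E^{n^2}=F^{n^2}=0$, $FE-q^{-1}EF=1-\kappa^{-1}\hat\kappa$. Put $1_i=\frac1n\sum_{r=0}^{n-1}(\mathfrak q^{n-i})^r\kappa^r$ and $\flat=\sum_{i=0}^{n-1}q^{-i}1_i$. $A$ is a quasi-Hopf algebra with reassociator $\sum_{i,j,r=0}^{n-1}\mathfrak q^{-i[\frac{j+r}{n}]}1_i\otimes1_j\otimes1_r$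 ($[\cdot]$ the integer part), comultiplication $\Delta(\kappa)=\kappa\otimes\kappa$, $\Delta(\hat\kappa)=\hat\kappa\otimes\hat\kappa$, $\Delta(E)=E\otimes\flat^{-1}+\kappa^{-1}\otimes1_0E+1\otimes\sum_{i=1}^{n-1}1_iE$, $\Delta(F)=F\otimes\flat+\kappa^{-1}\hat\kappa\otimes F\sum_{i=1}^{n-1}1_i+\hat\kappa\otimes F1_0$, and counit $\varepsilon(\kappa)=\varepsilon(\hat\kappa)=1$, $\varepsilon(E)=\varepsilon(F)=0$. For left $A$-modules $M,N$, $M\otimes N$ is $M\otimes_kN$ with $A$ acting through $\Delta$. The Grothendieck ring $K_0$ is the Grothendieck group of the category of finite-dimensional left $A$-modules modulo short exact sequences (free abelian on the classes of simple modules), with product $[M][N]=[M\otimes N]$ and unit the class of the trivial module given by $\varepsilon$. Write $\overline r\in\{0,1\}$ for the residue of $r$ modulo $2$. The polynomials $f_{2m,j}$ are defined inductively by $f_{0,0}=1$, $f_{0,1}=g$, $f_{2,0}=x$, $f_{2,1}=xg$, $f_{4,0}=x^2-xg-1$, $f_{4,1}=x^2g-x-g$, and, for $m\ge2$: if $f_{2m,j}=x^mg^j-a_1f_{2(m-1),\overline{j+1}}-a_2f_{2(m-2),\overline{j+2}}-\cdots-a_mf_{0,\overline{j+m}}$ with integers $a_l=a_l^{(m)}$ (the coefficients produced by the construction, depending on $m$ but not on $j$; for $m=2$ they are $a_1=a_2=1$), then with $a_0=1$ $$f_{2(m+1),j}=x^{m+1}g^j-(1+a_1)f_{2m,\overline{j+1}}-\sum_{l=1}^{m-1}(a_{l-1}+a_l+a_{l+1})f_{2(m-l),\overline{j+l+1}}-a_{m-1}f_{0,\overline{j+m+1}},$$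 so that $a^{(m+1)}_1=1+a_1$, $a^{(m+1)}_{l+1}=a_{l-1}+a_l+a_{l+1}$ for $1\le l\le m-1$, and $a^{(m+1)}_{m+1}=a_{m-1}$. *)

theory Defs
  imports
    "HOL-Algebra.QuotRing"
    "HOL-Algebra.Generated_Groups"
    "HOL-Algebra.Free_Abelian_Groups"
    "HOL-Algebra.Algebraic_Closure_Type"
    "HOL-Computational_Algebra.Polynomial"
    "Jordan_Normal_Form.Matrix"
begin

section \<open>The algebra $\mathrm{Qu}_q(\mathfrak{sl}_2)$\<close>

datatype gen = gen_kappa | gen_kappa_hat | gen_E | gen_F

text \<open>
  The free associative unital algebra on the four generators: finitely supported functions on
  words. The sum in the product runs over all ways of cutting the word \<open>w\<close> in two.
\<close>

definition free_alg :: "(gen list \<Rightarrow> 'k::field) ring" where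
  "free_alg = \<lparr>
     carrier = {f. finite {w. f w \<noteq> 0}},
     monoid.mult = (\<lambda>f g w. \<Sum>i\<le>length w. f (take i w) * g (drop i w)),
     one = (\<lambda>w. if w = [] then 1 else 0),
     zero = (\<lambda>w. 0),
     add = (\<lambda>f g w. f w + g w)\<rparr>"

definition free_scal :: "'k::field \<Rightarrow> gen list \<Rightarrow> 'k" where
  "free_scal c = (\<lambda>w. if w = [] then c else 0)"

definition free_gen :: "gen \<Rightarrow> gen list \<Rightarrow> 'k::field" where
  "free_gen s = (\<lambda>w. if w = [s] then 1 else 0)"

text \<open>
  The free algebra has no inverses, so the defining relations are written without them:
  \<open>\<kappa> E = \<qq> E \<kappa>\<close> stands for \<open>\<kappa> E \<kappa>\<inverse> = \<qq> E\<close> (similarly for the other commutation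
  relations), the relation between the powers of the two group-like generators is multiplied by
  \<open>\<kappa>\<^sup>2\<close>, and \<open>\<kappa>\<inverse>\<close> is \<open>\<kappa> ^ (n - 1)\<close>. Both \<open>\<kappa>\<close> and \<open>\<kappa>'\<close> (the generator with a hat)
  become units in the quotient by the first two relations, so that the relations with inverses
  are recovered there. Here \<open>\<qq> = q ^ n\<close>.
\<close>

definition qu_relations :: "nat \<Rightarrow> 'k::field \<Rightarrow> (gen list \<Rightarrow> 'k) set" where
  "qu_relations n q =
    (let \<kappa> = free_gen gen_kappa; \<kappa>' = free_gen gen_kappa_hat;
         E = free_gen gen_E; F = free_gen gen_F; \<qq> = q ^ n in
     { \<kappa> [^]\<^bsub>free_alg\<^esub> n \<ominus>\<^bsub>free_alg\<^esub> \<one>\<^bsub>free_alg\<^esub>,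
       \<kappa>' [^]\<^bsub>free_alg\<^esub> n \<otimes>\<^bsub>free_alg\<^esub> \<kappa> [^]\<^bsub>free_alg\<^esub> (2::nat) \<ominus>\<^bsub>free_alg\<^esub> \<one>\<^bsub>free_alg\<^esub>,
       \<kappa> \<otimes>\<^bsub>free_alg\<^esub> \<kappa>' \<ominus>\<^bsub>free_alg\<^esub> \<kappa>' \<otimes>\<^bsub>free_alg\<^esub> \<kappa>,
       \<kappa> \<otimes>\<^bsub>free_alg\<^esub> E \<ominus>\<^bsub>free_alg\<^esub> free_scal \<qq> \<otimes>\<^bsub>free_alg\<^esub> E \<otimes>\<^bsub>free_alg\<^esub> \<kappa>,
       \<kappa> \<otimes>\<^bsub>free_alg\<^esub> F \<ominus>\<^bsub>free_alg\<^esub> free_scal (inverse \<qq>) \<otimes>\<^bsub>free_alg\<^esub> F \<otimes>\<^bsub>free_alg\<^esub> \<kappa>,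
       \<kappa>' \<otimes>\<^bsub>free_alg\<^esub> E
         \<ominus>\<^bsub>free_alg\<^esub> free_scal (\<qq> * inverse q ^ 2) \<otimes>\<^bsub>free_alg\<^esub> E \<otimes>\<^bsub>free_alg\<^esub> \<kappa>',
       \<kappa>' \<otimes>\<^bsub>free_alg\<^esub> F
         \<ominus>\<^bsub>free_alg\<^esub> free_scal (inverse \<qq> * q ^ 2) \<otimes>\<^bsub>free_alg\<^esub> F \<otimes>\<^bsub>free_alg\<^esub> \<kappa>',
       E [^]\<^bsub>free_alg\<^esub> (n ^ 2),
       F [^]\<^bsub>free_alg\<^esub> (n ^ 2),
       (F \<otimes>\<^bsub>free_alg\<^esub> E \<ominus>\<^bsub>free_alg\<^esub> free_scal (inverse q) \<otimes>\<^bsub>free_alg\<^esub> E \<otimes>\<^bsub>free_alg\<^esub> F)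
         \<ominus>\<^bsub>free_alg\<^esub> (\<one>\<^bsub>free_alg\<^esub> \<ominus>\<^bsub>free_alg\<^esub> \<kappa> [^]\<^bsub>free_alg\<^esub> (n - 1) \<otimes>\<^bsub>free_alg\<^esub> \<kappa>') })"

type_synonym 'k qu_elem = "(gen list \<Rightarrow> 'k) set"

definition qu_ideal :: "nat \<Rightarrow> 'k::field \<Rightarrow> (gen list \<Rightarrow> 'k) set" where
  "qu_ideal n q = Idl\<^bsub>free_alg\<^esub> (qu_relations n q)"

definition qu_alg :: "nat \<Rightarrow> 'k::field \<Rightarrow> 'k qu_elem ring" where
  "qu_alg n q = free_alg Quot (qu_ideal n q)"

definition qu_scal :: "nat \<Rightarrow> 'k::field \<Rightarrow> 'k \<Rightarrow> 'k qu_elem" where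
  "qu_scal n q c = qu_ideal n q +>\<^bsub>free_alg\<^esub> free_scal c"

definition qu_gen :: "nat \<Rightarrow> 'k::field \<Rightarrow> gen \<Rightarrow> 'k qu_elem" where
  "qu_gen n q s = qu_ideal n q +>\<^bsub>free_alg\<^esub> free_gen s"

text \<open>The elements $1_i$ and $\flat$.\<close>

definition qu_idem :: "nat \<Rightarrow> 'k::field \<Rightarrow> nat \<Rightarrow> 'k qu_elem" where
  "qu_idem n q i =
     qu_scal n q (1 / of_nat n) \<otimes>\<^bsub>qu_alg n q\<^esub>
     (\<Oplus>\<^bsub>qu_alg n q\<^esub>r\<in>{0..<n}.
        qu_scal n q (((q ^ n) ^ (n - i)) ^ r) \<otimes>\<^bsub>qu_alg n q\<^esub> qu_gen n q gen_kappa [^]\<^bsub>qu_alg n q\<^esub> r)"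

definition qu_flat :: "nat \<Rightarrow> 'k::field \<Rightarrow> 'k qu_elem" where
  "qu_flat n q =
     (\<Oplus>\<^bsub>qu_alg n q\<^esub>i\<in>{0..<n}. qu_scal n q (inverse q ^ i) \<otimes>\<^bsub>qu_alg n q\<^esub> qu_idem n q i)"

text \<open>
  The comultiplication on the generators; the list $[(a_1,b_1),\dots,(a_r,b_r)]$ stands for the
  tensor $\sum_s a_s \otimes b_s$ in $A \otimes A$.
\<close>

fun qu_comult :: "nat \<Rightarrow> 'k::field \<Rightarrow> gen \<Rightarrow> ('k qu_elem \<times> 'k qu_elem) list" where
  "qu_comult n q gen_kappa = [(qu_gen n q gen_kappa, qu_gen n q gen_kappa)]"
| "qu_comult n q gen_kappa_hat = [(qu_gen n q gen_kappa_hat, qu_gen n q gen_kappa_hat)]"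
| "qu_comult n q gen_E =
    (let A = qu_alg n q; \<kappa> = qu_gen n q gen_kappa; E = qu_gen n q gen_E in
     [(E, inv\<^bsub>A\<^esub> (qu_flat n q)),
      (inv\<^bsub>A\<^esub> \<kappa>, qu_idem n q 0 \<otimes>\<^bsub>A\<^esub> E),
      (\<one>\<^bsub>A\<^esub>, (\<Oplus>\<^bsub>A\<^esub>i\<in>{1..<n}. qu_idem n q i \<otimes>\<^bsub>A\<^esub> E))])"
| "qu_comult n q gen_F =
    (let A = qu_alg n q; \<kappa> = qu_gen n q gen_kappa; \<kappa>' = qu_gen n q gen_kappa_hat;
         F = qu_gen n q gen_F in
     [(F, qu_flat n q),
      (inv\<^bsub>A\<^esub> \<kappa> \<otimes>\<^bsub>A\<^esub> \<kappa>', F \<otimes>\<^bsub>A\<^esub> (\<Oplus>\<^bsub>A\<^esub>i\<in>{1..<n}. qu_idem n q i)),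
      (\<kappa>', F \<otimes>\<^bsub>A\<^esub> qu_idem n q 0)])"

fun qu_counit :: "gen \<Rightarrow> 'k::field" where
  "qu_counit gen_kappa = 1"
| "qu_counit gen_kappa_hat = 1"
| "qu_counit gen_E = 0"
| "qu_counit gen_F = 0"


section \<open>Finite-dimensional modules\<close>

text \<open>
  A finite-dimensional left module is taken on a column space $k^d$: it is a pair \<open>(d, \<rho>)\<close>
  with \<open>\<rho>\<close> a unital $k$-algebra homomorphism from $A$ to the $d \times d$ matrices (\<open>d = 0\<close> is the
  zero module). Every finite-dimensional module is isomorphic to one of these. Only the values of
  \<open>\<rho>\<close> on the carrier of $A$ matter.
\<close>

type_synonym 'k qu_module = "nat \<times> ('k qu_elem \<Rightarrow> 'k mat)"

definition qu_modules :: "nat \<Rightarrow> 'k::field \<Rightarrow> 'k qu_module set" where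
  "qu_modules n q =
     {(d, \<rho>). \<rho> \<in> Ring.ring_hom (qu_alg n q) (ring_mat TYPE('k) d ()) \<and>
              (\<forall>c. \<rho> (qu_scal n q c) = c \<cdot>\<^sub>m 1\<^sub>m d)}"

definition qu_module_hom ::
  "nat \<Rightarrow> 'k::field \<Rightarrow> 'k qu_module \<Rightarrow> 'k qu_module \<Rightarrow> 'k mat \<Rightarrow> bool" where
  "qu_module_hom n q M N f \<longleftrightarrow>
     f \<in> carrier_mat (fst N) (fst M) \<and>
     (\<forall>a\<in>carrier (qu_alg n q). f * snd M a = snd N a * f)"

definition qu_short_exact ::
  "nat \<Rightarrow> 'k::field \<Rightarrow> 'k qu_module \<Rightarrow> 'k qu_module \<Rightarrow> 'k qu_module \<Rightarrow> bool" where
  "qu_short_exact n q L M N \<longleftrightarrow>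
     (\<exists>f g. qu_module_hom n q L M f \<and> qu_module_hom n q M N g \<and>
        inj_on (\<lambda>v. f *\<^sub>v v) (carrier_vec (fst L)) \<and>
        (\<lambda>v. f *\<^sub>v v) ` carrier_vec (fst L) = {v \<in> carrier_vec (fst M). g *\<^sub>v v = 0\<^sub>v (fst N)} \<and>
        (\<lambda>v. g *\<^sub>v v) ` carrier_vec (fst M) = carrier_vec (fst N))"

text \<open>
  The module given by the matrices \<open>G s\<close> by which the generators \<open>s\<close> act: a word acts by the
  product of matrices, and a coset in $A$ acts as any of its representatives (the choice is
  immaterial when the matrices satisfy the defining relations).
\<close>

definition word_mat :: "nat \<Rightarrow> (gen \<Rightarrow> 'k::field mat) \<Rightarrow> gen list \<Rightarrow> 'k mat" where
  "word_mat d G w = foldr (\<lambda>s P. G s * P) w (1\<^sub>m d)"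

definition free_eval :: "nat \<Rightarrow> (gen \<Rightarrow> 'k::field mat) \<Rightarrow> (gen list \<Rightarrow> 'k) \<Rightarrow> 'k mat" where
  "free_eval d G f = mat d d (\<lambda>(i, j). \<Sum>w | f w \<noteq> 0. f w * word_mat d G w $$ (i, j))"

definition module_of_gens :: "nat \<Rightarrow> (gen \<Rightarrow> 'k::field mat) \<Rightarrow> 'k qu_module" where
  "module_of_gens d G = (d, \<lambda>a. free_eval d G (SOME f. f \<in> a))"

text \<open>
  The Kronecker product is the matrix of the tensor product of two linear maps, with the basis
  vector $e_i \otimes e_j$ of $k^d \otimes k^{d'} = k^{dd'}$ numbered $i d' + j$.
\<close>

definition kronecker :: "'k::field mat \<Rightarrow> 'k mat \<Rightarrow> 'k mat" where
  "kronecker A B = mat (dim_row A * dim_row B) (dim_col A * dim_col B)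
     (\<lambda>(i, j). A $$ (i div dim_row B, j div dim_col B) * B $$ (i mod dim_row B, j mod dim_col B))"

definition tensor_action ::
  "'k::field qu_module \<Rightarrow> 'k qu_module \<Rightarrow> ('k qu_elem \<times> 'k qu_elem) list \<Rightarrow> 'k mat" where
  "tensor_action M N ts =
     foldr (\<lambda>(a, b) S. kronecker (snd M a) (snd N b) + S) ts (0\<^sub>m (fst M * fst N) (fst M * fst N))"

definition qu_tensor ::
  "nat \<Rightarrow> 'k::field \<Rightarrow> 'k qu_module \<Rightarrow> 'k qu_module \<Rightarrow> 'k qu_module" where
  "qu_tensor n q M N =
     module_of_gens (fst M * fst N) (\<lambda>s. tensor_action M N (qu_comult n q s))"

definition qu_trivial :: "'k::field qu_module" where
  "qu_trivial = module_of_gens 1 (\<lambda>s. qu_counit s \<cdot>\<^sub>m 1\<^sub>m 1)"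


section \<open>The Grothendieck ring\<close>

text \<open>
  The free abelian group on the modules, with the bilinear extension of the tensor product. It is
  not itself a ring (the product is neither associative nor unital before passing to classes);
  the record only serves to form the quotient below.
\<close>

definition groth_free :: "nat \<Rightarrow> 'k::field \<Rightarrow> ('k qu_module \<Rightarrow>\<^sub>0 int) ring" where
  "groth_free n q = \<lparr>
     carrier = carrier (free_Abelian_group (qu_modules n q)),
     monoid.mult = (\<lambda>x y. frag_extend (\<lambda>M. frag_extend (\<lambda>N. frag_of (qu_tensor n q M N)) y) x),
     one = frag_of qu_trivial,
     zero = 0,
     add = (+)\<rparr>"

definition ses_subgroup :: "nat \<Rightarrow> 'k::field \<Rightarrow> ('k qu_module \<Rightarrow>\<^sub>0 int) set" where
  "ses_subgroup n q =
     generate (free_Abelian_group (qu_modules n q))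
       {frag_of M - frag_of L - frag_of N | L M N.
          L \<in> qu_modules n q \<and> M \<in> qu_modules n q \<and> N \<in> qu_modules n q \<and>
          qu_short_exact n q L M N}"

definition grothendieck_ring :: "nat \<Rightarrow> 'k::field \<Rightarrow> ('k qu_module \<Rightarrow>\<^sub>0 int) set ring" where
  "grothendieck_ring n q = groth_free n q Quot ses_subgroup n q"


section \<open>The polynomials $f_{2m,j}$ in $\mathbb{Z}[g,x]$\<close>

text \<open>$\mathbb{Z}[g,x]$ is realised as $(\mathbb{Z}[g])[x]$.\<close>

definition gvar :: "int poly poly" where "gvar = [:[:0, 1:]:]"

definition xvar :: "int poly poly" where "xvar = [:0, 1:]"

text \<open>
  \<open>acoef m l\<close> is $a_l^{(m)}$ for $m \ge 2$ and $0 \le l \le m$ (with $a_0^{(m)} = 1$); the values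
  for \<open>m < 2\<close> or \<open>l > m\<close> are not used. In the last equation \<open>m\<close> plays the role of the index
  called $m$ in the recursion for $a^{(m+1)}$, so \<open>m \<ge> 2\<close>.
\<close>

fun acoef :: "nat \<Rightarrow> nat \<Rightarrow> int" where
  "acoef 0 l = 0"
| "acoef (Suc 0) l = 0"
| "acoef (Suc (Suc 0)) l = (if l \<le> 2 then 1 else 0)"
| "acoef (Suc (Suc (Suc m'))) l =
    (let m = Suc (Suc m') in
      if l = 0 then 1
      else if l = 1 then 1 + acoef m 1
      else if l \<le> m then acoef m (l - 2) + acoef m (l - 1) + acoef m l
      else if l = m + 1 then acoef m (m - 1)
      else 0)"

text \<open>\<open>fpoly m j\<close> is $f_{2m,\overline j}$ (the first index is halved).\<close>

fun fpoly :: "nat \<Rightarrow> nat \<Rightarrow> int poly poly" where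
  "fpoly 0 j = (if even j then 1 else gvar)"
| "fpoly (Suc 0) j = (if even j then xvar else xvar * gvar)"
| "fpoly (Suc (Suc 0)) j =
    (if even j then xvar ^ 2 - xvar * gvar - 1 else xvar ^ 2 * gvar - xvar - gvar)"
| "fpoly (Suc (Suc (Suc m'))) j =
    (let m = Suc (Suc m') in
      xvar ^ (m + 1) * gvar ^ (j mod 2)
      - of_int (1 + acoef m 1) * fpoly m (j + 1)
      - (\<Sum>l = 1..m - 1. of_int (acoef m (l - 1) + acoef m l + acoef m (l + 1))
                          * fpoly (m - l) (j + l + 1))
      - of_int (acoef m (m - 1)) * fpoly 0 (j + m + 1))"

end

theory Submission
  imports Defs
begin

text \<open>
  Put $N = n^2/2$. The simple modules are $S_{m,j}$ with $0 \le m < N$, $j < 2$, of dimension $2m + 1$: a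
  lowest weight vector exists in every nonzero module and its powers under $E$ span a copy of some $S_{m,j}$.
  Hence the classes $[S_{m,j}]$ span $K_0$, and they are independent because traces are additive on short
  exact sequences. Send $[S_{m,j}]$ to $g^j U_m$, where $U_0 = 1$, $U_1 = gx$,
  $U_{m+2} = (gx - 1) U_{m+1} - U_m$. Modulo $g^2 - 1$ one has $f_{2m,j} = g^{m+j} U_m$, so the second
  generator of the ideal becomes $U_N - U_{N-1} - 2$, and the elements $g^j U_m$ with $m < N$ form a basis of
  the quotient ring. Multiplicativity needs no decomposition of $S_{m,j} \otimes S_{l,i}$: this module is
  graded, and the class of a graded module can be read off the degrees of a homogeneous basis, which add
  under tensor products.
\<close>

section \<open>The free algebra and its representations\<close>

text \<open>The eigenvalues of kappa and kappa-hat do not suffice to find composition factors: they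
  see degrees only modulo N, and the weights of S_{m,j} and S_{N-1-m,j} together fill every residue
  class exactly twice, whatever m is. Two devices get around this. For independence, the trace is
  tested on elements involving EF, which tells the middle weight vectors of different S_{m,j} apart.
  For products, an integer grading is carried along, in which degrees are not reduced. Put y = gx
  and write y - 1 as t + 1/t. Then U_m is t^m + ... + t^-m, and the second generator becomes t^N +
  t^-N - 2. A homogeneous vector of degree i contributes t^i + t^-i. This symmetrised count yields
  twice the class, so it has to be known that the quotient has no 2-torsion; the integral basis
  provides this. The record \<open>groth_free\<close> is not a ring, and \<open>ses_subgroup\<close>
  is not known in advance to behave like an ideal. Therefore the isomorphism is built from Z[g,x]
  towards K_0, and K_0 inherits its ring axioms as a homomorphic image.\<close>

lemma sum_convolution_assoc:
  fixes a :: "nat \<Rightarrow> nat \<Rightarrow> 'b::comm_monoid_add"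
  shows "(\<Sum>i\<le>n. \<Sum>j\<le>i. a j i) = (\<Sum>j\<le>n. \<Sum>k\<le>n - j. a j (j + k))"
proof -
  have "(\<Sum>i\<le>n. \<Sum>j\<le>i. a j i) = sum (\<lambda>(i,j). a j i) (SIGMA i:{..n}. {..i})"
    by (simp add: sum.Sigma)
  also have "\<dots> = sum (\<lambda>(j,k). a j (j + k)) (SIGMA j:{..n}. {..n - j})"
    by (rule sum.reindex_bij_witness[where i = "\<lambda>(j,k). (j + k, j)" and j = "\<lambda>(i,j). (j, i - j)"]) auto
  also have "\<dots> = (\<Sum>j\<le>n. \<Sum>k\<le>n - j. a j (j + k))"
    by (simp add: sum.Sigma)
  finally show ?thesis .
qed

lemma free_alg_simps:
  "carrier free_alg = {f :: gen list \<Rightarrow> 'k::field. finite {w. f w \<noteq> 0}}"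
  "x \<otimes>\<^bsub>free_alg\<^esub> y = (\<lambda>w. \<Sum>i\<le>length w. x (take i w) * y (drop i w))"
  "\<one>\<^bsub>free_alg\<^esub> = (\<lambda>w. if w = [] then 1 else (0::'k))"
  "\<zero>\<^bsub>free_alg\<^esub> = (\<lambda>w. (0::'k))"
  "x \<oplus>\<^bsub>free_alg\<^esub> y = (\<lambda>w. x w + y w)"
  by (simp_all add: free_alg_def)

lemma free_alg_mult_finite:
  fixes x y :: "gen list \<Rightarrow> 'k::field"
  assumes "finite {w. x w \<noteq> 0}" "finite {w. y w \<noteq> 0}"
  shows "finite {w. (\<Sum>i\<le>length w. x (take i w) * y (drop i w)) \<noteq> 0}"
proof (rule finite_subset)
  show "{w. (\<Sum>i\<le>length w. x (take i w) * y (drop i w)) \<noteq> 0}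
     \<subseteq> (\<lambda>(u,v). u @ v) ` ({w. x w \<noteq> 0} \<times> {w. y w \<noteq> 0})"
  proof
    fix w assume "w \<in> {w. (\<Sum>i\<le>length w. x (take i w) * y (drop i w)) \<noteq> 0}"
    then obtain i where "x (take i w) * y (drop i w) \<noteq> 0"
      by (metis (mono_tags, lifting) mem_Collect_eq sum.neutral)
    then show "w \<in> (\<lambda>(u,v). u @ v) ` ({w. x w \<noteq> 0} \<times> {w. y w \<noteq> 0})"
      by (intro image_eqI[where x = "(take i w, drop i w)"]) auto
  qed
qed (use assms in auto)

lemma ring_free_alg: "ring (free_alg :: (gen list \<Rightarrow> 'k::field) ring)"
proof (rule ringI)
  let ?A = "free_alg :: (gen list \<Rightarrow> 'k::field) ring"
  have addc: "finite {w. x w + y w \<noteq> 0}"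
    if "finite {w. x w \<noteq> (0::'k)}" "finite {w. y w \<noteq> 0}" for x y :: "gen list \<Rightarrow> 'k"
    by (rule finite_subset[of _ "{w. x w \<noteq> 0} \<union> {w. y w \<noteq> 0}"]) (use that in auto)
  show "abelian_group ?A"
  proof (rule abelian_groupI)
    fix x assume "x \<in> carrier ?A"
    then show "\<exists>y\<in>carrier ?A. y \<oplus>\<^bsub>?A\<^esub> x = \<zero>\<^bsub>?A\<^esub>"
      by (intro bexI[of _ "\<lambda>w. - x w"]) (auto simp: free_alg_simps)
  qed (auto simp: free_alg_simps addc add_ac)
  show "monoid ?A"
  proof (rule monoidI)
    fix x y z :: "gen list \<Rightarrow> 'k"
    show "x \<otimes>\<^bsub>?A\<^esub> y \<otimes>\<^bsub>?A\<^esub> z = x \<otimes>\<^bsub>?A\<^esub> (y \<otimes>\<^bsub>?A\<^esub> z)"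
    proof
      fix w :: "gen list"
      let ?a = "\<lambda>j i. x (take j w) * y (drop j (take i w)) * z (drop i w)"
      have "(x \<otimes>\<^bsub>?A\<^esub> y \<otimes>\<^bsub>?A\<^esub> z) w = (\<Sum>i\<le>length w. \<Sum>j\<le>i. ?a j i)"
        by (auto simp: free_alg_simps sum_distrib_right min_def intro!: sum.cong)
      also have "\<dots> = (\<Sum>j\<le>length w. \<Sum>k\<le>length w - j. ?a j (j + k))"
        by (rule sum_convolution_assoc)
      also have "\<dots> = (x \<otimes>\<^bsub>?A\<^esub> (y \<otimes>\<^bsub>?A\<^esub> z)) w"
        by (auto simp: free_alg_simps sum_distrib_left take_drop add_ac mult.assoc intro!: sum.cong)
      finally show "(x \<otimes>\<^bsub>?A\<^esub> y \<otimes>\<^bsub>?A\<^esub> z) w = (x \<otimes>\<^bsub>?A\<^esub> (y \<otimes>\<^bsub>?A\<^esub> z)) w" .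
    qed
  next
    fix x :: "gen list \<Rightarrow> 'k"
    have "(\<Sum>i\<le>length w. (if take i w = [] then 1 else 0) * x (drop i w)) = x w" for w :: "gen list"
    proof -
      have "(\<Sum>i\<le>length w. (if take i w = [] then 1 else 0) * x (drop i w))
         = (\<Sum>i\<le>length w. if i = 0 then x w else 0)"
        by (rule sum.cong) auto
      then show ?thesis by simp
    qed
    then show "\<one>\<^bsub>?A\<^esub> \<otimes>\<^bsub>?A\<^esub> x = x"
      by (simp add: free_alg_simps)
    have "(\<Sum>i\<le>length w. x (take i w) * (if drop i w = [] then 1 else 0)) = x w" for w :: "gen list"
    proof -
      have "(\<Sum>i\<le>length w. x (take i w) * (if drop i w = [] then 1 else 0))
         = (\<Sum>i\<le>length w. if i = length w then x w else 0)"
        by (rule sum.cong) auto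
      then show ?thesis by simp
    qed
    then show "x \<otimes>\<^bsub>?A\<^esub> \<one>\<^bsub>?A\<^esub> = x"
      by (simp add: free_alg_simps)
  qed (auto simp: free_alg_simps free_alg_mult_finite)
qed (auto simp: free_alg_simps sum.distrib algebra_simps)

lemma free_scal_carrier [simp]: "free_scal c \<in> carrier free_alg"
  by (simp add: free_alg_simps free_scal_def)

lemma free_gen_carrier [simp]: "free_gen s \<in> carrier free_alg"
  by (simp add: free_alg_simps free_gen_def)

lemma free_scal_one: "free_scal 1 = \<one>\<^bsub>free_alg\<^esub>"
  by (simp add: free_alg_simps free_scal_def)

lemma free_scal_mult_left: "free_scal c \<otimes>\<^bsub>free_alg\<^esub> x = (\<lambda>w. c * x w)"
proof
  fix w
  have "(\<Sum>i\<le>length w. free_scal c (take i w) * x (drop i w)) = (\<Sum>i\<le>length w. if i = 0 then c * x w else 0)"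
    by (rule sum.cong) (auto simp: free_scal_def)
  then show "(free_scal c \<otimes>\<^bsub>free_alg\<^esub> x) w = c * x w"
    by (simp add: free_alg_simps)
qed

lemma free_gen_mult_left:
  "free_gen s \<otimes>\<^bsub>free_alg\<^esub> (\<lambda>w. if w = v then 1 else 0) = (\<lambda>w. if w = s # v then 1 else (0::'k::field))"
proof
  fix w
  show "(free_gen s \<otimes>\<^bsub>free_alg\<^esub> (\<lambda>w. if w = v then 1 else 0)) w = (if w = s # v then 1 else (0::'k))"
  proof (cases w)
    case Nil
    then show ?thesis by (simp add: free_alg_simps free_gen_def)
  next
    case (Cons a u)
    have "(\<Sum>i\<le>length w. free_gen s (take i w) * (if drop i w = v then 1 else 0))
      = (\<Sum>i\<le>length w. if i = 1 then (if w = s # v then 1 else (0::'k)) else 0)"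
    proof (rule sum.cong)
      fix i assume "i \<in> {..length w}"
      show "free_gen s (take i w) * (if drop i w = v then 1 else 0) = (if i = 1 then (if w = s # v then 1 else (0::'k)) else 0)"
        using Cons \<open>i \<in> _\<close>
        by (cases i) (auto simp: free_gen_def take_Cons')
    qed simp
    moreover have "1 \<in> {..length w}" using Cons by simp
    ultimately show ?thesis by (simp add: free_alg_simps del: length_0_conv)
  qed
qed

text \<open>Each word is a product of generators and each element a finite combination of words, so
  a property stable under sums and products can be checked on scalars and generators. This is how
  commutation with a matrix is transferred from the generators to the whole algebra.\<close>

lemma free_alg_induct [consumes 1, case_names scal gen add mult]:
  fixes x :: "gen list \<Rightarrow> 'k::field"
  assumes x: "x \<in> carrier free_alg"
    and scal: "\<And>c. P (free_scal c)" and gen: "\<And>s. P (free_gen s)"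
    and add: "\<And>x y. x \<in> carrier free_alg \<Longrightarrow> y \<in> carrier free_alg \<Longrightarrow> P x \<Longrightarrow> P y \<Longrightarrow> P (x \<oplus>\<^bsub>free_alg\<^esub> y)"
    and mult: "\<And>x y. x \<in> carrier free_alg \<Longrightarrow> y \<in> carrier free_alg \<Longrightarrow> P x \<Longrightarrow> P y \<Longrightarrow> P (x \<otimes>\<^bsub>free_alg\<^esub> y)"
  shows "P x"
proof -
  interpret ring "free_alg :: (gen list \<Rightarrow> 'k) ring" by (rule ring_free_alg)
  have word: "P (\<lambda>w. if w = v then 1 else 0)" for v
  proof (induction v)
    case Nil
    then show ?case using scal[of 1] by (simp add: free_scal_def cong: if_cong)
  next
    case (Cons s v)
    show ?case
      by (subst free_gen_mult_left[symmetric], rule mult) (simp_all add: Cons gen, simp add: free_alg_simps)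
  qed
  have "P x" if "finite W" "{w. x w \<noteq> 0} \<subseteq> W" for W x
    using that
  proof (induction W arbitrary: x rule: finite_induct)
    case empty
    then have "x = free_scal 0" by (auto simp: free_scal_def)
    then show ?case using scal by simp
  next
    case (insert v W)
    let ?y = "free_scal (x v) \<otimes>\<^bsub>free_alg\<^esub> (\<lambda>w. if w = v then 1 else 0)"
    have y: "?y = (\<lambda>w. if w = v then x v else 0)"
      by (auto simp: free_scal_mult_left)
    have "P ?y" by (rule mult) (simp_all add: word scal, simp add: free_alg_simps)
    moreover have "P (x(v := 0))" by (rule insert.IH) (use insert in auto)
    moreover have "?y \<oplus>\<^bsub>free_alg\<^esub> x(v := 0) = x"
      by (subst y) (auto simp: free_alg_simps)
    moreover have "?y \<in> carrier free_alg" by (subst y) (auto simp: free_alg_simps)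
    moreover have "x(v := 0) \<in> carrier free_alg"
      using finite_subset[OF insert.prems] insert.hyps
      by (auto simp: free_alg_simps elim!: rev_finite_subset)
    ultimately show ?case using add by metis
  qed
  then show ?thesis using x by (auto simp: free_alg_simps)
qed

section \<open>Matrices that satisfy the defining relations\<close>

lemma ring_mat_a_inv: "A \<in> carrier_mat d d \<Longrightarrow> \<ominus>\<^bsub>ring_mat TYPE('k::field) d ()\<^esub> A = - A"
proof -
  interpret ring "ring_mat TYPE('k) d ()" by (rule ring_mat)
  assume "A \<in> carrier_mat d d"
  then show ?thesis
    by (intro minus_equality) (auto simp: ring_mat_simps)
qed

lemma mat_diff_eq_0_iff:
  fixes A B :: "'k::field mat"
  assumes "A \<in> carrier_mat d d'" "B \<in> carrier_mat d d'"
  shows "A - B = 0\<^sub>m d d' \<longleftrightarrow> A = B"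
proof
  assume *: "A - B = 0\<^sub>m d d'"
  show "A = B"
  proof (rule eq_matI)
    fix i j assume "i < dim_row B" "j < dim_col B"
    then show "A $$ (i,j) = B $$ (i,j)"
      using arg_cong[OF *, of "\<lambda>T. T $$ (i,j)"] assms by auto
  qed (use assms in auto)
qed (use assms in auto)

text \<open>The relations keep the inverse-free form of \<open>qu_relations\<close>, so that passing
  between the two is a term by term translation.\<close>

definition qu_rep :: "nat \<Rightarrow> 'k::field \<Rightarrow> nat \<Rightarrow> (gen \<Rightarrow> 'k mat) \<Rightarrow> bool" where
  "qu_rep n q d G \<longleftrightarrow> (\<forall>s. G s \<in> carrier_mat d d) \<and>
    G gen_kappa ^\<^sub>m n = 1\<^sub>m d \<and>
    G gen_kappa_hat ^\<^sub>m n * G gen_kappa ^\<^sub>m 2 = 1\<^sub>m d \<and>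
    G gen_kappa * G gen_kappa_hat = G gen_kappa_hat * G gen_kappa \<and>
    G gen_kappa * G gen_E = q ^ n \<cdot>\<^sub>m (G gen_E * G gen_kappa) \<and>
    G gen_kappa * G gen_F = inverse (q ^ n) \<cdot>\<^sub>m (G gen_F * G gen_kappa) \<and>
    G gen_kappa_hat * G gen_E = (q ^ n * inverse q ^ 2) \<cdot>\<^sub>m (G gen_E * G gen_kappa_hat) \<and>
    G gen_kappa_hat * G gen_F = (inverse (q ^ n) * q ^ 2) \<cdot>\<^sub>m (G gen_F * G gen_kappa_hat) \<and>
    G gen_E ^\<^sub>m (n ^ 2) = 0\<^sub>m d d \<and>
    G gen_F ^\<^sub>m (n ^ 2) = 0\<^sub>m d d \<and>
    G gen_F * G gen_E - inverse q \<cdot>\<^sub>m (G gen_E * G gen_F)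
      = 1\<^sub>m d - G gen_kappa ^\<^sub>m (n - 1) * G gen_kappa_hat"

lemma qu_relations_carrier: "qu_relations n q \<subseteq> carrier (free_alg :: (gen list \<Rightarrow> 'k::field) ring)"
proof -
  interpret ring "free_alg :: (gen list \<Rightarrow> 'k) ring" by (rule ring_free_alg)
  show ?thesis unfolding qu_relations_def Let_def by auto
qed

text \<open>Formulated for an arbitrary homomorphism so that it serves in both directions: with the
  action of a module it extracts matrices satisfying the relations, and with
  \<open>free_eval\<close> it shows that such matrices define a module.\<close>

lemma qu_rep_iff_hom:
  fixes h :: "(gen list \<Rightarrow> 'k::field) \<Rightarrow> 'k mat"
  assumes h: "h \<in> Ring.ring_hom free_alg (ring_mat TYPE('k) d ())"
    and scal: "\<And>c. h (free_scal c) = c \<cdot>\<^sub>m 1\<^sub>m d"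
  shows "(\<forall>r\<in>qu_relations n q. h r = 0\<^sub>m d d) \<longleftrightarrow> qu_rep n q d (\<lambda>s. h (free_gen s))"
proof -
  interpret F: ring "free_alg :: (gen list \<Rightarrow> 'k) ring" by (rule ring_free_alg)
  interpret R: ring "ring_mat TYPE('k) d ()" by (rule ring_mat)
  interpret H: ring_hom_ring free_alg "ring_mat TYPE('k) d ()" h
    by (rule ring_hom_ringI2[OF F.ring_axioms R.ring_axioms h])
  have carr [simp]: "h x \<in> carrier_mat d d" if "x \<in> carrier free_alg" for x
    using H.hom_closed[OF that] by (simp add: ring_mat_simps)
  have mul: "h (x \<otimes>\<^bsub>free_alg\<^esub> y) = h x * h y" if "x \<in> carrier free_alg" "y \<in> carrier free_alg" for x y
    using H.hom_mult[OF that] by (simp add: ring_mat_simps)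
  have min: "h (x \<ominus>\<^bsub>free_alg\<^esub> y) = h x - h y" if "x \<in> carrier free_alg" "y \<in> carrier free_alg" for x y
    using that by (simp add: a_minus_def ring_mat_a_inv) (auto simp: ring_mat_simps)
  have pow: "h (x [^]\<^bsub>free_alg\<^esub> (k::nat)) = h x ^\<^sub>m k" if "x \<in> carrier free_alg" for x k
    using H.hom_nat_pow[OF that, of k] pow_mat_ring_pow[OF carr[OF that], of k "()"] by simp
  have one: "h \<one>\<^bsub>free_alg\<^esub> = 1\<^sub>m d" using H.hom_one by (simp add: ring_mat_simps)
  have sc: "c \<cdot>\<^sub>m 1\<^sub>m d * A * B = c \<cdot>\<^sub>m (A * B)" if "A \<in> carrier_mat d d" "B \<in> carrier_mat d d" for c and A B :: "'k mat"
  proof -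
    have "c \<cdot>\<^sub>m 1\<^sub>m d * A = c \<cdot>\<^sub>m A"
      using that mult_smult_assoc_mat[of "1\<^sub>m d" d d A d c] by simp
    then show ?thesis
      using that mult_smult_assoc_mat[of A d d B d c] by simp
  qed
  show ?thesis
    unfolding qu_rep_def qu_relations_def Let_def
    by (simp add: mul min pow one scal sc ring_mat_simps mult_carrier_mat[of _ d d _ d] minus_carrier_mat mat_diff_eq_0_iff[where d = d and d' = d])
qed

lemma word_mat_carrier [simp]: "(\<And>s. G s \<in> carrier_mat d d) \<Longrightarrow> word_mat d G w \<in> carrier_mat d d"
  by (induction w) (auto simp: word_mat_def intro: mult_carrier_mat)

lemma word_mat_append:
  assumes "\<And>s. G s \<in> carrier_mat d d"
  shows "word_mat d G (u @ v) = word_mat d G u * word_mat d G v"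
proof (induction u)
  case Nil
  then show ?case using left_mult_one_mat[OF word_mat_carrier[OF assms]] by (simp add: word_mat_def)
next
  case (Cons s u)
  have "word_mat d G ((s # u) @ v) = G s * word_mat d G (u @ v)" by (simp add: word_mat_def)
  also have "\<dots> = G s * word_mat d G u * word_mat d G v"
    unfolding Cons using assms by (intro assoc_mult_mat[symmetric, where ?n\<^sub>1.0 = d and ?n\<^sub>2.0 = d and ?n\<^sub>3.0 = d and ?n\<^sub>4.0 = d]) simp_all
  finally show ?case by (simp add: word_mat_def)
qed

lemma free_eval_carrier [simp]: "free_eval d G f \<in> carrier_mat d d"
  by (simp add: free_eval_def)

lemma free_eval_dim [simp]: "dim_row (free_eval d G f) = d" "dim_col (free_eval d G f) = d"
  by (simp_all add: free_eval_def)

lemma free_eval_index: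
  assumes "finite W" "{w. f w \<noteq> 0} \<subseteq> W" "i < d" "j < d"
  shows "free_eval d G f $$ (i,j) = (\<Sum>w\<in>W. f w * word_mat d G w $$ (i,j))"
  unfolding free_eval_def using assms
  by (auto intro!: sum.mono_neutral_left)

lemma free_eval_ring_hom:
  fixes G :: "gen \<Rightarrow> 'k::field mat"
  assumes G: "\<And>s. G s \<in> carrier_mat d d"
  shows "free_eval d G \<in> Ring.ring_hom free_alg (ring_mat TYPE('k) d ())"
proof (rule ring_hom_memI)
  fix x y :: "gen list \<Rightarrow> 'k" assume x: "x \<in> carrier free_alg" and y: "y \<in> carrier free_alg"
  define A where "A = {w. x w \<noteq> 0}"
  define B where "B = {w. y w \<noteq> 0}"
  have fin: "finite A" "finite B" using x y by (auto simp: free_alg_simps A_def B_def)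
  show "free_eval d G (x \<oplus>\<^bsub>free_alg\<^esub> y)
      = free_eval d G x \<oplus>\<^bsub>ring_mat TYPE('k) d ()\<^esub> free_eval d G y"
  proof (rule eq_matI)
    fix i j assume "i < dim_row (free_eval d G x \<oplus>\<^bsub>ring_mat TYPE('k) d ()\<^esub> free_eval d G y)"
      "j < dim_col (free_eval d G x \<oplus>\<^bsub>ring_mat TYPE('k) d ()\<^esub> free_eval d G y)"
    then have ij: "i < d" "j < d" by (auto simp: ring_mat_simps free_eval_def)
    have *: "{w. (x \<oplus>\<^bsub>free_alg\<^esub> y) w \<noteq> 0} \<subseteq> A \<union> B"
      by (auto simp: A_def B_def free_alg_simps)
    show "free_eval d G (x \<oplus>\<^bsub>free_alg\<^esub> y) $$ (i,j)
      = (free_eval d G x \<oplus>\<^bsub>ring_mat TYPE('k) d ()\<^esub> free_eval d G y) $$ (i,j)"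
      using ij fin free_eval_index[of "A \<union> B" x i d j G] free_eval_index[of "A \<union> B" y i d j G]
        free_eval_index[OF _ *, of i d j G]
      by (auto simp: ring_mat_simps A_def B_def free_alg_simps sum.distrib algebra_simps)
  qed (auto simp: ring_mat_simps free_eval_def)
  show "free_eval d G (x \<otimes>\<^bsub>free_alg\<^esub> y)
      = free_eval d G x \<otimes>\<^bsub>ring_mat TYPE('k) d ()\<^esub> free_eval d G y"
  proof (rule eq_matI)
    fix i j assume "i < dim_row (free_eval d G x \<otimes>\<^bsub>ring_mat TYPE('k) d ()\<^esub> free_eval d G y)"
      "j < dim_col (free_eval d G x \<otimes>\<^bsub>ring_mat TYPE('k) d ()\<^esub> free_eval d G y)"
    then have ij: "i < d" "j < d" by (auto simp: ring_mat_simps free_eval_def)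
    let ?M = "word_mat d G"
    \<comment> \<open>All concatenations from the two supports. This set may exceed the support of
      the product, where cancellation can occur, but sums over it are unaffected.\<close>
    define W where "W = (\<lambda>(u,v). u @ v) ` (A \<times> B)"
    have "finite W" using fin by (simp add: W_def)
    have inW: "u @ v \<in> W" if "x u \<noteq> 0" "y v \<noteq> 0" for u v
      using that by (auto simp: W_def A_def B_def)
    have supp: "{w. (x \<otimes>\<^bsub>free_alg\<^esub> y) w \<noteq> 0} \<subseteq> W"
    proof
      fix w assume "w \<in> {w. (x \<otimes>\<^bsub>free_alg\<^esub> y) w \<noteq> 0}"
      then obtain l where "x (take l w) * y (drop l w) \<noteq> 0"
        unfolding free_alg_simps by (metis (mono_tags, lifting) mem_Collect_eq sum.neutral)
      then show "w \<in> W"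
        unfolding W_def A_def B_def by (intro image_eqI[where x = "(take l w, drop l w)"]) auto
    qed
    have "free_eval d G (x \<otimes>\<^bsub>free_alg\<^esub> y) $$ (i,j)
      = (\<Sum>w\<in>W. \<Sum>l\<le>length w. x (take l w) * y (drop l w) * ?M w $$ (i,j))"
      by (subst free_eval_index[OF \<open>finite W\<close> supp ij])
        (simp add: free_alg_simps sum_distrib_right)
    also have "\<dots> = sum (\<lambda>(w,l). x (take l w) * y (drop l w) * ?M w $$ (i,j)) (SIGMA w:W. {..length w})"
      using \<open>finite W\<close> by (simp add: sum.Sigma)
    also have "\<dots> = sum (\<lambda>(u,v). x u * y v * ?M (u @ v) $$ (i,j)) (A \<times> B)"
    \<comment> \<open>A word with a cut position is the same as a pair of words. Cuts whose halves
      leave the supports contribute zero and are collected in \<open>S'\<close>.\<close>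
    proof (rule sum.reindex_bij_witness_not_neutral[where T' = "{}"
          and S' = "{(w,l) \<in> (SIGMA w:W. {..length w}). (take l w, drop l w) \<notin> A \<times> B}"
          and i = "\<lambda>(u,v). (u @ v, length u)" and j = "\<lambda>(w,l). (take l w, drop l w)"])
      show "finite {(w,l) \<in> (SIGMA w:W. {..length w}). (take l w, drop l w) \<notin> A \<times> B}"
        by (rule finite_subset[of _ "SIGMA w:W. {..length w}"]) (use \<open>finite W\<close> in auto)
      show "(\<lambda>(u,v). (u @ v, length u)) ((\<lambda>(w,l). (take l w, drop l w)) a) = a"
        if "a \<in> (SIGMA w:W. {..length w}) - {(w,l) \<in> (SIGMA w:W. {..length w}). (take l w, drop l w) \<notin> A \<times> B}" for a
        using that by (auto simp: min_absorb2)
      show "(\<lambda>(w,l). (take l w, drop l w)) a \<in> A \<times> B - {}"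
        if "a \<in> (SIGMA w:W. {..length w}) - {(w,l) \<in> (SIGMA w:W. {..length w}). (take l w, drop l w) \<notin> A \<times> B}" for a
        using that by auto
    qed (auto simp: A_def B_def inW)
    also have "\<dots> = (\<Sum>u\<in>A. \<Sum>v\<in>B. x u * y v * ?M (u @ v) $$ (i,j))"
      by (simp add: sum.cartesian_product)
    also have "\<dots> = (\<Sum>u\<in>A. \<Sum>v\<in>B. \<Sum>k<d. x u * ?M u $$ (i,k) * (y v * ?M v $$ (k,j)))"
    proof (intro sum.cong refl)
      fix u v
      have "?M (u @ v) $$ (i,j) = (\<Sum>k<d. ?M u $$ (i,k) * ?M v $$ (k,j))"
        unfolding word_mat_append[OF G]
        using ij carrier_matD[OF word_mat_carrier[of G d u]] carrier_matD[OF word_mat_carrier[of G d v]] G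
        by (simp add: times_mat_def scalar_prod_def lessThan_atLeast0)
      then show "x u * y v * ?M (u @ v) $$ (i,j) = (\<Sum>k<d. x u * ?M u $$ (i,k) * (y v * ?M v $$ (k,j)))"
        by (simp add: sum_distrib_left mult_ac)
    qed
    also have "\<dots> = (\<Sum>k<d. \<Sum>u\<in>A. \<Sum>v\<in>B. x u * ?M u $$ (i,k) * (y v * ?M v $$ (k,j)))"
      by (simp only: sum.swap[of _ "{..<d}" B] sum.swap[of _ "{..<d}" A])
    also have "\<dots> = (\<Sum>k<d. free_eval d G x $$ (i,k) * free_eval d G y $$ (k,j))"
      using fin ij
      by (simp add: free_eval_index[of A] free_eval_index[of B] A_def B_def sum_product)
    also have "\<dots> = (free_eval d G x * free_eval d G y) $$ (i,j)"
      using ij free_eval_carrier[of d G x] free_eval_carrier[of d G y]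
      by (simp add: times_mat_def scalar_prod_def lessThan_atLeast0 del: free_eval_carrier)
    finally show "free_eval d G (x \<otimes>\<^bsub>free_alg\<^esub> y) $$ (i,j)
      = (free_eval d G x \<otimes>\<^bsub>ring_mat TYPE('k) d ()\<^esub> free_eval d G y) $$ (i,j)"
      by (simp add: ring_mat_simps)
  qed (auto simp: ring_mat_simps free_eval_def)
next
  show "free_eval d G \<one>\<^bsub>free_alg\<^esub> = \<one>\<^bsub>ring_mat TYPE('k) d ()\<^esub>"
    by (rule eq_matI, subst free_eval_index[where W = "{[]}"])
      (auto simp: free_alg_simps ring_mat_simps word_mat_def free_eval_def)
qed (simp add: ring_mat_simps)

lemma free_eval_scal: "free_eval d G (free_scal c) = c \<cdot>\<^sub>m 1\<^sub>m d"
  by (rule eq_matI, subst free_eval_index[where W = "{[]}"])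
    (auto simp: free_scal_def word_mat_def free_eval_def)

lemma free_eval_gen: "G s \<in> carrier_mat d d \<Longrightarrow> free_eval d G (free_gen s) = G s"
  by (rule eq_matI, subst free_eval_index[where W = "{[s]}"])
    (auto simp: free_gen_def word_mat_def free_eval_def)

section \<open>The quotient algebra and its finite-dimensional modules\<close>

lemma qu_ideal: "ideal (qu_ideal n q) (free_alg :: (gen list \<Rightarrow> 'k::field) ring)"
  unfolding qu_ideal_def by (rule ring.genideal_ideal[OF ring_free_alg qu_relations_carrier])

lemma ring_qu_alg: "ring (qu_alg n q)"
  unfolding qu_alg_def by (rule ideal.quotient_is_ring[OF qu_ideal])

definition qu_class :: "nat \<Rightarrow> 'k::field \<Rightarrow> (gen list \<Rightarrow> 'k) \<Rightarrow> 'k qu_elem" where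
  "qu_class n q x = qu_ideal n q +>\<^bsub>free_alg\<^esub> x"

lemma qu_class_hom: "qu_class n q \<in> Ring.ring_hom free_alg (qu_alg n q)"
  using ideal.rcos_ring_hom[OF qu_ideal, of n q] unfolding qu_alg_def qu_class_def[abs_def] by simp

lemma carrier_qu_alg: "carrier (qu_alg n q) = qu_class n q ` carrier free_alg"
  by (auto simp: qu_alg_def qu_class_def FactRing_def A_RCOSETS_def')

lemma qu_gen_class: "qu_gen n q s = qu_class n q (free_gen s)"
  by (simp add: qu_gen_def qu_class_def)

lemma qu_scal_class: "qu_scal n q c = qu_class n q (free_scal c)"
  by (simp add: qu_scal_def qu_class_def)

lemma qu_alg_induct [consumes 1, case_names scal gen add mult]:
  fixes q :: "'k::field"
  assumes a: "a \<in> carrier (qu_alg n q)"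
    and scal: "\<And>c. P (qu_scal n q c)" and gen: "\<And>s. P (qu_gen n q s)"
    and add: "\<And>a b. a \<in> carrier (qu_alg n q) \<Longrightarrow> b \<in> carrier (qu_alg n q) \<Longrightarrow> P a \<Longrightarrow> P b \<Longrightarrow> P (a \<oplus>\<^bsub>qu_alg n q\<^esub> b)"
    and mult: "\<And>a b. a \<in> carrier (qu_alg n q) \<Longrightarrow> b \<in> carrier (qu_alg n q) \<Longrightarrow> P a \<Longrightarrow> P b \<Longrightarrow> P (a \<otimes>\<^bsub>qu_alg n q\<^esub> b)"
  shows "P a"
proof -
  have cl: "qu_class n q x \<in> carrier (qu_alg n q)" if "x \<in> carrier free_alg" for x
    using that by (simp add: carrier_qu_alg)
  obtain x where "x \<in> carrier free_alg" "a = qu_class n q x"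
    using a by (auto simp: carrier_qu_alg)
  from this(1) have "P (qu_class n q x)"
  proof (induction x rule: free_alg_induct)
    case (scal c) then show ?case using assms(2) by (simp add: qu_scal_class)
  next
    case (gen s) then show ?case using assms(3) by (simp add: qu_gen_class)
  next
    case (add x y)
    then show ?case using assms(4) cl by (simp add: ring_hom_add[OF qu_class_hom])
  next
    case (mult x y)
    then show ?case using assms(5) cl by (simp add: ring_hom_mult[OF qu_class_hom])
  qed
  then show ?thesis using \<open>a = _\<close> by simp
qed

lemma qu_scal_carrier [simp]: "qu_scal n q c \<in> carrier (qu_alg n q)"
  by (simp add: qu_scal_class carrier_qu_alg)

lemma qu_gen_carrier [simp]: "qu_gen n q s \<in> carrier (qu_alg n q)"
  by (simp add: qu_gen_class carrier_qu_alg)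

definition mod_gen :: "nat \<Rightarrow> 'k::field \<Rightarrow> 'k qu_module \<Rightarrow> gen \<Rightarrow> 'k mat" where
  "mod_gen n q M s = snd M (qu_gen n q s)"

lemma qu_modules_mult:
  fixes q :: "'k::field"
  assumes "M \<in> qu_modules n q" "a \<in> carrier (qu_alg n q)" "b \<in> carrier (qu_alg n q)"
  shows "snd M (a \<otimes>\<^bsub>qu_alg n q\<^esub> b) = snd M a * snd M b"
  using assms ring_hom_mult[of "snd M" "qu_alg n q" "ring_mat TYPE('k) (fst M) ()" a b]
  by (auto simp: qu_modules_def ring_mat_simps)

lemma qu_modules_add:
  fixes q :: "'k::field"
  assumes "M \<in> qu_modules n q" "a \<in> carrier (qu_alg n q)" "b \<in> carrier (qu_alg n q)"
  shows "snd M (a \<oplus>\<^bsub>qu_alg n q\<^esub> b) = snd M a + snd M b"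
  using assms ring_hom_add[of "snd M" "qu_alg n q" "ring_mat TYPE('k) (fst M) ()" a b]
  by (auto simp: qu_modules_def ring_mat_simps)

lemma qu_modules_one:
  fixes q :: "'k::field"
  assumes "M \<in> qu_modules n q"
  shows "snd M \<one>\<^bsub>qu_alg n q\<^esub> = 1\<^sub>m (fst M)"
  using assms ring_hom_one[of "snd M" "qu_alg n q" "ring_mat TYPE('k) (fst M) ()"]
  by (auto simp: qu_modules_def ring_mat_simps)

lemma qu_modules_scal: "M \<in> qu_modules n q \<Longrightarrow> snd M (qu_scal n q c) = c \<cdot>\<^sub>m 1\<^sub>m (fst M)"
  by (auto simp: qu_modules_def)

lemma qu_modules_carrier:
  fixes q :: "'k::field"
  assumes "M \<in> qu_modules n q" "a \<in> carrier (qu_alg n q)"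
  shows "snd M a \<in> carrier_mat (fst M) (fst M)"
  using assms ring_hom_closed[of "snd M" "qu_alg n q" "ring_mat TYPE('k) (fst M) ()" a]
  by (auto simp: qu_modules_def ring_mat_simps)

lemma mod_gen_carrier [simp]: "M \<in> qu_modules n q \<Longrightarrow> mod_gen n q M s \<in> carrier_mat (fst M) (fst M)"
  by (simp add: mod_gen_def qu_modules_carrier)

lemma qu_rep_mod_gen:
  fixes q :: "'k::field"
  assumes M: "M \<in> qu_modules n q"
  shows "qu_rep n q (fst M) (mod_gen n q M)"
proof -
  interpret ideal "qu_ideal n q" "free_alg :: (gen list \<Rightarrow> 'k) ring" by (rule qu_ideal)
  let ?R = "ring_mat TYPE('k) (fst M) ()"
  have "snd M \<in> Ring.ring_hom (qu_alg n q) ?R"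
    using M by (auto simp: qu_modules_def)
  then interpret H: ring_hom_ring "qu_alg n q" ?R "snd M"
    by (intro ring_hom_ringI2 ring_qu_alg ring_mat)
  let ?h = "\<lambda>x. snd M (qu_class n q x)"
  have h: "?h \<in> Ring.ring_hom free_alg ?R"
    using ring_hom_trans[OF qu_class_hom H.homh] by (simp add: comp_def)
  have "?h r = 0\<^sub>m (fst M) (fst M)" if "r \<in> qu_relations n q" for r
  proof -
    have "r \<in> qu_ideal n q"
      unfolding qu_ideal_def using ring.genideal_self[OF ring_free_alg qu_relations_carrier] that by blast
    then have "qu_class n q r = \<zero>\<^bsub>qu_alg n q\<^esub>"
      by (simp add: qu_class_def qu_alg_def FactRing_def a_rcos_const)
    then show ?thesis using H.hom_zero by (simp add: ring_mat_simps)
  qed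
  then have "qu_rep n q (fst M) (\<lambda>s. ?h (free_gen s))"
    using qu_rep_iff_hom[OF h, of n q] qu_modules_scal[OF M] by (simp add: qu_scal_class)
  then show ?thesis by (simp add: mod_gen_def[abs_def] qu_gen_class)
qed

lemma fst_module_of_gens [simp]: "fst (module_of_gens d G) = d"
  by (simp add: module_of_gens_def)

context
  fixes n d :: nat and q :: "'k::field" and G
  assumes G: "qu_rep n q d G"
begin

lemma qu_rep_carrier: "G s \<in> carrier_mat d d"
  using G by (simp add: qu_rep_def)

lemma free_eval_qu_ideal:
  assumes "x \<in> qu_ideal n q" shows "free_eval d G x = 0\<^sub>m d d"
proof -
  let ?R = "ring_mat TYPE('k) d ()"
  interpret H: ring_hom_ring free_alg ?R "free_eval d G"
    by (rule ring_hom_ringI2[OF ring_free_alg ring_mat free_eval_ring_hom[OF qu_rep_carrier]])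
  have "\<forall>r\<in>qu_relations n q. free_eval d G r = 0\<^sub>m d d"
    unfolding qu_rep_iff_hom[OF free_eval_ring_hom[OF qu_rep_carrier] free_eval_scal]
      free_eval_gen[OF qu_rep_carrier] by (rule G)
  then have "qu_relations n q \<subseteq> a_kernel free_alg ?R (free_eval d G)"
    using qu_relations_carrier[of n q] unfolding a_kernel_def' ring_mat_simps by blast
  then have "qu_ideal n q \<subseteq> a_kernel free_alg ?R (free_eval d G)"
    unfolding qu_ideal_def by (rule H.R.genideal_minimal[OF H.kernel_is_ideal])
  then show ?thesis using assms unfolding a_kernel_def' ring_mat_simps by blast
qed

text \<open>Removes the choice made in \<open>module_of_gens\<close>: two representatives of a coset
  differ by an element of the ideal, on which \<open>free_eval\<close> vanishes.\<close>

lemma snd_module_of_gens: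
  assumes x: "x \<in> carrier free_alg"
  shows "snd (module_of_gens d G) (qu_class n q x) = free_eval d G x"
proof -
  interpret ideal "qu_ideal n q" "free_alg :: (gen list \<Rightarrow> 'k) ring" by (rule qu_ideal)
  have "x \<in> qu_class n q x" using x by (simp add: qu_class_def a_rcos_self)
  then have "(SOME f. f \<in> qu_class n q x) \<in> qu_class n q x" by (rule someI[of "\<lambda>f. f \<in> qu_class n q x"])
  then obtain h where h: "h \<in> qu_ideal n q" "(SOME f. f \<in> qu_class n q x) = h \<oplus>\<^bsub>free_alg\<^esub> x"
    by (auto simp: qu_class_def a_r_coset_def' )
  then have "free_eval d G (SOME f. f \<in> qu_class n q x) = free_eval d G h + free_eval d G x"
    using ring_hom_add[OF free_eval_ring_hom[OF qu_rep_carrier] a_Hcarr[OF h(1)] x]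
    by (simp add: ring_mat_simps)
  also have "\<dots> = free_eval d G x"
    by (simp add: free_eval_qu_ideal[OF h(1)])
  finally show ?thesis by (simp add: module_of_gens_def)
qed

lemma module_of_gens_in: "module_of_gens d G \<in> qu_modules n q"
proof -
  let ?R = "ring_mat TYPE('k) d ()" let ?M = "module_of_gens d G"
  have hom: "free_eval d G \<in> Ring.ring_hom free_alg ?R"
    by (rule free_eval_ring_hom[OF qu_rep_carrier])
  have "snd ?M \<in> Ring.ring_hom (qu_alg n q) ?R"
  proof (rule ring_hom_memI)
    interpret ring "free_alg :: (gen list \<Rightarrow> 'k) ring" by (rule ring_free_alg)
    show "snd ?M \<one>\<^bsub>qu_alg n q\<^esub> = \<one>\<^bsub>?R\<^esub>"
      using snd_module_of_gens[OF one_closed] ring_hom_one[OF hom] ring_hom_one[OF qu_class_hom, of n q] by simp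
    fix a assume a: "a \<in> carrier (qu_alg n q)"
    then obtain x where x: "x \<in> carrier free_alg" "a = qu_class n q x" by (auto simp: carrier_qu_alg)
    show "snd ?M a \<in> carrier ?R"
      using x by (simp add: snd_module_of_gens ring_mat_simps)
    fix b assume b: "b \<in> carrier (qu_alg n q)"
    then obtain y where y: "y \<in> carrier free_alg" "b = qu_class n q y" by (auto simp: carrier_qu_alg)
    show "snd ?M (a \<otimes>\<^bsub>qu_alg n q\<^esub> b) = snd ?M a \<otimes>\<^bsub>?R\<^esub> snd ?M b"
      using x y snd_module_of_gens[OF m_closed[OF x(1) y(1)]]
      by (simp add: snd_module_of_gens ring_hom_mult[OF qu_class_hom] ring_hom_mult[OF hom])
    show "snd ?M (a \<oplus>\<^bsub>qu_alg n q\<^esub> b) = snd ?M a \<oplus>\<^bsub>?R\<^esub> snd ?M b"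
      using x y snd_module_of_gens[OF a_closed[OF x(1) y(1)]]
      by (simp add: snd_module_of_gens ring_hom_add[OF qu_class_hom] ring_hom_add[OF hom])
  qed
  moreover have "snd ?M (qu_scal n q c) = c \<cdot>\<^sub>m 1\<^sub>m d" for c
    by (simp add: qu_scal_class snd_module_of_gens free_eval_scal)
  ultimately show ?thesis
    by (simp add: qu_modules_def module_of_gens_def)
qed

lemma mod_gen_module_of_gens [simp]: "mod_gen n q (module_of_gens d G) s = G s"
  by (simp add: mod_gen_def qu_gen_class snd_module_of_gens free_eval_gen[OF qu_rep_carrier])

end

text \<open>Intertwining passes to scalars, sums and products, hence from the generators to the
  whole algebra.\<close>

lemma qu_module_hom_iff:
  fixes q :: "'k::field"
  assumes M: "M \<in> qu_modules n q" and N: "N \<in> qu_modules n q"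
  shows "qu_module_hom n q M N f \<longleftrightarrow> f \<in> carrier_mat (fst N) (fst M) \<and>
    (\<forall>s. f * mod_gen n q M s = mod_gen n q N s * f)"
proof
  assume *: "f \<in> carrier_mat (fst N) (fst M) \<and> (\<forall>s. f * mod_gen n q M s = mod_gen n q N s * f)"
  then have f: "f \<in> carrier_mat (fst N) (fst M)" by simp
  have "f * snd M a = snd N a * f" if "a \<in> carrier (qu_alg n q)" for a
    using that
  proof (induction rule: qu_alg_induct)
    case (scal c)
    show ?case
      using f by (simp add: qu_modules_scal[OF M] qu_modules_scal[OF N] mult_smult_distrib[where n = "fst M" and nr = "fst N" and nc = "fst M"]
        mult_smult_assoc_mat[where n = "fst N" and nr = "fst N" and nc = "fst M"])
  next
    case (gen s)
    then show ?case using * by (simp add: mod_gen_def)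
  next
    case (add a b)
    then show ?case
      using f qu_modules_carrier[OF M add(1)] qu_modules_carrier[OF M add(2)]
        qu_modules_carrier[OF N add(1)] qu_modules_carrier[OF N add(2)]
      by (simp add: qu_modules_add[OF M] qu_modules_add[OF N] mult_add_distrib_mat[where n = "fst M" and nr = "fst N" and nc = "fst M"]
        add_mult_distrib_mat[where n = "fst N" and nr = "fst N" and nc = "fst M"])
  next
    case (mult a b)
    have "f * snd M (a \<otimes>\<^bsub>qu_alg n q\<^esub> b) = (f * snd M a) * snd M b"
      using f qu_modules_carrier[OF M mult(1)] qu_modules_carrier[OF M mult(2)] mult(1,2)
      by (simp add: qu_modules_mult[OF M] assoc_mult_mat[where ?n\<^sub>1.0 = "fst N" and ?n\<^sub>2.0 = "fst M" and ?n\<^sub>3.0 = "fst M" and ?n\<^sub>4.0 = "fst M"])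
    also have "\<dots> = snd N a * (f * snd M b)"
      unfolding mult.IH(1) by (rule assoc_mult_mat[OF qu_modules_carrier[OF N mult(1)] f qu_modules_carrier[OF M mult(2)]])
    also have "\<dots> = snd N (a \<otimes>\<^bsub>qu_alg n q\<^esub> b) * f"
      unfolding mult.IH(2) using f qu_modules_carrier[OF N mult(1)] qu_modules_carrier[OF N mult(2)] mult(1,2)
      by (simp add: qu_modules_mult[OF N] assoc_mult_mat[where ?n\<^sub>1.0 = "fst N" and ?n\<^sub>2.0 = "fst N" and ?n\<^sub>3.0 = "fst N" and ?n\<^sub>4.0 = "fst M"])
    finally show ?case .
  qed
  then show "qu_module_hom n q M N f"
    using f by (simp add: qu_module_hom_def)
qed (auto simp: qu_module_hom_def mod_gen_def)

section \<open>Spectral projections of an element of finite order\<close>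

lemma sum_powers_root_of_unity:
  fixes z :: "'k::field"
  assumes "z ^ L = 1"
  shows "(\<Sum>r<L. z ^ r) = (if z = 1 then of_nat L else 0)"
  using assms sum_gp_strict[of z L] by simp

lemma primitive_root_power_eq_1_iff:
  fixes \<omega> :: "'k::field"
  assumes "\<omega> ^ L = 1" "\<forall>m. 0 < m \<and> m < L \<longrightarrow> \<omega> ^ m \<noteq> 1" "L > 0"
  shows "\<omega> ^ k = 1 \<longleftrightarrow> L dvd k"
proof -
  have "\<omega> ^ k = \<omega> ^ (L * (k div L) + k mod L)" by simp
  also have "\<dots> = \<omega> ^ (k mod L)" by (simp only: power_add power_mult assms(1)) simp
  finally show ?thesis using assms mod_less_divisor[of L k]
    by (cases "k mod L = 0") (auto simp: dvd_eq_mod_eq_0)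
qed

text \<open>A ring with central scalars. The same projections are needed in the algebra, where they
  are the elements 1_i, and in matrix rings, where they split a module into weight spaces; the
  abstract setting treats both at once.\<close>

locale scal_ring = ring R for R :: "('a, 'b) ring_scheme" (structure) +
  fixes \<sigma> :: "'k::field_char_0 \<Rightarrow> 'a"
  assumes scal_closed [simp]: "\<sigma> c \<in> carrier R"
    and scal_add: "\<sigma> (c + c') = \<sigma> c \<oplus> \<sigma> c'"
    and scal_mult: "\<sigma> (c * c') = \<sigma> c \<otimes> \<sigma> c'"
    and scal_one: "\<sigma> 1 = \<one>"
    and scal_comm: "a \<in> carrier R \<Longrightarrow> a \<otimes> \<sigma> c = \<sigma> c \<otimes> a"
begin

lemma scal_zero: "\<sigma> 0 = \<zero>"
  using scal_add[of 0 0] by (metis add.l_cancel_one' add_0 scal_closed)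

lemma scal_sum_mult:
  assumes "finite I" "a \<in> carrier R"
  shows "(\<Oplus>i\<in>I. \<sigma> (c i) \<otimes> a) = \<sigma> (\<Sum>i\<in>I. c i) \<otimes> a"
  using assms(1)
proof (induction I rule: finite_induct)
  case (insert x F)
  then show ?case using assms(2) by (simp add: finsum_insert scal_add l_distr)
qed (simp add: scal_zero assms(2))

text \<open>The exponent \<open>L - i\<close> stands for -i when \<omega>^L = 1. For kappa in the
  algebra this is 1_i.\<close>

definition proj :: "nat \<Rightarrow> 'k \<Rightarrow> 'a \<Rightarrow> nat \<Rightarrow> 'a" where
  "proj L \<omega> T i = \<sigma> (1 / of_nat L) \<otimes> (\<Oplus>r\<in>{0..<L}. \<sigma> ((\<omega> ^ (L - i)) ^ r) \<otimes> T [^] r)"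

lemma scal_assoc: "a \<in> carrier R \<Longrightarrow> \<sigma> c \<otimes> (\<sigma> c' \<otimes> a) = \<sigma> (c * c') \<otimes> a"
  by (simp add: scal_mult m_assoc)

context
  fixes L :: nat and \<omega> :: 'k and T :: 'a
  assumes T [simp]: "T \<in> carrier R" and TL: "T [^] L = \<one>"
    and \<omega>L: "\<omega> ^ L = 1" and \<omega>: "\<forall>m. 0 < m \<and> m < L \<longrightarrow> \<omega> ^ m \<noteq> 1" and L: "L > 0"
begin

lemma proj_closed [simp]: "proj L \<omega> T i \<in> carrier R"
  unfolding proj_def by (intro m_closed scal_closed finsum_closed) auto

text \<open>On an eigenvector the sum becomes the geometric sum of the powers of \<omega>^(b-i),
  which is L or 0 according to whether i = b.\<close>

lemma proj_eigen:
  assumes a: "a \<in> carrier R" and Ta: "T \<otimes> a = \<sigma> (\<omega> ^ b) \<otimes> a" and b: "b < L" and i: "i < L"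
  shows "proj L \<omega> T i \<otimes> a = (if i = b then a else \<zero>)"
proof -
  have pow: "T [^] r \<otimes> a = \<sigma> ((\<omega> ^ b) ^ r) \<otimes> a" for r :: nat
  proof (induction r)
    case 0 then show ?case using a by (simp add: scal_one)
  next
    case (Suc r)
    have "T [^] Suc r \<otimes> a = T [^] r \<otimes> (\<sigma> (\<omega> ^ b) \<otimes> a)"
      using a Ta by (simp add: m_assoc)
    also have "\<dots> = \<sigma> (\<omega> ^ b) \<otimes> (T [^] r \<otimes> a)"
      using a by (simp add: m_assoc[symmetric] scal_comm)
    also have "\<dots> = \<sigma> ((\<omega> ^ b) ^ Suc r) \<otimes> a"
      unfolding Suc using a by (simp add: scal_assoc)
    finally show ?case .
  qed
  let ?z = "\<omega> ^ (L - i + b)"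
  have "(\<Oplus>r\<in>{0..<L}. \<sigma> ((\<omega> ^ (L - i)) ^ r) \<otimes> T [^] r) \<otimes> a
      = (\<Oplus>r\<in>{0..<L}. \<sigma> ((\<omega> ^ (L - i)) ^ r) \<otimes> T [^] r \<otimes> a)"
    using a by (intro finsum_ldistr) auto
  also have "\<dots> = (\<Oplus>r\<in>{0..<L}. \<sigma> (?z ^ r) \<otimes> a)"
    using a by (intro finsum_cong') (auto simp: m_assoc pow scal_assoc power_add power_mult_distrib)
  also have "\<dots> = \<sigma> (\<Sum>r<L. ?z ^ r) \<otimes> a"
    using a by (simp add: scal_sum_mult lessThan_atLeast0)
  finally have *: "proj L \<omega> T i \<otimes> a = \<sigma> (1 / of_nat L * (\<Sum>r<L. ?z ^ r)) \<otimes> a"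
    unfolding proj_def using a
    by (simp add: m_assoc finsum_closed scal_assoc del: times_divide_eq_left)
  have z: "?z ^ L = 1" by (metis \<omega>L mult.commute power_mult power_one)
  have "?z = 1 \<longleftrightarrow> i = b"
  proof -
    have "?z = 1 \<longleftrightarrow> L dvd (L - i + b)" by (rule primitive_root_power_eq_1_iff[OF \<omega>L \<omega> L])
    also have "\<dots> \<longleftrightarrow> i = b"
    proof
      assume "L dvd L - i + b"
      then obtain k where k: "L - i + b = L * k" by (auto simp: dvd_def)
      \<comment> \<open>The exponent lies strictly between 0 and 2L, so it is divisible by L only if
        it equals L.\<close>
      have "0 < L * k" "L * k < L * 2" using i b by (auto simp flip: k)
      then have "k = 1" by auto
      then show "i = b" using k i by simp
    qed (use i in simp)
    finally show ?thesis .
  qed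
  then show ?thesis
    unfolding * sum_powers_root_of_unity[OF z] using a L by (simp add: scal_one scal_zero)
qed

lemma finsum_shift:
  assumes "f \<in> UNIV \<rightarrow> carrier R" "f L = f 0"
  shows "(\<Oplus>r\<in>{0..<L}. f (Suc r)) = (\<Oplus>r\<in>{0..<L}. f r)"
proof -
  have f: "f r \<in> carrier R" for r using assms(1) by auto
  have "(\<Oplus>r\<in>{0..<m}. f (Suc r)) \<oplus> f 0 = (\<Oplus>r\<in>{0..<m}. f r) \<oplus> f m" for m
  proof (induction m)
    case (Suc m)
    have "(\<Oplus>r\<in>{0..<Suc m}. f (Suc r)) = f (Suc m) \<oplus> (\<Oplus>r\<in>{0..<m}. f (Suc r))"
      by (subst atLeast0_lessThan_Suc, subst finsum_insert) (auto simp: f)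
    moreover have "(\<Oplus>r\<in>{0..<Suc m}. f r) = f m \<oplus> (\<Oplus>r\<in>{0..<m}. f r)"
      by (subst atLeast0_lessThan_Suc, subst finsum_insert) (auto simp: f)
    moreover have "(\<Oplus>r\<in>{0..<m}. f r) \<in> carrier R" "(\<Oplus>r\<in>{0..<m}. f (Suc r)) \<in> carrier R"
      using f by (auto intro: finsum_closed)
    moreover from this have "f (Suc m) \<oplus> (\<Oplus>r\<in>{0..<m}. f (Suc r)) \<oplus> f 0
        = f (Suc m) \<oplus> ((\<Oplus>r\<in>{0..<m}. f r) \<oplus> f m)"
      using f by (subst a_assoc) (auto simp: Suc)
    ultimately show ?case
      using f by (simp add: a_ac)
  qed (simp add: f)
  moreover have "(\<Oplus>r\<in>{0..<L}. f r) \<in> carrier R" "(\<Oplus>r\<in>{0..<L}. f (Suc r)) \<in> carrier R"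
    using f by (auto intro: finsum_closed)
  ultimately show ?thesis using f assms(2) by (metis add.r_cancel)
qed

text \<open>Multiplication by \<open>T\<close> raises each power by one, and
  \<open>finsum_shift\<close> rotates the index back because both \<open>T\<close> and the scalar
  have L-th power one.\<close>

lemma mult_proj:
  assumes i: "i \<le> L"
  shows "T \<otimes> proj L \<omega> T i = \<sigma> (\<omega> ^ i) \<otimes> proj L \<omega> T i"
proof -
  let ?f = "\<lambda>r. \<sigma> ((\<omega> ^ (L - i)) ^ r) \<otimes> T [^] r"
  let ?S = "\<Oplus>r\<in>{0..<L}. ?f r"
  have S: "?S \<in> carrier R" by (intro finsum_closed) auto
  have *: "\<omega> ^ i * \<omega> ^ (L - i) = 1" using i \<omega>L by (simp flip: power_add)
  have cL: "(\<omega> ^ (L - i)) ^ L = 1" by (metis \<omega>L mult.commute power_mult power_one)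
  have "T \<otimes> ?S = (\<Oplus>r\<in>{0..<L}. T \<otimes> ?f r)"
    by (intro finsum_rdistr) auto
  also have "\<dots> = (\<Oplus>r\<in>{0..<L}. \<sigma> (\<omega> ^ i) \<otimes> ?f (Suc r))"
  proof (intro finsum_cong')
    fix r
    have c: "(\<omega> ^ (L - i)) ^ r = \<omega> ^ i * (\<omega> ^ (L - i)) ^ Suc r"
      using * by (simp add: mult.assoc[symmetric])
    have "T \<otimes> ?f r = \<sigma> ((\<omega> ^ (L - i)) ^ r) \<otimes> (T \<otimes> T [^] r)"
      by (simp add: m_assoc[symmetric] scal_comm)
    also have "\<dots> = \<sigma> ((\<omega> ^ (L - i)) ^ r) \<otimes> T [^] Suc r"
      by (simp only: nat_pow_Suc2[OF T])
    also have "\<dots> = \<sigma> (\<omega> ^ i) \<otimes> ?f (Suc r)"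
      by (subst c) (simp only: scal_assoc[symmetric] nat_pow_closed T)
    finally show "T \<otimes> ?f r = \<sigma> (\<omega> ^ i) \<otimes> ?f (Suc r)" .
  qed auto
  also have "\<dots> = \<sigma> (\<omega> ^ i) \<otimes> (\<Oplus>r\<in>{0..<L}. ?f (Suc r))"
    by (intro finsum_rdistr[symmetric]) auto
  also have "(\<Oplus>r\<in>{0..<L}. ?f (Suc r)) = ?S"
    by (rule finsum_shift) (auto simp: TL scal_one cL)
  finally have **: "T \<otimes> ?S = \<sigma> (\<omega> ^ i) \<otimes> ?S" .
  have "T \<otimes> proj L \<omega> T i = \<sigma> (1 / of_nat L) \<otimes> (T \<otimes> ?S)"
    unfolding proj_def using S by (simp add: m_assoc[symmetric] scal_comm)
  also have "\<dots> = \<sigma> (\<omega> ^ i) \<otimes> proj L \<omega> T i"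
    unfolding proj_def ** by (simp only: scal_assoc[OF S] mult.commute)
  finally show ?thesis .
qed

text \<open>After exchanging the two sums, the coefficient of the r-th power of \<open>T\<close> is
  a full geometric sum over roots of unity, so only r = 0 survives.\<close>

lemma finsum_proj: "(\<Oplus>i\<in>{0..<L}. proj L \<omega> T i) = \<one>"
proof -
  let ?f = "\<lambda>i r. \<sigma> ((\<omega> ^ (L - i)) ^ r) \<otimes> T [^] r"
  have coef: "(\<Sum>i<L. (\<omega> ^ (L - i)) ^ r) = (if r = 0 then of_nat L else 0)" if "r < L" for r
  proof -
    have z: "(\<omega> ^ r) ^ L = 1" by (metis \<omega>L mult.commute power_mult power_one)
    have "(\<Sum>i<L. (\<omega> ^ (L - i)) ^ r) = (\<Sum>i<L. (\<omega> ^ r) ^ Suc (L - Suc i))"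
      by (intro sum.cong) (auto simp flip: power_mult simp add: mult.commute Suc_diff_Suc)
    also have "\<dots> = \<omega> ^ r * (\<Sum>i<L. (\<omega> ^ r) ^ i)"
      by (subst sum.nat_diff_reindex[of "\<lambda>i. (\<omega> ^ r) ^ Suc i"]) (simp add: sum_distrib_left)
    also have "\<dots> = (if r = 0 then of_nat L else 0)"
      unfolding sum_powers_root_of_unity[OF z] using \<omega> that by auto
    finally show ?thesis .
  qed
  have "(\<Oplus>i\<in>{0..<L}. proj L \<omega> T i) = \<sigma> (1 / of_nat L) \<otimes> (\<Oplus>i\<in>{0..<L}. \<Oplus>r\<in>{0..<L}. ?f i r)"
    unfolding proj_def by (intro finsum_rdistr[symmetric]) (auto intro!: finsum_closed)
  also have "(\<Oplus>i\<in>{0..<L}. \<Oplus>r\<in>{0..<L}. ?f i r) = (\<Oplus>r\<in>{0..<L}. \<Oplus>i\<in>{0..<L}. ?f i r)"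
    by (intro finsum_finsum_swap) auto
  also have "\<dots> = (\<Oplus>r\<in>{0..<L}. if 0 = r then \<sigma> (of_nat L) else \<zero>)"
  proof (intro finsum_cong')
    fix r assume "r \<in> {0..<L}"
    then show "(\<Oplus>i\<in>{0..<L}. ?f i r) = (if 0 = r then \<sigma> (of_nat L) else \<zero>)"
      using coef[of r] by (subst scal_sum_mult) (auto simp: scal_zero simp flip: lessThan_atLeast0)
  qed auto
  also have "\<dots> = \<sigma> (of_nat L)"
    using L finsum_singleton[of 0 "{0..<L}" "\<lambda>_. \<sigma> (of_nat L)"] by simp
  finally show ?thesis using L by (simp add: scal_one flip: scal_mult)
qed

end

end

lemma scal_ring_qu_alg: "scal_ring (qu_alg n q) (qu_scal n (q :: 'k::field_char_0))"
proof -
  interpret A: ring "qu_alg n q" by (rule ring_qu_alg)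
  note hom = ring_hom_add[OF qu_class_hom, of _ _ n q] ring_hom_mult[OF qu_class_hom, of _ _ n q]
  show ?thesis
  proof
    fix c c' :: 'k and a
    show "qu_scal n q (c + c') = qu_scal n q c \<oplus>\<^bsub>qu_alg n q\<^esub> qu_scal n q c'"
      unfolding qu_scal_class by (subst hom(1)[symmetric]) (simp_all, auto simp: free_alg_simps(5) free_scal_def intro!: arg_cong[of _ _ "qu_class n q"])
    show "qu_scal n q (c * c') = qu_scal n q c \<otimes>\<^bsub>qu_alg n q\<^esub> qu_scal n q c'"
      unfolding qu_scal_class by (subst hom(2)[symmetric]) (simp_all add: free_scal_mult_left, auto simp: free_scal_def intro!: arg_cong[of _ _ "qu_class n q"])
    show "qu_scal n q 1 = \<one>\<^bsub>qu_alg n q\<^esub>"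
      unfolding qu_scal_class using ring_hom_one[OF qu_class_hom, of n q] by (simp add: free_scal_one)
    assume "a \<in> carrier (qu_alg n q)"
    then obtain x where x: "x \<in> carrier free_alg" "a = qu_class n q x" by (auto simp: carrier_qu_alg)
    have "x \<otimes>\<^bsub>free_alg\<^esub> free_scal c = free_scal c \<otimes>\<^bsub>free_alg\<^esub> x"
    proof
      fix w
      have "(\<Sum>i\<le>length w. x (take i w) * free_scal c (drop i w)) = (\<Sum>i\<le>length w. if i = length w then c * x w else 0)"
        by (rule sum.cong) (auto simp: free_scal_def)
      then show "(x \<otimes>\<^bsub>free_alg\<^esub> free_scal c) w = (free_scal c \<otimes>\<^bsub>free_alg\<^esub> x) w"
        unfolding free_scal_mult_left by (simp add: free_alg_simps(2))
    qed
    then show "a \<otimes>\<^bsub>qu_alg n q\<^esub> qu_scal n q c = qu_scal n q c \<otimes>\<^bsub>qu_alg n q\<^esub> a"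
      using x by (simp add: qu_scal_class flip: hom(2))
  qed auto
qed

lemma scal_ring_mat: "scal_ring (ring_mat TYPE('k::field_char_0) d ()) (\<lambda>c. c \<cdot>\<^sub>m 1\<^sub>m d)"
proof -
  interpret ring "ring_mat TYPE('k) d ()" by (rule ring_mat)
  show ?thesis
    by unfold_locales (auto simp: ring_mat_simps add_smult_distrib_right_mat[of _ d d]
      mult_smult_assoc_mat[where n = d and nc = d] mult_smult_distrib[where n = d and nr = d and nc = d] ac_simps)
qed

definition mat_proj :: "nat \<Rightarrow> nat \<Rightarrow> 'k::field_char_0 \<Rightarrow> 'k mat \<Rightarrow> nat \<Rightarrow> 'k mat" where
  "mat_proj d = scal_ring.proj (ring_mat TYPE('k) d ()) (\<lambda>c. c \<cdot>\<^sub>m 1\<^sub>m d)"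

lemma snd_module_ring_hom:
  fixes q :: "'k::field"
  assumes "M \<in> qu_modules n q"
  shows "ring_hom_ring (qu_alg n q) (ring_mat TYPE('k) (fst M) ()) (snd M)"
  using assms by (intro ring_hom_ringI2 ring_qu_alg ring_mat) (auto simp: qu_modules_def)

lemma snd_module_pow:
  fixes q :: "'k::field"
  assumes M: "M \<in> qu_modules n q" and a: "a \<in> carrier (qu_alg n q)"
  shows "snd M (a [^]\<^bsub>qu_alg n q\<^esub> (r::nat)) = snd M a ^\<^sub>m r"
proof -
  interpret H: ring_hom_ring "qu_alg n q" "ring_mat TYPE('k) (fst M) ()" "snd M"
    by (rule snd_module_ring_hom[OF M])
  show ?thesis
    using H.hom_nat_pow[OF a, of r] pow_mat_ring_pow[OF qu_modules_carrier[OF M a], of r "()"] by simp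
qed

lemma snd_module_finsum_mult:
  fixes q :: "'k::field"
  assumes M: "M \<in> qu_modules n q" and f: "f \<in> I \<rightarrow> carrier (qu_alg n q)" and I: "finite I"
  shows "snd M (finsum (qu_alg n q) f I) = finsum (ring_mat TYPE('k) (fst M) ()) (\<lambda>i. snd M (f i)) I"
proof -
  interpret H: ring_hom_ring "qu_alg n q" "ring_mat TYPE('k) (fst M) ()" "snd M"
    by (rule snd_module_ring_hom[OF M])
  show ?thesis using H.hom_finsum[OF f] by (simp add: comp_def)
qed

lemma snd_module_proj:
  fixes q :: "'k::field_char_0"
  assumes M: "M \<in> qu_modules n q" and T: "T \<in> carrier (qu_alg n q)"
  shows "snd M (scal_ring.proj (qu_alg n q) (qu_scal n q) L \<omega> T i) = mat_proj (fst M) L \<omega> (snd M T) i"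
proof -
  interpret A: scal_ring "qu_alg n q" "qu_scal n q" by (rule scal_ring_qu_alg)
  interpret B: scal_ring "ring_mat TYPE('k) (fst M) ()" "\<lambda>c. c \<cdot>\<^sub>m 1\<^sub>m (fst M)" by (rule scal_ring_mat)
  interpret H: ring_hom_ring "qu_alg n q" "ring_mat TYPE('k) (fst M) ()" "snd M"
    by (rule snd_module_ring_hom[OF M])
  show ?thesis
    unfolding A.proj_def B.proj_def mat_proj_def
    using T by (subst H.hom_mult) (auto simp: comp_def qu_modules_scal[OF M] H.hom_nat_pow
        intro!: A.finsum_closed arg_cong2[where f = "(\<otimes>\<^bsub>ring_mat TYPE('k) (fst M) ()\<^esub>)"] B.finsum_cong')
qed

lemma qu_idem_proj:
  "qu_idem n q i = scal_ring.proj (qu_alg n q) (qu_scal n (q :: 'k::field_char_0)) n (q ^ n) (qu_gen n q gen_kappa) i"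
  unfolding qu_idem_def scal_ring.proj_def[OF scal_ring_qu_alg] ..

section \<open>Kronecker products and traces\<close>

lemma sum_div_mod:
  fixes f :: "nat \<Rightarrow> nat \<Rightarrow> 'b::comm_monoid_add"
  shows "(\<Sum>k<a * b. f (k div b) (k mod b)) = (\<Sum>i<a. \<Sum>j<b. f i j)"
proof -
  have "(\<Sum>k<a * b. f (k div b) (k mod b)) = sum (\<lambda>(i,j). f i j) ({..<a} \<times> {..<b})"
  proof (rule sum.reindex_bij_witness[where i = "\<lambda>(i,j). i * b + j" and j = "\<lambda>k. (k div b, k mod b)"])
    fix k assume "k \<in> {..<a * b}"
    then have "b > 0" "k < a * b" by (auto intro: gr0I)
    then show "(k div b, k mod b) \<in> {..<a} \<times> {..<b}"
      by (auto simp: less_mult_imp_div_less)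
  next
    fix p assume p: "p \<in> {..<a} \<times> {..<b}"
    obtain i j where ij: "p = (i,j)" "i < a" "j < b" using p by auto
    have "i * b + j < Suc i * b" using ij by simp
    also have "\<dots> \<le> a * b" using ij by (intro mult_le_mono1) simp
    finally show "(case p of (i,j) \<Rightarrow> i * b + j) \<in> {..<a * b}" using ij by simp
  qed auto
  then show ?thesis by (simp add: sum.cartesian_product)
qed

lemma kronecker_carrier [simp]:
  "A \<in> carrier_mat a b \<Longrightarrow> B \<in> carrier_mat c d \<Longrightarrow> kronecker A B \<in> carrier_mat (a * c) (b * d)"
  by (simp add: kronecker_def)

lemma kronecker_dim [simp]:
  "dim_row (kronecker A B) = dim_row A * dim_row B"
  "dim_col (kronecker A B) = dim_col A * dim_col B"
  by (simp_all add: kronecker_def)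

lemma kronecker_index:
  "A \<in> carrier_mat a b \<Longrightarrow> B \<in> carrier_mat c d \<Longrightarrow> i < a * c \<Longrightarrow> j < b * d \<Longrightarrow>
   kronecker A B $$ (i,j) = A $$ (i div c, j div d) * B $$ (i mod c, j mod d)"
  by (auto simp: kronecker_def)

lemma div_mod_bounds:
  fixes i a c :: nat
  assumes "i < a * c"
  shows "i div c < a" "i mod c < c"
proof -
  have "c > 0" using assms by (auto intro: gr0I)
  then show "i div c < a" "i mod c < c" using assms by (auto simp: less_mult_imp_div_less)
qed

lemma times_mat_index:
  "A \<in> carrier_mat a b \<Longrightarrow> B \<in> carrier_mat b c \<Longrightarrow> i < a \<Longrightarrow> j < c \<Longrightarrow>
   (A * B) $$ (i,j) = (\<Sum>k<b. A $$ (i,k) * B $$ (k,j))"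
  by (simp add: times_mat_def scalar_prod_def lessThan_atLeast0)

lemma kronecker_mult:
  fixes A B C D :: "'k::field mat"
  assumes A: "A \<in> carrier_mat a b" and B: "B \<in> carrier_mat a' b'"
    and C: "C \<in> carrier_mat b c" and D: "D \<in> carrier_mat b' c'"
  shows "kronecker A B * kronecker C D = kronecker (A * C) (B * D)"
proof (rule eq_matI)
  fix i j assume "i < dim_row (kronecker (A * C) (B * D))" "j < dim_col (kronecker (A * C) (B * D))"
  then have ij: "i < a * a'" "j < c * c'"
    using A B C D by (auto simp: kronecker_def)
  note ij' = div_mod_bounds[OF ij(1)] div_mod_bounds[OF ij(2)]
  have "(kronecker A B * kronecker C D) $$ (i,j)
    = (\<Sum>k<b * b'. kronecker A B $$ (i,k) * kronecker C D $$ (k,j))"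
    by (rule times_mat_index[OF kronecker_carrier[OF A B] kronecker_carrier[OF C D] ij])
  also have "\<dots> = (\<Sum>k<b * b'. A $$ (i div a', k div b') * B $$ (i mod a', k mod b')
      * (C $$ (k div b', j div c') * D $$ (k mod b', j mod c')))"
    using ij by (intro sum.cong) (auto simp: kronecker_index[OF A B] kronecker_index[OF C D])
  also have "\<dots> = (\<Sum>k<b. \<Sum>l<b'. A $$ (i div a', k) * B $$ (i mod a', l) * (C $$ (k, j div c') * D $$ (l, j mod c')))"
    by (rule sum_div_mod)
  also have "\<dots> = (A * C) $$ (i div a', j div c') * (B * D) $$ (i mod a', j mod c')"
    unfolding times_mat_index[OF A C ij'(1,3)] times_mat_index[OF B D ij'(2,4)] sum_product
    by (simp add: mult_ac)
  also have "\<dots> = kronecker (A * C) (B * D) $$ (i,j)"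
    using kronecker_index[OF mult_carrier_mat[OF A C] mult_carrier_mat[OF B D] ij] by simp
  finally show "(kronecker A B * kronecker C D) $$ (i,j) = kronecker (A * C) (B * D) $$ (i,j)" .
qed (use A B C D in \<open>auto simp: kronecker_def\<close>)

lemma kronecker_eqI:
  fixes A B Z :: "'k::field mat"
  assumes "A \<in> carrier_mat a b" "B \<in> carrier_mat c d" "Z \<in> carrier_mat (a * c) (b * d)"
    and "\<And>i j. i < a * c \<Longrightarrow> j < b * d \<Longrightarrow> i div c < a \<Longrightarrow> i mod c < c \<Longrightarrow> j div d < b \<Longrightarrow> j mod d < d \<Longrightarrow>
      A $$ (i div c, j div d) * B $$ (i mod c, j mod d) = Z $$ (i,j)"
  shows "kronecker A B = Z"
  by (rule eq_matI) (use assms in \<open>auto simp: kronecker_def div_mod_bounds\<close>)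

lemma kronecker_add_left:
  fixes A A' B :: "'k::field mat"
  assumes A: "A \<in> carrier_mat a b" and A': "A' \<in> carrier_mat a b" and B: "B \<in> carrier_mat c d"
  shows "kronecker (A + A') B = kronecker A B + kronecker A' B"
  by (rule kronecker_eqI[where a = a and b = b and c = c and d = d])
    (use assms in \<open>simp_all add: kronecker_index[where a = a and b = b and c = c and d = d] algebra_simps\<close>)

lemma kronecker_add_right:
  fixes A B B' :: "'k::field mat"
  assumes A: "A \<in> carrier_mat a b" and B: "B \<in> carrier_mat c d" and B': "B' \<in> carrier_mat c d"
  shows "kronecker A (B + B') = kronecker A B + kronecker A B'"
  by (rule kronecker_eqI[where a = a and b = b and c = c and d = d])
    (use assms in \<open>simp_all add: kronecker_index[where a = a and b = b and c = c and d = d] algebra_simps\<close>)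

lemma kronecker_smult_left:
  fixes A B :: "'k::field mat"
  assumes A: "A \<in> carrier_mat a b" and B: "B \<in> carrier_mat c d"
  shows "kronecker (x \<cdot>\<^sub>m A) B = x \<cdot>\<^sub>m kronecker A B"
  by (rule kronecker_eqI[where a = a and b = b and c = c and d = d])
    (use assms in \<open>simp_all add: kronecker_index[where a = a and b = b and c = c and d = d] algebra_simps\<close>)

lemma kronecker_smult_right:
  fixes A B :: "'k::field mat"
  assumes A: "A \<in> carrier_mat a b" and B: "B \<in> carrier_mat c d"
  shows "kronecker A (x \<cdot>\<^sub>m B) = x \<cdot>\<^sub>m kronecker A B"
  by (rule kronecker_eqI[where a = a and b = b and c = c and d = d])
    (use assms in \<open>simp_all add: kronecker_index[where a = a and b = b and c = c and d = d] algebra_simps\<close>)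

lemma kronecker_zero_left: "B \<in> carrier_mat c d \<Longrightarrow> kronecker (0\<^sub>m a b) B = 0\<^sub>m (a * c) (b * d)"
  for B :: "'k::field mat"
  by (rule kronecker_eqI[where a = a and b = b and c = c and d = d]) simp_all

lemma kronecker_zero_right: "A \<in> carrier_mat a b \<Longrightarrow> kronecker A (0\<^sub>m c d) = 0\<^sub>m (a * c) (b * d)"
  for A :: "'k::field mat"
  by (rule kronecker_eqI[where a = a and b = b and c = c and d = d]) simp_all

lemma kronecker_one: "kronecker (1\<^sub>m a) (1\<^sub>m b) = 1\<^sub>m (a * b)"
proof (rule eq_matI)
  fix i j assume "i < dim_row (1\<^sub>m (a * b))" "j < dim_col (1\<^sub>m (a * b))"
  then have ij: "i < a * b" "j < a * b" by auto
  have "i = j \<longleftrightarrow> i div b = j div b \<and> i mod b = j mod b"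
    by (metis div_mult_mod_eq)
  then show "kronecker (1\<^sub>m a) (1\<^sub>m b) $$ (i,j) = 1\<^sub>m (a * b) $$ (i,j)"
    using ij by (auto simp: kronecker_def div_mod_bounds)
qed (auto simp: kronecker_def)

lemma kronecker_pow:
  fixes A B :: "'k::field mat"
  assumes "A \<in> carrier_mat a a" "B \<in> carrier_mat b b"
  shows "kronecker A B ^\<^sub>m r = kronecker (A ^\<^sub>m r) (B ^\<^sub>m r)"
proof (induction r)
  case 0
  then show ?case using assms by (simp add: kronecker_one kronecker_def[of A B])
next
  case (Suc r)
  then show ?case using assms kronecker_mult[of "A ^\<^sub>m r" a a "B ^\<^sub>m r" b b A a B b] by simp
qed

section \<open>Traces\<close>

definition mat_trace :: "'k::field mat \<Rightarrow> 'k" where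
  "mat_trace A = (\<Sum>i<dim_row A. A $$ (i,i))"

lemma mat_trace_add: "A \<in> carrier_mat d d \<Longrightarrow> B \<in> carrier_mat d d \<Longrightarrow> mat_trace (A + B) = mat_trace A + mat_trace B"
  by (auto simp: mat_trace_def sum.distrib)

lemma mat_trace_comm:
  assumes A: "A \<in> carrier_mat a b" and B: "B \<in> carrier_mat b a"
  shows "mat_trace (A * B) = mat_trace (B * A)"
proof -
  have "mat_trace (A * B) = (\<Sum>i<a. \<Sum>k<b. A $$ (i,k) * B $$ (k,i))"
    using A B by (simp add: mat_trace_def times_mat_index[OF A B] del: index_mult_mat(1))
  also have "\<dots> = (\<Sum>k<b. \<Sum>i<a. B $$ (k,i) * A $$ (i,k))"
    by (subst sum.swap) (simp add: mult.commute)
  also have "\<dots> = mat_trace (B * A)"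
    using A B by (simp add: mat_trace_def times_mat_index[OF B A] del: index_mult_mat(1))
  finally show ?thesis .
qed

section \<open>Short exact sequences\<close>

text \<open>A short exact sequence of column spaces with a linear splitting \<open>f'\<close>, \<open>g'\<close>.\<close>

definition split_mats :: "nat \<Rightarrow> nat \<Rightarrow> nat \<Rightarrow> 'k::field mat \<Rightarrow> 'k mat \<Rightarrow> 'k mat \<Rightarrow> 'k mat \<Rightarrow> bool" where
  "split_mats l m r f g f' g' \<longleftrightarrow>
    f \<in> carrier_mat m l \<and> f' \<in> carrier_mat l m \<and> g \<in> carrier_mat r m \<and> g' \<in> carrier_mat m r \<and>
    f' * f = 1\<^sub>m l \<and> g * g' = 1\<^sub>m r \<and> f * f' + g' * g = 1\<^sub>m m"

text \<open>Exactness in the middle is a consequence of the splitting: multiply f f' + g' g = 1 by f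
  from the right, so that g' g f = 0, then by g from the left.\<close>

lemma split_mats_gf:
  assumes "split_mats l m r f g f' g'"
  shows "g * f = 0\<^sub>m r l"
proof -
  have c: "f \<in> carrier_mat m l" "f' \<in> carrier_mat l m" "g \<in> carrier_mat r m" "g' \<in> carrier_mat m r"
    and e: "f' * f = 1\<^sub>m l" "g * g' = 1\<^sub>m r" "f * f' + g' * g = 1\<^sub>m m"
    using assms by (auto simp: split_mats_def)
  have "f = (f * f' + g' * g) * f" using c e by simp
  also have "\<dots> = f * (f' * f) + g' * (g * f)"
    using c by (simp add: add_mult_distrib_mat[where n = m and nr = m and nc = l] assoc_mult_mat[of f m l f' m f l] assoc_mult_mat[of g' m r g m f l])
  also have "\<dots> = f + g' * (g * f)" using c e by simp
  finally have 1: "f = f + g' * (g * f)" .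
  have gf: "g' * (g * f) \<in> carrier_mat m l" using c by simp
  have "g' * (g * f) = 0\<^sub>m m l"
  proof (rule eq_matI)
    fix i j assume ij: "i < dim_row (0\<^sub>m m l)" "j < dim_col (0\<^sub>m m l)"
    have "f $$ (i,j) = (f + g' * (g * f)) $$ (i,j)" using 1 by metis
    then show "(g' * (g * f)) $$ (i,j) = 0\<^sub>m m l $$ (i,j)" using ij gf c
      by (simp del: index_mult_mat(1))
  qed (use gf in auto)
  then have "g * (g' * (g * f)) = 0\<^sub>m r l" using c by simp
  then show ?thesis
    using c e by (simp add: assoc_mult_mat[of g r m g' r "g * f" l, symmetric])
qed

lemma mult_mat_unit_vec:
  "A \<in> carrier_mat a b \<Longrightarrow> i < b \<Longrightarrow> A *\<^sub>v unit_vec b i = col A (i::nat)" for A :: "'k::field mat"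
  by (intro eq_vecI) auto

lemma mat_eqI_vec:
  fixes A B :: "'k::field mat"
  assumes "A \<in> carrier_mat a b" "B \<in> carrier_mat a b"
    "\<And>v. v \<in> carrier_vec b \<Longrightarrow> A *\<^sub>v v = B *\<^sub>v v"
  shows "A = B"
proof (rule mat_col_eqI)
  fix i assume i: "i < dim_col B"
  have "A *\<^sub>v unit_vec b i = B *\<^sub>v unit_vec b i" by (rule assms(3)) simp
  then show "col A i = col B i" using assms(1,2) i mult_mat_unit_vec[of A a b i] mult_mat_unit_vec[of B a b i] by simp
qed (use assms in auto)

lemma mat_of_col_fun:
  fixes v :: "nat \<Rightarrow> 'k::field vec"
  assumes "\<And>i. i < b \<Longrightarrow> v i \<in> carrier_vec a"
  obtains V where "V \<in> carrier_mat a b" "\<And>i. i < b \<Longrightarrow> col V i = v i"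
proof
  show "mat a b (\<lambda>(j,i). v i $ j) \<in> carrier_mat a b" by simp
  show "col (mat a b (\<lambda>(j,i). v i $ j)) i = v i" if "i < b" for i
    using assms[OF that] that by (intro eq_vecI) auto
qed

text \<open>The map 1 - g' g takes values in the kernel of g, which is the image of f; lifting its
  columns through f gives f'. The section g' is kept as given, because
  \<open>composition_step\<close> works with a homogeneous one.\<close>

lemma section_imp_split_mats:
  fixes f g :: "'k::field mat"
  assumes f: "f \<in> carrier_mat m l" and g: "g \<in> carrier_mat r m" and g': "g' \<in> carrier_mat m r"
    and inj: "inj_on (\<lambda>v. f *\<^sub>v v) (carrier_vec l)"
    and ex: "(\<lambda>v. f *\<^sub>v v) ` carrier_vec l = {v \<in> carrier_vec m. g *\<^sub>v v = 0\<^sub>v r}"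
    and gg': "g * g' = 1\<^sub>m r"
  obtains f' where "split_mats l m r f g f' g'"
proof -
  have gf: "g *\<^sub>v (f *\<^sub>v v) = 0\<^sub>v r" if "v \<in> carrier_vec l" for v
    using ex that by blast
  let ?p = "1\<^sub>m m - g' * g"
  have p: "?p \<in> carrier_mat m m" using g g' by (intro minus_carrier_mat mult_carrier_mat)
  have "g * ?p = g - g * (g' * g)"
    using g g' mult_minus_distrib_mat[of g r m "1\<^sub>m m" m "g' * g"] by simp
  also have "g * (g' * g) = g"
    using g g' gg' by (simp flip: assoc_mult_mat[of g r m g' r g m])
  finally have gp: "g * ?p = 0\<^sub>m r m" using g by auto
  have "\<exists>w\<in>carrier_vec l. f *\<^sub>v w = v" if "v \<in> carrier_vec m" "g *\<^sub>v v = 0\<^sub>v r" for v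
  proof -
    have "v \<in> (\<lambda>v. f *\<^sub>v v) ` carrier_vec l" unfolding ex using that by simp
    then show ?thesis by blast
  qed
  then obtain t where t: "\<And>v. v \<in> carrier_vec m \<Longrightarrow> g *\<^sub>v v = 0\<^sub>v r \<Longrightarrow> t v \<in> carrier_vec l \<and> f *\<^sub>v t v = v" by metis
  have ker: "col ?p i \<in> carrier_vec m \<and> g *\<^sub>v col ?p i = 0\<^sub>v r" if "i < m" for i
  proof -
    have "g *\<^sub>v col ?p i = col (g * ?p) i" using g p that by (simp add: col_mult2[OF g p])
    then show ?thesis using p that unfolding gp by (auto simp: carrier_vecI)
  qed
  obtain f' where f': "f' \<in> carrier_mat l m" and col': "\<And>i. i < m \<Longrightarrow> col f' i = t (col ?p i)"
    using mat_of_col_fun[of m "\<lambda>i. t (col ?p i)" l] t ker by blast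
  have ff': "f * f' = ?p"
  proof (rule mat_col_eqI)
    fix i assume "i < dim_col ?p"
    then have i: "i < m" using p by auto
    have "col (f * f') i = f *\<^sub>v t (col ?p i)" using i by (simp add: col_mult2[OF f f'] col')
    also have "\<dots> = col ?p i" using t ker[OF i] by blast
    finally show "col (f * f') i = col ?p i" .
  qed (use f f' p g in auto)
  have sum: "f * f' + g' * g = 1\<^sub>m m"
    unfolding ff' by (rule eq_matI) (use g g' in \<open>auto simp del: index_mult_mat(1)\<close>)
  have "f' * f = 1\<^sub>m l"
  proof (rule mat_eqI_vec)
    fix v :: "'k vec" assume v: "v \<in> carrier_vec l"
    have fv: "f *\<^sub>v v \<in> carrier_vec m" using f v by simp
    have "f *\<^sub>v (f' *\<^sub>v (f *\<^sub>v v)) = ?p *\<^sub>v (f *\<^sub>v v)"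
      unfolding ff'[symmetric] using f f' fv by simp
    also have "\<dots> = f *\<^sub>v v - g' *\<^sub>v (g *\<^sub>v (f *\<^sub>v v))"
      using g g' fv by (simp add: minus_mult_distrib_mat_vec[of _ m m])
    also have "g' *\<^sub>v (g *\<^sub>v (f *\<^sub>v v)) = 0\<^sub>v m"
      unfolding gf[OF v] using g' by (intro eq_vecI) auto
    also have "f *\<^sub>v v - 0\<^sub>v m = f *\<^sub>v v" using fv by (intro eq_vecI) auto
    finally have "f' *\<^sub>v (f *\<^sub>v v) = v"
      using inj_onD[OF inj] f' fv v by auto
    then show "(f' * f) *\<^sub>v v = 1\<^sub>m l *\<^sub>v v" using f f' v by simp
  qed (use f f' in auto)
  then show thesis using that f f' g g' gg' sum by (auto simp: split_mats_def)
qed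

lemma exact_imp_split_mats:
  fixes f g :: "'k::field mat"
  assumes f: "f \<in> carrier_mat m l" and g: "g \<in> carrier_mat r m"
    and inj: "inj_on (\<lambda>v. f *\<^sub>v v) (carrier_vec l)"
    and ex: "(\<lambda>v. f *\<^sub>v v) ` carrier_vec l = {v \<in> carrier_vec m. g *\<^sub>v v = 0\<^sub>v r}"
    and surj: "(\<lambda>v. g *\<^sub>v v) ` carrier_vec m = carrier_vec r"
  obtains f' g' where "split_mats l m r f g f' g'"
proof -
  have "\<exists>w\<in>carrier_vec m. g *\<^sub>v w = v" if "v \<in> carrier_vec r" for v
  proof -
    have "v \<in> (\<lambda>v. g *\<^sub>v v) ` carrier_vec m" unfolding surj using that .
    then show ?thesis by blast
  qed
  then obtain s where s: "\<And>v. v \<in> carrier_vec r \<Longrightarrow> s v \<in> carrier_vec m \<and> g *\<^sub>v s v = v" by metis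
  obtain g' where g': "g' \<in> carrier_mat m r" and col: "\<And>i. i < r \<Longrightarrow> col g' i = s (unit_vec r i)"
    using mat_of_col_fun[of r "\<lambda>i. s (unit_vec r i)" m] s by auto
  have gg': "g * g' = 1\<^sub>m r"
    by (rule mat_col_eqI) (use g g' s in \<open>auto simp: col_mult2[OF g g'] col\<close>)
  from section_imp_split_mats[OF f g g' inj ex gg'] obtain f' where "split_mats l m r f g f' g'" .
  then show thesis by (rule that)
qed

lemma split_mats_imp_exact:
  fixes f g :: "'k::field mat"
  assumes s: "split_mats l m r f g f' g'"
  shows "inj_on (\<lambda>v. f *\<^sub>v v) (carrier_vec l)"
    and "(\<lambda>v. f *\<^sub>v v) ` carrier_vec l = {v \<in> carrier_vec m. g *\<^sub>v v = 0\<^sub>v r}"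
    and "(\<lambda>v. g *\<^sub>v v) ` carrier_vec m = carrier_vec r"
proof -
  have c: "f \<in> carrier_mat m l" "f' \<in> carrier_mat l m" "g \<in> carrier_mat r m" "g' \<in> carrier_mat m r"
    and e: "f' * f = 1\<^sub>m l" "g * g' = 1\<^sub>m r" "f * f' + g' * g = 1\<^sub>m m"
    using s by (auto simp: split_mats_def)
  have f'f: "f' *\<^sub>v (f *\<^sub>v v) = v" if "v \<in> carrier_vec l" for v
    using c e(1) that by (simp flip: assoc_mult_mat_vec[of f' l m f l])
  then show "inj_on (\<lambda>v. f *\<^sub>v v) (carrier_vec l)" by (metis inj_onI)
  have gg': "g *\<^sub>v (g' *\<^sub>v v) = v" if "v \<in> carrier_vec r" for v
    using c e(2) that by (simp flip: assoc_mult_mat_vec[of g r m g' r])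
  then show "(\<lambda>v. g *\<^sub>v v) ` carrier_vec m = carrier_vec r"
  proof (intro equalityI subsetI)
    fix v :: "'k vec" assume "v \<in> carrier_vec r"
    then show "v \<in> (\<lambda>v. g *\<^sub>v v) ` carrier_vec m"
      using c gg' by (intro image_eqI[where x = "g' *\<^sub>v v"]) auto
  qed (use c in auto)
  have gf: "g *\<^sub>v (f *\<^sub>v v) = 0\<^sub>v r" if "v \<in> carrier_vec l" for v
  proof -
    have "0\<^sub>m r l *\<^sub>v v = 0\<^sub>v r" using that by (intro eq_vecI) auto
    then show ?thesis
      using c split_mats_gf[OF s] that by (simp flip: assoc_mult_mat_vec[of g r m f l])
  qed
  have "v = f *\<^sub>v (f' *\<^sub>v v)" if "v \<in> carrier_vec m" "g *\<^sub>v v = 0\<^sub>v r" for v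
  proof -
    have "v = (f * f' + g' * g) *\<^sub>v v" using e(3) that by simp
    also have "\<dots> = f *\<^sub>v (f' *\<^sub>v v) + g' *\<^sub>v (g *\<^sub>v v)"
      using c that by (simp add: add_mult_distrib_mat_vec[of _ m m])
    also have "g' *\<^sub>v (g *\<^sub>v v) = 0\<^sub>v m"
      unfolding that(2) using c by (intro eq_vecI) auto
    also have "f *\<^sub>v (f' *\<^sub>v v) + 0\<^sub>v m = f *\<^sub>v (f' *\<^sub>v v)" using c that by simp
    finally show ?thesis .
  qed
  then show "(\<lambda>v. f *\<^sub>v v) ` carrier_vec l = {v \<in> carrier_vec m. g *\<^sub>v v = 0\<^sub>v r}"
  proof (intro equalityI subsetI)
    fix v assume "v \<in> {v \<in> carrier_vec m. g *\<^sub>v v = 0\<^sub>v r}"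
    then show "v \<in> (\<lambda>v. f *\<^sub>v v) ` carrier_vec l"
      using c \<open>\<And>v. v \<in> carrier_vec m \<Longrightarrow> g *\<^sub>v v = 0\<^sub>v r \<Longrightarrow> v = f *\<^sub>v (f' *\<^sub>v v)\<close>
      by (intro image_eqI[where x = "f' *\<^sub>v v"]) auto
  qed (use c gf in auto)
qed

text \<open>Column spaces over a field always split; the splitting maps need not be module
  homomorphisms. This reduces exactness to matrix identities, which survive Kronecker products and
  can be inserted into traces.\<close>

lemma qu_short_exact_iff_split:
  "qu_short_exact n q L M N \<longleftrightarrow> (\<exists>f g f' g'. split_mats (fst L) (fst M) (fst N) f g f' g' \<and>
     qu_module_hom n q L M f \<and> qu_module_hom n q M N g)"
proof
  assume "qu_short_exact n q L M N"
  then obtain f g where *: "qu_module_hom n q L M f" "qu_module_hom n q M N g"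
     "inj_on (\<lambda>v. f *\<^sub>v v) (carrier_vec (fst L))"
     "(\<lambda>v. f *\<^sub>v v) ` carrier_vec (fst L) = {v \<in> carrier_vec (fst M). g *\<^sub>v v = 0\<^sub>v (fst N)}"
     "(\<lambda>v. g *\<^sub>v v) ` carrier_vec (fst M) = carrier_vec (fst N)"
    by (auto simp: qu_short_exact_def)
  then have "f \<in> carrier_mat (fst M) (fst L)" "g \<in> carrier_mat (fst N) (fst M)"
    by (auto simp: qu_module_hom_def)
  from exact_imp_split_mats[OF this *(3-5)] obtain f' g' where
    "split_mats (fst L) (fst M) (fst N) f g f' g'" .
  then show "\<exists>f g f' g'. split_mats (fst L) (fst M) (fst N) f g f' g' \<and>
     qu_module_hom n q L M f \<and> qu_module_hom n q M N g"
    using * by blast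
next
  assume "\<exists>f g f' g'. split_mats (fst L) (fst M) (fst N) f g f' g' \<and>
     qu_module_hom n q L M f \<and> qu_module_hom n q M N g"
  then obtain f g f' g' where "split_mats (fst L) (fst M) (fst N) f g f' g'"
     "qu_module_hom n q L M f" "qu_module_hom n q M N g" by auto
  then show "qu_short_exact n q L M N"
    unfolding qu_short_exact_def using split_mats_imp_exact[of "fst L" "fst M" "fst N" f g f' g'] by blast
qed

text \<open>Insert f f' + g' g = 1 next to \<open>AM\<close>, move \<open>AM\<close> past f and g,
  and use that the trace is cyclic.\<close>

lemma mat_trace_split:
  fixes f g :: "'k::field mat"
  assumes s: "split_mats l m r f g f' g'"
    and AL: "AL \<in> carrier_mat l l" and AM: "AM \<in> carrier_mat m m" and AN: "AN \<in> carrier_mat r r"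
    and fA: "f * AL = AM * f" and gA: "g * AM = AN * g"
  shows "mat_trace AM = mat_trace AL + mat_trace AN"
proof -
  have c: "f \<in> carrier_mat m l" "f' \<in> carrier_mat l m" "g \<in> carrier_mat r m" "g' \<in> carrier_mat m r"
    and e: "f' * f = 1\<^sub>m l" "g * g' = 1\<^sub>m r" "f * f' + g' * g = 1\<^sub>m m"
    using s by (auto simp: split_mats_def)
  have "AM = AM * (f * f' + g' * g)" using AM e by simp
  also have "\<dots> = AM * (f * f') + AM * (g' * g)"
    using AM c by (simp add: mult_add_distrib_mat[where n = m and nr = m and nc = m])
  finally have "mat_trace AM = mat_trace (AM * (f * f')) + mat_trace (AM * (g' * g))"
    using AM c mat_trace_add[of "AM * (f * f')" m "AM * (g' * g)"] by simp
  also have "AM * (f * f') = f * (AL * f')"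
    using assoc_mult_mat[OF AM c(1,2)] assoc_mult_mat[OF c(1) AL c(2)] fA by simp
  also have "mat_trace (f * (AL * f')) = mat_trace (AL * f' * f)"
    using AL c by (intro mat_trace_comm) auto
  also have "AL * f' * f = AL" using AL c e by simp
  also have "mat_trace (AM * (g' * g)) = mat_trace (g' * g * AM)"
    using AM c by (intro mat_trace_comm) auto
  also have "g' * g * AM = g' * (AN * g)"
    using AM c gA by simp
  also have "mat_trace (g' * (AN * g)) = mat_trace (AN * g * g')"
    using AN c by (intro mat_trace_comm) auto
  also have "AN * g * g' = AN" using AN c e by simp
  finally show ?thesis .
qed

lemma split_mats_kronecker_left:
  fixes f g :: "'k::field mat"
  assumes "split_mats l m r f g f' g'"
  shows "split_mats (l * d) (m * d) (r * d) (kronecker f (1\<^sub>m d)) (kronecker g (1\<^sub>m d))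
    (kronecker f' (1\<^sub>m d)) (kronecker g' (1\<^sub>m d))"
  using assms unfolding split_mats_def
  by (auto simp: kronecker_mult[where b' = d and a' = d and c' = d] kronecker_one
      kronecker_add_left[where a = m and b = m and c = d and d = d, symmetric])

lemma split_mats_kronecker_right:
  fixes f g :: "'k::field mat"
  assumes "split_mats l m r f g f' g'"
  shows "split_mats (d * l) (d * m) (d * r) (kronecker (1\<^sub>m d) f) (kronecker (1\<^sub>m d) g)
    (kronecker (1\<^sub>m d) f') (kronecker (1\<^sub>m d) g')"
  using assms unfolding split_mats_def
  by (auto simp: kronecker_mult[where b = d and a = d and c = d] kronecker_one
      kronecker_add_right[where a = d and b = d and c = m and d = m, symmetric])

section \<open>Tensor products of modules\<close>

context scal_ring
begin

context
  fixes L :: nat and \<omega> :: 'k and T :: 'a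
  assumes T [simp]: "T \<in> carrier R" and TL: "T [^] L = \<one>"
    and \<omega>L: "\<omega> ^ L = 1" and \<omega>: "\<forall>m. 0 < m \<and> m < L \<longrightarrow> \<omega> ^ m \<noteq> 1" and L: "L > 0"
begin

lemma finsum_proj_eigen:
  assumes a: "a \<in> carrier R" and Ta: "T \<otimes> a = \<sigma> (\<omega> ^ b) \<otimes> a" and b: "b < L" and I: "I \<subseteq> {0..<L}"
  shows "(\<Oplus>i\<in>I. \<sigma> (\<phi> i) \<otimes> proj L \<omega> T i) \<otimes> a = (if b \<in> I then \<sigma> (\<phi> b) \<otimes> a else \<zero>)"
proof -
  note pc = proj_closed[OF T TL \<omega>L \<omega> L]
  have I': "finite I" using I by (rule finite_subset) simp
  have "(\<Oplus>i\<in>I. \<sigma> (\<phi> i) \<otimes> proj L \<omega> T i) \<otimes> a = (\<Oplus>i\<in>I. \<sigma> (\<phi> i) \<otimes> proj L \<omega> T i \<otimes> a)"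
    using I' a pc by (intro finsum_ldistr) auto
  also have "\<dots> = (\<Oplus>i\<in>I. if b = i then \<sigma> (\<phi> b) \<otimes> a else \<zero>)"
    using a pc proj_eigen[OF T TL \<omega>L \<omega> L a Ta b] I
    by (intro finsum_cong') (auto simp: m_assoc)
  also have "\<dots> = (if b \<in> I then \<sigma> (\<phi> b) \<otimes> a else \<zero>)"
  proof (cases "b \<in> I")
    case True
    then show ?thesis using finsum_singleton[of b I "\<lambda>_. \<sigma> (\<phi> b) \<otimes> a"] a I' by simp
  next
    case False
    then have "(\<Oplus>i\<in>I. if b = i then \<sigma> (\<phi> b) \<otimes> a else \<zero>) = (\<Oplus>i\<in>I. \<zero>)"
      by (intro finsum_cong') auto
    then show ?thesis using False by simp
  qed
  finally show ?thesis .
qed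

text \<open>Combinations of orthogonal idempotents multiply coefficientwise; this is how
  \<open>qu_flat\<close> is inverted.\<close>

lemma finsum_proj_mult:
  "(\<Oplus>i\<in>{0..<L}. \<sigma> (\<phi> i) \<otimes> proj L \<omega> T i) \<otimes> (\<Oplus>i\<in>{0..<L}. \<sigma> (\<psi> i) \<otimes> proj L \<omega> T i)
     = (\<Oplus>i\<in>{0..<L}. \<sigma> (\<phi> i * \<psi> i) \<otimes> proj L \<omega> T i)"
proof -
  note pc = proj_closed[OF T TL \<omega>L \<omega> L]
  let ?f = "\<Oplus>i\<in>{0..<L}. \<sigma> (\<phi> i) \<otimes> proj L \<omega> T i"
  have f: "?f \<in> carrier R" using pc by (intro finsum_closed) auto
  have "?f \<otimes> (\<Oplus>i\<in>{0..<L}. \<sigma> (\<psi> i) \<otimes> proj L \<omega> T i)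
      = (\<Oplus>i\<in>{0..<L}. ?f \<otimes> (\<sigma> (\<psi> i) \<otimes> proj L \<omega> T i))"
    using pc f by (intro finsum_rdistr) auto
  also have "\<dots> = (\<Oplus>i\<in>{0..<L}. \<sigma> (\<phi> i * \<psi> i) \<otimes> proj L \<omega> T i)"
  proof (intro finsum_cong')
    fix i assume i: "i \<in> {0..<L}"
    have "?f \<otimes> (\<sigma> (\<psi> i) \<otimes> proj L \<omega> T i) = \<sigma> (\<psi> i) \<otimes> (?f \<otimes> proj L \<omega> T i)"
      using pc f by (simp add: m_assoc[symmetric] scal_comm)
    also have "?f \<otimes> proj L \<omega> T i = \<sigma> (\<phi> i) \<otimes> proj L \<omega> T i"
      using finsum_proj_eigen[OF pc mult_proj[OF T TL \<omega>L \<omega> L], of i "{0..<L}" \<phi>] i by simp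
    finally show "?f \<otimes> (\<sigma> (\<psi> i) \<otimes> proj L \<omega> T i) = \<sigma> (\<phi> i * \<psi> i) \<otimes> proj L \<omega> T i"
      using pc by (simp add: scal_assoc mult.commute)
  qed (use pc in auto)
  finally show ?thesis .
qed

end

section \<open>Gaussian binomial coefficients and the q-binomial theorem at a root of unity\<close>

fun gauss_binom :: "'k \<Rightarrow> nat \<Rightarrow> nat \<Rightarrow> 'k" where
  "gauss_binom \<omega> 0 k = (if k = 0 then 1 else 0)"
| "gauss_binom \<omega> (Suc m) 0 = 1"
| "gauss_binom \<omega> (Suc m) (Suc k) = \<omega> ^ Suc k * gauss_binom \<omega> m (Suc k) + gauss_binom \<omega> m k"

lemma gauss_binom_gt: "m < k \<Longrightarrow> gauss_binom \<omega> m k = 0"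
  by (induction \<omega> m k rule: gauss_binom.induct) auto

lemma gauss_binom_0 [simp]: "gauss_binom \<omega> m 0 = 1"
  by (cases m) auto

lemma gauss_binom_self: "gauss_binom \<omega> m m = 1"
  by (induction m) (auto simp: gauss_binom_gt)

text \<open>The ratio of neighbouring coefficients with denominators cleared. In this form, as with
  the Pascal recursion, it remains valid at roots of unity, where quotients of q-factorials may be
  undefined.\<close>

lemma gauss_binom_absorb:
  "k \<le> m \<Longrightarrow> (1 - \<omega> ^ Suc k) * gauss_binom \<omega> m (Suc k) = (1 - \<omega> ^ (m - k)) * gauss_binom \<omega> m k"
proof (induction m arbitrary: k)
  case (Suc m)
  \<comment> \<open>Both sides of the claim for \<open>Suc m\<close> will be shown equal to 1 -
    \<omega>^(m+1) times the coefficient at m and k; this treats the left side.\<close>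
  have up: "(1 - \<omega> ^ Suc k) * gauss_binom \<omega> (Suc m) (Suc k) = (1 - \<omega> ^ Suc m) * gauss_binom \<omega> m k" if "k \<le> m" for k
  proof -
    have *: "\<omega> ^ Suc k * \<omega> ^ (m - k) = \<omega> ^ Suc m" using that by (simp flip: power_Suc power_add)
    have "(1 - \<omega> ^ Suc k) * gauss_binom \<omega> (Suc m) (Suc k)
       = \<omega> ^ Suc k * ((1 - \<omega> ^ Suc k) * gauss_binom \<omega> m (Suc k)) + (1 - \<omega> ^ Suc k) * gauss_binom \<omega> m k"
      by (simp only: gauss_binom.simps) (simp only: algebra_simps)
    also have "\<dots> = (1 - \<omega> ^ Suc k * \<omega> ^ (m - k)) * gauss_binom \<omega> m k"
      unfolding Suc.IH[OF that] by (simp only: algebra_simps) (simp add: algebra_simps)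
    finally show ?thesis unfolding * .
  qed
  show ?case
  proof (cases k)
    case 0
    then show ?thesis using up[of 0] by simp
  next
    case (Suc j)
    have "(1 - \<omega> ^ (m - j)) * gauss_binom \<omega> (Suc m) (Suc j)
      = \<omega> ^ Suc j * (1 - \<omega> ^ (m - j)) * gauss_binom \<omega> m (Suc j) + (1 - \<omega> ^ (m - j)) * gauss_binom \<omega> m j"
      by (simp only: gauss_binom.simps) (simp only: algebra_simps)
    also have "\<dots> = (\<omega> ^ Suc j * (1 - \<omega> ^ (m - j)) + (1 - \<omega> ^ Suc j)) * gauss_binom \<omega> m (Suc j)"
      using Suc.IH[of j] Suc Suc.prems by (simp only: distrib_right)
    also have "\<omega> ^ Suc j * (1 - \<omega> ^ (m - j)) + (1 - \<omega> ^ Suc j) = 1 - \<omega> ^ Suc m"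
      using Suc Suc.prems by (simp add: right_diff_distrib flip: power_Suc power_add)
    finally have "(1 - \<omega> ^ (m - j)) * gauss_binom \<omega> (Suc m) (Suc j) = (1 - \<omega> ^ Suc m) * gauss_binom \<omega> m (Suc j)" .
    then show ?thesis
      using up[of "Suc j"] Suc Suc.prems by (cases "Suc j = Suc m") (auto simp: gauss_binom_gt Suc_le_eq le_less_Suc_eq)
  qed
qed auto

text \<open>In \<open>gauss_binom_absorb\<close> the right factor at k = 0 is 1 - \<omega>^m = 0,
  and the left factors do not vanish below m; so the zero propagates upwards.\<close>

lemma gauss_binom_root_of_unity:
  assumes "\<omega> ^ m = 1" "\<forall>i. 0 < i \<and> i < m \<longrightarrow> \<omega> ^ i \<noteq> 1" "0 < k" "k < m"
  shows "gauss_binom \<omega> m k = 0"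
  using assms(3,4)
proof (induction k)
  case (Suc k)
  have "(1 - \<omega> ^ Suc k) * gauss_binom \<omega> m (Suc k) = 0"
    using gauss_binom_absorb[of k m \<omega>] Suc assms(1) by (cases "k = 0") auto
  moreover have "\<omega> ^ Suc k \<noteq> 1" using assms(2) Suc.prems by blast
  ultimately show ?case by simp
qed simp

lemma q_binomial:
  assumes U [simp]: "U \<in> carrier R" and V [simp]: "V \<in> carrier R" and comm: "U \<otimes> V = \<sigma> \<omega> \<otimes> (V \<otimes> U)"
  shows "(U \<oplus> V) [^] m = (\<Oplus>k\<in>{..m}. \<sigma> (gauss_binom \<omega> m k) \<otimes> (V [^] k \<otimes> U [^] (m - k)))"
proof (induction m)
  case 0
  have "\<sigma> 1 \<in> carrier R" by (rule scal_closed)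
  then show ?case by (simp add: scal_one)
next
  case (Suc m)
  have UV: "U \<otimes> V [^] k = \<sigma> (\<omega> ^ k) \<otimes> (V [^] k \<otimes> U)" for k :: nat
  proof (induction k)
    case (Suc k)
    have "U \<otimes> V [^] Suc k = \<sigma> (\<omega> ^ k) \<otimes> (V [^] k \<otimes> (U \<otimes> V))"
      using Suc by (simp add: m_assoc[symmetric])
    also have "\<dots> = \<sigma> (\<omega> ^ k) \<otimes> (\<sigma> \<omega> \<otimes> (V [^] k \<otimes> (V \<otimes> U)))"
      unfolding comm by (simp add: m_assoc[symmetric] scal_comm[of "V [^] k"])
    also have "\<dots> = \<sigma> (\<omega> ^ Suc k) \<otimes> (V [^] Suc k \<otimes> U)"
      by (simp add: scal_assoc m_assoc mult.commute)
    finally show ?case .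
  qed (simp add: scal_one)
  let ?t = "\<lambda>k. V [^] k \<otimes> U [^] (Suc m - k)"
  let ?g = "gauss_binom \<omega> m"
  have t [simp]: "?t k \<in> carrier R" for k by simp
  have cl: "(\<lambda>k. \<sigma> (c k) \<otimes> ?t k) \<in> I \<rightarrow> carrier R" for I c by auto
  have "(U \<oplus> V) [^] Suc m = (U \<oplus> V) \<otimes> (\<Oplus>k\<in>{..m}. \<sigma> (?g k) \<otimes> (V [^] k \<otimes> U [^] (m - k)))"
    unfolding Suc[symmetric] by (rule nat_pow_Suc2) simp
  also have "\<dots> = (\<Oplus>k\<in>{..m}. (U \<oplus> V) \<otimes> (\<sigma> (?g k) \<otimes> (V [^] k \<otimes> U [^] (m - k))))"
    by (intro finsum_rdistr) auto
  also have "\<dots> = (\<Oplus>k\<in>{..m}. \<sigma> (\<omega> ^ k * ?g k) \<otimes> ?t k \<oplus> \<sigma> (?g k) \<otimes> ?t (Suc k))"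
  proof (intro finsum_cong')
    fix k assume "k \<in> {..m}"
    then have k: "Suc m - k = Suc (m - k)" by auto
    have "(U \<oplus> V) \<otimes> (\<sigma> (?g k) \<otimes> (V [^] k \<otimes> U [^] (m - k)))
       = \<sigma> (?g k) \<otimes> ((U \<oplus> V) \<otimes> (V [^] k \<otimes> U [^] (m - k)))"
      by (simp add: m_assoc[symmetric] scal_comm[of "U \<oplus> V"])
    also have "(U \<oplus> V) \<otimes> (V [^] k \<otimes> U [^] (m - k))
      = \<sigma> (\<omega> ^ k) \<otimes> ?t k \<oplus> ?t (Suc k)"
    proof -
      have "U \<otimes> (V [^] k \<otimes> U [^] (m - k)) = (U \<otimes> V [^] k) \<otimes> U [^] (m - k)"
        by (simp add: m_assoc)
      also have "\<dots> = \<sigma> (\<omega> ^ k) \<otimes> (V [^] k \<otimes> (U \<otimes> U [^] (m - k)))"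
        unfolding UV by (simp add: m_assoc)
      also have "U \<otimes> U [^] (m - k) = U [^] (Suc m - k)"
        unfolding k by (rule nat_pow_Suc2[symmetric]) simp
      finally have 1: "U \<otimes> (V [^] k \<otimes> U [^] (m - k)) = \<sigma> (\<omega> ^ k) \<otimes> ?t k" .
      have "V \<otimes> (V [^] k \<otimes> U [^] (m - k)) = ?t (Suc k)"
        unfolding nat_pow_Suc2[OF V] by (simp add: m_assoc)
      with 1 show ?thesis by (simp add: l_distr)
    qed
    finally show "(U \<oplus> V) \<otimes> (\<sigma> (?g k) \<otimes> (V [^] k \<otimes> U [^] (m - k)))
       = \<sigma> (\<omega> ^ k * ?g k) \<otimes> ?t k \<oplus> \<sigma> (?g k) \<otimes> ?t (Suc k)"
      using t[of k] t[of "Suc k"] by (simp add: r_distr scal_assoc mult.commute del: nat_pow_Suc)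
  qed (use t in auto)
  also have "\<dots> = (\<Oplus>k\<in>{..m}. \<sigma> (\<omega> ^ k * ?g k) \<otimes> ?t k) \<oplus> (\<Oplus>k\<in>{..m}. \<sigma> (?g k) \<otimes> ?t (Suc k))"
    by (intro finsum_addf) (use t in auto)
  also have "(\<Oplus>k\<in>{..m}. \<sigma> (\<omega> ^ k * ?g k) \<otimes> ?t k) = (\<Oplus>k\<in>{..Suc m}. \<sigma> (\<omega> ^ k * ?g k) \<otimes> ?t k)"
    using finsum_Suc[OF cl, of "\<lambda>k. \<omega> ^ k * ?g k" m] cl[of "\<lambda>k. \<omega> ^ k * ?g k" "{..m}"]
    by (simp add: gauss_binom_gt scal_zero finsum_closed)
  also have "(\<Oplus>k\<in>{..m}. \<sigma> (?g k) \<otimes> ?t (Suc k)) = (\<Oplus>k\<in>{..Suc m}. \<sigma> (case k of 0 \<Rightarrow> 0 | Suc j \<Rightarrow> ?g j) \<otimes> ?t k)"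
    using finsum_Suc2[OF cl, of "\<lambda>k. case k of 0 \<Rightarrow> 0 | Suc j \<Rightarrow> ?g j" m]
    by (simp add: scal_zero finsum_closed Pi_def)
  also have "(\<Oplus>k\<in>{..Suc m}. \<sigma> (\<omega> ^ k * ?g k) \<otimes> ?t k) \<oplus> (\<Oplus>k\<in>{..Suc m}. \<sigma> (case k of 0 \<Rightarrow> 0 | Suc j \<Rightarrow> ?g j) \<otimes> ?t k)
    = (\<Oplus>k\<in>{..Suc m}. \<sigma> (\<omega> ^ k * ?g k) \<otimes> ?t k \<oplus> \<sigma> (case k of 0 \<Rightarrow> 0 | Suc j \<Rightarrow> ?g j) \<otimes> ?t k)"
    by (intro finsum_addf[symmetric]) (use t in auto)
  also have "\<dots> = (\<Oplus>k\<in>{..Suc m}. \<sigma> (gauss_binom \<omega> (Suc m) k) \<otimes> ?t k)"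
  proof (intro finsum_cong')
    fix k assume "k \<in> {..Suc m}"
    have "\<sigma> (\<omega> ^ k * ?g k) \<otimes> ?t k \<oplus> \<sigma> (case k of 0 \<Rightarrow> 0 | Suc j \<Rightarrow> ?g j) \<otimes> ?t k
      = \<sigma> (\<omega> ^ k * ?g k + (case k of 0 \<Rightarrow> 0 | Suc j \<Rightarrow> ?g j)) \<otimes> ?t k"
      unfolding scal_add by (rule l_distr[symmetric]) (rule scal_closed t)+
    also have "\<omega> ^ k * ?g k + (case k of 0 \<Rightarrow> 0 | Suc j \<Rightarrow> ?g j) = gauss_binom \<omega> (Suc m) k"
      by (cases k) auto
    finally show "\<sigma> (\<omega> ^ k * ?g k) \<otimes> ?t k \<oplus> \<sigma> (case k of 0 \<Rightarrow> 0 | Suc j \<Rightarrow> ?g j) \<otimes> ?t k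
      = \<sigma> (gauss_binom \<omega> (Suc m) k) \<otimes> ?t k" .
  qed (use t in auto)
  finally show ?case .
qed

text \<open>At a primitive m-th root of unity only the two outer terms survive. Applied with m =
  n^2, this gives the nilpotency of E and F on tensor products.\<close>

lemma q_binomial_root_of_unity:
  assumes U [simp]: "U \<in> carrier R" and V [simp]: "V \<in> carrier R" and comm: "U \<otimes> V = \<sigma> \<omega> \<otimes> (V \<otimes> U)"
    and \<omega>: "\<omega> ^ m = 1" "\<forall>i. 0 < i \<and> i < m \<longrightarrow> \<omega> ^ i \<noteq> 1" and m: "m > 0"
  shows "(U \<oplus> V) [^] m = U [^] m \<oplus> V [^] m"
proof -
  let ?f = "\<lambda>k. \<sigma> (gauss_binom \<omega> m k) \<otimes> (V [^] k \<otimes> U [^] (m - k))"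
  have "(U \<oplus> V) [^] m = finsum R ?f {..m}" by (rule q_binomial[OF U V comm])
  also have "{..m} = insert 0 (insert m ({..m} - {0,m}))" using m by auto
  also have "finsum R ?f \<dots> = ?f 0 \<oplus> finsum R ?f (insert m ({..m} - {0,m}))"
    using m by (intro finsum_insert) auto
  also have "finsum R ?f (insert m ({..m} - {0,m})) = ?f m \<oplus> finsum R ?f ({..m} - {0,m})"
    using m by (intro finsum_insert) auto
  also have "finsum R ?f ({..m} - {0,m}) = finsum R (\<lambda>_. \<zero>) ({..m} - {0,m})"
    using gauss_binom_root_of_unity[OF \<omega>] by (intro finsum_cong') (auto simp: scal_zero)
  finally show ?thesis by (simp add: gauss_binom_self scal_one)
qed

end

lemma mat_smult_smult: "a \<cdot>\<^sub>m (b \<cdot>\<^sub>m A) = (a * b) \<cdot>\<^sub>m A" for a b :: "'k::field"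
  by (rule eq_matI) auto

lemma mat_smult_1 [simp]: "1 \<cdot>\<^sub>m A = A" for A :: "'k::field mat"
  by (rule eq_matI) auto

lemma mat_scalar_mult: "V \<in> carrier_mat d e \<Longrightarrow> c \<cdot>\<^sub>m 1\<^sub>m d * V = c \<cdot>\<^sub>m V" for V :: "'k::field mat"
  using mult_smult_assoc_mat[of "1\<^sub>m d" d d V e c] by simp

section \<open>Weight spaces of kappa\<close>

locale qu_setup =
  fixes n :: nat and q :: "'k::field_char_0"
  assumes n_pos: "n > 0" and n_dvd: "4 dvd n"
    and q_pow: "q ^ (n ^ 2) = 1" and q_prim: "\<forall>m. 0 < m \<and> m < n ^ 2 \<longrightarrow> q ^ m \<noteq> 1"
begin

lemma q_nonzero [simp]: "q \<noteq> 0"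
  using q_pow n_pos by (metis power_0_left one_neq_zero power_eq_0_iff zero_less_power less_irrefl)

lemma Q_pow: "(q ^ n) ^ n = 1"
  using q_pow by (simp add: power2_eq_square power_mult)

lemma Q_prim: "\<forall>m. 0 < m \<and> m < n \<longrightarrow> (q ^ n) ^ m \<noteq> 1"
proof (intro allI impI)
  fix m assume "0 < m \<and> m < n"
  then have "0 < n * m \<and> n * m < n ^ 2" using n_pos by (simp add: power2_eq_square)
  then show "(q ^ n) ^ m \<noteq> 1" using q_prim by (simp flip: power_mult)
qed

lemma Q_pow_mod: "(q ^ n) ^ (b mod n) = (q ^ n) ^ b"
proof -
  have "(q ^ n) ^ b = (q ^ n) ^ (n * (b div n) + b mod n)" by simp
  also have "\<dots> = (q ^ n) ^ (b mod n)" by (simp only: power_add power_mult Q_pow) simp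
  finally show ?thesis by simp
qed

sublocale A: scal_ring "qu_alg n q" "qu_scal n q" by (rule scal_ring_qu_alg)

abbreviation "kap \<equiv> qu_gen n q gen_kappa"

lemma kap_pow: "kap [^]\<^bsub>qu_alg n q\<^esub> n = \<one>\<^bsub>qu_alg n q\<^esub>"
proof -
  interpret I: ideal "qu_ideal n q" "free_alg :: (gen list \<Rightarrow> 'k) ring" by (rule qu_ideal)
  interpret H: ring_hom_ring free_alg "qu_alg n q" "qu_class n q"
    by (intro ring_hom_ringI2 I.ring_axioms A.ring_axioms qu_class_hom)
  let ?r = "free_gen gen_kappa [^]\<^bsub>free_alg\<^esub> n \<ominus>\<^bsub>free_alg\<^esub> \<one>\<^bsub>free_alg\<^esub> :: gen list \<Rightarrow> 'k"
  have "?r \<in> qu_relations n q" by (simp add: qu_relations_def Let_def)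
  then have "?r \<in> qu_ideal n q"
    unfolding qu_ideal_def using ring.genideal_self[OF ring_free_alg qu_relations_carrier] by blast
  then have "qu_class n q ?r = \<zero>\<^bsub>qu_alg n q\<^esub>"
    by (simp add: qu_class_def qu_alg_def FactRing_def I.a_rcos_const)
  moreover have "qu_class n q ?r = kap [^]\<^bsub>qu_alg n q\<^esub> n \<ominus>\<^bsub>qu_alg n q\<^esub> \<one>\<^bsub>qu_alg n q\<^esub>"
    by (simp add: a_minus_def H.hom_nat_pow qu_gen_class)
  ultimately show ?thesis by (simp add: A.r_right_minus_eq)
qed

lemma inv_kap: "inv\<^bsub>qu_alg n q\<^esub> kap = kap [^]\<^bsub>qu_alg n q\<^esub> (n - 1)"
proof -
  have "kap \<otimes>\<^bsub>qu_alg n q\<^esub> kap [^]\<^bsub>qu_alg n q\<^esub> (n - 1) = \<one>\<^bsub>qu_alg n q\<^esub>"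
    using A.nat_pow_Suc2[of kap "n - 1"] n_pos kap_pow by simp
  moreover have "kap [^]\<^bsub>qu_alg n q\<^esub> (n - 1) \<otimes>\<^bsub>qu_alg n q\<^esub> kap = \<one>\<^bsub>qu_alg n q\<^esub>"
    using A.nat_pow_Suc[of kap "n - 1"] n_pos kap_pow by simp
  ultimately show ?thesis by (intro A.inv_unique'[symmetric]) auto
qed

lemmas kap_facts = qu_gen_carrier[of n q gen_kappa] kap_pow Q_pow Q_prim n_pos

lemma qu_idem_carrier [simp]: "qu_idem n q i \<in> carrier (qu_alg n q)"
  unfolding qu_idem_proj by (rule A.proj_closed[OF kap_facts])

lemma qu_flat_carrier [simp]: "qu_flat n q \<in> carrier (qu_alg n q)"
  unfolding qu_flat_def by (intro A.finsum_closed) auto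

definition flat_inv :: "'k qu_elem" where
  "flat_inv = (\<Oplus>\<^bsub>qu_alg n q\<^esub>i\<in>{0..<n}. qu_scal n q (q ^ i) \<otimes>\<^bsub>qu_alg n q\<^esub> qu_idem n q i)"

lemma flat_inv_carrier [simp]: "flat_inv \<in> carrier (qu_alg n q)"
  unfolding flat_inv_def by (intro A.finsum_closed) auto

lemma inv_flat: "inv\<^bsub>qu_alg n q\<^esub> (qu_flat n q) = flat_inv"
proof -
  have one: "(\<Oplus>\<^bsub>qu_alg n q\<^esub>i\<in>{0..<n}. qu_scal n q 1 \<otimes>\<^bsub>qu_alg n q\<^esub> qu_idem n q i) = \<one>\<^bsub>qu_alg n q\<^esub>"
    unfolding A.finsum_proj[OF kap_facts, symmetric] qu_idem_proj[symmetric]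
    by (intro A.finsum_cong') (auto simp: A.scal_one)
  have p: "inverse q ^ i * q ^ i = 1" "q ^ i * inverse q ^ i = 1" for i
    by (simp_all flip: power_mult_distrib)
  have "qu_flat n q \<otimes>\<^bsub>qu_alg n q\<^esub> flat_inv = \<one>\<^bsub>qu_alg n q\<^esub>"
    using A.finsum_proj_mult[OF kap_facts, of "\<lambda>i. inverse q ^ i" "\<lambda>i. q ^ i"]
    unfolding qu_flat_def flat_inv_def qu_idem_proj[symmetric] p one .
  moreover have "flat_inv \<otimes>\<^bsub>qu_alg n q\<^esub> qu_flat n q = \<one>\<^bsub>qu_alg n q\<^esub>"
    using A.finsum_proj_mult[OF kap_facts, of "\<lambda>i. q ^ i" "\<lambda>i. inverse q ^ i"]
    unfolding qu_flat_def flat_inv_def qu_idem_proj[symmetric] p one .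
  ultimately show ?thesis by (intro A.inv_unique'[symmetric]) auto
qed

text \<open>Square matrices take the place of weight vectors: the Kronecker calculus applies to them
  directly, and the identity matrix is a sum of such matrices. The weight b matters only modulo
  n.\<close>

definition wt :: "'k qu_module \<Rightarrow> nat \<Rightarrow> 'k mat \<Rightarrow> bool" where
  "wt M b V \<longleftrightarrow> V \<in> carrier_mat (fst M) (fst M) \<and> mod_gen n q M gen_kappa * V = (q ^ n) ^ b \<cdot>\<^sub>m V"

lemma wt_carrier: "wt M b V \<Longrightarrow> V \<in> carrier_mat (fst M) (fst M)"
  by (simp add: wt_def)

context
  fixes M :: "'k qu_module"
  assumes M: "M \<in> qu_modules n q"
begin

lemma mat_kappa_facts:
  "mod_gen n q M gen_kappa \<in> carrier (ring_mat TYPE('k) (fst M) ())"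
  "mod_gen n q M gen_kappa [^]\<^bsub>ring_mat TYPE('k) (fst M) ()\<^esub> n = \<one>\<^bsub>ring_mat TYPE('k) (fst M) ()\<^esub>"
proof -
  show 1: "mod_gen n q M gen_kappa \<in> carrier (ring_mat TYPE('k) (fst M) ())"
    using M by (simp add: ring_mat_simps)
  show "mod_gen n q M gen_kappa [^]\<^bsub>ring_mat TYPE('k) (fst M) ()\<^esub> n = \<one>\<^bsub>ring_mat TYPE('k) (fst M) ()\<^esub>"
    using pow_mat_ring_pow[of "mod_gen n q M gen_kappa" "fst M" n "()"] qu_rep_mod_gen[OF M] M
    by (simp add: qu_rep_def ring_mat_simps)
qed

lemma snd_finsum_idem_wt:
  assumes V: "wt M b V" and I: "I \<subseteq> {0..<n}"
  shows "snd M (\<Oplus>\<^bsub>qu_alg n q\<^esub>i\<in>I. qu_scal n q (\<phi> i) \<otimes>\<^bsub>qu_alg n q\<^esub> qu_idem n q i) * V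
    = (if b mod n \<in> I then \<phi> (b mod n) else 0) \<cdot>\<^sub>m V"
proof -
  interpret B: scal_ring "ring_mat TYPE('k) (fst M) ()" "\<lambda>c. c \<cdot>\<^sub>m 1\<^sub>m (fst M)" by (rule scal_ring_mat)
  let ?B = "ring_mat TYPE('k) (fst M) ()" let ?k = "mod_gen n q M gen_kappa"
  have Vc: "V \<in> carrier_mat (fst M) (fst M)" by (rule wt_carrier[OF V])
  have smul: "c \<cdot>\<^sub>m 1\<^sub>m (fst M) * V = c \<cdot>\<^sub>m V" for c
    using Vc by (rule mat_scalar_mult)
  have fin: "finite I" using I by (rule finite_subset) simp
  have "snd M (\<Oplus>\<^bsub>qu_alg n q\<^esub>i\<in>I. qu_scal n q (\<phi> i) \<otimes>\<^bsub>qu_alg n q\<^esub> qu_idem n q i)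
    = (\<Oplus>\<^bsub>?B\<^esub>i\<in>I. snd M (qu_scal n q (\<phi> i) \<otimes>\<^bsub>qu_alg n q\<^esub> qu_idem n q i))"
    by (rule snd_module_finsum_mult[OF M _ fin]) auto
  also have "\<dots> = (\<Oplus>\<^bsub>?B\<^esub>i\<in>I. \<phi> i \<cdot>\<^sub>m 1\<^sub>m (fst M) \<otimes>\<^bsub>?B\<^esub> B.proj n (q ^ n) ?k i)"
  proof (rule B.finsum_cong')
    fix i
    show "snd M (qu_scal n q (\<phi> i) \<otimes>\<^bsub>qu_alg n q\<^esub> qu_idem n q i) = \<phi> i \<cdot>\<^sub>m 1\<^sub>m (fst M) \<otimes>\<^bsub>?B\<^esub> B.proj n (q ^ n) ?k i"
      by (simp add: qu_modules_mult[OF M] qu_modules_scal[OF M])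
        (simp add: qu_idem_proj snd_module_proj[OF M] mat_proj_def mod_gen_def ring_mat_simps)
  next
    show "(\<lambda>i. \<phi> i \<cdot>\<^sub>m 1\<^sub>m (fst M) \<otimes>\<^bsub>?B\<^esub> B.proj n (q ^ n) ?k i) \<in> I \<rightarrow> carrier ?B"
      using B.proj_closed[OF mat_kappa_facts Q_pow Q_prim n_pos] by (auto intro!: B.m_closed)
  qed simp
  finally have "snd M (\<Oplus>\<^bsub>qu_alg n q\<^esub>i\<in>I. qu_scal n q (\<phi> i) \<otimes>\<^bsub>qu_alg n q\<^esub> qu_idem n q i) * V
    = (\<Oplus>\<^bsub>?B\<^esub>i\<in>I. \<phi> i \<cdot>\<^sub>m 1\<^sub>m (fst M) \<otimes>\<^bsub>?B\<^esub> B.proj n (q ^ n) ?k i) \<otimes>\<^bsub>?B\<^esub> V"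
    by (simp add: ring_mat_simps)
  also have "\<dots> = (if b mod n \<in> I then \<phi> (b mod n) \<cdot>\<^sub>m 1\<^sub>m (fst M) \<otimes>\<^bsub>?B\<^esub> V else \<zero>\<^bsub>?B\<^esub>)"
  proof (rule B.finsum_proj_eigen[OF mat_kappa_facts Q_pow Q_prim n_pos])
    show "?k \<otimes>\<^bsub>?B\<^esub> V = (q ^ n) ^ (b mod n) \<cdot>\<^sub>m 1\<^sub>m (fst M) \<otimes>\<^bsub>?B\<^esub> V"
      using V smul by (simp add: wt_def Q_pow_mod ring_mat_simps)
  qed (use Vc I n_pos in \<open>auto simp: ring_mat_simps\<close>)
  also have "\<dots> = (if b mod n \<in> I then \<phi> (b mod n) else 0) \<cdot>\<^sub>m V"
    using Vc by (auto simp: ring_mat_simps smul)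
  finally show ?thesis .
qed

lemma snd_flat_wt: "wt M b V \<Longrightarrow> snd M (qu_flat n q) * V = inverse q ^ (b mod n) \<cdot>\<^sub>m V"
  unfolding qu_flat_def using snd_finsum_idem_wt[of b V "{0..<n}" "\<lambda>i. inverse q ^ i"] n_pos by simp

lemma snd_flat_inv_wt: "wt M b V \<Longrightarrow> snd M flat_inv * V = q ^ (b mod n) \<cdot>\<^sub>m V"
  unfolding flat_inv_def using snd_finsum_idem_wt[of b V "{0..<n}" "\<lambda>i. q ^ i"] n_pos by simp

lemma snd_finsum_idem:
  assumes V: "wt M b V" and I: "I \<subseteq> {0..<n}"
  shows "snd M (\<Oplus>\<^bsub>qu_alg n q\<^esub>i\<in>I. qu_idem n q i) * V = (if b mod n \<in> I then 1 else 0) \<cdot>\<^sub>m V"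
proof -
  have "(\<Oplus>\<^bsub>qu_alg n q\<^esub>i\<in>I. qu_scal n q 1 \<otimes>\<^bsub>qu_alg n q\<^esub> qu_idem n q i) = (\<Oplus>\<^bsub>qu_alg n q\<^esub>i\<in>I. qu_idem n q i)"
    by (intro A.finsum_cong') (auto simp: A.scal_one)
  then show ?thesis using snd_finsum_idem_wt[OF V I, of "\<lambda>_. 1"] by simp
qed

lemma snd_idem_wt: "wt M b V \<Longrightarrow> i < n \<Longrightarrow> snd M (qu_idem n q i) * V = (if b mod n = i then 1 else 0) \<cdot>\<^sub>m V"
  using snd_finsum_idem[of b V "{i}"] by simp

lemma pow_wt:
  assumes V: "wt M b V"
  shows "mod_gen n q M gen_kappa ^\<^sub>m r * V = ((q ^ n) ^ b) ^ r \<cdot>\<^sub>m V"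
proof (induction r)
  case 0
  then show ?case using mod_gen_carrier[OF M, of gen_kappa] wt_carrier[OF V] by simp
next
  case (Suc r)
  have k: "mod_gen n q M gen_kappa \<in> carrier_mat (fst M) (fst M)" by (rule mod_gen_carrier[OF M])
  note Vc = wt_carrier[OF V]
  have "mod_gen n q M gen_kappa ^\<^sub>m Suc r * V = mod_gen n q M gen_kappa ^\<^sub>m r * (mod_gen n q M gen_kappa * V)"
    using k Vc by (simp add: assoc_mult_mat[of _ "fst M" "fst M" _ "fst M" _ "fst M"])
  also have "\<dots> = (q ^ n) ^ b \<cdot>\<^sub>m (mod_gen n q M gen_kappa ^\<^sub>m r * V)"
    using V k Vc by (simp add: wt_def mult_smult_distrib[where n = "fst M" and nr = "fst M" and nc = "fst M"])
  finally show ?case unfolding Suc by (simp add: mat_smult_smult)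
qed

lemma inverse_Q: "((q ^ n) ^ b) ^ (n - 1) = inverse ((q ^ n) ^ b)"
proof -
  have "((q ^ n) ^ b) ^ n = 1" by (metis Q_pow mult.commute power_mult power_one)
  then have "((q ^ n) ^ b) * ((q ^ n) ^ b) ^ (n - 1) = 1"
    using n_pos by (simp flip: power_Suc)
  then show ?thesis by (simp add: field_simps)
qed

lemma snd_inv_kappa: "snd M (inv\<^bsub>qu_alg n q\<^esub> kap) = mod_gen n q M gen_kappa ^\<^sub>m (n - 1)"
  by (simp add: inv_kap snd_module_pow[OF M] mod_gen_def)

lemma snd_inv_kappa_wt: "wt M b V \<Longrightarrow> mod_gen n q M gen_kappa ^\<^sub>m (n - 1) * V = inverse ((q ^ n) ^ b) \<cdot>\<^sub>m V"
  using pow_wt[of b V "n - 1"] by (simp only: inverse_Q)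

text \<open>F lowers the weight by one; modulo n this is the shift by \<open>n - 1\<close>, which
  stays in the naturals.\<close>

lemma wt_gen:
  assumes V: "wt M b V"
  shows "wt M (b + 1) (mod_gen n q M gen_E * V)"
    and "wt M (b + (n - 1)) (mod_gen n q M gen_F * V)"
    and "wt M b (mod_gen n q M gen_kappa_hat * V)"
proof -
  let ?d = "fst M" let ?G = "mod_gen n q M"
  have G: "?G s \<in> carrier_mat ?d ?d" for s by (rule mod_gen_carrier[OF M])
  note Vc = wt_carrier[OF V]
  note rel = qu_rep_mod_gen[OF M, unfolded qu_rep_def]
  have kV: "?G gen_kappa * V = (q ^ n) ^ b \<cdot>\<^sub>m V" using V by (simp add: wt_def)
  have gen: "?G gen_kappa * (?G s * V) = (c * (q ^ n) ^ b) \<cdot>\<^sub>m (?G s * V)"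
    if "?G gen_kappa * ?G s = c \<cdot>\<^sub>m (?G s * ?G gen_kappa)" for s c
  proof -
    have "?G gen_kappa * (?G s * V) = ?G gen_kappa * ?G s * V"
      by (rule assoc_mult_mat[symmetric, OF G G Vc])
    also have "\<dots> = c \<cdot>\<^sub>m (?G s * ?G gen_kappa * V)"
      unfolding that by (rule mult_smult_assoc_mat[OF mult_carrier_mat[OF G G] Vc])
    also have "?G s * ?G gen_kappa * V = ?G s * (?G gen_kappa * V)"
      by (rule assoc_mult_mat[OF G G Vc])
    also have "\<dots> = (q ^ n) ^ b \<cdot>\<^sub>m (?G s * V)"
      unfolding kV by (rule mult_smult_distrib[OF G Vc])
    finally show ?thesis by (simp add: mat_smult_smult)
  qed
  show "wt M (b + 1) (?G gen_E * V)"
    using gen[of gen_E "q ^ n"] rel mult_carrier_mat[OF G Vc] by (simp add: wt_def mult.commute)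
  have "(q ^ n) ^ (b + (n - 1)) = inverse (q ^ n) * (q ^ n) ^ b"
    using inverse_Q[of 1] by (simp add: power_add mult.commute)
  then show "wt M (b + (n - 1)) (?G gen_F * V)"
    using gen[of gen_F "inverse (q ^ n)"] rel mult_carrier_mat[OF G Vc] by (simp add: wt_def)
  show "wt M b (?G gen_kappa_hat * V)"
    using gen[of gen_kappa_hat 1] rel mult_carrier_mat[OF G Vc] by (simp add: wt_def)
qed

text \<open>The identity is the sum of the spectral projections of kappa, and each projection is a
  weight matrix. An additive property is thereby reduced to weight matrices.\<close>

lemma wt_induct:
  assumes zero: "P (0\<^sub>m (fst M) (fst M))"
    and add: "\<And>U V. U \<in> carrier_mat (fst M) (fst M) \<Longrightarrow> V \<in> carrier_mat (fst M) (fst M) \<Longrightarrow> P U \<Longrightarrow> P V \<Longrightarrow> P (U + V)"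
    and wt: "\<And>b V. b < n \<Longrightarrow> wt M b V \<Longrightarrow> P V"
  shows "P (1\<^sub>m (fst M))"
proof -
  interpret B: scal_ring "ring_mat TYPE('k) (fst M) ()" "\<lambda>c. c \<cdot>\<^sub>m 1\<^sub>m (fst M)" by (rule scal_ring_mat)
  let ?B = "ring_mat TYPE('k) (fst M) ()" let ?k = "mod_gen n q M gen_kappa"
  note pc = B.proj_closed[OF mat_kappa_facts Q_pow Q_prim n_pos]
  have smul: "c \<cdot>\<^sub>m 1\<^sub>m (fst M) * V = c \<cdot>\<^sub>m V" if "V \<in> carrier_mat (fst M) (fst M)" for c and V :: "'k mat"
    using that by (rule mat_scalar_mult)
  have w: "wt M i (B.proj n (q ^ n) ?k i)" if "i < n" for i
    using B.mult_proj[OF mat_kappa_facts Q_pow Q_prim n_pos, of i] that pc[of i]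
    by (simp add: wt_def ring_mat_simps smul)
  have "P (finsum ?B (B.proj n (q ^ n) ?k) I)" if "finite I" "I \<subseteq> {0..<n}" for I
    using that
  proof (induction I rule: finite_induct)
    case empty
    then show ?case using zero by (simp add: ring_mat_simps)
  next
    case (insert i I)
    have "finsum ?B (B.proj n (q ^ n) ?k) (insert i I) = B.proj n (q ^ n) ?k i + finsum ?B (B.proj n (q ^ n) ?k) I"
      using insert pc by (subst B.finsum_insert) (auto simp: ring_mat_simps)
    moreover have "P (B.proj n (q ^ n) ?k i)" using w insert.prems by (intro wt[of i]) auto
    moreover have "finsum ?B (B.proj n (q ^ n) ?k) I \<in> carrier ?B" using pc by (intro B.finsum_closed) auto
    ultimately show ?case using insert pc[of i] add by (auto simp: ring_mat_simps)
  qed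
  from this[of "{0..<n}"] show ?thesis
    using B.finsum_proj[OF mat_kappa_facts Q_pow Q_prim n_pos] by (simp add: ring_mat_simps)
qed

end

text \<open>Applying \<open>wt_induct\<close> in each factor leads to the Kronecker product of the
  identities. Relations on a tensor product can thus be checked on products of weight matrices,
  where the idempotents in the comultiplication act by scalars.\<close>

lemma wt_kronecker_ext:
  assumes M: "M \<in> qu_modules n q" and N: "N \<in> qu_modules n q"
    and T: "T \<in> carrier_mat (fst M * fst N) (fst M * fst N)" "T' \<in> carrier_mat (fst M * fst N) (fst M * fst N)"
    and eq: "\<And>a b A B. a < n \<Longrightarrow> b < n \<Longrightarrow> wt M a A \<Longrightarrow> wt N b B \<Longrightarrow> T * kronecker A B = T' * kronecker A B"
  shows "T = T'"
proof -
  let ?D = "fst M * fst N"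
  have "T * kronecker A (1\<^sub>m (fst N)) = T' * kronecker A (1\<^sub>m (fst N))" if "a < n" "wt M a A" for a A
  proof (rule wt_induct[OF N])
    show "T * kronecker A (0\<^sub>m (fst N) (fst N)) = T' * kronecker A (0\<^sub>m (fst N) (fst N))"
      using wt_carrier[OF that(2)] T by (simp add: kronecker_zero_right)
  next
    fix U V :: "'k mat" assume *: "U \<in> carrier_mat (fst N) (fst N)" "V \<in> carrier_mat (fst N) (fst N)"
      "T * kronecker A U = T' * kronecker A U" "T * kronecker A V = T' * kronecker A V"
    show "T * kronecker A (U + V) = T' * kronecker A (U + V)"
      using wt_carrier[OF that(2)] T * 
      by (simp add: kronecker_add_right[where a = "fst M" and b = "fst M" and c = "fst N" and d = "fst N"]
        mult_add_distrib_mat[of _ ?D ?D _ ?D])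
  qed (use eq that in blast)
  then have "T * kronecker (1\<^sub>m (fst M)) (1\<^sub>m (fst N)) = T' * kronecker (1\<^sub>m (fst M)) (1\<^sub>m (fst N))"
  proof (intro wt_induct[OF M, where P = "\<lambda>A. T * kronecker A (1\<^sub>m (fst N)) = T' * kronecker A (1\<^sub>m (fst N))"])
    show "T * kronecker (0\<^sub>m (fst M) (fst M)) (1\<^sub>m (fst N)) = T' * kronecker (0\<^sub>m (fst M) (fst M)) (1\<^sub>m (fst N))"
      using T by (simp add: kronecker_zero_left[where c = "fst N" and d = "fst N"])
  next
    fix U V :: "'k mat" assume *: "U \<in> carrier_mat (fst M) (fst M)" "V \<in> carrier_mat (fst M) (fst M)"
      "T * kronecker U (1\<^sub>m (fst N)) = T' * kronecker U (1\<^sub>m (fst N))" "T * kronecker V (1\<^sub>m (fst N)) = T' * kronecker V (1\<^sub>m (fst N))"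
    show "T * kronecker (U + V) (1\<^sub>m (fst N)) = T' * kronecker (U + V) (1\<^sub>m (fst N))"
      using T * 
      by (simp add: kronecker_add_left[where a = "fst M" and b = "fst M" and c = "fst N" and d = "fst N"]
        mult_add_distrib_mat[of _ ?D ?D _ ?D])
  qed auto
  then show ?thesis using T by (simp add: kronecker_one)
qed

end

section \<open>The comultiplication on products of weight matrices\<close>

context qu_setup
begin

text \<open>
  On the tensor product of the weight spaces of weights \<open>a\<close> and \<open>b\<close>, the parts of $\Delta(E)$ and
  $\Delta(F)$ that act on the second factor are the action of $E$ and $F$ up to the scalars \<open>th a b\<close>
  and \<open>ph a b\<close>.
\<close>

definition th :: "nat \<Rightarrow> nat \<Rightarrow> 'k" where
  "th a b = (if (b + 1) mod n = 0 then inverse ((q ^ n) ^ a) else 1)"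

definition ph :: "nat \<Rightarrow> nat \<Rightarrow> 'k" where
  "ph a b = (if b mod n = 0 then 1 else inverse ((q ^ n) ^ a))"

context
  fixes M N :: "'k qu_module"
  assumes M: "M \<in> qu_modules n q" and N: "N \<in> qu_modules n q"
begin

abbreviation "GM \<equiv> mod_gen n q M"
abbreviation "GN \<equiv> mod_gen n q N"
abbreviation "TT s \<equiv> tensor_action M N (qu_comult n q s)"
abbreviation "DD \<equiv> fst M * fst N"

definition "nonzero_idem = (\<Oplus>\<^bsub>qu_alg n q\<^esub>i\<in>{1..<n}. qu_idem n q i)"

text \<open>\<open>XE\<close> and \<open>YE\<close> commute up to $q$, so the $q$-binomial theorem gives the nilpotency of their sum.\<close>

definition "XE = kronecker (GM gen_E) (snd N flat_inv)"
definition "YE = kronecker (GM gen_kappa ^\<^sub>m (n - 1)) (snd N (qu_idem n q 0) * GN gen_E)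
   + kronecker (1\<^sub>m (fst M)) (snd N nonzero_idem * GN gen_E)"
definition "XF = kronecker (GM gen_F) (snd N (qu_flat n q))"
definition "YF = kronecker (GM gen_kappa ^\<^sub>m (n - 1) * GM gen_kappa_hat) (GN gen_F * snd N nonzero_idem)
   + kronecker (GM gen_kappa_hat) (GN gen_F * snd N (qu_idem n q 0))"

lemma nonzero_idem_carrier [simp]: "nonzero_idem \<in> carrier (qu_alg n q)"
  unfolding nonzero_idem_def by (intro A.finsum_closed) auto

lemma GM_carrier [simp]: "GM s \<in> carrier_mat (fst M) (fst M)" by (rule mod_gen_carrier[OF M])
lemma GN_carrier [simp]: "GN s \<in> carrier_mat (fst N) (fst N)" by (rule mod_gen_carrier[OF N])

lemma N_carrier [simp]: "a \<in> carrier (qu_alg n q) \<Longrightarrow> snd N a \<in> carrier_mat (fst N) (fst N)"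
  by (rule qu_modules_carrier[OF N])

lemmas mulM [simp] = mult_carrier_mat[of _ "fst M" "fst M" _ "fst M"]
lemmas mulN [simp] = mult_carrier_mat[of _ "fst N" "fst N" _ "fst N"]
lemmas mulD [simp] = mult_carrier_mat[of _ DD DD _ DD]
lemmas kronD [simp] = kronecker_carrier[of _ "fst M" "fst M" _ "fst N" "fst N"]

lemma nonzero_idem_wt: "wt N b B \<Longrightarrow> snd N nonzero_idem * B = (if b mod n = 0 then 0 else 1) \<cdot>\<^sub>m B"
  unfolding nonzero_idem_def using n_pos by (subst snd_finsum_idem[OF N]) auto

lemma XY_carrier [simp]: "XE \<in> carrier_mat DD DD" "YE \<in> carrier_mat DD DD" "XF \<in> carrier_mat DD DD" "YF \<in> carrier_mat DD DD"
  unfolding XE_def YE_def XF_def YF_def by auto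

lemma TT_kappa: "TT gen_kappa = kronecker (GM gen_kappa) (GN gen_kappa)"
  using kronD[OF GM_carrier GN_carrier, of gen_kappa gen_kappa]
  by (simp add: tensor_action_def mod_gen_def)

lemma TT_kappa_hat: "TT gen_kappa_hat = kronecker (GM gen_kappa_hat) (GN gen_kappa_hat)"
  using kronD[OF GM_carrier GN_carrier, of gen_kappa_hat gen_kappa_hat]
  by (simp add: tensor_action_def mod_gen_def)

lemma TT_E: "TT gen_E = XE + YE"
proof -
  have 1: "(\<Oplus>\<^bsub>qu_alg n q\<^esub>i\<in>{1..<n}. qu_idem n q i \<otimes>\<^bsub>qu_alg n q\<^esub> qu_gen n q gen_E)
    = nonzero_idem \<otimes>\<^bsub>qu_alg n q\<^esub> qu_gen n q gen_E"
    unfolding nonzero_idem_def by (intro A.finsum_ldistr[symmetric]) auto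
  have "TT gen_E = XE + (kronecker (GM gen_kappa ^\<^sub>m (n - 1)) (snd N (qu_idem n q 0) * GN gen_E)
   + (kronecker (1\<^sub>m (fst M)) (snd N nonzero_idem * GN gen_E) + 0\<^sub>m DD DD))"
    unfolding tensor_action_def XE_def qu_comult.simps(3) Let_def inv_flat 1
    by (simp add: qu_modules_mult[OF N] qu_modules_one[OF M] snd_inv_kappa[OF M] mod_gen_def)
  then show ?thesis by (simp add: YE_def right_add_zero_mat[of _ DD DD])
qed

lemma TT_F: "TT gen_F = XF + YF"
proof -
  have "TT gen_F = XF + (kronecker (GM gen_kappa ^\<^sub>m (n - 1) * GM gen_kappa_hat) (GN gen_F * snd N nonzero_idem)
   + (kronecker (GM gen_kappa_hat) (GN gen_F * snd N (qu_idem n q 0)) + 0\<^sub>m DD DD))"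
    unfolding tensor_action_def XF_def qu_comult.simps(4) Let_def nonzero_idem_def[symmetric]
    by (simp add: qu_modules_mult[OF N] qu_modules_mult[OF M] snd_inv_kappa[OF M] inv_kap mod_gen_def snd_module_pow[OF M])
  then show ?thesis by (simp add: YF_def right_add_zero_mat[of _ DD DD])
qed

lemma TT_carrier [simp]: "TT s \<in> carrier_mat DD DD"
  by (cases s) (simp_all add: TT_kappa TT_kappa_hat TT_E TT_F del: qu_comult.simps)

lemmas kmul = kronecker_mult[of _ "fst M" "fst M" _ "fst N" "fst N" _ "fst M" _ "fst N"]
lemmas ksml = kronecker_smult_left[of _ "fst M" "fst M" _ "fst N" "fst N"]
lemmas ksmr = kronecker_smult_right[of _ "fst M" "fst M" _ "fst N" "fst N"]

context
  fixes a b :: nat and A B :: "'k mat"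
  assumes A: "wt M a A" and B: "wt N b B"
begin

lemma AB_carrier [simp]: "A \<in> carrier_mat (fst M) (fst M)" "B \<in> carrier_mat (fst N) (fst N)"
  using A B by (simp_all add: wt_carrier)

lemma kappa_act: "TT gen_kappa * kronecker A B = (q ^ n) ^ (a + b) \<cdot>\<^sub>m kronecker A B"
  using A B unfolding TT_kappa by (simp add: kmul wt_def ksml ksmr mat_smult_smult power_add mult.commute)

lemma kappa_hat_act: "TT gen_kappa_hat * kronecker A B = kronecker (GM gen_kappa_hat * A) (GN gen_kappa_hat * B)"
  unfolding TT_kappa_hat by (simp add: kmul)

lemma XE_act: "XE * kronecker A B = q ^ (b mod n) \<cdot>\<^sub>m kronecker (GM gen_E * A) B"
  unfolding XE_def by (simp add: kmul snd_flat_inv_wt[OF N B] ksmr)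

lemma XF_act: "XF * kronecker A B = inverse q ^ (b mod n) \<cdot>\<^sub>m kronecker (GM gen_F * A) B"
  unfolding XF_def by (simp add: kmul snd_flat_wt[OF N B] ksmr)

text \<open>The idempotents stand to the left of E, so they see the raised weight b + 1; exactly one
  of the two summands of \<open>YE\<close> survives, and \<open>th\<close> records which. In
  \<open>YF\<close> they stand to the right of F, so there b itself decides.\<close>

lemma YE_act: "YE * kronecker A B = th a b \<cdot>\<^sub>m kronecker A (GN gen_E * B)"
proof -
  have EB: "wt N (b + 1) (GN gen_E * B)" by (rule wt_gen(1)[OF N B])
  have P0: "snd N (qu_idem n q 0) * GN gen_E * B = (if (b + 1) mod n = 0 then 1 else 0) \<cdot>\<^sub>m (GN gen_E * B)"
    using snd_idem_wt[OF N EB, of 0] n_pos by (simp add: assoc_mult_mat[of _ "fst N" "fst N" _ "fst N" _ "fst N"])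
  have P1: "snd N nonzero_idem * GN gen_E * B = (if (b + 1) mod n = 0 then 0 else 1) \<cdot>\<^sub>m (GN gen_E * B)"
    using nonzero_idem_wt[OF EB] by (simp add: assoc_mult_mat[of _ "fst N" "fst N" _ "fst N" _ "fst N"])
  have "YE * kronecker A B = kronecker (GM gen_kappa ^\<^sub>m (n - 1)) (snd N (qu_idem n q 0) * GN gen_E) * kronecker A B
    + kronecker (1\<^sub>m (fst M)) (snd N nonzero_idem * GN gen_E) * kronecker A B"
    unfolding YE_def by (rule add_mult_distrib_mat[of _ DD DD _ _ DD]) auto
  also have "\<dots> = kronecker (inverse ((q ^ n) ^ a) \<cdot>\<^sub>m A) ((if (b + 1) mod n = 0 then 1 else 0) \<cdot>\<^sub>m (GN gen_E * B))
    + kronecker A ((if (b + 1) mod n = 0 then 0 else 1) \<cdot>\<^sub>m (GN gen_E * B))"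
    by (simp add: kmul P0 P1 snd_inv_kappa_wt[OF M A] left_mult_one_mat[of A "fst M" "fst M"] del: mult_carrier_mat assoc_mult_mat One_nat_def)
  also have "\<dots> = th a b \<cdot>\<^sub>m kronecker A (GN gen_E * B)"
    by (auto simp: th_def ksml ksmr mat_smult_smult intro!: eq_matI)
  finally show ?thesis .
qed

lemma YF_act: "YF * kronecker A B = ph a b \<cdot>\<^sub>m kronecker (GM gen_kappa_hat * A) (GN gen_F * B)"
proof -
  have P0: "GN gen_F * snd N (qu_idem n q 0) * B = (if b mod n = 0 then 1 else 0) \<cdot>\<^sub>m (GN gen_F * B)"
    using snd_idem_wt[OF N B, of 0] n_pos
    by (simp add: assoc_mult_mat[of _ "fst N" "fst N" _ "fst N" _ "fst N"] mult_smult_distrib[of _ "fst N" "fst N" _ "fst N"])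
  have P1: "GN gen_F * snd N nonzero_idem * B = (if b mod n = 0 then 0 else 1) \<cdot>\<^sub>m (GN gen_F * B)"
    using nonzero_idem_wt[OF B]
    by (simp add: assoc_mult_mat[of _ "fst N" "fst N" _ "fst N" _ "fst N"] mult_smult_distrib[of _ "fst N" "fst N" _ "fst N"])
  have hA: "GM gen_kappa ^\<^sub>m (n - 1) * GM gen_kappa_hat * A = inverse ((q ^ n) ^ a) \<cdot>\<^sub>m (GM gen_kappa_hat * A)"
    using snd_inv_kappa_wt[OF M wt_gen(3)[OF M A]]
    by (simp add: assoc_mult_mat[of _ "fst M" "fst M" _ "fst M" _ "fst M"])
  have "YF * kronecker A B = kronecker (GM gen_kappa ^\<^sub>m (n - 1) * GM gen_kappa_hat) (GN gen_F * snd N nonzero_idem) * kronecker A B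
   + kronecker (GM gen_kappa_hat) (GN gen_F * snd N (qu_idem n q 0)) * kronecker A B"
    unfolding YF_def by (rule add_mult_distrib_mat[of _ DD DD _ _ DD]) auto
  also have "\<dots> = kronecker (inverse ((q ^ n) ^ a) \<cdot>\<^sub>m (GM gen_kappa_hat * A)) ((if b mod n = 0 then 0 else 1) \<cdot>\<^sub>m (GN gen_F * B))
    + kronecker (GM gen_kappa_hat * A) ((if b mod n = 0 then 1 else 0) \<cdot>\<^sub>m (GN gen_F * B))"
    by (simp add: kmul P0 P1 hA del: mult_carrier_mat assoc_mult_mat One_nat_def)
  also have "\<dots> = ph a b \<cdot>\<^sub>m kronecker (GM gen_kappa_hat * A) (GN gen_F * B)"
    by (auto simp: ph_def ksml ksmr mat_smult_smult intro!: eq_matI)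
  finally show ?thesis .
qed

lemma E_act: "TT gen_E * kronecker A B = q ^ (b mod n) \<cdot>\<^sub>m kronecker (GM gen_E * A) B + th a b \<cdot>\<^sub>m kronecker A (GN gen_E * B)"
  unfolding TT_E by (simp add: add_mult_distrib_mat[of _ DD DD _ _ DD] XE_act YE_act)

lemma F_act: "TT gen_F * kronecker A B = inverse q ^ (b mod n) \<cdot>\<^sub>m kronecker (GM gen_F * A) B
    + ph a b \<cdot>\<^sub>m kronecker (GM gen_kappa_hat * A) (GN gen_F * B)"
  unfolding TT_F by (simp add: add_mult_distrib_mat[of _ DD DD _ _ DD] XF_act YF_act)

end

lemma pow_Q_add: "(q ^ n) ^ (a + (n - 1)) = (q ^ n) ^ a * inverse (q ^ n)"
  using inverse_Q[OF M, of 1] by (simp add: power_add)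

lemma mod_pred: "b < n \<Longrightarrow> (b + (n - 1)) mod n = (if b = 0 then n - 1 else b - 1)"
proof -
  assume b: "b < n"
  show ?thesis
  proof (cases b)
    case (Suc j)
    then have "b + (n - 1) = j + n" using b by simp
    then show ?thesis using Suc b by simp
  qed (use n_pos in simp)
qed

lemma mod_succ: "b < n \<Longrightarrow> (b + 1) mod n = (if b = n - 1 then 0 else b + 1)"
  using n_pos by auto

lemma q_pow_pred: "q ^ (n - 1) = q ^ n * inverse q"
  using n_pos by (cases n) simp_all

text \<open>The scalars compared in the relations below. Items 2 and 3 make the mixed terms of FE -
  q^-1 EF cancel, items 4 and 5 equate the coefficients of the terms on the second factor, and items
  6 and 7 give the commutation of \<open>XE\<close> with \<open>YE\<close> and of \<open>XF\<close>
  with \<open>YF\<close>. Where the weight wraps around, the power of q jumps by a factor q^n or its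
  inverse; the case distinctions in \<open>th\<close> and \<open>ph\<close> compensate for
  this.\<close>

lemma coef_facts:
  assumes b: "b < n"
  shows "q ^ b * inverse q ^ b = 1"
    and "q ^ b * ph (a + 1) b * (q ^ n * inverse q ^ 2) = inverse q * (ph a b * q ^ ((b + (n - 1)) mod n))"
    and "th a b * inverse q ^ ((b + 1) mod n) = inverse q * (inverse q ^ b * th (a + (n - 1)) b)"
    and "th a b * ph a (b + 1) = inverse ((q ^ n) ^ a)"
    and "ph a b * th a (b + (n - 1)) = inverse ((q ^ n) ^ a)"
    and "th a b * q ^ ((b + 1) mod n) = q * (q ^ b * th (a + 1) b)"
    and "ph a b * inverse q ^ ((b + (n - 1)) mod n) = inverse q * (inverse q ^ b * ph (a + (n - 1)) b * (inverse (q ^ n) * q ^ 2))"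
proof -
  show 1: "q ^ b * inverse q ^ b = 1" by (simp flip: power_mult_distrib)
  have nz: "q ^ n \<noteq> 0" "(q ^ n) ^ a \<noteq> 0" by simp_all
  have qb: "q ^ (b - 1) = q ^ b * inverse q" if "b \<noteq> 0" using that by (cases b) auto
  show "q ^ b * ph (a + 1) b * (q ^ n * inverse q ^ 2) = inverse q * (ph a b * q ^ ((b + (n - 1)) mod n))"
    unfolding mod_pred[OF b] ph_def using b nz
    by (auto simp: q_pow_pred qb power2_eq_square field_simps power_add simp del: One_nat_def)
  show "th a b * inverse q ^ ((b + 1) mod n) = inverse q * (inverse q ^ b * th (a + (n - 1)) b)"
    unfolding mod_succ[OF b] th_def pow_Q_add using b nz n_pos
    by (auto simp: q_pow_pred power_inverse field_simps power_add simp del: One_nat_def)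
  show "th a b * ph a (b + 1) = inverse ((q ^ n) ^ a)"
    unfolding th_def ph_def by auto
  show "ph a b * th a (b + (n - 1)) = inverse ((q ^ n) ^ a)"
  proof -
    have "b + (n - 1) + 1 = b + n" using n_pos by simp
    then show ?thesis unfolding th_def ph_def by (simp add: mod_add_self2)
  qed
  show "th a b * q ^ ((b + 1) mod n) = q * (q ^ b * th (a + 1) b)"
    unfolding mod_succ[OF b] th_def using b nz n_pos
    by (auto simp: q_pow_pred field_simps power_add simp del: One_nat_def)
  show "ph a b * inverse q ^ ((b + (n - 1)) mod n) = inverse q * (inverse q ^ b * ph (a + (n - 1)) b * (inverse (q ^ n) * q ^ 2))"
    unfolding mod_pred[OF b] ph_def pow_Q_add using b nz
    by (auto simp: q_pow_pred qb power2_eq_square power_inverse field_simps power_add simp del: One_nat_def)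
qed

lemmas assocD = assoc_mult_mat[of _ DD DD _ DD _ DD]
lemmas maddD = mult_add_distrib_mat[of _ DD DD _ DD]

lemmas msmD = mult_smult_distrib[of _ DD DD _ DD]
lemmas smaD = mult_smult_assoc_mat[of _ DD DD _ DD]
lemmas saddD = add_smult_distrib_left_mat[of _ DD DD]

lemmas relM = qu_rep_mod_gen[OF M, unfolded qu_rep_def]
lemmas relN = qu_rep_mod_gen[OF N, unfolded qu_rep_def]

lemma comm_act:
  fixes G :: "gen \<Rightarrow> 'k mat"
  assumes G: "\<And>s. G s \<in> carrier_mat d d" and V: "V \<in> carrier_mat d d" and r: "G s * G t = c \<cdot>\<^sub>m (G t * G s)"
  shows "G s * (G t * V) = c \<cdot>\<^sub>m (G t * (G s * V))"
proof -
  have "G s * (G t * V) = c \<cdot>\<^sub>m (G t * G s) * V"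
    using assoc_mult_mat[OF G G V, of s t] r by simp
  also have "\<dots> = c \<cdot>\<^sub>m (G t * G s * V)" by (rule mult_smult_assoc_mat[OF mult_carrier_mat[OF G G] V])
  also have "G t * G s * V = G t * (G s * V)" by (rule assoc_mult_mat[OF G G V])
  finally show ?thesis .
qed

section \<open>The defining relations on a tensor product\<close>

lemma TT_kappa_E: "TT gen_kappa * TT gen_E = q ^ n \<cdot>\<^sub>m (TT gen_E * TT gen_kappa)"
proof (rule wt_kronecker_ext[OF M N])
  fix a b A B assume A: "wt M a A" and B: "wt N b B"
  note EA = wt_gen(1)[OF M A] note EB = wt_gen(1)[OF N B]
  note [simp] = wt_carrier[OF A] wt_carrier[OF B]
  show "TT gen_kappa * TT gen_E * kronecker A B = q ^ n \<cdot>\<^sub>m (TT gen_E * TT gen_kappa) * kronecker A B"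
    by (simp add: assocD smaD maddD msmD saddD E_act[OF A B] kappa_act[OF A B] kappa_act[OF EA B] kappa_act[OF A EB]
      mat_smult_smult power_add mult_ac del: qu_comult.simps)
qed (simp_all del: qu_comult.simps)

lemma TT_kappa_F: "TT gen_kappa * TT gen_F = inverse (q ^ n) \<cdot>\<^sub>m (TT gen_F * TT gen_kappa)"
proof (rule wt_kronecker_ext[OF M N])
  fix a b A B assume A: "wt M a A" and B: "wt N b B"
  note FA = wt_gen(2)[OF M A] note FB = wt_gen(2)[OF N B] note hA = wt_gen(3)[OF M A]
  note [simp] = wt_carrier[OF A] wt_carrier[OF B]
  have *: "(q ^ n) ^ (a + (b + (n - 1))) = (q ^ n) ^ (a + b) * inverse (q ^ n)"
     "(q ^ n) ^ (a + (n - 1) + b) = (q ^ n) ^ (a + b) * inverse (q ^ n)"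
    using pow_Q_add[of "a + b"] by (simp_all add: add_ac)
  show "TT gen_kappa * TT gen_F * kronecker A B = inverse (q ^ n) \<cdot>\<^sub>m (TT gen_F * TT gen_kappa) * kronecker A B"
    by (simp add: assocD smaD maddD msmD saddD F_act[OF A B] kappa_act[OF A B] kappa_act[OF FA B] kappa_act[OF hA FB]
      mat_smult_smult * del: qu_comult.simps One_nat_def) (simp add: mult_ac)
qed (simp_all del: qu_comult.simps)

lemma TT_kappa_hat_E: "TT gen_kappa_hat * TT gen_E = (q ^ n * inverse q ^ 2) \<cdot>\<^sub>m (TT gen_E * TT gen_kappa_hat)"
proof (rule wt_kronecker_ext[OF M N])
  fix a b A B assume A: "wt M a A" and B: "wt N b B"
  note EA = wt_gen(1)[OF M A] note EB = wt_gen(1)[OF N B]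
  note hA = wt_gen(3)[OF M A] note hB = wt_gen(3)[OF N B]
  note [simp] = wt_carrier[OF A] wt_carrier[OF B]
  have 1: "GM gen_kappa_hat * (GM gen_E * A) = (q ^ n * inverse q ^ 2) \<cdot>\<^sub>m (GM gen_E * (GM gen_kappa_hat * A))"
    using relM by (intro comm_act[where d = "fst M"]) auto
  have 2: "GN gen_kappa_hat * (GN gen_E * B) = (q ^ n * inverse q ^ 2) \<cdot>\<^sub>m (GN gen_E * (GN gen_kappa_hat * B))"
    using relN by (intro comm_act[where d = "fst N"]) auto
  show "TT gen_kappa_hat * TT gen_E * kronecker A B = (q ^ n * inverse q ^ 2) \<cdot>\<^sub>m (TT gen_E * TT gen_kappa_hat) * kronecker A B"
    by (simp add: assocD smaD maddD msmD saddD E_act[OF A B] kappa_hat_act[OF A B] kappa_hat_act[OF EA B] kappa_hat_act[OF A EB]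
      E_act[OF hA hB] 1 2 ksml ksmr mat_smult_smult mult_ac del: qu_comult.simps)
qed (simp_all del: qu_comult.simps)

lemma TT_kappa_hat_F: "TT gen_kappa_hat * TT gen_F = (inverse (q ^ n) * q ^ 2) \<cdot>\<^sub>m (TT gen_F * TT gen_kappa_hat)"
proof (rule wt_kronecker_ext[OF M N])
  fix a b A B assume A: "wt M a A" and B: "wt N b B"
  note FA = wt_gen(2)[OF M A] note FB = wt_gen(2)[OF N B]
  note hA = wt_gen(3)[OF M A] note hB = wt_gen(3)[OF N B]
  note [simp] = wt_carrier[OF A] wt_carrier[OF B]
  have 1: "GM gen_kappa_hat * (GM gen_F * A) = (inverse (q ^ n) * q ^ 2) \<cdot>\<^sub>m (GM gen_F * (GM gen_kappa_hat * A))"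
    using relM by (intro comm_act[where d = "fst M"]) auto
  have 2: "GN gen_kappa_hat * (GN gen_F * B) = (inverse (q ^ n) * q ^ 2) \<cdot>\<^sub>m (GN gen_F * (GN gen_kappa_hat * B))"
    using relN by (intro comm_act[where d = "fst N"]) auto
  show "TT gen_kappa_hat * TT gen_F * kronecker A B = (inverse (q ^ n) * q ^ 2) \<cdot>\<^sub>m (TT gen_F * TT gen_kappa_hat) * kronecker A B"
    by (simp add: assocD smaD maddD msmD saddD F_act[OF A B] kappa_hat_act[OF A B] kappa_hat_act[OF FA B] kappa_hat_act[OF hA FB]
      F_act[OF hA hB] 1 2 ksml ksmr mat_smult_smult mult_ac del: qu_comult.simps)
qed (simp_all del: qu_comult.simps)

text \<open>\<open>XE\<close> and \<open>YE\<close> commute up to q, so the n^2-th power of their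
  sum is the sum of the powers. That of \<open>XE\<close> has the power of E on \<open>M\<close> as
  a factor; that of \<open>YE\<close> acts on products of weight matrices as a scalar times the
  power of E on \<open>N\<close>. Both vanish.\<close>

lemma TT_E_nilpotent: "TT gen_E ^\<^sub>m (n ^ 2) = 0\<^sub>m DD DD"
proof -
  interpret B: scal_ring "ring_mat TYPE('k) DD ()" "\<lambda>c. c \<cdot>\<^sub>m 1\<^sub>m DD" by (rule scal_ring_mat)
  let ?B = "ring_mat TYPE('k) DD ()"
  have comm: "XE * YE = q \<cdot>\<^sub>m (YE * XE)"
  proof (rule wt_kronecker_ext[OF M N])
    fix a b A B assume b: "b < n" and A: "wt M a A" and B: "wt N b B"
    note EA = wt_gen(1)[OF M A] note EB = wt_gen(1)[OF N B]
    note [simp] = wt_carrier[OF A] wt_carrier[OF B]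
    show "XE * YE * kronecker A B = q \<cdot>\<^sub>m (YE * XE) * kronecker A B"
      using coef_facts(6)[OF b, of a] b
      by (simp add: assocD smaD msmD XE_act[OF A B] YE_act[OF A B] XE_act[OF A EB] YE_act[OF EA B] mat_smult_smult)
  qed auto
  have Y: "\<exists>s. YE ^\<^sub>m p * kronecker A B = s \<cdot>\<^sub>m kronecker A (GN gen_E ^\<^sub>m p * B)"
    if A: "wt M a A" and B: "wt N b B" for a b A B p
    using B
  proof (induction p arbitrary: b B)
    case 0
    note [simp] = wt_carrier[OF A] wt_carrier[OF 0]
    have "YE ^\<^sub>m 0 * kronecker A B = 1 \<cdot>\<^sub>m kronecker A (GN gen_E ^\<^sub>m 0 * B)"
      using carrier_matD[OF XY_carrier(2)] carrier_matD[OF GN_carrier, of gen_E]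
        left_mult_one_mat[of B "fst N" "fst N"] left_mult_one_mat[of "kronecker A B" DD DD] by simp
    then show ?case by blast
  next
    case (Suc p)
    note [simp] = wt_carrier[OF A] wt_carrier[OF Suc.prems]
    note EB = wt_gen(1)[OF N Suc.prems]
    obtain s where s: "YE ^\<^sub>m p * kronecker A (GN gen_E * B) = s \<cdot>\<^sub>m kronecker A (GN gen_E ^\<^sub>m p * (GN gen_E * B))"
      using Suc.IH[OF EB] by blast
    have "YE ^\<^sub>m Suc p * kronecker A B = (th a b * s) \<cdot>\<^sub>m kronecker A (GN gen_E ^\<^sub>m Suc p * B)"
      by (simp add: assocD msmD YE_act[OF A Suc.prems] s mat_smult_smult assoc_mult_mat[of _ "fst N" "fst N" _ "fst N" _ "fst N"])
    then show ?case by blast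
  qed
  have Y0: "YE ^\<^sub>m (n ^ 2) = 0\<^sub>m DD DD"
  proof (rule wt_kronecker_ext[OF M N])
    fix a b A B assume A: "wt M a A" and B: "wt N b B"
    note [simp] = wt_carrier[OF A] wt_carrier[OF B]
    have z: "GN gen_E ^\<^sub>m (n ^ 2) * B = 0\<^sub>m (fst N) (fst N)" using relN left_mult_zero_mat[OF wt_carrier[OF B]] by simp
    show "YE ^\<^sub>m (n ^ 2) * kronecker A B = 0\<^sub>m DD DD * kronecker A B"
      using Y[OF A B, of "n ^ 2"] kronecker_zero_right[of A "fst M" "fst M" "fst N" "fst N"] unfolding z
      by (auto simp: left_mult_zero_mat[of _ DD DD])
  qed auto
  have X0: "XE ^\<^sub>m (n ^ 2) = 0\<^sub>m DD DD"
    unfolding XE_def using relM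
    by (subst kronecker_pow[where a = "fst M" and b = "fst N"])
      (simp_all add: kronecker_zero_left[where c = "fst N" and d = "fst N"])
  have "(XE + YE) ^\<^sub>m (n ^ 2) = XE ^\<^sub>m (n ^ 2) + YE ^\<^sub>m (n ^ 2)"
    using B.q_binomial_root_of_unity[of XE YE q "n ^ 2"] q_pow q_prim n_pos comm
    by (simp add: ring_mat_simps mat_scalar_mult[of _ DD DD] pow_mat_ring_pow[of _ DD _ "()", symmetric])
  then show ?thesis by (simp add: TT_E X0 Y0 del: qu_comult.simps)
qed

lemma TT_F_nilpotent: "TT gen_F ^\<^sub>m (n ^ 2) = 0\<^sub>m DD DD"
proof -
  interpret B: scal_ring "ring_mat TYPE('k) DD ()" "\<lambda>c. c \<cdot>\<^sub>m 1\<^sub>m DD" by (rule scal_ring_mat)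
  let ?B = "ring_mat TYPE('k) DD ()"
  have comm: "XF * YF = inverse q \<cdot>\<^sub>m (YF * XF)"
  proof (rule wt_kronecker_ext[OF M N])
    fix a b A B assume b: "b < n" and A: "wt M a A" and B: "wt N b B"
    note FA = wt_gen(2)[OF M A] note FB = wt_gen(2)[OF N B] note hA = wt_gen(3)[OF M A]
    note [simp] = wt_carrier[OF A] wt_carrier[OF B]
    have 1: "GM gen_kappa_hat * (GM gen_F * A) = (inverse (q ^ n) * q ^ 2) \<cdot>\<^sub>m (GM gen_F * (GM gen_kappa_hat * A))"
      using relM by (intro comm_act[where d = "fst M"]) auto
    show "XF * YF * kronecker A B = inverse q \<cdot>\<^sub>m (YF * XF) * kronecker A B"
      using coef_facts(7)[OF b, of a] b
      by (simp add: assocD smaD msmD XF_act[OF A B] YF_act[OF A B] XF_act[OF hA FB] YF_act[OF FA B] 1 ksml mat_smult_smult del: One_nat_def)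
        (simp add: mult_ac)
  qed auto
  \<comment> \<open>\<open>YF\<close> also multiplies the first factor by kappa-hat, so the first
    matrix changes along the induction; the vanishing comes from the second one.\<close>
  have Y: "\<exists>s A'. A' \<in> carrier_mat (fst M) (fst M) \<and> YF ^\<^sub>m p * kronecker A B = s \<cdot>\<^sub>m kronecker A' (GN gen_F ^\<^sub>m p * B)"
    if A: "wt M a A" and B: "wt N b B" for a b A B p
    using A B
  proof (induction p arbitrary: a b A B)
    case 0
    note [simp] = wt_carrier[OF 0(1)] wt_carrier[OF 0(2)]
    have "YF ^\<^sub>m 0 * kronecker A B = 1 \<cdot>\<^sub>m kronecker A (GN gen_F ^\<^sub>m 0 * B)"
      using carrier_matD[OF XY_carrier(4)] carrier_matD[OF GN_carrier, of gen_F]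
        left_mult_one_mat[of B "fst N" "fst N"] left_mult_one_mat[of "kronecker A B" DD DD] by simp
    then show ?case using wt_carrier[OF 0(1)] by blast
  next
    case (Suc p)
    note A = Suc.prems(1) note B = Suc.prems(2)
    note [simp] = wt_carrier[OF A] wt_carrier[OF B]
    note FB = wt_gen(2)[OF N B] note hA = wt_gen(3)[OF M A]
    obtain s A' where s: "YF ^\<^sub>m p * kronecker (GM gen_kappa_hat * A) (GN gen_F * B) = s \<cdot>\<^sub>m kronecker A' (GN gen_F ^\<^sub>m p * (GN gen_F * B))"
      and A': "A' \<in> carrier_mat (fst M) (fst M)"
      using Suc.IH[OF hA FB] by blast
    have "YF ^\<^sub>m Suc p * kronecker A B = (ph a b * s) \<cdot>\<^sub>m kronecker A' (GN gen_F ^\<^sub>m Suc p * B)"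
      by (simp add: assocD msmD YF_act[OF A B] s mat_smult_smult assoc_mult_mat[of _ "fst N" "fst N" _ "fst N" _ "fst N"])
    then show ?case using A' by blast
  qed
  have Y0: "YF ^\<^sub>m (n ^ 2) = 0\<^sub>m DD DD"
  proof (rule wt_kronecker_ext[OF M N])
    fix a b A B assume A: "wt M a A" and B: "wt N b B"
    note [simp] = wt_carrier[OF A] wt_carrier[OF B]
    have z: "GN gen_F ^\<^sub>m (n ^ 2) * B = 0\<^sub>m (fst N) (fst N)" using relN left_mult_zero_mat[OF wt_carrier[OF B]] by simp
    show "YF ^\<^sub>m (n ^ 2) * kronecker A B = 0\<^sub>m DD DD * kronecker A B"
      using Y[OF A B, of "n ^ 2"] unfolding z
      by (auto simp: left_mult_zero_mat[of _ DD DD] kronecker_zero_right[of _ "fst M" "fst M" "fst N" "fst N"])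
  qed auto
  have X0: "XF ^\<^sub>m (n ^ 2) = 0\<^sub>m DD DD"
    unfolding XF_def using relM
    by (subst kronecker_pow[where a = "fst M" and b = "fst N"])
      (simp_all add: kronecker_zero_left[where c = "fst N" and d = "fst N"])
  have "(XF + YF) ^\<^sub>m (n ^ 2) = XF ^\<^sub>m (n ^ 2) + YF ^\<^sub>m (n ^ 2)"
    using B.q_binomial_root_of_unity[of XF YF "inverse q" "n ^ 2"] q_pow q_prim n_pos comm
    by (simp add: ring_mat_simps mat_scalar_mult[of _ DD DD] pow_mat_ring_pow[of _ DD _ "()", symmetric] power_inverse)
  then show ?thesis by (simp add: TT_F X0 Y0 del: qu_comult.simps)
qed

text \<open>On a product of weight matrices the mixed terms \<open>k5\<close> and \<open>k6\<close>
  cancel. By the relation on each factor the rest telescopes: the first factor leaves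
  \<open>k0\<close> - Qa \<open>k2\<close>, the second adds Qa \<open>k2\<close> - Qa Qb
  \<open>k9\<close>, where Qa and Qb are the eigenvalues of kappa^-1 on \<open>A\<close> and
  \<open>B\<close>.\<close>

lemma TT_FE:
  "TT gen_F * TT gen_E - inverse q \<cdot>\<^sub>m (TT gen_E * TT gen_F)
    = 1\<^sub>m DD - TT gen_kappa ^\<^sub>m (n - 1) * TT gen_kappa_hat"
proof (rule wt_kronecker_ext[OF M N])
  have Tkp: "TT gen_kappa ^\<^sub>m (n - 1) * kronecker A B = inverse ((q ^ n) ^ a * (q ^ n) ^ b) \<cdot>\<^sub>m kronecker A B"
    if A: "wt M a A" and B: "wt N b B" for a b A B
  proof -
    note [simp] = wt_carrier[OF A] wt_carrier[OF B]
    show ?thesis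
      unfolding TT_kappa
      by (simp add: kronecker_pow[where a = "fst M" and b = "fst N"] kmul snd_inv_kappa_wt[OF M A] snd_inv_kappa_wt[OF N B]
        ksml ksmr mat_smult_smult mult.commute del: One_nat_def)
  qed
  fix a b A B assume b: "b < n" and A: "wt M a A" and B: "wt N b B"
  note EA = wt_gen(1)[OF M A] note EB = wt_gen(1)[OF N B]
  note FA = wt_gen(2)[OF M A] note FB = wt_gen(2)[OF N B]
  note hA = wt_gen(3)[OF M A] note hB = wt_gen(3)[OF N B]
  note [simp] = wt_carrier[OF A] wt_carrier[OF B]
  let ?Qa = "inverse ((q ^ n) ^ a)" let ?Qb = "inverse ((q ^ n) ^ b)" let ?i = "inverse q"
  have khE: "GM gen_kappa_hat * (GM gen_E * A) = (q ^ n * inverse q ^ 2) \<cdot>\<^sub>m (GM gen_E * (GM gen_kappa_hat * A))"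
    using relM by (intro comm_act[where d = "fst M"]) auto
  \<comment> \<open>The relation applied to \<open>V\<close> and rearranged so that both sides are
    sums, over which \<open>kronecker\<close> distributes.\<close>
  have FE: "G gen_F * (G gen_E * V) + r \<cdot>\<^sub>m (G gen_kappa_hat * V) = ?i \<cdot>\<^sub>m (G gen_E * (G gen_F * V)) + V"
    if G: "\<And>s. G s \<in> carrier_mat d d" and V: "V \<in> carrier_mat d d"
      and rel: "G gen_F * G gen_E - ?i \<cdot>\<^sub>m (G gen_E * G gen_F) = 1\<^sub>m d - G gen_kappa ^\<^sub>m (n - 1) * G gen_kappa_hat"
      and inv: "G gen_kappa ^\<^sub>m (n - 1) * (G gen_kappa_hat * V) = r \<cdot>\<^sub>m (G gen_kappa_hat * V)"
    for G :: "gen \<Rightarrow> 'k mat" and V d r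
  proof -
    have c [simp]: "G s * V \<in> carrier_mat d d" "G s * (G t * V) \<in> carrier_mat d d" for s t
      using G V by (auto intro!: mult_carrier_mat)
    have "(G gen_F * G gen_E - ?i \<cdot>\<^sub>m (G gen_E * G gen_F)) * V = G gen_F * G gen_E * V - ?i \<cdot>\<^sub>m (G gen_E * G gen_F) * V"
      using G V mult_carrier_mat[OF G G] by (intro minus_mult_distrib_mat[of _ d d _ _ d]) simp_all
    also have "\<dots> = G gen_F * (G gen_E * V) - ?i \<cdot>\<^sub>m (G gen_E * (G gen_F * V))"
      using assoc_mult_mat[OF G G V] mult_smult_assoc_mat[OF mult_carrier_mat[OF G G] V] by simp
    finally have 1: "(G gen_F * G gen_E - ?i \<cdot>\<^sub>m (G gen_E * G gen_F)) * V = G gen_F * (G gen_E * V) - ?i \<cdot>\<^sub>m (G gen_E * (G gen_F * V))" .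
    have "(1\<^sub>m d - G gen_kappa ^\<^sub>m (n - 1) * G gen_kappa_hat) * V = 1\<^sub>m d * V - G gen_kappa ^\<^sub>m (n - 1) * G gen_kappa_hat * V"
      using G V mult_carrier_mat[OF pow_carrier_mat[OF G] G] by (intro minus_mult_distrib_mat[of _ d d _ _ d]) simp_all
    also have "\<dots> = V - r \<cdot>\<^sub>m (G gen_kappa_hat * V)"
      using assoc_mult_mat[OF pow_carrier_mat[OF G] G V] V inv by simp
    finally have 2: "G gen_F * (G gen_E * V) - ?i \<cdot>\<^sub>m (G gen_E * (G gen_F * V)) = V - r \<cdot>\<^sub>m (G gen_kappa_hat * V)"
      using 1 rel by simp
    show ?thesis
    proof (rule eq_matI)
      fix i j assume "i < dim_row (?i \<cdot>\<^sub>m (G gen_E * (G gen_F * V)) + V)" "j < dim_col (?i \<cdot>\<^sub>m (G gen_E * (G gen_F * V)) + V)"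
      then have ij: "i < d" "j < d" using V by auto
      show "(G gen_F * (G gen_E * V) + r \<cdot>\<^sub>m (G gen_kappa_hat * V)) $$ (i,j) = (?i \<cdot>\<^sub>m (G gen_E * (G gen_F * V)) + V) $$ (i,j)"
        using arg_cong[OF 2, of "\<lambda>Z. Z $$ (i,j)"] ij V carrier_matD[OF c(1)] carrier_matD[OF c(2)]
        by (simp add: algebra_simps del: index_mult_mat(1) c)
    qed (use V carrier_matD[OF c(1)] in auto)
  qed
  have FEA: "GM gen_F * (GM gen_E * A) + ?Qa \<cdot>\<^sub>m (GM gen_kappa_hat * A) = ?i \<cdot>\<^sub>m (GM gen_E * (GM gen_F * A)) + A"
    using relM snd_inv_kappa_wt[OF M hA] by (intro FE[OF GM_carrier]) simp_all
  have FEB: "GN gen_F * (GN gen_E * B) + ?Qb \<cdot>\<^sub>m (GN gen_kappa_hat * B) = ?i \<cdot>\<^sub>m (GN gen_E * (GN gen_F * B)) + B"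
    using relN snd_inv_kappa_wt[OF N hB] by (intro FE[OF GN_carrier]) simp_all
  define k0 where "k0 = kronecker A B"
  define k1 where "k1 = kronecker (GM gen_F * (GM gen_E * A)) B"
  define k2 where "k2 = kronecker (GM gen_kappa_hat * A) B"
  define k3 where "k3 = kronecker (GM gen_E * (GM gen_F * A)) B"
  define k5 where "k5 = kronecker (GM gen_E * (GM gen_kappa_hat * A)) (GN gen_F * B)"
  define k6 where "k6 = kronecker (GM gen_F * A) (GN gen_E * B)"
  define k7 where "k7 = kronecker (GM gen_kappa_hat * A) (GN gen_F * (GN gen_E * B))"
  define k8 where "k8 = kronecker (GM gen_kappa_hat * A) (GN gen_E * (GN gen_F * B))"
  define k9 where "k9 = kronecker (GM gen_kappa_hat * A) (GN gen_kappa_hat * B)"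
  note kd = k0_def k1_def k2_def k3_def k5_def k6_def k7_def k8_def k9_def
  have kc [simp]: "k0 \<in> carrier_mat DD DD" "k1 \<in> carrier_mat DD DD" "k2 \<in> carrier_mat DD DD" "k3 \<in> carrier_mat DD DD"
    "k5 \<in> carrier_mat DD DD" "k6 \<in> carrier_mat DD DD" "k7 \<in> carrier_mat DD DD" "k8 \<in> carrier_mat DD DD" "k9 \<in> carrier_mat DD DD"
    unfolding kd by simp_all
  have e1: "k1 + ?Qa \<cdot>\<^sub>m k2 = ?i \<cdot>\<^sub>m k3 + k0"
    using arg_cong[OF FEA, of "\<lambda>Z. kronecker Z B"] unfolding kd
    by (simp add: kronecker_add_left[of _ "fst M" "fst M" _ _ "fst N" "fst N"] ksml)
  have e2: "k7 + ?Qb \<cdot>\<^sub>m k9 = ?i \<cdot>\<^sub>m k8 + k2"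
    using arg_cong[OF FEB, of "kronecker (GM gen_kappa_hat * A)"] unfolding kd
    by (simp add: kronecker_add_right[of _ "fst M" "fst M" _ "fst N" "fst N"] ksmr)
  have "(TT gen_F * TT gen_E) * k0 = (q ^ b * ?i ^ b) \<cdot>\<^sub>m k1 + (q ^ b * ph (a + 1) b * (q ^ n * ?i ^ 2)) \<cdot>\<^sub>m k5
     + ((th a b * ?i ^ ((b + 1) mod n)) \<cdot>\<^sub>m k6 + (th a b * ph a (b + 1)) \<cdot>\<^sub>m k7)"
    unfolding kd using b
    by (simp add: assocD maddD msmD saddD E_act[OF A B] F_act[OF EA B] F_act[OF A EB] khE ksml mat_smult_smult mult.assoc del: qu_comult.simps)
  then have l1: "(TT gen_F * TT gen_E) * k0 = k1 + (?i * (ph a b * q ^ ((b + (n - 1)) mod n))) \<cdot>\<^sub>m k5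
     + ((?i * (?i ^ b * th (a + (n - 1)) b)) \<cdot>\<^sub>m k6 + ?Qa \<cdot>\<^sub>m k7)"
    unfolding coef_facts(1-4)[OF b] by simp
  have "(TT gen_E * TT gen_F) * k0 = (?i ^ b * q ^ b) \<cdot>\<^sub>m k3 + (?i ^ b * th (a + (n - 1)) b) \<cdot>\<^sub>m k6
     + ((ph a b * q ^ ((b + (n - 1)) mod n)) \<cdot>\<^sub>m k5 + (ph a b * th a (b + (n - 1))) \<cdot>\<^sub>m k8)"
    unfolding kd using b
    by (simp add: assocD maddD msmD saddD F_act[OF A B] E_act[OF FA B] E_act[OF hA FB] mat_smult_smult mult.assoc del: qu_comult.simps One_nat_def)
  then have l2: "(TT gen_E * TT gen_F) * k0 = k3 + (?i ^ b * th (a + (n - 1)) b) \<cdot>\<^sub>m k6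
     + ((ph a b * q ^ ((b + (n - 1)) mod n)) \<cdot>\<^sub>m k5 + ?Qa \<cdot>\<^sub>m k8)"
    unfolding coef_facts(5)[OF b] mult.commute[of "?i ^ b" "q ^ b"] coef_facts(1)[OF b] by simp
  have r: "TT gen_kappa ^\<^sub>m (n - 1) * TT gen_kappa_hat * k0 = (?Qa * ?Qb) \<cdot>\<^sub>m k9"
    unfolding kd by (simp add: assocD kappa_hat_act[OF A B] Tkp[OF hA hB] del: qu_comult.simps One_nat_def)
  have "(TT gen_F * TT gen_E - ?i \<cdot>\<^sub>m (TT gen_E * TT gen_F)) * k0
    = (TT gen_F * TT gen_E) * k0 - ?i \<cdot>\<^sub>m ((TT gen_E * TT gen_F) * k0)"
    by (simp add: minus_mult_distrib_mat[of _ DD DD _ _ DD] smaD del: qu_comult.simps assoc_mult_mat)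
  also have "\<dots> = 1\<^sub>m DD * k0 - TT gen_kappa ^\<^sub>m (n - 1) * TT gen_kappa_hat * k0"
    unfolding l1 l2 r
  proof (rule eq_matI)
    fix i j assume "i < dim_row (1\<^sub>m DD * k0 - (?Qa * ?Qb) \<cdot>\<^sub>m k9)" "j < dim_col (1\<^sub>m DD * k0 - (?Qa * ?Qb) \<cdot>\<^sub>m k9)"
    then have ij: "i < DD" "j < DD" using kc by auto
    note d = kc[THEN carrier_matD(1)] kc[THEN carrier_matD(2)]
    have s1: "k1 $$ (i,j) = ?i * k3 $$ (i,j) + k0 $$ (i,j) - ?Qa * k2 $$ (i,j)"
      using arg_cong[OF e1, of "\<lambda>Z. Z $$ (i,j)"] ij d by (simp add: algebra_simps)
    have s2: "k7 $$ (i,j) = ?i * k8 $$ (i,j) + k2 $$ (i,j) - ?Qb * k9 $$ (i,j)"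
      using arg_cong[OF e2, of "\<lambda>Z. Z $$ (i,j)"] ij d by (simp add: algebra_simps)
    have one: "1\<^sub>m DD * k0 = k0" by (rule left_mult_one_mat[OF kc(1)])
    show "(k1 + (?i * (ph a b * q ^ ((b + (n - 1)) mod n))) \<cdot>\<^sub>m k5
     + ((?i * (?i ^ b * th (a + (n - 1)) b)) \<cdot>\<^sub>m k6 + ?Qa \<cdot>\<^sub>m k7)
     - ?i \<cdot>\<^sub>m (k3 + (?i ^ b * th (a + (n - 1)) b) \<cdot>\<^sub>m k6
     + ((ph a b * q ^ ((b + (n - 1)) mod n)) \<cdot>\<^sub>m k5 + ?Qa \<cdot>\<^sub>m k8))) $$ (i,j)
     = (1\<^sub>m DD * k0 - (?Qa * ?Qb) \<cdot>\<^sub>m k9) $$ (i,j)"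
      unfolding one using ij d by (simp add: s1 s2 del: One_nat_def) (simp only: algebra_simps, simp)
  qed (use kc[THEN carrier_matD(1)] kc[THEN carrier_matD(2)] in simp_all)
  also have "\<dots> = (1\<^sub>m DD - TT gen_kappa ^\<^sub>m (n - 1) * TT gen_kappa_hat) * k0"
    by (rule minus_mult_distrib_mat[of _ DD DD _ _ DD, symmetric]) (simp_all del: qu_comult.simps)
  finally show "(TT gen_F * TT gen_E - ?i \<cdot>\<^sub>m (TT gen_E * TT gen_F)) * kronecker A B
    = (1\<^sub>m DD - TT gen_kappa ^\<^sub>m (n - 1) * TT gen_kappa_hat) * kronecker A B"
    unfolding k0_def .
qed (auto intro!: minus_carrier_mat simp del: qu_comult.simps)

lemma qu_rep_TT: "qu_rep n q DD (\<lambda>s. TT s)"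
  unfolding qu_rep_def
proof (intro conjI allI)
  show "TT gen_kappa ^\<^sub>m n = 1\<^sub>m DD"
    unfolding TT_kappa using relM relN by (simp add: kronecker_pow[where a = "fst M" and b = "fst N"] kronecker_one)
  show "TT gen_kappa_hat ^\<^sub>m n * TT gen_kappa ^\<^sub>m 2 = 1\<^sub>m DD"
    unfolding TT_kappa TT_kappa_hat using relM relN
    by (simp add: kronecker_pow[where a = "fst M" and b = "fst N"] kmul kronecker_one)
  show "TT gen_kappa * TT gen_kappa_hat = TT gen_kappa_hat * TT gen_kappa"
    unfolding TT_kappa TT_kappa_hat using relM relN by (simp add: kmul)
qed (use TT_kappa_E TT_kappa_F TT_kappa_hat_E TT_kappa_hat_F TT_E_nilpotent TT_F_nilpotent TT_FE TT_carrier in blast)+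

lemma qu_tensor_in: "qu_tensor n q M N \<in> qu_modules n q"
  unfolding qu_tensor_def by (rule module_of_gens_in[OF qu_rep_TT])

lemma fst_qu_tensor: "fst (qu_tensor n q M N) = DD"
  by (simp add: qu_tensor_def)

lemma mod_gen_qu_tensor: "mod_gen n q (qu_tensor n q M N) s = TT s"
  unfolding qu_tensor_def by (rule mod_gen_module_of_gens[OF qu_rep_TT])

end

end

section \<open>Simple modules\<close>

definition hom_mat :: "(nat \<Rightarrow> int) \<Rightarrow> (nat \<Rightarrow> int) \<Rightarrow> int \<Rightarrow> 'k::field mat \<Rightarrow> bool" where
  "hom_mat dr dc s A \<longleftrightarrow> (\<forall>i<dim_row A. \<forall>j<dim_col A. A $$ (i,j) \<noteq> 0 \<longrightarrow> dr i = dc j + s)"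

lemma hom_matD: "hom_mat dr dc s A \<Longrightarrow> i < dim_row A \<Longrightarrow> j < dim_col A \<Longrightarrow> A $$ (i,j) \<noteq> 0 \<Longrightarrow> dr i = dc j + s"
  by (auto simp: hom_mat_def)

lemma hom_mat_mult:
  fixes A B :: "'k::field mat"
  assumes A: "A \<in> carrier_mat a b" and B: "B \<in> carrier_mat b c"
    and hA: "hom_mat d1 d2 s A" and hB: "hom_mat d2 d3 t B"
  shows "hom_mat d1 d3 (s + t) (A * B)"
  unfolding hom_mat_def
proof (intro allI impI)
  fix i j assume "i < dim_row (A * B)" "j < dim_col (A * B)" and nz: "(A * B) $$ (i,j) \<noteq> 0"
  then have ij: "i < a" "j < c" using A B by auto
  have "(\<Sum>k<b. A $$ (i,k) * B $$ (k,j)) \<noteq> 0" using nz unfolding times_mat_index[OF A B ij] .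
  then obtain k where k: "k < b" "A $$ (i,k) * B $$ (k,j) \<noteq> 0" by (metis (no_types, lifting) lessThan_iff sum.neutral)
  then show "d1 i = d3 j + (s + t)"
    using hom_matD[OF hA, of i k] hom_matD[OF hB, of k j] A B ij by auto
qed

lemma hom_mat_add:
  "A \<in> carrier_mat a b \<Longrightarrow> B \<in> carrier_mat a b \<Longrightarrow> hom_mat d1 d2 s A \<Longrightarrow> hom_mat d1 d2 s B \<Longrightarrow> hom_mat d1 d2 s (A + B)"
  unfolding hom_mat_def by (metis add_0 carrier_matD index_add_mat)

lemma hom_mat_smult: "hom_mat d1 d2 s A \<Longrightarrow> hom_mat d1 d2 s (c \<cdot>\<^sub>m A)"
  by (auto simp: hom_mat_def)

lemma hom_mat_one: "hom_mat d d 0 (1\<^sub>m r)"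
  by (auto simp: hom_mat_def)

lemma hom_mat_pow:
  fixes A :: "'k::field mat"
  assumes A: "A \<in> carrier_mat a a" and hA: "hom_mat d1 d1 s A"
  shows "hom_mat d1 d1 (int k * s) (A ^\<^sub>m k)"
proof (induction k)
  case 0
  then show ?case using A by (simp add: hom_mat_one)
next
  case (Suc k)
  have "int (Suc k) * s = int k * s + s" by (simp add: algebra_simps)
  then show ?case using hom_mat_mult[OF pow_carrier_mat[OF A] A Suc hA] by simp
qed

definition hom_vec :: "(nat \<Rightarrow> int) \<Rightarrow> int \<Rightarrow> 'k::field vec \<Rightarrow> bool" where
  "hom_vec d s v \<longleftrightarrow> (\<forall>i<dim_vec v. v $ i \<noteq> 0 \<longrightarrow> d i = s)"

lemma hom_vec_mult:
  fixes A :: "'k::field mat"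
  assumes A: "A \<in> carrier_mat a b" and v: "v \<in> carrier_vec b"
    and hA: "hom_mat d1 d2 s A" and hv: "hom_vec d2 t v"
  shows "hom_vec d1 (t + s) (A *\<^sub>v v)"
  unfolding hom_vec_def
proof (intro allI impI)
  fix i assume "i < dim_vec (A *\<^sub>v v)" and nz: "(A *\<^sub>v v) $ i \<noteq> 0"
  then have i: "i < a" using A by simp
  have "(A *\<^sub>v v) $ i = (\<Sum>k<b. A $$ (i,k) * v $ k)"
    using A v i by (simp add: scalar_prod_def lessThan_atLeast0)
  then obtain k where k: "k < b" "A $$ (i,k) * v $ k \<noteq> 0" using nz by (metis (no_types, lifting) lessThan_iff sum.neutral)
  then show "d1 i = t + s"
    using hom_matD[OF hA, of i k] hv A v i by (auto simp: hom_vec_def)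
qed

definition diag_fun :: "nat \<Rightarrow> (nat \<Rightarrow> 'k::field) \<Rightarrow> 'k mat" where
  "diag_fun d f = mat d d (\<lambda>(i,j). if i = j then f i else 0)"

lemma diag_fun_carrier [simp]: "diag_fun d f \<in> carrier_mat d d"
  by (simp add: diag_fun_def)

lemma diag_fun_index: "i < d \<Longrightarrow> j < d \<Longrightarrow> diag_fun d f $$ (i,j) = (if i = j then f i else 0)"
  by (simp add: diag_fun_def)

lemma diag_fun_mult_left_index:
  assumes A: "A \<in> carrier_mat d e" and ij: "i < d" "j < e"
  shows "(diag_fun d f * A) $$ (i,j) = f i * A $$ (i,j)"
proof -
  have "(diag_fun d f * A) $$ (i,j) = (\<Sum>k<d. diag_fun d f $$ (i,k) * A $$ (k,j))"
    by (rule times_mat_index[OF diag_fun_carrier A ij])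
  also have "\<dots> = (\<Sum>k<d. if k = i then f i * A $$ (i,j) else 0)"
    using ij by (intro sum.cong) (auto simp: diag_fun_index)
  finally show ?thesis using ij by simp
qed

lemma diag_fun_mult_right_index:
  assumes A: "A \<in> carrier_mat e d" and ij: "i < e" "j < d"
  shows "(A * diag_fun d f) $$ (i,j) = A $$ (i,j) * f j"
proof -
  have "(A * diag_fun d f) $$ (i,j) = (\<Sum>k<d. A $$ (i,k) * diag_fun d f $$ (k,j))"
    by (rule times_mat_index[OF A diag_fun_carrier ij])
  also have "\<dots> = (\<Sum>k<d. if k = j then A $$ (i,j) * f j else 0)"
    using ij by (intro sum.cong) (auto simp: diag_fun_index)
  finally show ?thesis using ij by simp
qed

lemma diag_fun_dim [simp]: "dim_row (diag_fun d f) = d" "dim_col (diag_fun d f) = d"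
  by (simp_all add: diag_fun_def)

lemma diag_fun_mult: "diag_fun d f * diag_fun d g = diag_fun d (\<lambda>i. f i * g i)"
  by (rule eq_matI) (simp_all add: diag_fun_mult_left_index[of _ d d] diag_fun_index del: index_mult_mat(1))

lemma diag_fun_one: "diag_fun d (\<lambda>i. 1) = 1\<^sub>m d"
  by (rule eq_matI) (auto simp: diag_fun_def)

lemma diag_fun_pow: "diag_fun d f ^\<^sub>m k = diag_fun d (\<lambda>i. f i ^ k)"
proof (induction k)
  case 0
  show ?case by (simp add: diag_fun_one)
next
  case (Suc k)
  then show ?case by (simp add: diag_fun_mult mult.commute)
qed

lemma mat_trace_diag_fun: "mat_trace (diag_fun d f) = (\<Sum>i<d. f i)"
  by (simp add: mat_trace_def diag_fun_def)

section \<open>The modules \<open>qu_simple\<close>\<close>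

context qu_setup
begin

text \<open>The order of \<open>q ^ 2\<close>. On a lowest weight vector kappa^-1 kappa-hat acts by
  a power of \<open>q ^ 2\<close>, which leaves N possibilities.\<close>

definition NN :: nat where "NN = n ^ 2 div 2"

lemma n_sq: "n ^ 2 = 2 * NN" and NN_pos: "NN > 0" and NN_even: "even NN" and n_dvd_NN: "n dvd NN"
  and n_even: "even n" and NN_ge: "NN \<ge> 2"
proof -
  obtain k where k: "n = 4 * k" using n_dvd by (auto simp: dvd_def)
  then have "k > 0" using n_pos by simp
  show 1: "n ^ 2 = 2 * NN" by (unfold NN_def, unfold k) (simp add: power2_eq_square)
  have NN: "NN = n * (2 * k)" by (unfold NN_def, unfold k) (simp add: power2_eq_square)
  then show "NN > 0" "n dvd NN" "even NN" using n_pos \<open>k > 0\<close> by auto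
  then show "NN \<ge> 2" by (metis One_nat_def Suc_1 Suc_leI dvd_imp_le le_antisym not_less_eq_eq zero_less_iff_neq_zero)
  show "even n" using k by simp
qed

lemma q_pow_eq_1_iff: "q ^ k = 1 \<longleftrightarrow> 2 * NN dvd k"
  using primitive_root_power_eq_1_iff[OF q_pow q_prim] n_pos NN_pos by (simp add: n_sq)

lemma q_neq_1: "q \<noteq> 1"
  using q_pow_eq_1_iff[of 1] NN_pos by auto

lemma q_pow_inj: "q ^ a = q ^ b \<Longrightarrow> a < 2 * NN \<Longrightarrow> b < 2 * NN \<Longrightarrow> a = b"
proof (induction a b rule: linorder_wlog)
  case (le a b)
  have "q ^ a * q ^ (b - a) = q ^ b" using le(1) by (simp flip: power_add)
  then have "q ^ a * q ^ (b - a) = q ^ a * 1" using le(2) by simp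
  then have "q ^ (b - a) = 1" by simp
  then have "2 * NN dvd b - a" by (simp only: q_pow_eq_1_iff)
  then show ?case using le by (auto dest: dvd_imp_le)
qed metis

text \<open>If $Fv = 0$ and $\kappa^{-1}\hat\kappa v = l v$, then $F E^r v = \mathit{cc}\,l\,r \cdot E^{r-1} v$.\<close>

fun cc :: "'k \<Rightarrow> nat \<Rightarrow> 'k" where
  "cc l 0 = 0"
| "cc l (Suc r) = inverse q * cc l r + 1 - l * inverse q ^ (2 * r)"

text \<open>Sums the recursion as a geometric series, with denominators cleared. The factors on the
  right display the zeros of \<open>cc\<close>, which decide where a chain of powers of E can
  end.\<close>

lemma cc_closed: "(q - 1) * q ^ (2 * r) * cc l r = q * (q ^ r - 1) * (q ^ r - l * q)"
proof (induction r)
  case (Suc r)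
  let ?P = "q ^ r"
  have e: "q ^ (2 * Suc r) = q ^ 2 * q ^ (2 * r)" by (simp add: power_add power2_eq_square)
  have i: "q ^ (2 * r) * inverse q ^ (2 * r) = 1" by (simp flip: power_mult_distrib)
  have sq: "q ^ (2 * r) = ?P ^ 2" by (simp add: power_mult mult.commute)
  have "(q - 1) * q ^ (2 * Suc r) * cc l (Suc r)
    = q * ((q - 1) * q ^ (2 * r) * cc l r) * (q * inverse q)
      + (q - 1) * q ^ 2 * q ^ (2 * r) - (q - 1) * q ^ 2 * l * (q ^ (2 * r) * inverse q ^ (2 * r))"
    unfolding e by (simp add: algebra_simps power2_eq_square del: right_inverse)
  also have "\<dots> = q * (q * (?P - 1) * (?P - l * q)) + (q - 1) * q ^ 2 * ?P ^ 2 - (q - 1) * q ^ 2 * l"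
    unfolding Suc i unfolding sq by simp
  also have "\<dots> = q * (q ^ Suc r - 1) * (q ^ Suc r - l * q)"
    by (simp add: algebra_simps power2_eq_square)
  finally show ?case .
qed simp

lemma cc_eq_0_iff: "cc l r = 0 \<longleftrightarrow> q ^ r = 1 \<or> q ^ r = l * q"
proof -
  have "cc l r = 0 \<longleftrightarrow> (q - 1) * q ^ (2 * r) * cc l r = 0" using q_neq_1 by simp
  also have "\<dots> \<longleftrightarrow> q ^ r = 1 \<or> q ^ r = l * q" unfolding cc_closed by auto
  finally show ?thesis .
qed

lemma cc_simple: "cc (q ^ (2 * m)) (2 * m + 1) = 0"
  unfolding cc_eq_0_iff by (simp add: power_add)

text \<open>Let kappa-hat act on the lowest weight vector by q^(2m) times the eigenvalue of kappa.
  The relations kappa^n = 1 and kappa-hat^n = kappa^-2 then force the square of the kappa eigenvalue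
  to be q^(-2mn); the index j chooses the square root.\<close>

definition kap_val :: "nat \<Rightarrow> nat \<Rightarrow> 'k" where
  "kap_val m j = (- 1) ^ j * inverse (q ^ n) ^ m"

text \<open>\<open>qu_simple m j\<close> has basis $v, Ev, \dots, E^{2m}v$ with $Fv = 0$.\<close>

fun simple_gen :: "nat \<Rightarrow> nat \<Rightarrow> gen \<Rightarrow> 'k mat" where
  "simple_gen m j gen_kappa = diag_fun (2 * m + 1) (\<lambda>r. kap_val m j * (q ^ n) ^ r)"
| "simple_gen m j gen_kappa_hat = diag_fun (2 * m + 1) (\<lambda>r. kap_val m j * (q ^ n) ^ r * (q ^ (2 * m) * inverse q ^ (2 * r)))"
| "simple_gen m j gen_E = mat (2 * m + 1) (2 * m + 1) (\<lambda>(a,b). if a = Suc b then 1 else 0)"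
| "simple_gen m j gen_F = mat (2 * m + 1) (2 * m + 1) (\<lambda>(a,b). if b = Suc a then cc (q ^ (2 * m)) b else 0)"

definition qu_simple :: "nat \<Rightarrow> nat \<Rightarrow> 'k qu_module" where
  "qu_simple m j = module_of_gens (2 * m + 1) (simple_gen m j)"

lemma simple_gen_carrier [simp]: "simple_gen m j s \<in> carrier_mat (2 * m + 1) (2 * m + 1)"
  by (cases s) auto

lemma Q_pow_pow: "((q ^ n) ^ b) ^ n = 1"
  by (metis Q_pow mult.commute power_mult power_one)

lemma kap_val_pow: "kap_val m j ^ n = 1"
proof -
  have "((- 1 :: 'k) ^ j) ^ n = 1"
    using n_even by (metis mult.commute neg_one_even_power power_mult power_one)
  moreover have "(inverse (q ^ n) ^ m) ^ n = 1"
    using Q_pow_pow[of m] by (simp only: power_inverse inverse_1)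
  ultimately show ?thesis unfolding kap_val_def power_mult_distrib by simp
qed

lemma kap_val_sq: "kap_val m j ^ 2 * (q ^ (2 * m)) ^ n = 1"
proof -
  have "(q ^ (2 * m)) ^ n = ((q ^ n) ^ m) ^ 2" by (simp only: mult_ac flip: power_mult)
  moreover have "(inverse (q ^ n) ^ m * (q ^ n) ^ m) = 1" by (simp flip: power_mult_distrib)
  moreover have "((- 1 :: 'k) ^ j) ^ 2 = 1" by (simp flip: power_mult)
  ultimately show ?thesis unfolding kap_val_def power_mult_distrib
    by (metis mult.assoc mult_1 power_mult_distrib power_one)
qed

lemma kap_val_nonzero [simp]: "kap_val m j \<noteq> 0"
  by (simp add: kap_val_def)

lemma qu_rep_simple:
  assumes m: "m < NN"
  shows "qu_rep n q (2 * m + 1) (simple_gen m j)"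
  unfolding qu_rep_def
proof (intro conjI allI)
  let ?d = "2 * m + 1"
  let ?k = "\<lambda>r. kap_val m j * (q ^ n) ^ r" let ?K = "\<lambda>r. q ^ (2 * m) * inverse q ^ (2 * r)"
  let ?E = "simple_gen m j gen_E" let ?F = "simple_gen m j gen_F"
  have kn: "?k r ^ n = 1" for r
    unfolding power_mult_distrib kap_val_pow Q_pow_pow by simp
  show "simple_gen m j gen_kappa ^\<^sub>m n = 1\<^sub>m ?d"
    by (simp add: diag_fun_pow kn diag_fun_one del: power_mult_distrib)
  have K: "(?k r * ?K r) ^ n * ?k r ^ 2 = 1" for r
  proof -
    have "inverse q ^ (2 * r * n) * ((q ^ n) ^ r) ^ 2 = 1"
    proof -
      have "((q ^ n) ^ r) ^ 2 = q ^ (2 * r * n)" by (simp add: mult_ac flip: power_mult)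
      then show ?thesis by (simp flip: power_mult_distrib)
    qed
    moreover have "(?k r * ?K r) ^ n * ?k r ^ 2
       = ?k r ^ n * (kap_val m j ^ 2 * (q ^ (2 * m)) ^ n) * (inverse q ^ (2 * r * n) * ((q ^ n) ^ r) ^ 2)"
      unfolding power_mult[of "inverse q" "2 * r" n] power_mult_distrib by (simp only: mult_ac)
    ultimately show ?thesis unfolding kn kap_val_sq by simp
  qed
  show "simple_gen m j gen_kappa_hat ^\<^sub>m n * simple_gen m j gen_kappa ^\<^sub>m 2 = 1\<^sub>m ?d"
    by (simp add: diag_fun_pow diag_fun_mult K diag_fun_one)
  show "simple_gen m j gen_kappa * simple_gen m j gen_kappa_hat = simple_gen m j gen_kappa_hat * simple_gen m j gen_kappa"
    by (simp add: diag_fun_mult mult_ac)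
  note ix = diag_fun_mult_left_index[of _ "Suc (2 * m)" "Suc (2 * m)"] diag_fun_mult_right_index[of _ "Suc (2 * m)" "Suc (2 * m)"]
  show "simple_gen m j gen_kappa * ?E = q ^ n \<cdot>\<^sub>m (?E * simple_gen m j gen_kappa)"
    by (rule eq_matI) (auto simp: ix simp del: index_mult_mat(1))
  show "simple_gen m j gen_kappa * ?F = inverse (q ^ n) \<cdot>\<^sub>m (?F * simple_gen m j gen_kappa)"
    by (rule eq_matI) (simp_all add: ix del: index_mult_mat(1), (auto simp: field_simps)?)
  show "simple_gen m j gen_kappa_hat * ?E = (q ^ n * inverse q ^ 2) \<cdot>\<^sub>m (?E * simple_gen m j gen_kappa_hat)"
    by (rule eq_matI) (auto simp: ix power2_eq_square simp del: index_mult_mat(1))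
  show "simple_gen m j gen_kappa_hat * ?F = (inverse (q ^ n) * q ^ 2) \<cdot>\<^sub>m (?F * simple_gen m j gen_kappa_hat)"
    by (rule eq_matI) (simp_all add: ix del: index_mult_mat(1), (auto simp: power2_eq_square field_simps)?)
  \<comment> \<open>With the basis index as degree, E has degree 1 and F degree -1. Their n^2-th
    powers shift by more than the largest index 2m, hence vanish.\<close>
  have hE: "hom_mat int int 1 ?E" by (auto simp: hom_mat_def split: if_splits)
  have hF: "hom_mat int int (- 1) ?F" by (auto simp: hom_mat_def split: if_splits)
  have big: "int (n ^ 2) > int (2 * m)" using m n_sq by simp
  show "?E ^\<^sub>m (n ^ 2) = 0\<^sub>m ?d ?d"
  proof (rule eq_matI)
    fix a b assume "a < dim_row (0\<^sub>m ?d ?d)" "b < dim_col (0\<^sub>m ?d ?d)"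
    then have ab: "a < ?d" "b < ?d" by auto
    show "(?E ^\<^sub>m (n ^ 2)) $$ (a,b) = 0\<^sub>m ?d ?d $$ (a,b)"
    proof (rule ccontr)
      assume "\<not> ?thesis"
      then have "(?E ^\<^sub>m (n ^ 2)) $$ (a,b) \<noteq> 0" using ab by simp
      then have "int a = int b + int (n ^ 2) * 1"
        by (intro hom_matD[OF hom_mat_pow[OF simple_gen_carrier hE]])
          (use ab carrier_matD[OF pow_carrier_mat[OF simple_gen_carrier[of m j gen_E]]] in auto)
      then show False using ab big by simp
    qed
  qed (use carrier_matD[OF pow_carrier_mat[OF simple_gen_carrier[of m j gen_E]]] in auto)
  show "?F ^\<^sub>m (n ^ 2) = 0\<^sub>m ?d ?d"
  proof (rule eq_matI)
    fix a b assume "a < dim_row (0\<^sub>m ?d ?d)" "b < dim_col (0\<^sub>m ?d ?d)"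
    then have ab: "a < ?d" "b < ?d" by auto
    show "(?F ^\<^sub>m (n ^ 2)) $$ (a,b) = 0\<^sub>m ?d ?d $$ (a,b)"
    proof (rule ccontr)
      assume "\<not> ?thesis"
      then have "(?F ^\<^sub>m (n ^ 2)) $$ (a,b) \<noteq> 0" using ab by simp
      then have "int a = int b + int (n ^ 2) * (- 1)"
        by (intro hom_matD[OF hom_mat_pow[OF simple_gen_carrier hF]])
          (use ab carrier_matD[OF pow_carrier_mat[OF simple_gen_carrier[of m j gen_F]]] in auto)
      then show False using ab big by simp
    qed
  qed (use carrier_matD[OF pow_carrier_mat[OF simple_gen_carrier[of m j gen_F]]] in auto)
  have Kinv: "?k r ^ (n - 1) * (?k r * ?K r) = ?K r" for r
  proof -
    have "?k r ^ (n - 1) * ?k r = ?k r ^ n" using n_pos by (simp flip: power_Suc2)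
    then show ?thesis unfolding kn mult.assoc[symmetric] by simp
  qed
  have EF: "?E * ?F = diag_fun ?d (cc (q ^ (2 * m)))"
  proof (rule eq_matI)
    fix a b assume "a < dim_row (diag_fun ?d (cc (q ^ (2 * m))))" "b < dim_col (diag_fun ?d (cc (q ^ (2 * m))))"
    then have ab: "a < ?d" "b < ?d" by (auto simp: diag_fun_def)
    have "(?E * ?F) $$ (a,b) = (\<Sum>k<?d. ?E $$ (a,k) * ?F $$ (k,b))"
      by (rule times_mat_index[OF simple_gen_carrier simple_gen_carrier ab])
    \<comment> \<open>For a = 0 the truncated index a - 1 is 0, which is harmless because
      \<open>cc\<close> vanishes at 0.\<close>
    also have "\<dots> = (\<Sum>k<?d. if k = a - 1 then (if a = b then cc (q ^ (2 * m)) a else 0) else 0)"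
      using ab by (intro sum.cong) (auto, cases b, auto)
    also have "\<dots> = diag_fun ?d (cc (q ^ (2 * m))) $$ (a,b)" using ab by (cases a) (auto simp: diag_fun_index simp del: cc.simps(2))
    finally show "(?E * ?F) $$ (a,b) = diag_fun ?d (cc (q ^ (2 * m))) $$ (a,b)" .
  qed (auto simp: diag_fun_def)
  have FE: "?F * ?E = diag_fun ?d (\<lambda>r. cc (q ^ (2 * m)) (Suc r))"
  proof (rule eq_matI)
    fix a b assume "a < dim_row (diag_fun ?d (\<lambda>r. cc (q ^ (2 * m)) (Suc r)))" "b < dim_col (diag_fun ?d (\<lambda>r. cc (q ^ (2 * m)) (Suc r)))"
    then have ab: "a < ?d" "b < ?d" by (auto simp: diag_fun_def)
    have "(?F * ?E) $$ (a,b) = (\<Sum>k<?d. ?F $$ (a,k) * ?E $$ (k,b))"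
      by (rule times_mat_index[OF simple_gen_carrier simple_gen_carrier ab])
    also have "\<dots> = (\<Sum>k<?d. if k = Suc a then (if a = b then cc (q ^ (2 * m)) (Suc a) else 0) else 0)"
      using ab by (intro sum.cong) (auto simp del: cc.simps)
    also have "\<dots> = diag_fun ?d (\<lambda>r. cc (q ^ (2 * m)) (Suc r)) $$ (a,b)"
    proof (cases "Suc a < ?d")
      case False
      \<comment> \<open>E annihilates the top vector, so the diagonal entry must be zero there;
        \<open>cc_simple\<close> says that the formula agrees.\<close>
      then have "Suc a = 2 * m + 1" using ab by simp
      then have "cc (q ^ (2 * m)) (Suc a) = 0" using cc_simple by metis
      then show ?thesis using ab False by (auto simp: diag_fun_index simp del: cc.simps)
    qed (use ab in \<open>simp add: diag_fun_index del: cc.simps\<close>)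
    finally show "(?F * ?E) $$ (a,b) = diag_fun ?d (\<lambda>r. cc (q ^ (2 * m)) (Suc r)) $$ (a,b)" .
  qed (auto simp: diag_fun_def)
  show "?F * ?E - inverse q \<cdot>\<^sub>m (?E * ?F) = 1\<^sub>m ?d - simple_gen m j gen_kappa ^\<^sub>m (n - 1) * simple_gen m j gen_kappa_hat"
    unfolding EF FE unfolding simple_gen.simps diag_fun_pow diag_fun_mult Kinv
    by (rule eq_matI) (auto simp: diag_fun_def)
qed (rule simple_gen_carrier)

lemma qu_simple_in: "m < NN \<Longrightarrow> qu_simple m j \<in> qu_modules n q"
  unfolding qu_simple_def by (rule module_of_gens_in[OF qu_rep_simple])

lemma fst_qu_simple [simp]: "fst (qu_simple m j) = 2 * m + 1"
  by (simp add: qu_simple_def)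

lemma mod_gen_qu_simple: "m < NN \<Longrightarrow> mod_gen n q (qu_simple m j) s = simple_gen m j s"
  unfolding qu_simple_def by (rule mod_gen_module_of_gens[OF qu_rep_simple])

end

section \<open>Lowest weight vectors\<close>

lemma (in abelian_monoid) finsum_pred:
  assumes "finite I" "\<And>i. i \<in> I \<Longrightarrow> f i \<in> carrier G" "\<And>i. i \<in> I \<Longrightarrow> P (f i)"
    and "P \<zero>" "\<And>x y. x \<in> carrier G \<Longrightarrow> y \<in> carrier G \<Longrightarrow> P x \<Longrightarrow> P y \<Longrightarrow> P (x \<oplus> y)"
  shows "P (finsum G f I)"
  using assms(1-3)
proof (induction I rule: finite_induct)
  case (insert i I)
  then have "finsum G f (insert i I) = f i \<oplus> finsum G f I" by (intro finsum_insert) auto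
  moreover have "finsum G f I \<in> carrier G" using insert by (intro finsum_closed) auto
  ultimately show ?case using insert assms(5) by auto
qed (simp add: assms(4))

lemma smult_mat_mult_vec: "A \<in> carrier_mat a b \<Longrightarrow> v \<in> carrier_vec b \<Longrightarrow> (c \<cdot>\<^sub>m A) *\<^sub>v v = c \<cdot>\<^sub>v (A *\<^sub>v v)"
  for A :: "'k::field mat"
  by (intro eq_vecI) (auto simp: scalar_prod_def sum_distrib_left mult.assoc)

lemma mult_mat_zero_vec: "A \<in> carrier_mat a b \<Longrightarrow> A *\<^sub>v 0\<^sub>v b = 0\<^sub>v a" for A :: "'k::field mat"
  by (intro eq_vecI) auto

text \<open>A nonzero vector of \<open>W\<close> has a nonzero spectral component, because the
  projections add up to the identity, and that component stays in \<open>W\<close>, being a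
  polynomial in \<open>T\<close> applied to the vector. The subspace is given by closure properties
  of a predicate, so that common eigenvectors can be found by repeated use.\<close>

lemma eigen_in_subspace:
  fixes T :: "'k::field_char_0 mat"
  assumes T: "T \<in> carrier_mat d d" and TL: "T ^\<^sub>m L = 1\<^sub>m d"
    and w: "\<omega> ^ L = 1" "\<forall>m. 0 < m \<and> m < L \<longrightarrow> \<omega> ^ m \<noteq> 1" "L > 0"
    and W: "\<And>v. W v \<Longrightarrow> v \<in> carrier_vec d"
    and add: "\<And>u v. W u \<Longrightarrow> W v \<Longrightarrow> W (u + v)" and smult: "\<And>c v. W v \<Longrightarrow> W (c \<cdot>\<^sub>v v)"
    and mulT: "\<And>v. W v \<Longrightarrow> W (T *\<^sub>v v)"
    and w0: "W w0" "w0 \<noteq> 0\<^sub>v d"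
  obtains i v where "i < L" "W v" "v \<noteq> 0\<^sub>v d" "T *\<^sub>v v = \<omega> ^ i \<cdot>\<^sub>v v"
proof -
  interpret B: scal_ring "ring_mat TYPE('k) d ()" "\<lambda>c. c \<cdot>\<^sub>m 1\<^sub>m d" by (rule scal_ring_mat)
  let ?B = "ring_mat TYPE('k) d ()"
  have T': "T \<in> carrier ?B" and TL': "T [^]\<^bsub>?B\<^esub> L = \<one>\<^bsub>?B\<^esub>"
    using T TL by (simp_all add: ring_mat_simps pow_mat_ring_pow[of T d L "()", symmetric])
  have pc: "B.proj L \<omega> T i \<in> carrier_mat d d" for i
    using B.proj_closed[OF T' TL' w, of i] by (simp add: ring_mat_simps)
  note w0c = W[OF w0(1)]
  have pow: "W (T ^\<^sub>m r *\<^sub>v w0)" for r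
  proof (induction r)
    case (Suc r)
    have "T ^\<^sub>m Suc r *\<^sub>v w0 = T *\<^sub>v (T ^\<^sub>m r *\<^sub>v w0)"
    proof -
      have "T ^\<^sub>m r * T = T * T ^\<^sub>m r"
        using B.nat_pow_Suc[of T r] B.nat_pow_Suc2[OF T', of r]
        by (simp add: ring_mat_simps pow_mat_ring_pow[OF T, of r "()"])
      then show ?thesis using T w0c by (simp flip: assoc_mult_mat_vec[of _ d d _ d])
    qed
    then show ?case using mulT[OF Suc] by simp
  qed (use T w0 w0c in simp)
  have W0: "W (0\<^sub>m d d *\<^sub>v w0)"
  proof -
    have "0\<^sub>m d d *\<^sub>v w0 = 0 \<cdot>\<^sub>v w0" using w0c by (intro eq_vecI) auto
    then show ?thesis using smult[OF w0(1)] by simp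
  qed
  have Wp: "W (B.proj L \<omega> T i *\<^sub>v w0)" for i
  proof -
    let ?c = "\<lambda>r. (\<omega> ^ (L - i)) ^ r \<cdot>\<^sub>m 1\<^sub>m d \<otimes>\<^bsub>?B\<^esub> T [^]\<^bsub>?B\<^esub> r"
    have c: "?c r = (\<omega> ^ (L - i)) ^ r \<cdot>\<^sub>m T ^\<^sub>m r" for r
      using T by (simp add: ring_mat_simps pow_mat_ring_pow[of T d _ "()", symmetric] mat_scalar_mult[of _ d d])
    have fc: "finsum ?B ?c {0..<L} \<in> carrier ?B"
      unfolding c using T by (intro B.finsum_closed) (auto simp: ring_mat_simps)
    have "W (finsum ?B ?c {0..<L} *\<^sub>v w0)"
    proof (rule B.finsum_pred[of _ _ "\<lambda>Z. W (Z *\<^sub>v w0)"])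
      show "W (?c r *\<^sub>v w0)" for r
        unfolding c using smult[OF pow] T w0c by (simp add: smult_mat_mult_vec[of _ d d])
      show "W ((x \<oplus>\<^bsub>?B\<^esub> y) *\<^sub>v w0)" if "x \<in> carrier ?B" "y \<in> carrier ?B" "W (x *\<^sub>v w0)" "W (y *\<^sub>v w0)" for x y
        using that add w0c by (simp add: ring_mat_simps add_mult_distrib_mat_vec[of _ d d])
    qed (use T W0 in \<open>auto simp: c\<close>, auto simp: ring_mat_simps)
    then show ?thesis
      unfolding B.proj_def using smult fc w0c
      by (simp add: ring_mat_simps mat_scalar_mult[of _ d d] smult_mat_mult_vec[of _ d d])
  qed
  have "\<exists>i<L. B.proj L \<omega> T i *\<^sub>v w0 \<noteq> 0\<^sub>v d"
  proof (rule ccontr)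
    assume "\<not> ?thesis"
    then have "finsum ?B (B.proj L \<omega> T) {0..<L} *\<^sub>v w0 = 0\<^sub>v d"
    proof (intro B.finsum_pred[of _ _ "\<lambda>Z. Z *\<^sub>v w0 = 0\<^sub>v d"])
      show "\<zero>\<^bsub>?B\<^esub> *\<^sub>v w0 = 0\<^sub>v d" using w0c by (intro eq_vecI) (auto simp: ring_mat_simps)
      show "(x \<oplus>\<^bsub>?B\<^esub> y) *\<^sub>v w0 = 0\<^sub>v d" if "x \<in> carrier ?B" "y \<in> carrier ?B" "x *\<^sub>v w0 = 0\<^sub>v d" "y *\<^sub>v w0 = 0\<^sub>v d" for x y
        using that w0c by (simp add: ring_mat_simps add_mult_distrib_mat_vec[of _ d d])
    qed (use pc in \<open>auto simp: ring_mat_simps\<close>)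
    then show False
      unfolding B.finsum_proj[OF T' TL' w] using w0 w0c by (simp add: ring_mat_simps)
  qed
  then obtain i where i: "i < L" "B.proj L \<omega> T i *\<^sub>v w0 \<noteq> 0\<^sub>v d" by blast
  have "T * B.proj L \<omega> T i = \<omega> ^ i \<cdot>\<^sub>m B.proj L \<omega> T i"
    using B.mult_proj[OF T' TL' w, of i] i pc[of i] by (simp add: ring_mat_simps mat_scalar_mult[of _ d d])
  then have "T *\<^sub>v (B.proj L \<omega> T i *\<^sub>v w0) = \<omega> ^ i \<cdot>\<^sub>v (B.proj L \<omega> T i *\<^sub>v w0)"
    using T pc[of i] w0c by (simp flip: assoc_mult_mat_vec[of _ d d _ d] add: smult_mat_mult_vec[of _ d d])
  then show thesis using that i Wp by blast
qed

lemma pow_mat_Suc_left: "A \<in> carrier_mat d d \<Longrightarrow> A ^\<^sub>m Suc r = A * A ^\<^sub>m r" for A :: "'k::field mat"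
proof (induction r)
  case (Suc r)
  then show ?case using assoc_mult_mat[of A d d "A ^\<^sub>m r" d A d] by simp
qed simp

lemma pow_mat_mult: "A \<in> carrier_mat d d \<Longrightarrow> (A ^\<^sub>m r) ^\<^sub>m t = A ^\<^sub>m (r * t)" for A :: "'k::field mat"
proof -
  assume A: "A \<in> carrier_mat d d"
  interpret ring "ring_mat TYPE('k) d ()" by (rule ring_mat)
  have "A \<in> carrier (ring_mat TYPE('k) d ())" using A by (simp add: ring_mat_simps)
  note p = nat_pow_pow[OF this, of r t]
  have "(A ^\<^sub>m r) ^\<^sub>m t = (A ^\<^sub>m r) [^]\<^bsub>ring_mat TYPE('k) d ()\<^esub> t"
    by (rule pow_mat_ring_pow[OF pow_carrier_mat[OF A]])
  also have "\<dots> = A [^]\<^bsub>ring_mat TYPE('k) d ()\<^esub> (r * t)"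
    unfolding p[symmetric] pow_mat_ring_pow[OF A, of r "()"] ..
  also have "\<dots> = A ^\<^sub>m (r * t)" by (rule pow_mat_ring_pow[OF A, symmetric])
  finally show ?thesis .
qed

lemma ex_last_nonzero:
  assumes "P 0" "\<not> P k"
  shows "\<exists>p<k. P p \<and> \<not> P (Suc p)"
  using assms by (induction k) (auto simp: less_Suc_eq)

context qu_setup
begin

definition lowest :: "'k qu_module \<Rightarrow> nat \<Rightarrow> nat \<Rightarrow> 'k vec \<Rightarrow> bool" where
  "lowest M m j v \<longleftrightarrow> v \<in> carrier_vec (fst M) \<and> v \<noteq> 0\<^sub>v (fst M) \<and>
     mod_gen n q M gen_F *\<^sub>v v = 0\<^sub>v (fst M) \<and>
     mod_gen n q M gen_kappa *\<^sub>v v = kap_val m j \<cdot>\<^sub>v v \<and>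
     mod_gen n q M gen_kappa_hat *\<^sub>v v = (kap_val m j * q ^ (2 * m)) \<cdot>\<^sub>v v"

text \<open>The hypothesis is kappa-hat^n kappa^2 = 1 read on a common eigenvector with eigenvalues
  q^l and q^(ni). It forces n to divide l + 2i, so l is even and the ratio of the eigenvalues is an
  even power of q; the remaining square root is the sign given by j.\<close>

lemma weight_cases:
  assumes i: "i < n" and r: "q ^ (l * n) * (q ^ n) ^ (2 * i) = 1"
  obtains m j where "m < NN" "j < 2" "(q ^ n) ^ i = kap_val m j" "q ^ l = kap_val m j * q ^ (2 * m)"
proof -
  have "q ^ (n * (l + 2 * i)) = q ^ (l * n) * (q ^ n) ^ (2 * i)"
    by (simp add: power_add algebra_simps flip: power_mult)
  then have "n * n dvd n * (l + 2 * i)"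
    using r q_pow_eq_1_iff n_sq by (simp add: power2_eq_square)
  then have d: "n dvd l + 2 * i" using n_pos by simp
  then have "even (l + 2 * i)" using n_even dvd_trans by blast
  then have l: "even l" by simp
  have even: "even (l + n * (n - i))" using l n_even by simp
  \<comment> \<open>The ratio of the two eigenvalues is q^(2m'), with n(n - i) standing for -ni.
    Reducing m' modulo N keeps this value, since q^(2N) = 1.\<close>
  define m' where "m' = (l + n * (n - i)) div 2"
  have m': "2 * m' = l + n * (n - i)" using even by (simp add: m'_def)
  define m where "m = m' mod NN"
  have qm: "q ^ (2 * m) = q ^ (2 * m')"
  proof -
    obtain t where t: "m' div NN = t" by blast
    have "m' = NN * t + m" unfolding t[symmetric] m_def by simp
    then have "2 * m' = 2 * NN * (m' div NN) + 2 * m" unfolding t by simp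
    then have "q ^ (2 * m') = (q ^ (2 * NN)) ^ (m' div NN) * q ^ (2 * m)" by (simp only: power_add power_mult)
    then show ?thesis using q_pow n_sq by simp
  qed
  have inv: "(q ^ n) ^ i * q ^ (n * (n - i)) = 1"
    using i q_pow by (simp add: power2_eq_square algebra_simps flip: power_mult power_add)
  have ql: "q ^ l = (q ^ n) ^ i * q ^ (2 * m)"
  proof -
    have "(q ^ n) ^ i * (q ^ l * q ^ (n * (n - i))) = q ^ l * ((q ^ n) ^ i * q ^ (n * (n - i)))"
      by (simp only: mult_ac)
    then show ?thesis unfolding qm m' power_add inv by simp
  qed
  have "((q ^ n) ^ i * (q ^ n) ^ m) ^ 2 = (q ^ n) ^ (2 * i) * (q ^ (2 * m)) ^ n"
    by (simp add: power_mult_distrib mult_ac flip: power_mult)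
  also have "\<dots> = (q ^ n) ^ (2 * i) * (q ^ l) ^ n * (q ^ (n * (n - i))) ^ n"
    unfolding qm m' by (simp add: power_add power_mult_distrib)
  also have "(q ^ (n * (n - i))) ^ n = 1"
    using Q_pow_pow[of "n - i"] by (simp add: power_mult)
  also have "(q ^ n) ^ (2 * i) * (q ^ l) ^ n * 1 = 1"
    using r by (simp add: mult.commute power_mult)
  finally have "(q ^ n) ^ i * (q ^ n) ^ m = 1 \<or> (q ^ n) ^ i * (q ^ n) ^ m = - 1"
    by (simp add: power2_eq_1_iff)
  then obtain j :: nat where j: "j < 2" "(q ^ n) ^ i * (q ^ n) ^ m = (- 1) ^ j"
    by (metis One_nat_def lessI power_0 power_one_right Suc_1 zero_less_Suc)
  have "(q ^ n) ^ i = kap_val m j"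
    unfolding kap_val_def j(2)[symmetric] by (simp add: power_inverse field_simps)
  moreover have "m < NN" using NN_pos by (simp add: m_def)
  ultimately show thesis using that j(1) ql by metis
qed

context
  fixes M :: "'k qu_module"
  assumes M: "M \<in> qu_modules n q"
begin

abbreviation "GG \<equiv> mod_gen n q M"
abbreviation "dd \<equiv> fst M"

lemma GG_carrier [simp]: "GG s \<in> carrier_mat dd dd" by (rule mod_gen_carrier[OF M])

lemmas GG_rel = qu_rep_mod_gen[OF M, unfolded qu_rep_def]

lemma GG_comm_vec:
  assumes v: "v \<in> carrier_vec dd" and r: "GG s * GG t = c \<cdot>\<^sub>m (GG t * GG s)"
  shows "GG s *\<^sub>v (GG t *\<^sub>v v) = c \<cdot>\<^sub>v (GG t *\<^sub>v (GG s *\<^sub>v v))"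
proof -
  have "GG s *\<^sub>v (GG t *\<^sub>v v) = (GG s * GG t) *\<^sub>v v"
    by (rule assoc_mult_mat_vec[symmetric, OF GG_carrier GG_carrier v])
  also have "\<dots> = c \<cdot>\<^sub>v ((GG t * GG s) *\<^sub>v v)"
    unfolding r by (rule smult_mat_mult_vec[OF mult_carrier_mat[OF GG_carrier GG_carrier] v])
  also have "(GG t * GG s) *\<^sub>v v = GG t *\<^sub>v (GG s *\<^sub>v v)"
    by (rule assoc_mult_mat_vec[OF GG_carrier GG_carrier v])
  finally show ?thesis .
qed

text \<open>From kappa-hat^n = kappa^-2 and kappa^n = 1. Since q is a primitive n^2-th root of
  unity, \<open>eigen_in_subspace\<close> then yields eigenvectors of kappa-hat with powers of q as
  eigenvalues.\<close>

lemma kappa_hat_pow: "GG gen_kappa_hat ^\<^sub>m (n ^ 2) = 1\<^sub>m dd"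
proof -
  let ?a = "GG gen_kappa_hat ^\<^sub>m n" let ?b = "GG gen_kappa ^\<^sub>m 2"
  have a: "?a \<in> carrier_mat dd dd" and b: "?b \<in> carrier_mat dd dd" by (intro pow_carrier_mat GG_carrier)+
  have ab: "?a * ?b = 1\<^sub>m dd" using GG_rel by blast
  have "?a ^\<^sub>m k * ?b ^\<^sub>m k = 1\<^sub>m dd" for k
  proof (induction k)
    case (Suc k)
    have "?a ^\<^sub>m Suc k * ?b ^\<^sub>m Suc k = ?a ^\<^sub>m k * ?a * (?b * ?b ^\<^sub>m k)"
      using pow_mat_Suc_left[OF b, of k] by simp
    also have "\<dots> = ?a ^\<^sub>m k * ((?a * ?b) * ?b ^\<^sub>m k)"
      using assoc_mult_mat[OF pow_carrier_mat[OF a] a mult_carrier_mat[OF b pow_carrier_mat[OF b]], of k k]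
        assoc_mult_mat[OF a b pow_carrier_mat[OF b], of k] by simp
    also have "\<dots> = 1\<^sub>m dd" unfolding ab using Suc left_mult_one_mat[OF pow_carrier_mat[OF b], of k] by simp
    finally show ?case .
  qed (use carrier_matD[OF GG_carrier] in simp)
  from this[of n] have "GG gen_kappa_hat ^\<^sub>m (n * n) * GG gen_kappa ^\<^sub>m (n * 2) = 1\<^sub>m dd"
    by (simp add: pow_mat_mult[OF GG_carrier] mult.commute)
  moreover have "GG gen_kappa ^\<^sub>m (n * 2) = 1\<^sub>m dd"
  proof -
    have "(GG gen_kappa ^\<^sub>m n) ^\<^sub>m 2 = 1\<^sub>m dd" using GG_rel by (simp add: numeral_2_eq_2)
    then show ?thesis by (simp add: pow_mat_mult[OF GG_carrier])
  qed
  ultimately show ?thesis by (simp add: power2_eq_square right_mult_one_mat[OF pow_carrier_mat[OF GG_carrier]])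
qed

text \<open>The last nonzero vector F^p u, for a basis vector u, is homogeneous and killed by F. The
  vectors of its degree in the kernel of F are stable under kappa and kappa-hat, which gives a
  common eigenvector.\<close>

lemma lowest_exists:
  assumes d: "dd > 0"
    and hF: "hom_mat dg dg z (GG gen_F)" and hk: "hom_mat dg dg 0 (GG gen_kappa)" "hom_mat dg dg 0 (GG gen_kappa_hat)"
  obtains m j v \<gamma> where "m < NN" "j < 2" "lowest M m j v" "hom_vec dg \<gamma> v"
proof -
  let ?F = "GG gen_F" let ?k = "GG gen_kappa" let ?h = "GG gen_kappa_hat"
  define u :: "'k vec" where "u = unit_vec dd 0"
  have u: "u \<in> carrier_vec dd" "u \<noteq> 0\<^sub>v dd" using d by (auto simp: u_def)
  have Fp: "?F ^\<^sub>m Suc r *\<^sub>v u = ?F *\<^sub>v (?F ^\<^sub>m r *\<^sub>v u)" for r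
    unfolding pow_mat_Suc_left[OF GG_carrier] by (rule assoc_mult_mat_vec[OF GG_carrier pow_carrier_mat[OF GG_carrier] u(1)])
  have "?F ^\<^sub>m 0 *\<^sub>v u \<noteq> 0\<^sub>v dd" using u carrier_matD[OF GG_carrier[of gen_F]] by simp
  moreover have "?F ^\<^sub>m (n ^ 2) *\<^sub>v u = 0\<^sub>v dd"
  proof -
    have "?F ^\<^sub>m (n ^ 2) = 0\<^sub>m dd dd" using GG_rel by blast
    then show ?thesis using u by (auto intro!: eq_vecI)
  qed
  ultimately obtain p where p: "?F ^\<^sub>m p *\<^sub>v u \<noteq> 0\<^sub>v dd" "?F ^\<^sub>m Suc p *\<^sub>v u = 0\<^sub>v dd"
    using ex_last_nonzero[of "\<lambda>p. ?F ^\<^sub>m p *\<^sub>v u \<noteq> 0\<^sub>v dd"] by blast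
  define w where "w = ?F ^\<^sub>m p *\<^sub>v u"
  define \<gamma> where "\<gamma> = dg 0 + int p * z"
  have hw: "hom_vec dg \<gamma> w"
    unfolding w_def \<gamma>_def
    by (rule hom_vec_mult[OF pow_carrier_mat[OF GG_carrier] u(1) hom_mat_pow[OF GG_carrier hF]])
      (auto simp: hom_vec_def u_def)
  have w: "w \<in> carrier_vec dd" "w \<noteq> 0\<^sub>v dd" "?F *\<^sub>v w = 0\<^sub>v dd"
    using p(1) p(2)[unfolded Fp] mult_mat_vec_carrier[OF pow_carrier_mat[OF GG_carrier] u(1)] by (simp_all add: w_def)
  have Fk: "?F * ?k = q ^ n \<cdot>\<^sub>m (?k * ?F)"
  proof -
    have "?k * ?F = inverse (q ^ n) \<cdot>\<^sub>m (?F * ?k)" using GG_rel by blast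
    then show ?thesis by (simp add: mat_smult_smult)
  qed
  have Fh: "?F * ?h = (q ^ n * inverse q ^ 2) \<cdot>\<^sub>m (?h * ?F)"
  proof -
    have *: "q ^ n * inverse q ^ 2 * (inverse (q ^ n) * q ^ 2) = 1"
      by (simp add: power_inverse field_simps)
    have "?h * ?F = (inverse (q ^ n) * q ^ 2) \<cdot>\<^sub>m (?F * ?h)" using GG_rel by blast
    then show ?thesis by (simp only: mat_smult_smult * mat_smult_1)
  qed
  let ?W = "\<lambda>v. v \<in> carrier_vec dd \<and> ?F *\<^sub>v v = 0\<^sub>v dd \<and> hom_vec dg \<gamma> v"
  have Wadd: "?W (v + v')" if "?W v" "?W v'" for v v'
    using that by (auto simp: mult_add_distrib_mat_vec[OF GG_carrier] hom_vec_def)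
  have Wsmult: "?W (c \<cdot>\<^sub>v v)" if "?W v" for c v
    using that by (auto simp: mult_mat_vec[OF GG_carrier] hom_vec_def)
  have z: "GG s *\<^sub>v 0\<^sub>v dd = 0\<^sub>v dd" for s by (rule mult_mat_zero_vec[OF GG_carrier])
  have Wk: "?W (?k *\<^sub>v v)" if "?W v" for v
    using GG_comm_vec[OF _ Fk, of v] hom_vec_mult[OF GG_carrier _ hk(1), of v \<gamma>] that
      mult_mat_vec_carrier[OF GG_carrier, of v] by (auto simp: z)
  have Wh: "?W (?h *\<^sub>v v)" if "?W v" for v
    using GG_comm_vec[OF _ Fh, of v] hom_vec_mult[OF GG_carrier _ hk(2), of v \<gamma>] that
      mult_mat_vec_carrier[OF GG_carrier, of v] by (auto simp: z)
  have kn: "?k ^\<^sub>m n = 1\<^sub>m dd" using GG_rel by blast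
  obtain i v where v: "i < n" "?W v" "v \<noteq> 0\<^sub>v dd" "?k *\<^sub>v v = (q ^ n) ^ i \<cdot>\<^sub>v v"
    by (rule eigen_in_subspace[OF GG_carrier kn Q_pow Q_prim n_pos, of ?W w])
      (use Wadd Wsmult Wk w hw in auto)
  let ?W' = "\<lambda>v. ?W v \<and> ?k *\<^sub>v v = (q ^ n) ^ i \<cdot>\<^sub>v v"
  have kh: "?k * ?h = 1 \<cdot>\<^sub>m (?h * ?k)" using GG_rel by simp
  have n2: "n ^ 2 > 0" using n_pos by simp
  obtain l v' where v': "l < n ^ 2" "?W' v'" "v' \<noteq> 0\<^sub>v dd" "?h *\<^sub>v v' = q ^ l \<cdot>\<^sub>v v'"
  proof (rule eigen_in_subspace[OF GG_carrier kappa_hat_pow q_pow q_prim n2, of ?W' v])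
    show "?W' (u + v)" if "?W' u" "?W' v" for u v
      using that Wadd by (auto simp: mult_add_distrib_mat_vec[OF GG_carrier] smult_add_distrib_vec[of _ dd])
    show "?W' (c \<cdot>\<^sub>v v)" if "?W' v" for c v
      using that Wsmult by (auto simp: mult_mat_vec[OF GG_carrier] smult_smult_assoc mult.commute)
    show "?W' (?h *\<^sub>v v)" if "?W' v" for v
      using that Wh GG_comm_vec[OF _ kh, of v] by (auto simp: mult_mat_vec[OF GG_carrier])
  qed (use v in auto)
  have pow_eig: "A ^\<^sub>m r *\<^sub>v x = c ^ r \<cdot>\<^sub>v x" if "A \<in> carrier_mat dd dd" "x \<in> carrier_vec dd" "A *\<^sub>v x = c \<cdot>\<^sub>v x" for A x r and c :: 'k
  proof (induction r)
    case (Suc r)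
    have "A ^\<^sub>m Suc r *\<^sub>v x = A ^\<^sub>m r *\<^sub>v (A *\<^sub>v x)" using that by (simp add: assoc_mult_mat_vec[of _ dd dd _ dd])
    also have "\<dots> = c ^ Suc r \<cdot>\<^sub>v x" using that Suc by (simp add: mult_mat_vec[of _ dd dd] smult_smult_assoc)
    finally show ?case .
  qed (use that in simp)
  have "v' = (?h ^\<^sub>m n * ?k ^\<^sub>m 2) *\<^sub>v v'" using GG_rel v' by simp
  also have "\<dots> = ?h ^\<^sub>m n *\<^sub>v (?k ^\<^sub>m 2 *\<^sub>v v')"
    using v' by (intro assoc_mult_mat_vec[of _ dd dd _ dd] pow_carrier_mat GG_carrier) auto
  also have "\<dots> = (q ^ (l * n) * (q ^ n) ^ (2 * i)) \<cdot>\<^sub>v v'"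
    using v' pow_eig[OF GG_carrier, of v' gen_kappa "(q ^ n) ^ i" 2] pow_eig[OF GG_carrier, of v' gen_kappa_hat "q ^ l" n]
    by (simp add: mult_mat_vec[OF pow_carrier_mat[OF GG_carrier]] smult_smult_assoc power_mult mult.commute)
  finally have e: "v' = (q ^ (l * n) * (q ^ n) ^ (2 * i)) \<cdot>\<^sub>v v'" .
  obtain a where a: "a < dd" "v' $ a \<noteq> 0"
    using v' by (metis eq_vecI carrier_vecD index_zero_vec)
  have ia: "((q ^ (l * n) * (q ^ n) ^ (2 * i)) \<cdot>\<^sub>v v') $ a = (q ^ (l * n) * (q ^ n) ^ (2 * i)) * v' $ a"
    using a(1) v'(2) by (metis carrier_vecD index_smult_vec(1))
  have "v' $ a = (q ^ (l * n) * (q ^ n) ^ (2 * i)) * v' $ a"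
    using arg_cong[OF e, of "\<lambda>x :: 'k vec. x $ a"] unfolding ia .
  then have "q ^ (l * n) * (q ^ n) ^ (2 * i) = 1" using a(2) by (metis mult_cancel_right1)
  from weight_cases[OF v(1) this] obtain m j where
    "m < NN" "j < 2" "(q ^ n) ^ i = kap_val m j" "q ^ l = kap_val m j * q ^ (2 * m)" .
  then show thesis using that[of m j v' \<gamma>] v' by (simp add: lowest_def)
qed

section \<open>Chains of powers of E on a lowest weight vector\<close>

definition ev :: "'k vec \<Rightarrow> nat \<Rightarrow> 'k vec" where "ev v r = GG gen_E ^\<^sub>m r *\<^sub>v v"

lemma ev_carrier [simp]: "v \<in> carrier_vec dd \<Longrightarrow> ev v r \<in> carrier_vec dd"
  unfolding ev_def by (rule mult_mat_vec_carrier[OF pow_carrier_mat[OF GG_carrier]])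

lemma ev_0 [simp]: "v \<in> carrier_vec dd \<Longrightarrow> ev v 0 = v"
  using carrier_matD[OF GG_carrier[of gen_E]] by (simp add: ev_def)

lemma ev_Suc: "v \<in> carrier_vec dd \<Longrightarrow> ev v (Suc r) = GG gen_E *\<^sub>v ev v r"
  unfolding ev_def pow_mat_Suc_left[OF GG_carrier]
  by (rule assoc_mult_mat_vec[OF GG_carrier pow_carrier_mat[OF GG_carrier]])

lemma ev_add: "v \<in> carrier_vec dd \<Longrightarrow> ev v (r + t) = ev (ev v r) t"
  by (induction t) (simp_all add: ev_Suc)

lemma ev_nilpotent: "v \<in> carrier_vec dd \<Longrightarrow> ev v (n ^ 2) = 0\<^sub>v dd"
proof -
  assume "v \<in> carrier_vec dd"
  moreover have "GG gen_E ^\<^sub>m (n ^ 2) = 0\<^sub>m dd dd" using GG_rel by blast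
  ultimately show ?thesis unfolding ev_def by (auto intro!: eq_vecI)
qed

text \<open>The matrices \<open>simple_gen m j\<close> are modelled on these formulas, which hold
  for every r, wherever the chain ends.\<close>

lemma lowest_chain:
  assumes v: "lowest M m j v"
  shows "GG gen_kappa *\<^sub>v ev v r = (kap_val m j * (q ^ n) ^ r) \<cdot>\<^sub>v ev v r"
    and "GG gen_kappa_hat *\<^sub>v ev v r = (kap_val m j * (q ^ n) ^ r * (q ^ (2 * m) * inverse q ^ (2 * r))) \<cdot>\<^sub>v ev v r"
    and "GG gen_F *\<^sub>v ev v (Suc r) = cc (q ^ (2 * m)) (Suc r) \<cdot>\<^sub>v ev v r"
proof -
  have vc: "v \<in> carrier_vec dd" using v by (simp add: lowest_def)
  have k: "GG gen_kappa *\<^sub>v ev v r = (kap_val m j * (q ^ n) ^ r) \<cdot>\<^sub>v ev v r" for r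
  proof (induction r)
    case (Suc r)
    have "GG gen_kappa * GG gen_E = q ^ n \<cdot>\<^sub>m (GG gen_E * GG gen_kappa)" using GG_rel by blast
    from GG_comm_vec[OF ev_carrier[OF vc] this, of r] show ?case
      unfolding ev_Suc[OF vc] Suc using vc
      by (simp add: mult_mat_vec[OF GG_carrier] smult_smult_assoc mult_ac)
  qed (use v vc in \<open>simp add: lowest_def\<close>)
  have h: "GG gen_kappa_hat *\<^sub>v ev v r = (kap_val m j * (q ^ n) ^ r * (q ^ (2 * m) * inverse q ^ (2 * r))) \<cdot>\<^sub>v ev v r" for r
  proof (induction r)
    case (Suc r)
    have "GG gen_kappa_hat * GG gen_E = (q ^ n * inverse q ^ 2) \<cdot>\<^sub>m (GG gen_E * GG gen_kappa_hat)" using GG_rel by blast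
    from GG_comm_vec[OF ev_carrier[OF vc] this, of r] show ?case
      unfolding ev_Suc[OF vc] Suc using vc
      by (simp add: mult_mat_vec[OF GG_carrier] smult_smult_assoc mult_ac power2_eq_square)
  qed (use v vc in \<open>simp add: lowest_def\<close>)
  have kpow: "GG gen_kappa ^\<^sub>m t *\<^sub>v ev v r = (kap_val m j * (q ^ n) ^ r) ^ t \<cdot>\<^sub>v ev v r" for t r
  proof (induction t)
    case 0
    then show ?case using vc carrier_matD[OF GG_carrier[of gen_kappa]] by simp
  next
    case (Suc t)
    have "GG gen_kappa ^\<^sub>m Suc t *\<^sub>v ev v r = GG gen_kappa ^\<^sub>m t *\<^sub>v (GG gen_kappa *\<^sub>v ev v r)"
      using vc by (simp add: assoc_mult_mat_vec[of _ dd dd _ dd])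
    also have "\<dots> = (kap_val m j * (q ^ n) ^ r) ^ Suc t \<cdot>\<^sub>v ev v r"
      unfolding k using vc Suc by (simp add: mult_mat_vec[OF pow_carrier_mat[OF GG_carrier]] smult_smult_assoc)
    finally show ?case .
  qed
  have K: "(GG gen_kappa ^\<^sub>m (n - 1) * GG gen_kappa_hat) *\<^sub>v ev v r = (q ^ (2 * m) * inverse q ^ (2 * r)) \<cdot>\<^sub>v ev v r" for r
  proof -
    let ?x = "kap_val m j * (q ^ n) ^ r"
    have "?x ^ n = 1" unfolding power_mult_distrib kap_val_pow Q_pow_pow by simp
    then have one: "?x * ?x ^ (n - 1) = 1" using n_pos by (simp flip: power_Suc)
    have "?x * (q ^ (2 * m) * inverse q ^ (2 * r)) * ?x ^ (n - 1) = (?x * ?x ^ (n - 1)) * (q ^ (2 * m) * inverse q ^ (2 * r))"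
      by (simp only: mult_ac)
    then have x: "?x * (q ^ (2 * m) * inverse q ^ (2 * r)) * ?x ^ (n - 1) = q ^ (2 * m) * inverse q ^ (2 * r)"
      unfolding one by simp
    have "(GG gen_kappa ^\<^sub>m (n - 1) * GG gen_kappa_hat) *\<^sub>v ev v r = GG gen_kappa ^\<^sub>m (n - 1) *\<^sub>v (GG gen_kappa_hat *\<^sub>v ev v r)"
      by (rule assoc_mult_mat_vec[OF pow_carrier_mat[OF GG_carrier] GG_carrier ev_carrier[OF vc]])
    also have "\<dots> = (?x * (q ^ (2 * m) * inverse q ^ (2 * r)) * ?x ^ (n - 1)) \<cdot>\<^sub>v ev v r"
      unfolding h mult_mat_vec[OF pow_carrier_mat[OF GG_carrier] ev_carrier[OF vc]] kpow smult_smult_assoc ..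
    finally show ?thesis unfolding x .
  qed
  have FE: "GG gen_F *\<^sub>v (GG gen_E *\<^sub>v x) = inverse q \<cdot>\<^sub>v (GG gen_E *\<^sub>v (GG gen_F *\<^sub>v x)) + (1 - c) \<cdot>\<^sub>v x"
    if x: "x \<in> carrier_vec dd" and c: "(GG gen_kappa ^\<^sub>m (n - 1) * GG gen_kappa_hat) *\<^sub>v x = c \<cdot>\<^sub>v x" for x c
  proof -
    have rel: "GG gen_F * GG gen_E - inverse q \<cdot>\<^sub>m (GG gen_E * GG gen_F) = 1\<^sub>m dd - GG gen_kappa ^\<^sub>m (n - 1) * GG gen_kappa_hat"
      using GG_rel by blast
    have m: "GG s * GG t \<in> carrier_mat dd dd" "GG gen_kappa ^\<^sub>m (n - 1) * GG gen_kappa_hat \<in> carrier_mat dd dd" for s t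
      by (auto intro!: mult_carrier_mat[of _ dd dd])
    have "(GG gen_F * GG gen_E - inverse q \<cdot>\<^sub>m (GG gen_E * GG gen_F)) *\<^sub>v x
      = GG gen_F * GG gen_E *\<^sub>v x - (inverse q \<cdot>\<^sub>m (GG gen_E * GG gen_F)) *\<^sub>v x"
      by (rule minus_mult_distrib_mat_vec[of _ dd dd]) (use m x in auto)
    also have "\<dots> = GG gen_F *\<^sub>v (GG gen_E *\<^sub>v x) - inverse q \<cdot>\<^sub>v (GG gen_E *\<^sub>v (GG gen_F *\<^sub>v x))"
      using x m by (simp add: smult_mat_mult_vec[of _ dd dd] assoc_mult_mat_vec[OF GG_carrier GG_carrier x])
    finally have 1: "GG gen_F *\<^sub>v (GG gen_E *\<^sub>v x) - inverse q \<cdot>\<^sub>v (GG gen_E *\<^sub>v (GG gen_F *\<^sub>v x))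
      = (1\<^sub>m dd - GG gen_kappa ^\<^sub>m (n - 1) * GG gen_kappa_hat) *\<^sub>v x" using rel by simp
    also have "\<dots> = 1\<^sub>m dd *\<^sub>v x - c \<cdot>\<^sub>v x"
      unfolding c[symmetric] by (rule minus_mult_distrib_mat_vec[of _ dd dd]) (use m x in auto)
    finally have 2: "GG gen_F *\<^sub>v (GG gen_E *\<^sub>v x) - inverse q \<cdot>\<^sub>v (GG gen_E *\<^sub>v (GG gen_F *\<^sub>v x)) = x - c \<cdot>\<^sub>v x"
      using x by simp
    have cv: "GG s *\<^sub>v y \<in> carrier_vec dd" if "y \<in> carrier_vec dd" for s y by (rule mult_mat_vec_carrier[OF GG_carrier that])
    show ?thesis
    proof (rule eq_vecI)
      fix i assume "i < dim_vec (inverse q \<cdot>\<^sub>v (GG gen_E *\<^sub>v (GG gen_F *\<^sub>v x)) + (1 - c) \<cdot>\<^sub>v x)"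
      then have i: "i < dd" using x by simp
      note c1 = carrier_vecD[OF cv[OF cv[OF x], of gen_F gen_E]] carrier_vecD[OF cv[OF cv[OF x], of gen_E gen_F]]
      show "(GG gen_F *\<^sub>v (GG gen_E *\<^sub>v x)) $ i = (inverse q \<cdot>\<^sub>v (GG gen_E *\<^sub>v (GG gen_F *\<^sub>v x)) + (1 - c) \<cdot>\<^sub>v x) $ i"
        using arg_cong[OF 2, of "\<lambda>y :: 'k vec. y $ i"] i x c1 by (simp add: algebra_simps del: index_mult_mat_vec)
    qed (use x carrier_matD[OF GG_carrier[of gen_F]] in simp)
  qed
  have F: "GG gen_F *\<^sub>v ev v (Suc r) = cc (q ^ (2 * m)) (Suc r) \<cdot>\<^sub>v ev v r" for r
  proof (induction r)
    case 0
    have "GG gen_E *\<^sub>v 0\<^sub>v dd = 0\<^sub>v dd" by (rule mult_mat_zero_vec[OF GG_carrier])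
    then have "GG gen_F *\<^sub>v (GG gen_E *\<^sub>v ev v 0) = inverse q \<cdot>\<^sub>v 0\<^sub>v dd + (1 - q ^ (2 * m) * inverse q ^ (2 * 0)) \<cdot>\<^sub>v ev v 0"
      using FE[OF ev_carrier[OF vc] K, of 0] v vc by (simp add: lowest_def)
    moreover have "inverse q \<cdot>\<^sub>v 0\<^sub>v dd = 0\<^sub>v dd" by (intro eq_vecI) auto
    ultimately show ?case using vc by (simp add: ev_Suc)
  next
    case (Suc r)
    have "GG gen_F *\<^sub>v ev v (Suc (Suc r)) = inverse q \<cdot>\<^sub>v (GG gen_E *\<^sub>v (cc (q ^ (2 * m)) (Suc r) \<cdot>\<^sub>v ev v r))
       + (1 - q ^ (2 * m) * inverse q ^ (2 * Suc r)) \<cdot>\<^sub>v ev v (Suc r)"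
      using FE[OF ev_carrier[OF vc] K, of "Suc r"] Suc by (simp add: ev_Suc[OF vc, of "Suc r"] del: cc.simps)
    also have "\<dots> = (inverse q * cc (q ^ (2 * m)) (Suc r)) \<cdot>\<^sub>v ev v (Suc r)
       + (1 - q ^ (2 * m) * inverse q ^ (2 * Suc r)) \<cdot>\<^sub>v ev v (Suc r)"
      using vc by (simp add: mult_mat_vec[OF GG_carrier] smult_smult_assoc ev_Suc[OF vc, of r] del: cc.simps)
    also have "\<dots> = cc (q ^ (2 * m)) (Suc (Suc r)) \<cdot>\<^sub>v ev v (Suc r)"
      by (subst cc.simps(2)[of _ "Suc r"]) (simp add: add_smult_distrib_vec[symmetric] add_diff_eq del: cc.simps)
    finally show ?case .
  qed
  show "GG gen_kappa *\<^sub>v ev v r = (kap_val m j * (q ^ n) ^ r) \<cdot>\<^sub>v ev v r"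
    "GG gen_kappa_hat *\<^sub>v ev v r = (kap_val m j * (q ^ n) ^ r * (q ^ (2 * m) * inverse q ^ (2 * r))) \<cdot>\<^sub>v ev v r"
    "GG gen_F *\<^sub>v ev v (Suc r) = cc (q ^ (2 * m)) (Suc r) \<cdot>\<^sub>v ev v r"
    by (rule k h F)+
qed

end

end

section \<open>Composition series\<close>

lemma mult_mat_vec_index:
  "A \<in> carrier_mat a b \<Longrightarrow> v \<in> carrier_vec b \<Longrightarrow> i < a \<Longrightarrow> (A *\<^sub>v v) $ i = (\<Sum>k<b. A $$ (i,k) * v $ k)"
  for A :: "'k::field mat"
  by (auto simp: scalar_prod_def lessThan_atLeast0)

lemma vec_eq_0_iff: "v \<in> carrier_vec d \<Longrightarrow> v = 0\<^sub>v d \<longleftrightarrow> (\<forall>i<d. v $ i = 0)" for v :: "'k::field vec"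
  by (auto intro!: eq_vecI)

text \<open>The quotient by a line is modelled by dropping a coordinate k at which w is nonzero.
  Eliminating this coordinate affects only coordinates where w is nonzero; these share the degree of
  w, so the remaining basis vectors keep their degrees.\<close>

lemma vec_cokernel:
  fixes w :: "'k::field vec"
  assumes w: "w \<in> carrier_vec s" and w0: "w \<noteq> 0\<^sub>v s" and hw: "hom_vec dg \<gamma> w"
  obtains g g' dg' where "g \<in> carrier_mat (s - 1) s" "g' \<in> carrier_mat s (s - 1)" "g * g' = 1\<^sub>m (s - 1)"
    "\<And>v. v \<in> carrier_vec s \<Longrightarrow> g *\<^sub>v v = 0\<^sub>v (s - 1) \<longleftrightarrow> (\<exists>a. v = a \<cdot>\<^sub>v w)"
    "hom_mat dg' dg 0 g" "hom_mat dg dg' 0 g'"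
proof -
  obtain k where k: "k < s" "w $ k \<noteq> 0" using w w0 vec_eq_0_iff by blast
  define \<tau> where "\<tau> = (\<lambda>i. if i < k then i else Suc i)"
  have \<tau>_lt: "\<tau> i < s" if "i < s - 1" for i using that k by (auto simp: \<tau>_def)
  have \<tau>_k: "\<tau> i \<noteq> k" for i by (auto simp: \<tau>_def)
  have \<tau>_inj: "\<tau> i = \<tau> j \<longleftrightarrow> i = j" for i j by (auto simp: \<tau>_def)
  have \<tau>_surj: "\<exists>j<s - 1. i = \<tau> j" if "i < s" "i \<noteq> k" for i
    using that k by (intro exI[of _ "if i < k then i else i - 1"]) (auto simp: \<tau>_def)
  define g where "g = mat (s - 1) s (\<lambda>(i,l). (if l = \<tau> i then 1 else 0) - (if l = k then w $ \<tau> i / w $ k else 0))"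
  define g' :: "'k mat" where "g' = mat s (s - 1) (\<lambda>(l,i). if l = \<tau> i then 1 else 0)"
  have gc: "g \<in> carrier_mat (s - 1) s" "g' \<in> carrier_mat s (s - 1)" by (auto simp: g_def g'_def)
  have gv: "(g *\<^sub>v v) $ i = v $ \<tau> i - w $ \<tau> i / w $ k * v $ k" if "v \<in> carrier_vec s" "i < s - 1" for v i
  proof -
    have "(g *\<^sub>v v) $ i = (\<Sum>l<s. g $$ (i,l) * v $ l)"
      by (rule mult_mat_vec_index[OF gc(1) that])
    also have "\<dots> = (\<Sum>l<s. (if l = \<tau> i then v $ \<tau> i else 0) - (if l = k then w $ \<tau> i / w $ k * v $ k else 0))"
      using that by (intro sum.cong) (auto simp: g_def)
    also have "\<dots> = v $ \<tau> i - w $ \<tau> i / w $ k * v $ k"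
      using \<tau>_lt[OF that(2)] k by (simp add: sum_subtractf)
    finally show ?thesis .
  qed
  have "g * g' = 1\<^sub>m (s - 1)"
  proof (rule eq_matI)
    fix i j assume "i < dim_row (1\<^sub>m (s - 1))" "j < dim_col (1\<^sub>m (s - 1))"
    then have ij: "i < s - 1" "j < s - 1" by auto
    have "(g * g') $$ (i,j) = (g *\<^sub>v col g' j) $ i" using gc ij by simp
    also have "\<dots> = 1\<^sub>m (s - 1) $$ (i,j)"
      using gc ij k \<tau>_lt[OF ij(1)] \<tau>_k[of j] by (subst gv) (auto simp: g'_def \<tau>_inj)
    finally show "(g * g') $$ (i,j) = 1\<^sub>m (s - 1) $$ (i,j)" .
  qed (use gc in auto)
  moreover have "g *\<^sub>v v = 0\<^sub>v (s - 1) \<longleftrightarrow> (\<exists>a. v = a \<cdot>\<^sub>v w)" if v: "v \<in> carrier_vec s" for v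
  proof
    assume 0: "g *\<^sub>v v = 0\<^sub>v (s - 1)"
    have "v $ i = (v $ k / w $ k) * w $ i" if "i < s" for i
    proof (cases "i = k")
      case False
      then obtain j where j: "j < s - 1" "i = \<tau> j" using \<tau>_surj \<open>i < s\<close> by blast
      then show ?thesis using gv[OF v j(1)] 0 by simp
    qed (use k in simp)
    then have "v = (v $ k / w $ k) \<cdot>\<^sub>v w" using v w by (intro eq_vecI) auto
    then show "\<exists>a. v = a \<cdot>\<^sub>v w" by blast
  next
    assume "\<exists>a. v = a \<cdot>\<^sub>v w"
    then obtain a where a: "v = a \<cdot>\<^sub>v w" by blast
    have "(g *\<^sub>v v) $ i = 0" if "i < s - 1" for i
      using gv[OF v that] a w k \<tau>_lt[OF that] by simp
    then show "g *\<^sub>v v = 0\<^sub>v (s - 1)" using gc by (intro eq_vecI) (auto simp del: index_mult_mat_vec)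
  qed
  moreover have "hom_mat (\<lambda>i. dg (\<tau> i)) dg 0 g"
    using hw w k \<tau>_lt by (auto simp: hom_mat_def g_def hom_vec_def split: if_splits)
  moreover have "hom_mat dg (\<lambda>i. dg (\<tau> i)) 0 g'"
    by (auto simp: hom_mat_def g'_def split: if_splits)
  ultimately show thesis using that gc by blast
qed

text \<open>Induction on the columns of f: the image of the new column in the quotient so far is
  either zero or spans a line, which \<open>vec_cokernel\<close> divides out.\<close>

lemma homogeneous_cokernel:
  fixes f :: "'k::field mat"
  assumes "f \<in> carrier_mat d r" "hom_mat dg dc 0 f"
  shows "\<exists>s g g' dg'. g \<in> carrier_mat s d \<and> g' \<in> carrier_mat d s \<and> g * g' = 1\<^sub>m s \<and>
    (\<forall>v\<in>carrier_vec d. g *\<^sub>v v = 0\<^sub>v s \<longleftrightarrow> (\<exists>x\<in>carrier_vec r. f *\<^sub>v x = v)) \<and>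
    hom_mat dg' dg 0 g \<and> hom_mat dg dg' 0 g'"
  using assms
proof (induction r arbitrary: f)
  case 0
  have "f *\<^sub>v x = 0\<^sub>v d" if "x \<in> carrier_vec 0" for x
    using 0 that by (intro eq_vecI) (auto simp: scalar_prod_def)
  then have "\<forall>v\<in>carrier_vec d. 1\<^sub>m d *\<^sub>v v = 0\<^sub>v d \<longleftrightarrow> (\<exists>x\<in>carrier_vec 0. f *\<^sub>v x = v)"
  proof (intro ballI iffI)
    fix v :: "'k vec" assume v: "v \<in> carrier_vec d"
    { assume "1\<^sub>m d *\<^sub>v v = 0\<^sub>v d"
      then show "\<exists>x\<in>carrier_vec 0. f *\<^sub>v x = v"
        using v \<open>\<And>x. x \<in> carrier_vec 0 \<Longrightarrow> f *\<^sub>v x = 0\<^sub>v d\<close> by (intro bexI[of _ "0\<^sub>v 0"]) auto }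
    { assume "\<exists>x\<in>carrier_vec 0. f *\<^sub>v x = v"
      then show "1\<^sub>m d *\<^sub>v v = 0\<^sub>v d"
        using v \<open>\<And>x. x \<in> carrier_vec 0 \<Longrightarrow> f *\<^sub>v x = 0\<^sub>v d\<close> by auto }
  qed
  then show ?case
    by (intro exI[of _ d] exI[of _ "1\<^sub>m d"] exI[of _ dg]) (auto simp: hom_mat_one)
next
  case (Suc r)
  define f0 where "f0 = mat d r (\<lambda>(i,j). f $$ (i,j))"
  define c where "c = col f r"
  have f0: "f0 \<in> carrier_mat d r" and c: "c \<in> carrier_vec d" using Suc.prems by (auto simp: f0_def c_def)
  have hf0: "hom_mat dg dc 0 f0" using Suc.prems by (auto simp: hom_mat_def f0_def)
  have hc: "hom_vec dg (dc r) c" using Suc.prems by (auto simp: hom_mat_def hom_vec_def c_def)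
  have fx: "f *\<^sub>v x = f0 *\<^sub>v vec r (\<lambda>i. x $ i) + x $ r \<cdot>\<^sub>v c" if "x \<in> carrier_vec (Suc r)" for x
  proof (rule eq_vecI)
    fix i assume "i < dim_vec (f0 *\<^sub>v vec r (\<lambda>i. x $ i) + x $ r \<cdot>\<^sub>v c)"
    then have i: "i < d" using c by simp
    have "(f *\<^sub>v x) $ i = (\<Sum>k<Suc r. f $$ (i,k) * x $ k)"
      by (rule mult_mat_vec_index[OF Suc.prems(1) that i])
    then show "(f *\<^sub>v x) $ i = (f0 *\<^sub>v vec r (\<lambda>i. x $ i) + x $ r \<cdot>\<^sub>v c) $ i"
      using i c Suc.prems(1) mult_mat_vec_index[OF f0 vec_carrier i, of "\<lambda>i. x $ i"]
      by (simp del: index_mult_mat_vec) (simp add: f0_def c_def mult.commute)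
  qed (use Suc.prems c in auto)
  have fim: "(\<exists>x\<in>carrier_vec (Suc r). f *\<^sub>v x = v) \<longleftrightarrow> (\<exists>a. \<exists>x\<in>carrier_vec r. f0 *\<^sub>v x + a \<cdot>\<^sub>v c = v)" for v
  proof
    assume "\<exists>a. \<exists>x\<in>carrier_vec r. f0 *\<^sub>v x + a \<cdot>\<^sub>v c = v"
    then obtain a x where x: "x \<in> carrier_vec r" "f0 *\<^sub>v x + a \<cdot>\<^sub>v c = v" by blast
    let ?x = "vec (Suc r) (\<lambda>i. if i < r then x $ i else a)"
    have "vec r (\<lambda>i. ?x $ i) = x" using x by (intro eq_vecI) auto
    then have "f *\<^sub>v ?x = v" using x fx[of ?x] by simp
    then show "\<exists>x\<in>carrier_vec (Suc r). f *\<^sub>v x = v" by (intro bexI[of _ ?x]) auto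
  qed (use fx in \<open>metis vec_carrier\<close>)
  from Suc.IH[OF f0 hf0] obtain s g g' dg' where
    g: "g \<in> carrier_mat s d" and g': "g' \<in> carrier_mat d s" and gg': "g * g' = 1\<^sub>m s" and
    ker: "\<And>v. v \<in> carrier_vec d \<Longrightarrow> g *\<^sub>v v = 0\<^sub>v s \<longleftrightarrow> (\<exists>x\<in>carrier_vec r. f0 *\<^sub>v x = v)"
    and hg: "hom_mat dg' dg 0 g" and hg': "hom_mat dg dg' 0 g'" by blast
  define w where "w = g *\<^sub>v c"
  have w: "w \<in> carrier_vec s" using g c by (simp add: w_def)
  have hw: "hom_vec dg' (dc r) w" using hom_vec_mult[OF g c hg hc] by (simp add: w_def)
  have sub: "g *\<^sub>v (v + (- a) \<cdot>\<^sub>v c) = g *\<^sub>v v + (- a) \<cdot>\<^sub>v w" if "v \<in> carrier_vec d" for v a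
    using g c that by (simp add: mult_add_distrib_mat_vec[of _ s d] mult_mat_vec[of _ s d] w_def)
  have sol: "f0 *\<^sub>v x + a \<cdot>\<^sub>v c = v \<longleftrightarrow> f0 *\<^sub>v x = v + (- a) \<cdot>\<^sub>v c" if "v \<in> carrier_vec d" "x \<in> carrier_vec r" for v x a
  proof -
    have fc: "f0 *\<^sub>v x \<in> carrier_vec d" using f0 that by simp
    show ?thesis
    proof
      assume "f0 *\<^sub>v x + a \<cdot>\<^sub>v c = v"
      then show "f0 *\<^sub>v x = v + (- a) \<cdot>\<^sub>v c" using fc c f0 by (auto intro!: eq_vecI)
    next
      assume "f0 *\<^sub>v x = v + (- a) \<cdot>\<^sub>v c"
      then show "f0 *\<^sub>v x + a \<cdot>\<^sub>v c = v" using that c by (auto intro!: eq_vecI)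
    qed
  qed
  have ker': "(\<exists>x\<in>carrier_vec (Suc r). f *\<^sub>v x = v) \<longleftrightarrow> (\<exists>a. g *\<^sub>v v = a \<cdot>\<^sub>v w)" if v: "v \<in> carrier_vec d" for v
  proof -
    have "(\<exists>x\<in>carrier_vec (Suc r). f *\<^sub>v x = v) \<longleftrightarrow> (\<exists>a. g *\<^sub>v (v + (- a) \<cdot>\<^sub>v c) = 0\<^sub>v s)"
      unfolding fim using ker[of "v + (- _) \<cdot>\<^sub>v c"] v c sol[OF v] by (simp cong: bex_cong)
    also have "\<dots> \<longleftrightarrow> (\<exists>a. g *\<^sub>v v = a \<cdot>\<^sub>v w)"
    proof (intro ex_cong1)
      fix a
      have gv: "g *\<^sub>v v \<in> carrier_vec s" using g v by simp
      show "g *\<^sub>v (v + (- a) \<cdot>\<^sub>v c) = 0\<^sub>v s \<longleftrightarrow> g *\<^sub>v v = a \<cdot>\<^sub>v w"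
        unfolding sub[OF v] using w gv g by (auto simp: vec_eq_iff)
    qed
    finally show ?thesis .
  qed
  show ?case
  proof (cases "w = 0\<^sub>v s")
    case True
    then have "(\<exists>a. g *\<^sub>v v = a \<cdot>\<^sub>v w) \<longleftrightarrow> g *\<^sub>v v = 0\<^sub>v s" for v
      by (auto intro!: exI[of _ 0] eq_vecI)
    then have "\<forall>v\<in>carrier_vec d. g *\<^sub>v v = 0\<^sub>v s \<longleftrightarrow> (\<exists>x\<in>carrier_vec (Suc r). f *\<^sub>v x = v)"
      using ker' by simp
    then show ?thesis using g g' gg' hg hg'
      by (intro exI[of _ s] exI[of _ g] exI[of _ g'] exI[of _ dg'] conjI)
  next
    case False
    from vec_cokernel[OF w False hw] obtain g1 g1' dg1 where
      g1: "g1 \<in> carrier_mat (s - 1) s" and g1': "g1' \<in> carrier_mat s (s - 1)" and g1g1': "g1 * g1' = 1\<^sub>m (s - 1)" and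
      ker1: "\<And>v. v \<in> carrier_vec s \<Longrightarrow> g1 *\<^sub>v v = 0\<^sub>v (s - 1) \<longleftrightarrow> (\<exists>a. v = a \<cdot>\<^sub>v w)"
      and h1: "hom_mat dg1 dg' 0 g1" and h1': "hom_mat dg' dg1 0 g1'" by blast
    have "(g1 * g) * (g' * g1') = g1 * ((g * g') * g1')"
      using assoc_mult_mat[OF g1 g mult_carrier_mat[OF g' g1']] assoc_mult_mat[OF g g' g1'] by simp
    also have "\<dots> = 1\<^sub>m (s - 1)" unfolding gg' using g1' g1g1' by simp
    finally have 1: "(g1 * g) * (g' * g1') = 1\<^sub>m (s - 1)" .
    have 2: "(g1 * g) *\<^sub>v v = 0\<^sub>v (s - 1) \<longleftrightarrow> (\<exists>x\<in>carrier_vec (Suc r). f *\<^sub>v x = v)" if "v \<in> carrier_vec d" for v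
      using ker1[of "g *\<^sub>v v"] ker'[OF that] g g1 that by (simp add: assoc_mult_mat_vec[OF g1 g])
    have 3: "hom_mat dg1 dg 0 (g1 * g)" "hom_mat dg dg1 0 (g' * g1')"
      using hom_mat_mult[OF g1 g h1 hg] hom_mat_mult[OF g' g1' hg' h1'] by simp_all
    show ?thesis
      using 1 2 3 g g' g1 g1' by (intro exI[of _ "s - 1"] exI[of _ "g1 * g"] exI[of _ "g' * g1'"] exI[of _ dg1]) auto
  qed
qed

section \<open>A simple submodule generated by a lowest weight vector\<close>

context qu_setup
begin

definition shift_vec :: "nat \<Rightarrow> nat \<Rightarrow> 'k vec \<Rightarrow> 'k vec" where
  "shift_vec e k x = vec e (\<lambda>i. if i < k then 0 else x $ (i - k))"

lemma inverse_q_pow: "inverse q ^ k * q ^ k = 1"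
  by (simp flip: power_mult_distrib)

lemma Q_NN: "(q ^ n) ^ NN = 1"
proof -
  obtain t where "NN = n * t" using n_dvd_NN by (auto simp: dvd_def)
  then show ?thesis by (simp only: power_mult Q_pow power_one)
qed

context
  fixes M :: "'k qu_module"
  assumes M: "M \<in> qu_modules n q"
begin

abbreviation "GH \<equiv> mod_gen n q M"
abbreviation "dh \<equiv> fst M"

lemma GH_carrier [simp]: "GH s \<in> carrier_mat dh dh" by (rule mod_gen_carrier[OF M])

lemma lowest_carrier: "lowest M m j v \<Longrightarrow> v \<in> carrier_vec dh"
  by (simp add: lowest_def)

text \<open>Let p be maximal with E^p v nonzero. Applying F to E^(p+1) v = 0 shows that q^(p+1) is 1
  or q^(2m+1), where p + 1 is at most 2N. If p + 1 < 2N, then p = 2m and v itself generates a copy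
  of S_{m,j}. If p + 1 = 2N, then E^(2m+1) v is again killed by F, and the rest of the chain is a
  copy of S_{N-1-m,j}.\<close>

lemma simple_sub_vector:
  assumes v: "lowest M m j v" and m: "m < NN" and j: "j < 2"
  obtains m' w r where "m' < NN" "lowest M m' j w" "w = ev M v r"
    "ev M w (2 * m') \<noteq> 0\<^sub>v dh" "ev M w (2 * m' + 1) = 0\<^sub>v dh"
proof -
  note vc = lowest_carrier[OF v]
  note evS = ev_Suc[OF M vc] note evc = ev_carrier[OF M vc]
  have "ev M v 0 \<noteq> 0\<^sub>v dh" using v by (simp add: ev_0[OF M vc] lowest_def)
  then obtain p where p: "p < n ^ 2" "ev M v p \<noteq> 0\<^sub>v dh" "ev M v (Suc p) = 0\<^sub>v dh"
    using ex_last_nonzero[of "\<lambda>r. ev M v r \<noteq> 0\<^sub>v dh" "n ^ 2"] ev_nilpotent[OF M vc] by auto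
  have below: "ev M v r \<noteq> 0\<^sub>v dh" if "r \<le> p" for r
  proof
    assume 0: "ev M v r = 0\<^sub>v dh"
    have "ev M (0\<^sub>v dh) t = 0\<^sub>v dh" for t
      unfolding ev_def[OF M] by (rule mult_mat_zero_vec[OF pow_carrier_mat[OF GH_carrier]])
    then have "ev M v (r + (p - r)) = 0\<^sub>v dh" unfolding ev_add[OF M vc] 0 .
    then show False using p that by simp
  qed
  have "cc (q ^ (2 * m)) (Suc p) \<cdot>\<^sub>v ev M v p = 0\<^sub>v dh"
    using lowest_chain(3)[OF M v, of p] p(3) mult_mat_zero_vec[OF GH_carrier, of gen_F] by simp
  then have "cc (q ^ (2 * m)) (Suc p) = 0"
    using p(2) vec_eq_0_iff[OF evc[of p]] evc[of p]
    by (metis carrier_vecD index_smult_vec(1) index_zero_vec(1) mult_eq_0_iff)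
  then have cases: "q ^ Suc p = 1 \<or> q ^ Suc p = q ^ (2 * m + 1)"
    unfolding cc_eq_0_iff by (simp add: mult.commute)
  have pn: "Suc p \<le> 2 * NN" using p(1) n_sq by simp
  show thesis
  proof (cases "Suc p = 2 * NN")
    case False
    then have "Suc p < 2 * NN" using pn by simp
    moreover from this have "q ^ Suc p \<noteq> 1" unfolding q_pow_eq_1_iff by (auto dest: dvd_imp_le)
    ultimately have "Suc p = 2 * m + 1" using cases q_pow_inj m by auto
    then have "p = 2 * m" by simp
    then show thesis using that[of m v 0] m v p by (simp add: ev_0[OF M vc])
  next
    case True
    define w where "w = ev M v (2 * m + 1)"
    \<comment> \<open>The full chain has length 2N = (2m + 1) + (2m' + 1).\<close>
    define m' where "m' = NN - 1 - m"
    have m': "m' < NN" "m + m' + 1 = NN" using m by (auto simp: m'_def)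
    have kv: "kap_val m j * (q ^ n) ^ (2 * m + 1) = kap_val m' j"
    proof -
      have "inverse (q ^ n) ^ m * (q ^ n) ^ m = 1" by (simp flip: power_mult_distrib)
      then have 1: "kap_val m j * (q ^ n) ^ (2 * m + 1) = (- 1) ^ j * (q ^ n) ^ (m + 1)"
        unfolding kap_val_def mult_2 power_add by (simp add: mult_ac)
      have "(q ^ n) ^ (m + 1) * (q ^ n) ^ m' = 1" using Q_NN m'(2) by (metis add.assoc add.commute power_add)
      then have "(q ^ n) ^ (m + 1) = inverse (q ^ n) ^ m'"
        by (simp add: power_inverse field_simps)
      then show ?thesis unfolding 1 by (simp add: kap_val_def)
    qed
    have Kv: "q ^ (2 * m) * inverse q ^ (2 * (2 * m + 1)) = q ^ (2 * m')"
    proof -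
      have "2 * (2 * m + 1) + 2 * m' = 2 * m + 2 * NN" using m'(2) by simp
      then have "q ^ (2 * (2 * m + 1)) * q ^ (2 * m') = q ^ (2 * m) * q ^ (2 * NN)" by (metis power_add)
      moreover have "q ^ (2 * NN) = 1" using q_pow n_sq by simp
      ultimately have e: "q ^ (2 * m) = q ^ (2 * (2 * m + 1)) * q ^ (2 * m')" by simp
      have "q ^ (2 * m) * inverse q ^ (2 * (2 * m + 1)) = (inverse q ^ (2 * (2 * m + 1)) * q ^ (2 * (2 * m + 1))) * q ^ (2 * m')"
        unfolding e by (simp only: mult_ac)
      then show ?thesis unfolding inverse_q_pow by simp
    qed
    have mp: "2 * m + 1 \<le> p" using m True by simp
    have "lowest M m' j w"
      unfolding lowest_def
    proof (intro conjI)
      show "w \<in> carrier_vec dh" "w \<noteq> 0\<^sub>v dh" using evc below[OF mp] by (auto simp: w_def)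
      have "cc (q ^ (2 * m)) (Suc (2 * m)) = 0" using cc_simple[of m] by simp
      then show "GH gen_F *\<^sub>v w = 0\<^sub>v dh"
        unfolding w_def using lowest_chain(3)[OF M v, of "2 * m"] evc[of "2 * m"] by (simp del: cc.simps) (auto intro!: eq_vecI)
      show "GH gen_kappa *\<^sub>v w = kap_val m' j \<cdot>\<^sub>v w"
        unfolding w_def lowest_chain(1)[OF M v] kv ..
      show "GH gen_kappa_hat *\<^sub>v w = (kap_val m' j * q ^ (2 * m')) \<cdot>\<^sub>v w"
        unfolding w_def lowest_chain(2)[OF M v] kv Kv ..
    qed
    moreover have "ev M w t = ev M v (2 * m + 1 + t)" for t
      unfolding w_def ev_add[OF M vc, of "2 * m + 1" t] ..
    moreover have "2 * m + 1 + 2 * m' = p" "2 * m + 1 + (2 * m' + 1) = Suc p" using m' True by auto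
    ultimately show thesis using that[of m' w "2 * m + 1"] m' p by (simp add: w_def)
  qed
qed

text \<open>For injectivity, the coefficients of a vector in the kernel are eliminated in increasing
  order: once those before r are zero, E^(2m-r) kills all later terms and carries the r-th one to
  the nonzero vector E^(2m) w.\<close>

lemma simple_embedding:
  assumes w: "lowest M m j w" and m: "m < NN"
    and top: "ev M w (2 * m) \<noteq> 0\<^sub>v dh" and kill: "ev M w (2 * m + 1) = 0\<^sub>v dh"
  defines "f \<equiv> mat dh (2 * m + 1) (\<lambda>(i,r). ev M w r $ i)"
  shows "qu_module_hom n q (qu_simple m j) M f"
    and "inj_on (\<lambda>v. f *\<^sub>v v) (carrier_vec (2 * m + 1))"
proof -
  note wc = lowest_carrier[OF w]
  note evS = ev_Suc[OF M wc] note evc = ev_carrier[OF M wc]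
  let ?e = "2 * m + 1"
  have f: "f \<in> carrier_mat dh ?e" by (simp add: f_def)
  have col: "col f r = ev M w r" if "r < ?e" for r
    using that carrier_vecD[OF evc[of r]] by (intro eq_vecI) (auto simp: f_def)
  have fi: "f $$ (i,r) = ev M w r $ i" if "i < dh" "r < ?e" for i r using that by (simp add: f_def)
  have Gf: "(GH s * f) $$ (i,r) = (GH s *\<^sub>v ev M w r) $ i" if "i < dh" "r < ?e" for s i r
    using that f col[OF that(2)] carrier_matD[OF GH_carrier[of s]] by simp
  have fS: "(f * simple_gen m j s) $$ (i,r) = (\<Sum>k<?e. ev M w k $ i * simple_gen m j s $$ (k,r))" if "i < dh" "r < ?e" for s i r
    using that by (subst times_mat_index[OF f simple_gen_carrier that]) (simp add: fi)
  have inter: "f * simple_gen m j s = GH s * f" for s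
  proof (rule eq_matI)
    fix i r assume "i < dim_row (GH s * f)" "r < dim_col (GH s * f)"
    then have ir: "i < dh" "r < ?e" using f carrier_matD[OF GH_carrier[of s]] by auto
    note dv = carrier_vecD[OF evc]
    show "(f * simple_gen m j s) $$ (i,r) = (GH s * f) $$ (i,r)"
    proof (cases s)
      case gen_kappa
      have "(f * simple_gen m j gen_kappa) $$ (i,r) = f $$ (i,r) * (kap_val m j * (q ^ n) ^ r)"
        using diag_fun_mult_right_index[OF f ir] by simp
      then show ?thesis using gen_kappa Gf[OF ir, of s] ir dv
        by (simp add: lowest_chain(1)[OF M w] fi mult.commute del: index_mult_mat index_mult_mat_vec simple_gen.simps)
    next
      case gen_kappa_hat
      have "(f * simple_gen m j gen_kappa_hat) $$ (i,r) = f $$ (i,r) * (kap_val m j * (q ^ n) ^ r * (q ^ (2 * m) * inverse q ^ (2 * r)))"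
        using diag_fun_mult_right_index[OF f ir] by simp
      then show ?thesis using gen_kappa_hat Gf[OF ir, of s] ir dv
        by (simp add: lowest_chain(2)[OF M w] fi mult.commute del: index_mult_mat index_mult_mat_vec simple_gen.simps)
    next
      case gen_E
      have "(f * simple_gen m j gen_E) $$ (i,r) = (\<Sum>k<?e. if k = Suc r then ev M w (Suc r) $ i else 0)"
        unfolding fS[OF ir] using ir by (intro sum.cong) auto
      also have "\<dots> = ev M w (Suc r) $ i"
        using ir kill by (cases "Suc r < ?e") (auto simp: less_Suc_eq)
      finally show ?thesis using gen_E Gf[OF ir, of gen_E] by (simp add: evS)
    next
      case gen_F
      have "(f * simple_gen m j gen_F) $$ (i,r) = (\<Sum>k<?e. if k = r - 1 then ev M w (r - 1) $ i * cc (q ^ (2 * m)) r else 0)"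
        unfolding fS[OF ir] using ir by (intro sum.cong) (cases r; auto simp del: cc.simps(2))+
      also have "\<dots> = ev M w (r - 1) $ i * cc (q ^ (2 * m)) r" using ir by (cases r) (auto simp del: cc.simps(2))
      also have "\<dots> = (GH gen_F *\<^sub>v ev M w r) $ i"
      proof (cases r)
        case 0
        then show ?thesis using w ir by (simp add: ev_0[OF M wc] lowest_def)
      next
        case (Suc r')
        then show ?thesis using ir dv[of r'] by (simp add: lowest_chain(3)[OF M w] del: cc.simps index_mult_mat_vec)
      qed
      finally show ?thesis using gen_F Gf[OF ir, of gen_F] by simp
    qed
  qed (use f carrier_matD[OF GH_carrier[of s]] carrier_matD[OF simple_gen_carrier[of m j s]] in auto)
  show "qu_module_hom n q (qu_simple m j) M f"
    using f inter by (simp add: qu_module_hom_iff[OF qu_simple_in[OF m] M] mod_gen_qu_simple[OF m])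
  have sh: "shift_vec ?e k x \<in> carrier_vec ?e" for k x by (simp add: shift_vec_def)
  have Ef: "GH gen_E *\<^sub>v (f *\<^sub>v x) = f *\<^sub>v shift_vec ?e 1 x" if x: "x \<in> carrier_vec ?e" for x
  proof -
    have "simple_gen m j gen_E *\<^sub>v x = shift_vec ?e 1 x"
    proof (rule eq_vecI)
      fix i assume "i < dim_vec (shift_vec ?e 1 x)"
      then have i: "i < ?e" by (simp add: shift_vec_def)
      have "(simple_gen m j gen_E *\<^sub>v x) $ i = (\<Sum>k<?e. simple_gen m j gen_E $$ (i,k) * x $ k)"
        by (rule mult_mat_vec_index[OF simple_gen_carrier x i])
      also have "\<dots> = (\<Sum>k<?e. if k = i - 1 then (if i < 1 then 0 else x $ (i - 1)) else 0)"
        using i by (intro sum.cong) auto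
      also have "\<dots> = shift_vec ?e 1 x $ i" using i by (cases i) (auto simp: shift_vec_def)
      finally show "(simple_gen m j gen_E *\<^sub>v x) $ i = shift_vec ?e 1 x $ i" .
    qed (simp add: shift_vec_def)
    then show ?thesis
      using assoc_mult_mat_vec[OF GH_carrier f x, of gen_E] assoc_mult_mat_vec[OF f simple_gen_carrier x, of j gen_E] inter[of gen_E] by simp
  qed
  have Ekf: "GH gen_E ^\<^sub>m k *\<^sub>v (f *\<^sub>v x) = f *\<^sub>v shift_vec ?e k x" if x: "x \<in> carrier_vec ?e" for k x
  proof (induction k)
    case 0
    have "shift_vec ?e 0 x = x" using x by (intro eq_vecI) (auto simp: shift_vec_def)
    then show ?case using f x carrier_matD[OF GH_carrier[of gen_E]] by simp
  next
    case (Suc k)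
    have fx: "f *\<^sub>v x \<in> carrier_vec dh" using f x by simp
    have "GH gen_E ^\<^sub>m Suc k *\<^sub>v (f *\<^sub>v x) = GH gen_E *\<^sub>v (GH gen_E ^\<^sub>m k *\<^sub>v (f *\<^sub>v x))"
      unfolding pow_mat_Suc_left[OF GH_carrier] by (rule assoc_mult_mat_vec[OF GH_carrier pow_carrier_mat[OF GH_carrier] fx])
    also have "\<dots> = f *\<^sub>v shift_vec ?e 1 (shift_vec ?e k x)" unfolding Suc by (rule Ef[OF sh])
    also have "shift_vec ?e 1 (shift_vec ?e k x) = shift_vec ?e (Suc k) x"
      by (intro eq_vecI) (auto simp: shift_vec_def)
    finally show ?case .
  qed
  have ker: "x = 0\<^sub>v ?e" if x: "x \<in> carrier_vec ?e" and 0: "f *\<^sub>v x = 0\<^sub>v dh" for x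
  proof -
    have "x $ r = 0" if "r < ?e" for r
      using that
    proof (induction r rule: less_induct)
      case (less r)
      let ?k = "2 * m - r"
      have "shift_vec ?e ?k x = x $ r \<cdot>\<^sub>v unit_vec ?e (2 * m)"
        using less x by (intro eq_vecI) (auto simp: shift_vec_def unit_vec_def)
      then have "GH gen_E ^\<^sub>m ?k *\<^sub>v 0\<^sub>v dh = x $ r \<cdot>\<^sub>v (f *\<^sub>v unit_vec ?e (2 * m))"
        using Ekf[OF x, of ?k] f unfolding 0 by (simp add: mult_mat_vec[OF f])
      then have "0\<^sub>v dh = x $ r \<cdot>\<^sub>v ev M w (2 * m)"
        using mult_mat_unit_vec[OF f, of "2 * m"] col[of "2 * m"] mult_mat_zero_vec[OF pow_carrier_mat[OF GH_carrier]] by simp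
      then show "x $ r = 0"
        using top vec_eq_0_iff[OF evc[of "2 * m"]] evc[of "2 * m"]
        by (metis carrier_vecD index_smult_vec(1) index_zero_vec(1) mult_eq_0_iff)
    qed
    then show ?thesis using vec_eq_0_iff[OF x] by blast
  qed
  show "inj_on (\<lambda>v. f *\<^sub>v v) (carrier_vec ?e)"
  proof (rule inj_onI)
    fix x y assume xy: "x \<in> carrier_vec ?e" "y \<in> carrier_vec ?e" "f *\<^sub>v x = f *\<^sub>v y"
    have "f *\<^sub>v (x - y) = f *\<^sub>v x - f *\<^sub>v y" by (rule mult_minus_distrib_mat_vec[OF f xy(1,2)])
    also have "\<dots> = 0\<^sub>v dh" using xy f by auto
    finally have "x - y = 0\<^sub>v ?e" using ker xy by simp
    then have "(x - y) $ i = 0" if "i < ?e" for i using that by simp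
    then show "x = y" using xy by (intro eq_vecI) auto
  qed
qed

end

end

text \<open>The compression of a to g a g' is multiplicative because g a g' g = g a, which expresses
  that the image of f is a submodule.\<close>

lemma quotient_module:
  fixes q :: "'k::field"
  assumes S: "S \<in> qu_modules n q" and M: "M \<in> qu_modules n q"
    and f: "qu_module_hom n q S M f" and split: "split_mats (fst S) (fst M) r f g f' g'"
  defines "M' \<equiv> (r, \<lambda>a. g * snd M a * g')"
  shows "M' \<in> qu_modules n q" and "qu_short_exact n q S M M'" and "qu_module_hom n q M M' g"
proof -
  let ?m = "fst M" let ?l = "fst S"
  have c: "f \<in> carrier_mat ?m ?l" "f' \<in> carrier_mat ?l ?m" "g \<in> carrier_mat r ?m" "g' \<in> carrier_mat ?m r"
    and e: "f' * f = 1\<^sub>m ?l" "g * g' = 1\<^sub>m r" "f * f' + g' * g = 1\<^sub>m ?m"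
    using split by (auto simp: split_mats_def)
  note gf = split_mats_gf[OF split]
  have key: "g * snd M a = g * snd M a * g' * g" if a: "a \<in> carrier (qu_alg n q)" for a
  proof -
    note Ma = qu_modules_carrier[OF M a] note Sa = qu_modules_carrier[OF S a]
    have ga: "g * snd M a \<in> carrier_mat r ?m" using c Ma by simp
    have "g * snd M a * f = g * (f * snd S a)"
      using f a c Ma by (simp add: qu_module_hom_def assoc_mult_mat[OF c(3) Ma c(1)])
    also have "\<dots> = 0\<^sub>m r ?l"
      using Sa by (simp add: assoc_mult_mat[OF c(3) c(1) Sa, symmetric] gf)
    finally have 0: "g * snd M a * f = 0\<^sub>m r ?l" .
    have "g * snd M a = g * snd M a * (f * f' + g' * g)" unfolding e(3) by (rule right_mult_one_mat[OF ga, symmetric])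
    also have "\<dots> = g * snd M a * (f * f') + g * snd M a * (g' * g)"
      using ga c by (intro mult_add_distrib_mat[of _ r ?m _ ?m]) auto
    also have "g * snd M a * (f * f') = 0\<^sub>m r ?m"
      using assoc_mult_mat[OF ga c(1,2)] c(2) unfolding 0 by simp
    also have "g * snd M a * (g' * g) = g * snd M a * g' * g"
      using assoc_mult_mat[OF ga c(4,3)] by simp
    also have "0\<^sub>m r ?m + g * snd M a * g' * g = g * snd M a * g' * g"
      using ga c by (intro left_add_zero_mat) (auto intro!: mult_carrier_mat[of _ r r] mult_carrier_mat[of _ r ?m])
    finally show ?thesis .
  qed
  have carr: "g * snd M a * g' \<in> carrier_mat r r" if "a \<in> carrier (qu_alg n q)" for a
    using c qu_modules_carrier[OF M that] by (intro mult_carrier_mat[of _ r ?m]) auto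
  show 1: "M' \<in> qu_modules n q"
    unfolding qu_modules_def M'_def
  proof (intro CollectI, simp, intro conjI allI)
    show "(\<lambda>a. g * snd M a * g') \<in> Ring.ring_hom (qu_alg n q) (ring_mat TYPE('k) r ())"
    proof (rule ring_hom_memI)
      fix a assume a: "a \<in> carrier (qu_alg n q)"
      note Ma = qu_modules_carrier[OF M a]
      have ga: "g * snd M a \<in> carrier_mat r ?m" using c Ma by simp
      show "g * snd M a * g' \<in> carrier (ring_mat TYPE('k) r ())"
        using carr[OF a] by (simp add: ring_mat_simps)
      fix b assume b: "b \<in> carrier (qu_alg n q)"
      note Mb = qu_modules_carrier[OF M b]
      have gb: "g * snd M b \<in> carrier_mat r ?m" using c Mb by simp
      have "g * snd M (a \<otimes>\<^bsub>qu_alg n q\<^esub> b) * g' = g * snd M a * snd M b * g'"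
        using assoc_mult_mat[OF c(3) Ma Mb] by (simp add: qu_modules_mult[OF M a b])
      also have "g * snd M a * snd M b = g * snd M a * g' * (g * snd M b)"
        using key[OF a] assoc_mult_mat[OF carr[OF a] c(3) Mb] by simp
      also have "g * snd M a * g' * (g * snd M b) * g' = g * snd M a * g' * (g * snd M b * g')"
        by (rule assoc_mult_mat[OF carr[OF a] gb c(4)])
      finally show "g * snd M (a \<otimes>\<^bsub>qu_alg n q\<^esub> b) * g' = g * snd M a * g' \<otimes>\<^bsub>ring_mat TYPE('k) r ()\<^esub> (g * snd M b * g')"
        by (simp add: ring_mat_simps)
      have "g * snd M (a \<oplus>\<^bsub>qu_alg n q\<^esub> b) * g' = (g * snd M a + g * snd M b) * g'"
        using mult_add_distrib_mat[OF c(3) Ma Mb] by (simp add: qu_modules_add[OF M a b])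
      also have "\<dots> = g * snd M a * g' + g * snd M b * g'"
        by (rule add_mult_distrib_mat[OF ga gb c(4)])
      finally show "g * snd M (a \<oplus>\<^bsub>qu_alg n q\<^esub> b) * g' = g * snd M a * g' \<oplus>\<^bsub>ring_mat TYPE('k) r ()\<^esub> (g * snd M b * g')"
        by (simp add: ring_mat_simps)
    next
      show "g * snd M \<one>\<^bsub>qu_alg n q\<^esub> * g' = \<one>\<^bsub>ring_mat TYPE('k) r ()\<^esub>"
        using c e by (simp add: qu_modules_one[OF M] ring_mat_simps)
    qed
    show "g * snd M (qu_scal n q x) * g' = x \<cdot>\<^sub>m 1\<^sub>m r" for x
    proof -
      have "g * snd M (qu_scal n q x) = x \<cdot>\<^sub>m g"
        using c mult_smult_distrib[OF c(3) one_carrier_mat, of x] by (simp add: qu_modules_scal[OF M])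
      then show ?thesis using mult_smult_assoc_mat[OF c(3,4), of x] e by simp
    qed
  qed
  show 2: "qu_module_hom n q M M' g"
    using c key by (simp add: qu_module_hom_def M'_def)
  show "qu_short_exact n q S M M'"
    unfolding qu_short_exact_iff_split using split f 2 by (auto simp: M'_def)
qed

context qu_setup
begin

text \<open>
  For \<open>z = 1\<close> this is a grading in which $E$ lowers the degree; for \<open>z = 0\<close> and constant \<open>dg\<close> it is no
  condition, so that ungraded modules are covered as well.
\<close>

definition homogeneous :: "int \<Rightarrow> (nat \<Rightarrow> int) \<Rightarrow> 'k qu_module \<Rightarrow> bool" where
  "homogeneous z dg M \<longleftrightarrow> hom_mat dg dg (- z) (mod_gen n q M gen_E) \<and> hom_mat dg dg z (mod_gen n q M gen_F) \<and>
     hom_mat dg dg 0 (mod_gen n q M gen_kappa) \<and> hom_mat dg dg 0 (mod_gen n q M gen_kappa_hat)"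

text \<open>Besides the sequence it records the distribution of degrees: \<gamma> is the degree of
  the lowest weight vector of the simple submodule, and each E lowers it by z. The clauses with
  \<chi> say that if kappa or kappa-hat acts as a function of the degree, then it does so on the
  quotient as well, and the same function at \<gamma> is its eigenvalue on the lowest weight
  vector.\<close>

lemma composition_step:
  assumes M: "M \<in> qu_modules n q" and d: "fst M > 0" and h: "homogeneous z dg M"
  obtains m j \<gamma> M' dg' where "m < NN" "j < 2" "M' \<in> qu_modules n q" "fst M = 2 * m + 1 + fst M'"
    "qu_short_exact n q (qu_simple m j) M M'" "homogeneous z dg' M'"
    "\<And>\<delta>. card {i. i < fst M \<and> dg i = \<delta>} = card {r. r < 2 * m + 1 \<and> \<gamma> - z * int r = \<delta>} + card {i. i < fst M' \<and> dg' i = \<delta>}"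
    "\<And>\<chi>. mod_gen n q M gen_kappa = diag_fun (fst M) (\<lambda>i. \<chi> (dg i)) \<Longrightarrow>
       kap_val m j = \<chi> \<gamma> \<and> mod_gen n q M' gen_kappa = diag_fun (fst M') (\<lambda>i. \<chi> (dg' i))"
    "\<And>\<chi>. mod_gen n q M gen_kappa_hat = diag_fun (fst M) (\<lambda>i. \<chi> (dg i)) \<Longrightarrow>
       kap_val m j * q ^ (2 * m) = \<chi> \<gamma> \<and> mod_gen n q M' gen_kappa_hat = diag_fun (fst M') (\<lambda>i. \<chi> (dg' i))"
proof -
  let ?d = "fst M" let ?G = "mod_gen n q M"
  have G: "?G s \<in> carrier_mat ?d ?d" for s by (rule mod_gen_carrier[OF M])
  have hE: "hom_mat dg dg (- z) (?G gen_E)" and hF: "hom_mat dg dg z (?G gen_F)"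
    and hk: "hom_mat dg dg 0 (?G gen_kappa)" "hom_mat dg dg 0 (?G gen_kappa_hat)"
    using h by (auto simp: homogeneous_def)
  obtain m0 j v \<gamma>0 where v: "m0 < NN" "j < 2" "lowest M m0 j v" "hom_vec dg \<gamma>0 v"
    using lowest_exists[OF M d hF hk] by metis
  from simple_sub_vector[OF M v(3,1,2)] obtain m w r0 where
    w: "m < NN" "lowest M m j w" "w = ev M v r0" "ev M w (2 * m) \<noteq> 0\<^sub>v ?d" "ev M w (2 * m + 1) = 0\<^sub>v ?d" .
  note vc = lowest_carrier[OF M v(3)] and wc = lowest_carrier[OF M w(2)]
  let ?e = "2 * m + 1"
  have hev: "hom_vec dg (t + int r * - z) (ev M x r)" if "x \<in> carrier_vec ?d" "hom_vec dg t x" for x t r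
    unfolding ev_def[OF M] by (rule hom_vec_mult[OF pow_carrier_mat[OF G] that(1) hom_mat_pow[OF G hE] that(2)])
  define \<gamma> where "\<gamma> = \<gamma>0 + int r0 * - z"
  have hw: "hom_vec dg \<gamma> w" unfolding w(3) \<gamma>_def by (rule hev[OF vc v(4)])
  define f where "f = mat ?d ?e (\<lambda>(i,r). ev M w r $ i)"
  have fc: "f \<in> carrier_mat ?d ?e" by (simp add: f_def)
  note fhom = simple_embedding(1)[OF M w(2,1,4,5), folded f_def]
    and finj = simple_embedding(2)[OF M w(2,1,4,5), folded f_def]
  let ?dc = "\<lambda>r. \<gamma> - z * int r"
  have hf: "hom_mat dg ?dc 0 f"
    unfolding hom_mat_def
  proof (intro allI impI)
    fix i r assume ir: "i < dim_row f" "r < dim_col f" and nz: "f $$ (i,r) \<noteq> 0"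
    then have "ev M w r $ i \<noteq> 0" "i < ?d" by (auto simp: f_def)
    then show "dg i = ?dc r + 0"
      using hev[OF wc hw, of r] carrier_vecD[OF ev_carrier[OF M wc, of r]] by (auto simp: hom_vec_def algebra_simps)
  qed
  obtain s g g' dg' where g: "g \<in> carrier_mat s ?d" and g': "g' \<in> carrier_mat ?d s" and gg': "g * g' = 1\<^sub>m s"
    and ker: "\<forall>v\<in>carrier_vec ?d. g *\<^sub>v v = 0\<^sub>v s \<longleftrightarrow> (\<exists>x\<in>carrier_vec ?e. f *\<^sub>v x = v)"
    and hg: "hom_mat dg' dg 0 g" and hg': "hom_mat dg dg' 0 g'"
    using homogeneous_cokernel[OF fc hf] by blast
  have im: "(\<lambda>v. f *\<^sub>v v) ` carrier_vec ?e = {v \<in> carrier_vec ?d. g *\<^sub>v v = 0\<^sub>v s}"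
    using ker fc by auto
  from section_imp_split_mats[OF fc g g' finj im gg'] obtain f' where sp: "split_mats ?e ?d s f g f' g'" .
  define M' where "M' = (s, \<lambda>a. g * snd M a * g')"
  have fstM': "fst M' = s" by (simp add: M'_def)
  have sp': "split_mats (fst (qu_simple m j)) ?d s f g f' g'" using sp by simp
  note qm = quotient_module[OF qu_simple_in[OF w(1)] M fhom sp', folded M'_def]
  have G': "mod_gen n q M' t = g * ?G t * g'" for t by (simp add: mod_gen_def M'_def)
  have hom': "hom_mat dg' dg' c (g * A * g')" if "A \<in> carrier_mat ?d ?d" "hom_mat dg dg c A" for A c
    using hom_mat_mult[OF mult_carrier_mat[OF g that(1)] g' hom_mat_mult[OF g that(1) hg that(2)] hg'] by simp
  have h': "homogeneous z dg' M'"
    unfolding homogeneous_def G' using hom'[OF G] hE hF hk by blast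
  have diag': "g * diag_fun ?d (\<lambda>i. \<chi> (dg i)) = diag_fun s (\<lambda>i. \<chi> (dg' i)) * g" for \<chi> :: "int \<Rightarrow> 'k"
  proof (rule eq_matI)
    fix a b assume "a < dim_row (diag_fun s (\<lambda>i. \<chi> (dg' i)) * g)" "b < dim_col (diag_fun s (\<lambda>i. \<chi> (dg' i)) * g)"
    then have ab: "a < s" "b < ?d" using g by auto
    have "dg' a = dg b" if "g $$ (a,b) \<noteq> 0" using hom_matD[OF hg _ _ that] ab g by simp
    then show "(g * diag_fun ?d (\<lambda>i. \<chi> (dg i))) $$ (a,b) = (diag_fun s (\<lambda>i. \<chi> (dg' i)) * g) $$ (a,b)"
      unfolding diag_fun_mult_right_index[OF g ab] diag_fun_mult_left_index[OF g ab] by (cases "g $$ (a,b) = 0") auto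
  qed (use g in auto)
  have diagf: "f * diag_fun ?e (\<lambda>r. \<chi> (?dc r)) = diag_fun ?d (\<lambda>i. \<chi> (dg i)) * f" for \<chi> :: "int \<Rightarrow> 'k"
  proof (rule eq_matI)
    fix a b assume "a < dim_row (diag_fun ?d (\<lambda>i. \<chi> (dg i)) * f)" "b < dim_col (diag_fun ?d (\<lambda>i. \<chi> (dg i)) * f)"
    then have ab: "a < ?d" "b < ?e" using fc by auto
    have "dg a = ?dc b" if "f $$ (a,b) \<noteq> 0" using hom_matD[OF hf _ _ that] ab fc by simp
    then show "(f * diag_fun ?e (\<lambda>r. \<chi> (?dc r))) $$ (a,b) = (diag_fun ?d (\<lambda>i. \<chi> (dg i)) * f) $$ (a,b)"
      unfolding diag_fun_mult_right_index[OF fc ab] diag_fun_mult_left_index[OF fc ab] by (cases "f $$ (a,b) = 0") auto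
  qed (use fc in auto)
  \<comment> \<open>Additivity of the trace for the diagonal matrices with entries \<chi> of the
    degree. Indicator functions then count the vectors of each degree, since the field has
    characteristic zero.\<close>
  have tr: "(\<Sum>i<?d. \<chi> (dg i)) = (\<Sum>r<?e. \<chi> (?dc r)) + (\<Sum>i<s. \<chi> (dg' i))" for \<chi> :: "int \<Rightarrow> 'k"
    using mat_trace_split[OF sp diag_fun_carrier diag_fun_carrier diag_fun_carrier diagf[of \<chi>] diag'[of \<chi>]] by (simp add: mat_trace_diag_fun)
  have cnt: "(\<Sum>i<k. if P i then 1 else 0) = (of_nat (card {i. i < k \<and> P i}) :: 'k)" for k :: nat and P
  proof -
    have "{i. i < k \<and> P i} = {i \<in> {..<k}. P i}" by auto
    then show ?thesis using sum.inter_filter[of "{..<k}" "\<lambda>_. 1 :: 'k" P] by simp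
  qed
  have "(of_nat ?d :: 'k) = of_nat (?e + s)" using tr[of "\<lambda>_. 1"] by simp
  then have dims: "?d = ?e + s" by (simp only: of_nat_eq_iff)
  have counts: "card {i. i < ?d \<and> dg i = \<delta>} = card {r. r < ?e \<and> ?dc r = \<delta>} + card {i. i < s \<and> dg' i = \<delta>}" for \<delta>
    using tr[of "\<lambda>t. if t = \<delta> then 1 else 0"] unfolding cnt by (simp only: of_nat_eq_iff flip: of_nat_add)
  obtain a where a: "a < ?d" "w $ a \<noteq> 0"
    using w(2) vec_eq_0_iff[OF wc] by (auto simp: lowest_def)
  then have da: "dg a = \<gamma>" using hw wc by (auto simp: hom_vec_def)
  have val: "c = \<chi> \<gamma>" if "diag_fun ?d (\<lambda>i. \<chi> (dg i)) *\<^sub>v w = c \<cdot>\<^sub>v w" for \<chi> :: "int \<Rightarrow> 'k" and c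
  proof -
    have "(diag_fun ?d (\<lambda>i. \<chi> (dg i)) *\<^sub>v w) $ a = (\<Sum>k<?d. diag_fun ?d (\<lambda>i. \<chi> (dg i)) $$ (a,k) * w $ k)"
      by (rule mult_mat_vec_index[OF diag_fun_carrier wc a(1)])
    also have "\<dots> = (\<Sum>k<?d. if k = a then \<chi> \<gamma> * w $ a else 0)"
      using a da by (intro sum.cong) (auto simp: diag_fun_index)
    finally have "\<chi> \<gamma> * w $ a = (c \<cdot>\<^sub>v w) $ a" using that a by simp
    then show ?thesis using a wc by auto
  qed
  have quot: "g * diag_fun ?d (\<lambda>i. \<chi> (dg i)) * g' = diag_fun s (\<lambda>i. \<chi> (dg' i))" for \<chi> :: "int \<Rightarrow> 'k"
    unfolding diag' using assoc_mult_mat[OF diag_fun_carrier g g'] gg' by simp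
  show thesis
  proof (rule that[OF w(1) v(2) qm(1) _ qm(2) h', of \<gamma>])
    show "?d = ?e + fst M'" using dims by (simp add: fstM')
    show "card {i. i < ?d \<and> dg i = \<delta>} = card {r. r < ?e \<and> ?dc r = \<delta>} + card {i. i < fst M' \<and> dg' i = \<delta>}" for \<delta>
      using counts by (simp add: fstM')
    show "kap_val m j = \<chi> \<gamma> \<and> mod_gen n q M' gen_kappa = diag_fun (fst M') (\<lambda>i. \<chi> (dg' i))"
      if "?G gen_kappa = diag_fun ?d (\<lambda>i. \<chi> (dg i))" for \<chi>
      using val[of \<chi> "kap_val m j"] w(2) that by (simp add: G' quot lowest_def fstM')
    show "kap_val m j * q ^ (2 * m) = \<chi> \<gamma> \<and> mod_gen n q M' gen_kappa_hat = diag_fun (fst M') (\<lambda>i. \<chi> (dg' i))"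
      if "?G gen_kappa_hat = diag_fun ?d (\<lambda>i. \<chi> (dg i))" for \<chi>
      using val[of \<chi> "kap_val m j * q ^ (2 * m)"] w(2) that by (simp add: G' quot lowest_def fstM')
  qed
qed

end

section \<open>The Grothendieck group\<close>

definition trace_frag :: "'k::field qu_elem \<Rightarrow> ('k qu_module \<Rightarrow>\<^sub>0 int) \<Rightarrow> 'k" where
  "trace_frag a x = (\<Sum>M\<in>Poly_Mapping.keys x. of_int (Poly_Mapping.lookup x M) * mat_trace (snd M a))"

lemma trace_frag_superset:
  assumes "finite S" "Poly_Mapping.keys x \<subseteq> S"
  shows "trace_frag a x = (\<Sum>M\<in>S. of_int (Poly_Mapping.lookup x M) * mat_trace (snd M a))"
  unfolding trace_frag_def using assms by (intro sum.mono_neutral_left) (auto simp: in_keys_iff)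

lemma trace_frag_add: "trace_frag a (x + y) = trace_frag a x + trace_frag a y"
proof -
  let ?S = "Poly_Mapping.keys x \<union> Poly_Mapping.keys y"
  have "Poly_Mapping.keys (x + y) \<subseteq> ?S" by (rule keys_add)
  then show ?thesis
    by (simp add: trace_frag_superset[of ?S] lookup_add distrib_right sum.distrib)
qed

lemma trace_frag_0 [simp]: "trace_frag a 0 = 0"
  by (simp add: trace_frag_def)

lemma trace_frag_cmul_of: "trace_frag a (frag_cmul z (frag_of M)) = of_int z * mat_trace (snd M a)"
proof -
  have "Poly_Mapping.keys (frag_cmul z (frag_of M)) \<subseteq> {M}" by (rule order_trans[OF keys_cmul]) simp
  from trace_frag_superset[OF _ this] show ?thesis by simp
qed

lemma trace_frag_of: "trace_frag a (frag_of M) = mat_trace (snd M a)"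
  using trace_frag_cmul_of[of a 1 M] by simp

lemma trace_frag_minus: "trace_frag a (- x) = - trace_frag a x"
  using trace_frag_add[of a x "- x"] by (simp add: eq_neg_iff_add_eq_0 add.commute)

lemma trace_frag_diff: "trace_frag a (x - y) = trace_frag a x - trace_frag a y"
  using trace_frag_add[of a x "- y"] by (simp add: trace_frag_minus)

lemma trace_frag_sum: "trace_frag a (sum f A) = (\<Sum>i\<in>A. trace_frag a (f i))"
  by (induction A rule: infinite_finite_induct) (simp_all add: trace_frag_add)

lemma qu_short_exact_trace:
  fixes q :: "'k::field"
  assumes L: "L \<in> qu_modules n q" and M: "M \<in> qu_modules n q" and N: "N \<in> qu_modules n q"
    and ex: "qu_short_exact n q L M N" and a: "a \<in> carrier (qu_alg n q)"
  shows "mat_trace (snd M a) = mat_trace (snd L a) + mat_trace (snd N a)"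
proof -
  obtain f g f' g' where "split_mats (fst L) (fst M) (fst N) f g f' g'"
    "qu_module_hom n q L M f" "qu_module_hom n q M N g"
    using ex unfolding qu_short_exact_iff_split by blast
  then show ?thesis
    using a by (intro mat_trace_split[OF _ qu_modules_carrier[OF L a] qu_modules_carrier[OF M a] qu_modules_carrier[OF N a]])
      (auto simp: qu_module_hom_def)
qed

context
  fixes n :: nat and q :: "'k::field"
begin

abbreviation "FA \<equiv> free_Abelian_group (qu_modules n q)"

definition "ses_rel = {frag_of M - frag_of L - frag_of N | L M N.
          L \<in> qu_modules n q \<and> M \<in> qu_modules n q \<and> N \<in> qu_modules n q \<and> qu_short_exact n q L M N}"

lemma ses_subgroup_rel: "ses_subgroup n q = generate FA ses_rel"
  by (simp add: ses_subgroup_def ses_rel_def)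

lemma ses_rel_carrier: "ses_rel \<subseteq> carrier FA"
proof
  fix x assume "x \<in> ses_rel"
  then obtain L M N where "x = frag_of M - frag_of L - frag_of N" "L \<in> qu_modules n q" "M \<in> qu_modules n q" "N \<in> qu_modules n q"
    by (auto simp: ses_rel_def)
  moreover from this have "Poly_Mapping.keys x \<subseteq> {L, M, N}"
    by (auto simp: in_keys_iff lookup_minus split: if_splits)
  ultimately show "x \<in> carrier FA" by auto
qed

lemma ses_subgroup: "subgroup (ses_subgroup n q) FA"
  unfolding ses_subgroup_rel by (rule group.generate_is_subgroup[OF group_free_Abelian_group ses_rel_carrier])

lemma ses_subgroup_keys: "x \<in> ses_subgroup n q \<Longrightarrow> Poly_Mapping.keys x \<subseteq> qu_modules n q"
  using subgroup.mem_carrier[OF ses_subgroup] by (simp only: carrier_free_Abelian_group_iff)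

lemma ses_0: "0 \<in> ses_subgroup n q"
  using subgroup.one_closed[OF ses_subgroup] by simp

lemma ses_add: "x \<in> ses_subgroup n q \<Longrightarrow> y \<in> ses_subgroup n q \<Longrightarrow> x + y \<in> ses_subgroup n q"
  using subgroup.m_closed[OF ses_subgroup, of x y] by simp

lemma ses_minus: "x \<in> ses_subgroup n q \<Longrightarrow> - x \<in> ses_subgroup n q"
  using subgroup.m_inv_closed[OF ses_subgroup, of x] ses_subgroup_keys[of x] by simp

lemma ses_diff: "x \<in> ses_subgroup n q \<Longrightarrow> y \<in> ses_subgroup n q \<Longrightarrow> x - y \<in> ses_subgroup n q"
  using ses_add[of x "- y"] ses_minus by simp

lemma ses_short_exact:
  assumes "L \<in> qu_modules n q" "M \<in> qu_modules n q" "N \<in> qu_modules n q" "qu_short_exact n q L M N"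
  shows "frag_of M - frag_of L - frag_of N \<in> ses_subgroup n q"
  unfolding ses_subgroup_rel by (rule generate.incl) (use assms ses_rel_def in blast)

lemma ses_subgroup_induct:
  assumes x: "x \<in> ses_subgroup n q" and "P 0"
    and rel: "\<And>L M N. L \<in> qu_modules n q \<Longrightarrow> M \<in> qu_modules n q \<Longrightarrow> N \<in> qu_modules n q \<Longrightarrow>
      qu_short_exact n q L M N \<Longrightarrow> P (frag_of M - frag_of L - frag_of N)"
    and minus: "\<And>x. P x \<Longrightarrow> P (- x)" and add: "\<And>x y. P x \<Longrightarrow> P y \<Longrightarrow> P (x + y)"
  shows "P x"
  using x unfolding ses_subgroup_rel
proof (induction rule: generate.induct)
  case (incl h)
  then show ?case using rel by (auto simp: ses_rel_def)
next
  case (inv h)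
  then have "P h" using rel by (auto simp: ses_rel_def)
  moreover have "h \<in> carrier FA" using ses_rel_carrier inv by (rule subsetD)
  then have "inv\<^bsub>FA\<^esub> h = - h" by (intro inv_free_Abelian_group) (simp only: carrier_free_Abelian_group_iff)
  ultimately show ?case using minus by simp
qed (use assms(2) add in auto)

text \<open>The sequence with \<open>M\<close> in all three places and zero maps is exact, and its
  relation is minus the class of \<open>M\<close>.\<close>

lemma ses_zero_module:
  assumes M: "M \<in> qu_modules n q" and d: "fst M = 0"
  shows "frag_of M \<in> ses_subgroup n q"
proof -
  let ?z = "0\<^sub>m 0 0 :: 'k mat"
  have "split_mats 0 0 0 ?z ?z ?z ?z" by (auto simp: split_mats_def intro!: eq_matI)
  moreover have "qu_module_hom n q M M ?z"
    unfolding qu_module_hom_def d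
  proof (intro conjI ballI)
    fix a assume a: "a \<in> carrier (qu_alg n q)"
    have "snd M a \<in> carrier_mat 0 0" using qu_modules_carrier[OF M a] d by simp
    then show "?z * snd M a = snd M a * ?z" by (intro eq_matI) auto
  qed simp
  ultimately have "qu_short_exact n q M M M" unfolding qu_short_exact_iff_split d by blast
  from ses_minus[OF ses_short_exact[OF M M M this]] show ?thesis by simp
qed

lemma trace_frag_ses:
  assumes a: "a \<in> carrier (qu_alg n q)" and x: "x \<in> ses_subgroup n q"
  shows "trace_frag a x = 0"
  using x by (rule ses_subgroup_induct)
    (simp_all add: trace_frag_diff trace_frag_of trace_frag_add trace_frag_minus qu_short_exact_trace[OF _ _ _ _ a])

section \<open>Exactness of the tensor product\<close>

definition "carrier_pairs ts \<longleftrightarrow> (\<forall>(a, b)\<in>set ts. a \<in> carrier (qu_alg n q) \<and> b \<in> carrier (qu_alg n q))"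

lemma tensor_action_carrier:
  assumes M: "M \<in> qu_modules n q" and N: "N \<in> qu_modules n q" and "carrier_pairs ts"
  shows "tensor_action M N ts \<in> carrier_mat (fst M * fst N) (fst M * fst N)"
  using assms(3)
proof (induction ts)
  case (Cons t ts)
  then show ?case
    by (cases t) (simp add: tensor_action_def carrier_pairs_def kronecker_carrier[OF qu_modules_carrier[OF M] qu_modules_carrier[OF N]])
qed (simp add: tensor_action_def)

lemma tensor_action_hom_left:
  assumes M: "M \<in> qu_modules n q" and M': "M' \<in> qu_modules n q" and N: "N \<in> qu_modules n q"
    and f: "qu_module_hom n q M M' f" and ts: "carrier_pairs ts"
  shows "kronecker f (1\<^sub>m (fst N)) * tensor_action M N ts = tensor_action M' N ts * kronecker f (1\<^sub>m (fst N))"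
  using ts
proof (induction ts)
  case Nil
  have f': "f \<in> carrier_mat (fst M') (fst M)" using f by (simp add: qu_module_hom_def)
  then have "kronecker f (1\<^sub>m (fst N)) \<in> carrier_mat (fst M' * fst N) (fst M * fst N)"
    by (intro kronecker_carrier) auto
  from right_mult_zero_mat[OF this] left_mult_zero_mat[OF this] show ?case by (simp add: tensor_action_def)
next
  case (Cons t ts)
  obtain a b where t: "t = (a, b)" by (cases t)
  then have ab: "a \<in> carrier (qu_alg n q)" "b \<in> carrier (qu_alg n q)" and ts: "carrier_pairs ts"
    using Cons.prems by (auto simp: carrier_pairs_def)
  have f': "f \<in> carrier_mat (fst M') (fst M)" and fa: "f * snd M a = snd M' a * f"
    using f ab by (auto simp: qu_module_hom_def)
  note Ma = qu_modules_carrier[OF M ab(1)] and M'a = qu_modules_carrier[OF M' ab(1)] and Nb = qu_modules_carrier[OF N ab(2)]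
  let ?K = "kronecker f (1\<^sub>m (fst N))"
  have K: "?K \<in> carrier_mat (fst M' * fst N) (fst M * fst N)" using f' by (intro kronecker_carrier) auto
  have 1: "?K * kronecker (snd M a) (snd N b) = kronecker (snd M' a) (snd N b) * ?K"
    using kronecker_mult[OF f' one_carrier_mat Ma Nb] kronecker_mult[OF M'a Nb f' one_carrier_mat] fa Nb by simp
  have "?K * tensor_action M N (t # ts) = ?K * (kronecker (snd M a) (snd N b) + tensor_action M N ts)"
    by (simp add: tensor_action_def t)
  also have "\<dots> = ?K * kronecker (snd M a) (snd N b) + ?K * tensor_action M N ts"
    by (rule mult_add_distrib_mat[OF K kronecker_carrier[OF Ma Nb] tensor_action_carrier[OF M N ts]])
  also have "\<dots> = kronecker (snd M' a) (snd N b) * ?K + tensor_action M' N ts * ?K"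
    unfolding 1 Cons.IH[OF ts] ..
  also have "\<dots> = (kronecker (snd M' a) (snd N b) + tensor_action M' N ts) * ?K"
    by (rule add_mult_distrib_mat[OF kronecker_carrier[OF M'a Nb] tensor_action_carrier[OF M' N ts] K, symmetric])
  also have "\<dots> = tensor_action M' N (t # ts) * ?K"
    by (simp add: tensor_action_def t)
  finally show ?case .
qed

lemma tensor_action_hom_right:
  assumes M: "M \<in> qu_modules n q" and M': "M' \<in> qu_modules n q" and N: "N \<in> qu_modules n q"
    and f: "qu_module_hom n q M M' f" and ts: "carrier_pairs ts"
  shows "kronecker (1\<^sub>m (fst N)) f * tensor_action N M ts = tensor_action N M' ts * kronecker (1\<^sub>m (fst N)) f"
  using ts
proof (induction ts)
  case Nil
  have f': "f \<in> carrier_mat (fst M') (fst M)" using f by (simp add: qu_module_hom_def)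
  then have "kronecker (1\<^sub>m (fst N)) f \<in> carrier_mat (fst N * fst M') (fst N * fst M)"
    by (intro kronecker_carrier) auto
  from right_mult_zero_mat[OF this] left_mult_zero_mat[OF this] show ?case by (simp add: tensor_action_def)
next
  case (Cons t ts)
  obtain b a where t: "t = (b, a)" by (cases t)
  then have ab: "a \<in> carrier (qu_alg n q)" "b \<in> carrier (qu_alg n q)" and ts: "carrier_pairs ts"
    using Cons.prems by (auto simp: carrier_pairs_def)
  have f': "f \<in> carrier_mat (fst M') (fst M)" and fa: "f * snd M a = snd M' a * f"
    using f ab by (auto simp: qu_module_hom_def)
  note Ma = qu_modules_carrier[OF M ab(1)] and M'a = qu_modules_carrier[OF M' ab(1)] and Nb = qu_modules_carrier[OF N ab(2)]
  let ?K = "kronecker (1\<^sub>m (fst N)) f"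
  have K: "?K \<in> carrier_mat (fst N * fst M') (fst N * fst M)" using f' by (intro kronecker_carrier) auto
  have 1: "?K * kronecker (snd N b) (snd M a) = kronecker (snd N b) (snd M' a) * ?K"
    using kronecker_mult[OF one_carrier_mat f' Nb Ma] kronecker_mult[OF Nb M'a one_carrier_mat f'] fa Nb by simp
  have "?K * tensor_action N M (t # ts) = ?K * (kronecker (snd N b) (snd M a) + tensor_action N M ts)"
    by (simp add: tensor_action_def t)
  also have "\<dots> = ?K * kronecker (snd N b) (snd M a) + ?K * tensor_action N M ts"
    by (rule mult_add_distrib_mat[OF K kronecker_carrier[OF Nb Ma] tensor_action_carrier[OF N M ts]])
  also have "\<dots> = kronecker (snd N b) (snd M' a) * ?K + tensor_action N M' ts * ?K"
    unfolding 1 Cons.IH[OF ts] ..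
  also have "\<dots> = (kronecker (snd N b) (snd M' a) + tensor_action N M' ts) * ?K"
    by (rule add_mult_distrib_mat[OF kronecker_carrier[OF Nb M'a] tensor_action_carrier[OF N M' ts] K, symmetric])
  also have "\<dots> = tensor_action N M' (t # ts) * ?K"
    by (simp add: tensor_action_def t)
  finally show ?case .
qed

end

context qu_setup
begin

lemma carrier_pairs_comult: "carrier_pairs n q (qu_comult n q s)"
proof -
  have "(\<Oplus>\<^bsub>qu_alg n q\<^esub>i\<in>{1..<n}. qu_idem n q i \<otimes>\<^bsub>qu_alg n q\<^esub> qu_gen n q gen_E) \<in> carrier (qu_alg n q)"
    "(\<Oplus>\<^bsub>qu_alg n q\<^esub>i\<in>{1..<n}. qu_idem n q i) \<in> carrier (qu_alg n q)"
    by (intro A.finsum_closed; simp)+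
  then show ?thesis by (cases s) (simp_all add: carrier_pairs_def Let_def inv_flat inv_kap)
qed

lemma qu_module_hom_tensor_left:
  assumes M: "M \<in> qu_modules n q" and M': "M' \<in> qu_modules n q" and N: "N \<in> qu_modules n q"
    and f: "qu_module_hom n q M M' f"
  shows "qu_module_hom n q (qu_tensor n q M N) (qu_tensor n q M' N) (kronecker f (1\<^sub>m (fst N)))"
  unfolding qu_module_hom_iff[OF qu_tensor_in[OF M N] qu_tensor_in[OF M' N]] mod_gen_qu_tensor[OF M N] mod_gen_qu_tensor[OF M' N]
    fst_qu_tensor[OF M N] fst_qu_tensor[OF M' N]
  using tensor_action_hom_left[OF M M' N f carrier_pairs_comult] f
  by (auto simp: qu_module_hom_def intro!: kronecker_carrier)

lemma qu_module_hom_tensor_right: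
  assumes M: "M \<in> qu_modules n q" and M': "M' \<in> qu_modules n q" and N: "N \<in> qu_modules n q"
    and f: "qu_module_hom n q M M' f"
  shows "qu_module_hom n q (qu_tensor n q N M) (qu_tensor n q N M') (kronecker (1\<^sub>m (fst N)) f)"
  unfolding qu_module_hom_iff[OF qu_tensor_in[OF N M] qu_tensor_in[OF N M']] mod_gen_qu_tensor[OF N M] mod_gen_qu_tensor[OF N M']
    fst_qu_tensor[OF N M] fst_qu_tensor[OF N M']
  using tensor_action_hom_right[OF M M' N f carrier_pairs_comult] f
  by (auto simp: qu_module_hom_def intro!: kronecker_carrier)

text \<open>Kronecker products with an identity matrix preserve the linear splitting, and the action
  of the comultiplication is natural in each factor, so the new maps are module
  homomorphisms.\<close>

lemma qu_short_exact_tensor: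
  assumes L: "L \<in> qu_modules n q" and M: "M \<in> qu_modules n q" and N: "N \<in> qu_modules n q" and K: "K \<in> qu_modules n q"
    and ex: "qu_short_exact n q L M N"
  shows "qu_short_exact n q (qu_tensor n q L K) (qu_tensor n q M K) (qu_tensor n q N K)"
    and "qu_short_exact n q (qu_tensor n q K L) (qu_tensor n q K M) (qu_tensor n q K N)"
proof -
  obtain f g f' g' where s: "split_mats (fst L) (fst M) (fst N) f g f' g'"
    and fg: "qu_module_hom n q L M f" "qu_module_hom n q M N g"
    using ex unfolding qu_short_exact_iff_split by blast
  show "qu_short_exact n q (qu_tensor n q L K) (qu_tensor n q M K) (qu_tensor n q N K)"
    unfolding qu_short_exact_iff_split fst_qu_tensor[OF L K] fst_qu_tensor[OF M K] fst_qu_tensor[OF N K]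
    using split_mats_kronecker_left[OF s] qu_module_hom_tensor_left[OF L M K fg(1)] qu_module_hom_tensor_left[OF M N K fg(2)] by blast
  show "qu_short_exact n q (qu_tensor n q K L) (qu_tensor n q K M) (qu_tensor n q K N)"
    unfolding qu_short_exact_iff_split fst_qu_tensor[OF K L] fst_qu_tensor[OF K M] fst_qu_tensor[OF K N]
    using split_mats_kronecker_right[OF s] qu_module_hom_tensor_right[OF L M K fg(1)] qu_module_hom_tensor_right[OF M N K fg(2)] by blast
qed

text \<open>
  The functions on the weight bases of the simple modules by which elements of $A$ act diagonally. They
  separate the vectors of the middle weights, which gives elements dual to the simple modules under the trace.
\<close>

definition realizable :: "(nat \<Rightarrow> nat \<Rightarrow> nat \<Rightarrow> 'k) \<Rightarrow> bool" where
  "realizable f \<longleftrightarrow> (\<exists>a\<in>carrier (qu_alg n q). \<forall>m<NN. \<forall>j<2. snd (qu_simple m j) a = diag_fun (2 * m + 1) (f m j))"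

lemma realizable_add: "realizable f \<Longrightarrow> realizable g \<Longrightarrow> realizable (\<lambda>m j r. f m j r + g m j r)"
proof -
  assume "realizable f" "realizable g"
  then obtain a b where a: "a \<in> carrier (qu_alg n q)" "\<forall>m<NN. \<forall>j<2. snd (qu_simple m j) a = diag_fun (2 * m + 1) (f m j)"
    and b: "b \<in> carrier (qu_alg n q)" "\<forall>m<NN. \<forall>j<2. snd (qu_simple m j) b = diag_fun (2 * m + 1) (g m j)"
    unfolding realizable_def by blast
  have "snd (qu_simple m j) (a \<oplus>\<^bsub>qu_alg n q\<^esub> b) = diag_fun (2 * m + 1) (\<lambda>r. f m j r + g m j r)" if "m < NN" "j < 2" for m j
    unfolding qu_modules_add[OF qu_simple_in[OF that(1)] a(1) b(1)] using a(2) b(2) that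
    by (intro eq_matI) (auto simp: diag_fun_index)
  then show ?thesis unfolding realizable_def using a b by (intro bexI[of _ "a \<oplus>\<^bsub>qu_alg n q\<^esub> b"]) auto
qed

lemma realizable_mult: "realizable f \<Longrightarrow> realizable g \<Longrightarrow> realizable (\<lambda>m j r. f m j r * g m j r)"
proof -
  assume "realizable f" "realizable g"
  then obtain a b where a: "a \<in> carrier (qu_alg n q)" "\<forall>m<NN. \<forall>j<2. snd (qu_simple m j) a = diag_fun (2 * m + 1) (f m j)"
    and b: "b \<in> carrier (qu_alg n q)" "\<forall>m<NN. \<forall>j<2. snd (qu_simple m j) b = diag_fun (2 * m + 1) (g m j)"
    unfolding realizable_def by blast
  have "snd (qu_simple m j) (a \<otimes>\<^bsub>qu_alg n q\<^esub> b) = diag_fun (2 * m + 1) (\<lambda>r. f m j r * g m j r)" if "m < NN" "j < 2" for m j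
    unfolding qu_modules_mult[OF qu_simple_in[OF that(1)] a(1) b(1)] using a(2) b(2) that by (simp add: diag_fun_mult)
  then show ?thesis unfolding realizable_def using a b by (intro bexI[of _ "a \<otimes>\<^bsub>qu_alg n q\<^esub> b"]) auto
qed

lemma realizable_const: "realizable (\<lambda>m j r. c)"
  unfolding realizable_def
proof (intro bexI allI impI)
  fix m j :: nat assume "m < NN"
  show "snd (qu_simple m j) (qu_scal n q c) = diag_fun (2 * m + 1) (\<lambda>r. c)"
    unfolding qu_modules_scal[OF qu_simple_in[OF \<open>m < NN\<close>]] by (intro eq_matI) (auto simp: diag_fun_index)
qed simp

lemma realizable_kappa: "realizable (\<lambda>m j r. kap_val m j * (q ^ n) ^ r)"
  unfolding realizable_def
  by (rule bexI[of _ "qu_gen n q gen_kappa"]) (auto simp: mod_gen_def[symmetric] mod_gen_qu_simple)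

lemma realizable_kappa_hat: "realizable (\<lambda>m j r. kap_val m j * (q ^ n) ^ r * (q ^ (2 * m) * inverse q ^ (2 * r)))"
  unfolding realizable_def
  by (rule bexI[of _ "qu_gen n q gen_kappa_hat"]) (auto simp: mod_gen_def[symmetric] mod_gen_qu_simple)

lemma realizable_EF: "realizable (\<lambda>m j r. cc (q ^ (2 * m)) r)"
  unfolding realizable_def
proof (intro bexI allI impI)
  fix m j :: nat assume m: "m < NN"
  let ?d = "2 * m + 1"
  have "snd (qu_simple m j) (qu_gen n q gen_E \<otimes>\<^bsub>qu_alg n q\<^esub> qu_gen n q gen_F) = simple_gen m j gen_E * simple_gen m j gen_F"
    unfolding qu_modules_mult[OF qu_simple_in[OF m] qu_gen_carrier qu_gen_carrier] mod_gen_def[symmetric] mod_gen_qu_simple[OF m] ..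
  also have "\<dots> = diag_fun ?d (cc (q ^ (2 * m)))"
  proof (rule eq_matI)
    fix a b assume "a < dim_row (diag_fun ?d (cc (q ^ (2 * m))))" "b < dim_col (diag_fun ?d (cc (q ^ (2 * m))))"
    then have ab: "a < ?d" "b < ?d" by auto
    have "(simple_gen m j gen_E * simple_gen m j gen_F) $$ (a, b)
      = (\<Sum>i<?d. simple_gen m j gen_E $$ (a, i) * simple_gen m j gen_F $$ (i, b))"
      by (rule times_mat_index[OF simple_gen_carrier simple_gen_carrier ab])
    also have "\<dots> = (\<Sum>i<?d. if Suc i = b then (if a = b then cc (q ^ (2 * m)) b else 0) else 0)"
      using ab by (intro sum.cong) auto
    also have "\<dots> = (if a = b then cc (q ^ (2 * m)) b else 0)"
    proof (cases b)
      case (Suc b')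
      then have "(\<Sum>i<?d. if Suc i = b then (if a = b then cc (q ^ (2 * m)) b else 0) else 0)
        = (\<Sum>i<?d. if i = b' then (if a = b then cc (q ^ (2 * m)) b else 0) else 0)" by (intro sum.cong) auto
      then show ?thesis using ab Suc by simp
    qed simp
    finally show "(simple_gen m j gen_E * simple_gen m j gen_F) $$ (a, b) = diag_fun ?d (cc (q ^ (2 * m))) $$ (a, b)"
      using ab by (simp add: diag_fun_index)
  qed (use simple_gen_carrier[of m j gen_E] simple_gen_carrier[of m j gen_F] in auto)
  finally show "snd (qu_simple m j) (qu_gen n q gen_E \<otimes>\<^bsub>qu_alg n q\<^esub> qu_gen n q gen_F) = diag_fun ?d (cc (q ^ (2 * m)))" .
qed simp

text \<open>Up to a common factor the value is q^(m+1) + q^-m - q - 1. Hence equal values for m and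
  m' force q^m = q^m' or q^(m+m'+1) = 1, and both are excluded for distinct numbers below N.\<close>

lemma cc_middle_inj:
  assumes m: "m < NN" "m' < NN" and e: "cc (q ^ (2 * m)) m = cc (q ^ (2 * m')) m'"
  shows "m = m'"
proof (rule ccontr)
  assume ne: "m \<noteq> m'"
  have c: "(q - 1) * cc (q ^ (2 * m)) m * q ^ m = - (q * ((q ^ m - 1) * (q ^ (m + 1) - 1)))" for m
  proof -
    have e: "q ^ m * ((q - 1) * cc (q ^ (2 * m)) m * q ^ m) = q ^ m * (- (q * ((q ^ m - 1) * (q ^ (m + 1) - 1))))"
      using cc_closed[of m "q ^ (2 * m)"] by (simp add: algebra_simps power_add power_mult power2_eq_square)
    have nz: "q ^ m \<noteq> 0" by simp
    show ?thesis by (rule mult_left_cancel[OF nz, THEN iffD1, OF e])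
  qed
  have "q ^ m' * ((q ^ m - 1) * (q ^ (m + 1) - 1)) = q ^ m * ((q ^ m' - 1) * (q ^ (m' + 1) - 1))"
  proof -
    have "q * (q ^ m' * ((q ^ m - 1) * (q ^ (m + 1) - 1))) = - (((q - 1) * cc (q ^ (2 * m)) m * q ^ m) * q ^ m')"
      unfolding c by simp
    also have "\<dots> = - (((q - 1) * cc (q ^ (2 * m')) m' * q ^ m') * q ^ m)" unfolding e by simp
    also have "\<dots> = q * (q ^ m * ((q ^ m' - 1) * (q ^ (m' + 1) - 1)))" unfolding c by simp
    finally show ?thesis by simp
  qed
  then have "(q ^ m' - q ^ m) * (1 - q ^ (m + m' + 1)) = 0"
    by (simp add: algebra_simps power_add)
  then have "q ^ m' = q ^ m \<or> q ^ (m + m' + 1) = 1" by auto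
  then show False
  proof
    assume "q ^ m' = q ^ m"
    then show False using q_pow_inj[of m' m] m ne by auto
  next
    assume "q ^ (m + m' + 1) = 1"
    then have "2 * NN dvd m + m' + 1" unfolding q_pow_eq_1_iff .
    then show False using m by (auto dest: dvd_imp_le)
  qed
qed

text \<open>The middle vectors are those on which kappa and kappa-hat have the same eigenvalue,
  since m and r differ by less than N. On them kappa is the sign, and EF tells different m apart by
  \<open>cc_middle_inj\<close>.\<close>

lemma realizable_separates:
  assumes p: "m < NN" "j < 2" "r \<le> 2 * m" and p0: "m0 < NN" "j0 < 2" and ne: "(m, j, r) \<noteq> (m0, j0, m0)"
  obtains f where "realizable f" "f m j r \<noteq> f m0 j0 m0"
proof (rule ccontr)
  assume "\<not> thesis"
  then have "\<forall>f. realizable f \<longrightarrow> f m j r = f m0 j0 m0" using that by blast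
  then have eq: "f m j r = f m0 j0 m0" if "realizable f" for f using that by blast
  have Qp: "kap_val m j * (q ^ n) ^ m = (- 1) ^ j" for m j by (simp add: kap_val_def flip: power_mult_distrib)
  have k: "kap_val m j * (q ^ n) ^ r = kap_val m0 j0 * (q ^ n) ^ m0" using eq[OF realizable_kappa] .
  have one: "q ^ (2 * m) * inverse q ^ (2 * m) = 1" for m by (simp flip: power_mult_distrib)
  have "kap_val m j * (q ^ n) ^ r * (q ^ (2 * m) * inverse q ^ (2 * r)) = kap_val m0 j0 * (q ^ n) ^ m0"
    using eq[OF realizable_kappa_hat] one[of m0] by simp
  then have "q ^ (2 * m) * inverse q ^ (2 * r) = 1" unfolding k[symmetric] by simp
  then have "q ^ (2 * m) = q ^ (2 * r)" by (simp add: field_simps)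
  then have rm: "r = m"
  proof (cases "r \<le> m")
    case True
    then show ?thesis using q_pow_inj[of "2 * m" "2 * r"] \<open>q ^ (2 * m) = q ^ (2 * r)\<close> p by simp
  next
    case False
    then have "2 * m + 2 * (r - m) = 2 * r" by simp
    then have "q ^ (2 * m) * q ^ (2 * (r - m)) = q ^ (2 * r)" by (simp only: flip: power_add)
    then have "q ^ (2 * m) * q ^ (2 * (r - m)) = q ^ (2 * m) * 1"
      using \<open>q ^ (2 * m) = q ^ (2 * r)\<close> by simp
    then have "q ^ (2 * (r - m)) = 1" by simp
    then have "NN dvd r - m" unfolding q_pow_eq_1_iff by simp
    then show ?thesis using False p by (auto dest: dvd_imp_le)
  qed
  have "(- 1) ^ j = ((- 1) ^ j0 :: 'k)" using k unfolding rm Qp .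
  then have j: "j = j0" using p p0 by (cases j; cases j0) auto
  have "m = m0" using cc_middle_inj[OF p(1) p0(1)] eq[OF realizable_EF] unfolding rm by simp
  then show False using ne rm j by simp
qed

text \<open>Lagrange interpolation: one factor per point of \<open>S\<close>, vanishing at that
  point and normalised by c to be 1 at the middle vector.\<close>

lemma realizable_delta:
  assumes p0: "m0 < NN" "j0 < 2" and S: "finite S" "S \<subseteq> {(m, j, r). m < NN \<and> j < 2 \<and> r \<le> 2 * m}" "(m0, j0, m0) \<notin> S"
  shows "\<exists>f. realizable f \<and> f m0 j0 m0 = 1 \<and> (\<forall>(m, j, r)\<in>S. f m j r = 0)"
  using S
proof (induction S rule: finite_induct)
  case empty
  show ?case using realizable_const[of 1] by auto
next
  case (insert p S)
  obtain m j r where p: "p = (m, j, r)" by (cases p) auto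
  obtain f where f: "realizable f" "f m0 j0 m0 = 1" "\<forall>(m, j, r)\<in>S. f m j r = 0" using insert by auto
  obtain g where g: "realizable g" "g m j r \<noteq> g m0 j0 m0"
    using realizable_separates[of m j r m0 j0] insert.prems p0 p by auto
  define c where "c = inverse (g m0 j0 m0 - g m j r)"
  have "realizable (\<lambda>a b s. f a b s * (c * (g a b s + - g m j r)))"
    by (intro realizable_mult realizable_add realizable_const f g)
  moreover have "c * (g m0 j0 m0 + - g m j r) = 1" using g(2) by (simp add: c_def)
  ultimately show ?case using f p by (intro exI[of _ "\<lambda>a b s. f a b s * (c * (g a b s + - g m j r))"]) auto
qed

text \<open>Every S_{m,j} has exactly one middle vector, r = m. A function that is 1 at the middle
  vector of the chosen module and 0 at all other basis vectors of all simple modules has the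
  required traces.\<close>

lemma dual_element:
  assumes p0: "m0 < NN" "j0 < 2"
  obtains a where "a \<in> carrier (qu_alg n q)"
    "\<And>m j. m < NN \<Longrightarrow> j < 2 \<Longrightarrow> mat_trace (snd (qu_simple m j) a) = (if m = m0 \<and> j = j0 then 1 else 0)"
proof -
  define S where "S = {(m, j, r). m < NN \<and> j < 2 \<and> r \<le> 2 * m} - {(m0, j0, m0)}"
  have "{(m, j :: nat, r). m < NN \<and> j < 2 \<and> r \<le> 2 * m} \<subseteq> {..<NN} \<times> {..<2::nat} \<times> {..2 * NN}" by auto
  then have "finite {(m, j :: nat, r). m < NN \<and> j < 2 \<and> r \<le> 2 * m}" by (rule finite_subset) auto
  then have "finite S" by (simp add: S_def)
  then obtain f where f: "realizable f" "f m0 j0 m0 = 1" "\<forall>(m, j, r)\<in>S. f m j r = 0"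
    using realizable_delta[OF p0, of S] by (auto simp: S_def)
  obtain a where a: "a \<in> carrier (qu_alg n q)" "\<forall>m<NN. \<forall>j<2. snd (qu_simple m j) a = diag_fun (2 * m + 1) (f m j)"
    using f(1) unfolding realizable_def by blast
  show thesis
  proof (rule that[OF a(1)])
    fix m j :: nat assume mj: "m < NN" "j < 2"
    have v: "f m j r = (if m = m0 \<and> j = j0 \<and> r = m0 then 1 else 0)" if "r < 2 * m + 1" for r
      using f(2,3) mj that by (force simp: S_def)
    have "mat_trace (snd (qu_simple m j) a) = (\<Sum>r<2 * m + 1. f m j r)"
      using a(2) mj by (simp add: mat_trace_diag_fun)
    also have "\<dots> = (\<Sum>r<2 * m + 1. if r = m0 then (if m = m0 \<and> j = j0 then 1 else 0) else 0)"
      by (intro sum.cong) (auto simp: v)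
    finally show "mat_trace (snd (qu_simple m j) a) = (if m = m0 \<and> j = j0 then 1 else 0)" by auto
  qed
qed

section \<open>The classes of the simple modules as a basis\<close>

definition simple_frag :: "(nat \<Rightarrow> nat \<Rightarrow> int) \<Rightarrow> ('k qu_module \<Rightarrow>\<^sub>0 int)" where
  "simple_frag c = (\<Sum>m<NN. \<Sum>j<2. frag_cmul (c m j) (frag_of (qu_simple m j)))"

lemma simple_frag_diff: "simple_frag (\<lambda>m j. c m j - c' m j) = simple_frag c - simple_frag c'"
  by (simp add: simple_frag_def frag_cmul_diff_distrib sum_subtractf)

lemma simple_frag_add: "simple_frag (\<lambda>m j. c m j + c' m j) = simple_frag c + simple_frag c'"
  by (simp add: simple_frag_def frag_cmul_distrib sum.distrib)

lemma simple_frag_single: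
  assumes "m < NN" "j < 2"
  shows "simple_frag (\<lambda>m' j'. if m' = m \<and> j' = j then 1 else 0) = frag_of (qu_simple m j)"
proof -
  have "simple_frag (\<lambda>m' j'. if m' = m \<and> j' = j then 1 else 0)
    = (\<Sum>m'<NN. if m' = m then frag_of (qu_simple m j) else 0)"
    unfolding simple_frag_def
  proof (intro sum.cong refl)
    fix m'
    show "(\<Sum>j'<2. frag_cmul (if m' = m \<and> j' = j then 1 else 0) (frag_of (qu_simple m' j')))
      = (if m' = m then frag_of (qu_simple m j) else 0)"
      using assms(2) by (cases "m' = m") (auto simp: numeral_2_eq_2 less_Suc_eq)
  qed
  then show ?thesis using assms by simp
qed

text \<open>The trace of the dual element vanishes on the relations and returns a single coefficient
  as an element of the field; characteristic zero then makes the integer zero.\<close>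

lemma simple_frag_independent:
  assumes "simple_frag c \<in> ses_subgroup n q" "m < NN" "j < 2"
  shows "c m j = 0"
proof -
  obtain a where a: "a \<in> carrier (qu_alg n q)"
    "\<And>m' j'. m' < NN \<Longrightarrow> j' < 2 \<Longrightarrow> mat_trace (snd (qu_simple m' j') a) = (if m' = m \<and> j' = j then 1 else 0)"
    using dual_element[OF assms(2,3)] by blast
  have "0 = trace_frag a (simple_frag c)" using trace_frag_ses[OF a(1) assms(1)] by simp
  also have "\<dots> = (\<Sum>m'<NN. \<Sum>j'<2. of_int (c m' j') * (if m' = m \<and> j' = j then 1 else 0))"
    unfolding simple_frag_def trace_frag_sum trace_frag_cmul_of by (intro sum.cong refl) (auto simp: a(2))
  also have "\<dots> = (\<Sum>m'<NN. if m' = m then of_int (c m j) else 0)"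
  proof (intro sum.cong refl)
    fix m'
    show "(\<Sum>j'<2. of_int (c m' j') * (if m' = m \<and> j' = j then 1 else 0)) = (if m' = m then of_int (c m j) else (0 :: 'k))"
      using assms(3) by (cases "m' = m") (auto simp: numeral_2_eq_2 less_Suc_eq)
  qed
  finally show ?thesis using assms(2) by simp
qed

lemma qu_module_induct [consumes 1, case_names zero simple extension]:
  assumes M: "M \<in> qu_modules n q"
    and zero: "\<And>M. M \<in> qu_modules n q \<Longrightarrow> fst M = 0 \<Longrightarrow> P M"
    and simple: "\<And>m j. m < NN \<Longrightarrow> j < 2 \<Longrightarrow> P (qu_simple m j)"
    and ext: "\<And>L M N. L \<in> qu_modules n q \<Longrightarrow> M \<in> qu_modules n q \<Longrightarrow> N \<in> qu_modules n q \<Longrightarrow>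
      qu_short_exact n q L M N \<Longrightarrow> P L \<Longrightarrow> P N \<Longrightarrow> P M"
  shows "P M"
  using M
proof (induction "fst M" arbitrary: M rule: less_induct)
  case less
  show ?case
  proof (cases "fst M = 0")
    case False
    have h: "homogeneous 0 (\<lambda>_. 0) M" by (simp add: homogeneous_def hom_mat_def)
    have d: "fst M > 0" using False by simp
    obtain m j M' where m: "m < NN" "j < 2" "M' \<in> qu_modules n q" "fst M = 2 * m + 1 + fst M'"
      "qu_short_exact n q (qu_simple m j) M M'" by (rule composition_step[OF less.prems d h]) blast
    have "P M'" using less.hyps[OF _ m(3)] m(4) by simp
    then show ?thesis using ext[OF qu_simple_in[OF m(1)] less.prems m(3,5) simple[OF m(1,2)]] by simp
  qed (rule zero[OF less.prems])
qed

lemma simple_frag_0: "simple_frag (\<lambda>m j. 0) = 0"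
  by (simp add: simple_frag_def)

lemma simple_frag_span_module: "M \<in> qu_modules n q \<Longrightarrow> \<exists>c. frag_of M - simple_frag c \<in> ses_subgroup n q"
proof (induction M rule: qu_module_induct)
  case (zero M)
  then show ?case using ses_zero_module[OF zero] by (intro exI[of _ "\<lambda>m j. 0"]) (simp add: simple_frag_0)
next
  case (simple m j)
  then show ?case
    by (intro exI[of _ "\<lambda>m' j'. if m' = m \<and> j' = j then 1 else 0"]) (simp add: simple_frag_single ses_0)
next
  case (extension L M N)
  then obtain c c' where c: "frag_of L - simple_frag c \<in> ses_subgroup n q" "frag_of N - simple_frag c' \<in> ses_subgroup n q"
    by blast
  have "frag_of M - simple_frag (\<lambda>m j. c m j + c' m j)
    = (frag_of M - frag_of L - frag_of N) + ((frag_of L - simple_frag c) + (frag_of N - simple_frag c'))"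
    unfolding simple_frag_add by simp
  moreover have "\<dots> \<in> ses_subgroup n q" by (rule ses_add[OF ses_short_exact[OF extension(1-4)] ses_add[OF c]])
  ultimately show ?case by (intro exI[of _ "\<lambda>m j. c m j + c' m j"]) (simp only:)
qed

lemma simple_frag_span: "Poly_Mapping.keys x \<subseteq> qu_modules n q \<Longrightarrow> \<exists>c. x - simple_frag c \<in> ses_subgroup n q"
proof (induction x rule: frag_induction)
  case zero
  then show ?case using ses_0 by (intro exI[of _ "\<lambda>m j. 0"]) (simp add: simple_frag_0)
next
  case (diff x y)
  then obtain c c' where c: "x - simple_frag c \<in> ses_subgroup n q" "y - simple_frag c' \<in> ses_subgroup n q" by blast
  have "x - y - simple_frag (\<lambda>m j. c m j - c' m j) = (x - simple_frag c) - (y - simple_frag c')"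
    unfolding simple_frag_diff by simp
  moreover have "\<dots> \<in> ses_subgroup n q" by (rule ses_diff[OF c])
  ultimately show ?case by (intro exI[of _ "\<lambda>m j. c m j - c' m j"]) (simp only:)
qed (rule simple_frag_span_module)

end

section \<open>The polynomials and the defining ideal\<close>

definition yvar :: "int poly poly" where "yvar = gvar * xvar"

text \<open>With \<open>yvar - 1\<close> in the role of t + 1/t these are t^m + ... + t^-m, the
  characters of the odd-dimensional representations of SL2. In the variable (y - 1)/2 they are the
  Chebyshev polynomials of the fourth kind.\<close>

fun U_poly :: "nat \<Rightarrow> int poly poly" where
  "U_poly 0 = 1"
| "U_poly (Suc 0) = yvar"
| "U_poly (Suc (Suc m)) = (yvar - 1) * U_poly (Suc m) - U_poly m"

text \<open>$U_{-i-1} = -U_i$ is the extension to negative indices compatible with the recursion.\<close>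

definition U_int :: "int \<Rightarrow> int poly poly" where
  "U_int i = (if i \<ge> 0 then U_poly (nat i) else - U_poly (nat (- i - 1)))"

lemma U_int_of_nat [simp]: "U_int (int m) = U_poly m"
  by (simp add: U_int_def)

lemma U_int_reflect: "U_int (- i - 1) = - U_int i"
  by (auto simp: U_int_def)

lemma U_int_rec_nat: "U_int (int m + 1) + U_int (int m - 1) = (yvar - 1) * U_int (int m)"
proof (cases m)
  case 0
  then show ?thesis by (simp add: U_int_def)
next
  case (Suc k)
  have "U_int (int m + 1) = U_poly (Suc (Suc k))" "U_int (int m - 1) = U_poly k"
    using U_int_of_nat[of "Suc (Suc k)"] U_int_of_nat[of k] by (simp_all add: Suc algebra_simps)
  then show ?thesis using U_int_of_nat[of "Suc k"] by (simp add: Suc)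
qed

lemma U_int_rec: "U_int (i + 1) + U_int (i - 1) = (yvar - 1) * U_int i"
proof (cases "i \<ge> 0")
  case True
  then show ?thesis using U_int_rec_nat[of "nat i"] by simp
next
  case False
  define k where "k = nat (- i - 1)"
  have i: "i = - int k - 1" using False by (simp add: k_def)
  have 1: "U_int (i + 1) = - U_int (int k - 1)" using U_int_reflect[of "int k - 1"] by (simp add: i)
  have 2: "U_int (i - 1) = - U_int (int k + 1)" using U_int_reflect[of "int k + 1"] by (simp add: i algebra_simps)
  have 3: "U_int i = - U_int (int k)" using U_int_reflect[of "int k"] by (simp add: i)
  have "U_int (i + 1) + U_int (i - 1) = - (U_int (int k + 1) + U_int (int k - 1))" unfolding 1 2 by simp
  also have "\<dots> = (yvar - 1) * U_int i" unfolding U_int_rec_nat 3 by simp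
  finally show ?thesis .
qed

text \<open>Twice the class assigned to a weight of degree \<open>i\<close>, symmetric under \<open>i \<mapsto> - i\<close>.\<close>

definition wt_poly :: "int \<Rightarrow> int poly poly" where
  "wt_poly i = U_int i - U_int (i - 1)"

lemma sum_wt_poly: "(\<Sum>r<k. wt_poly (c - int r)) = U_int c - U_int (c - int k)"
  by (induction k) (simp_all add: wt_poly_def algebra_simps)

text \<open>The Clebsch-Gordan rule. For m > l the indices run below zero, where the reflection of
  \<open>U_int\<close> cancels the excess terms. The induction follows the recursion of
  \<open>U_poly\<close> in m.\<close>

lemma sum_U_int: "(\<Sum>r<2 * m + 1. U_int (l + int m - int r)) = U_poly m * U_int l"
proof (induction m arbitrary: l rule: U_poly.induct)
  case 2
  have "U_int (l + 1) + U_int (l - 1) = (yvar - 1) * U_int l" by (rule U_int_rec)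
  then show ?case by (simp add: numeral_3_eq_3 algebra_simps)
next
  case (3 m)
  let ?S = "\<lambda>k c. (\<Sum>r<k. U_int (c - int r))"
  have IH1: "?S (2 * Suc m + 1) (l + int (Suc m)) = U_poly (Suc m) * U_int l" for l using "3.IH"(1) .
  have IH2: "?S (2 * m + 1) (l + int m) = U_poly m * U_int l" using "3.IH"(2) .
  have "(yvar - 1) * ?S (2 * Suc m + 1) (l + int (Suc m)) = ?S (2 * m + 3) (l + int m + 2) + ?S (2 * m + 3) (l + int m)"
    unfolding sum_distrib_left sum.distrib[symmetric]
  proof (rule sum.cong)
    fix r
    have e: "l + int (Suc m) - int r + 1 = l + int m + 2 - int r" "l + int (Suc m) - int r - 1 = l + int m - int r" by simp_all
    show "(yvar - 1) * U_int (l + int (Suc m) - int r) = U_int (l + int m + 2 - int r) + U_int (l + int m - int r)"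
      using U_int_rec[of "l + int (Suc m) - int r"] unfolding e by (rule sym)
  qed simp
  also have "?S (2 * m + 3) (l + int m) = ?S (2 * m + 1) (l + int m) + U_int (l - int m - 1) + U_int (l - int m - 2)"
    by (simp add: numeral_3_eq_3 algebra_simps)
  finally have "?S (2 * m + 3) (l + int m + 2) + U_int (l - int m - 1) + U_int (l - int m - 2)
     = (yvar - 1) * (U_poly (Suc m) * U_int l) - U_poly m * U_int l"
    unfolding IH1 IH2 by (simp add: algebra_simps)
  moreover have "?S (2 * Suc (Suc m) + 1) (l + int (Suc (Suc m))) = ?S (2 * m + 3) (l + int m + 2) + U_int (l - int m - 1) + U_int (l - int m - 2)"
  proof -
    have "2 * Suc (Suc m) + 1 = Suc (Suc (2 * m + 3))" by simp
    then show ?thesis by (simp only: sum.lessThan_Suc) (simp add: algebra_simps)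
  qed
  ultimately show ?case by (simp add: algebra_simps)
qed simp

text \<open>The inner sum telescopes; after reflection it is U_{l+m-r} + U_{l-m+r}. Replacing r by
  2m - r exchanges the two parts, and each adds up to the Clebsch-Gordan sum.\<close>

lemma sum_wt_poly_product:
  "(\<Sum>r<2 * m + 1. \<Sum>t<2 * l + 1. wt_poly (int m - int r + (int l - int t))) = 2 * (U_poly m * U_poly l)"
proof -
  have "(\<Sum>t<2 * l + 1. wt_poly (int m - int r + (int l - int t))) = U_int (int l + int m - int r) + U_int (int l + int r - int m)" for r
  proof -
    have "(\<Sum>t<2 * l + 1. wt_poly (int m - int r + (int l - int t))) = U_int (int m - int r + int l) - U_int (int m - int r + int l - int (2 * l + 1))"
      using sum_wt_poly[where c = "int m - int r + int l" and k = "2 * l + 1"] by (simp add: algebra_simps)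
    also have "U_int (int m - int r + int l - int (2 * l + 1)) = - U_int (int l + int r - int m)"
      using U_int_reflect[of "int l + int r - int m"] by (simp add: algebra_simps)
    finally show ?thesis by (simp add: algebra_simps)
  qed
  then have "(\<Sum>r<2 * m + 1. \<Sum>t<2 * l + 1. wt_poly (int m - int r + (int l - int t)))
    = (\<Sum>r<2 * m + 1. U_int (int l + int m - int r)) + (\<Sum>r<2 * m + 1. U_int (int l + int r - int m))"
    by (simp only: sum.distrib)
  also have "(\<Sum>r<2 * m + 1. U_int (int l + int r - int m)) = (\<Sum>r<2 * m + 1. U_int (int l + int m - int r))"
    by (rule sum.reindex_bij_witness[where i = "\<lambda>r. 2 * m - r" and j = "\<lambda>r. 2 * m - r"]) (auto simp: of_nat_diff algebra_simps)
  finally show ?thesis unfolding sum_U_int by simp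
qed

section \<open>A three-term recursion for \<open>fpoly\<close>\<close>

lemma fpoly_mod2: "fpoly m (j + 2) = fpoly m j"
proof (induction m j rule: fpoly.induct)
  case (4 m' j)
  have 1: "fpoly (Suc (Suc m') - l) (j + 2 + l + 1) = fpoly (Suc (Suc m') - l) (j + l + 1)"
    if "l \<in> {1..Suc (Suc m') - 1}" for l
    using "4.IH"(2)[OF refl that] by (simp add: add_ac)
  have 2: "fpoly (Suc (Suc m')) (j + 2 + 1) = fpoly (Suc (Suc m')) (j + 1)"
    using "4.IH"(1)[OF refl] by (simp add: add_ac)
  have 3: "(\<Sum>l = 1..Suc (Suc m') - 1. of_int (c l) * fpoly (Suc (Suc m') - l) (j + 2 + l + 1))
    = (\<Sum>l = 1..Suc (Suc m') - 1. of_int (c l) * fpoly (Suc (Suc m') - l) (j + l + 1))" for c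
    by (rule sum.cong) (simp_all only: 1)
  have 4: "fpoly 0 (j + 2 + Suc (Suc m') + 1) = fpoly 0 (j + Suc (Suc m') + 1)" "(j + 2) mod 2 = j mod 2" by simp_all
  show ?case
    unfolding fpoly.simps(4) Let_def 2 3 4 ..
qed auto

text \<open>Puts the recursive clause and the base case into one uniform sum: the first and last
  coefficients, listed separately in the definition, are values of \<open>acoef\<close> as
  well.\<close>

lemma fpoly_expand:
  "fpoly (Suc (Suc m)) j = xvar ^ (m + 2) * gvar ^ (j mod 2)
     - (\<Sum>l = 1..m + 2. of_int (acoef (Suc (Suc m)) l) * fpoly (m + 2 - l) (j + l))"
proof (cases m)
  case 0
  have S: "(\<Sum>l = 1..2. g l) = g 1 + g 2" for g :: "nat \<Rightarrow> int poly poly"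
    by (simp add: numeral_2_eq_2)
  show ?thesis
    unfolding 0 add_0 S
  proof (cases "even j")
    case True
    then have "j mod 2 = 0" by auto
    then show "fpoly (Suc (Suc 0)) j = xvar ^ 2 * gvar ^ (j mod 2)
        - (of_int (acoef (Suc (Suc 0)) 1) * fpoly (2 - 1) (j + 1) + of_int (acoef (Suc (Suc 0)) 2) * fpoly (2 - 2) (j + 2))"
      using True by (simp add: power2_eq_square algebra_simps)
  next
    case False
    then have "j mod 2 = 1" by presburger
    then show "fpoly (Suc (Suc 0)) j = xvar ^ 2 * gvar ^ (j mod 2)
        - (of_int (acoef (Suc (Suc 0)) 1) * fpoly (2 - 1) (j + 1) + of_int (acoef (Suc (Suc 0)) 2) * fpoly (2 - 2) (j + 2))"
      using False by (simp add: power2_eq_square algebra_simps)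
  qed
next
  case (Suc k)
  let ?a = "acoef (Suc (Suc k))" let ?b = "acoef (Suc (Suc (Suc k)))"
  have "(\<Sum>l = 1..k + 3. of_int (?b l) * fpoly (k + 3 - l) (j + l))
    = of_int (?b 1) * fpoly (k + 2) (j + 1) + (\<Sum>l = 2..k + 3. of_int (?b l) * fpoly (k + 3 - l) (j + l))"
    by (subst sum.atLeast_Suc_atMost) (auto simp: numeral_2_eq_2)
  also have "(\<Sum>l = 2..k + 3. of_int (?b l) * fpoly (k + 3 - l) (j + l))
    = (\<Sum>l = 1..k + 2. of_int (?b (Suc l)) * fpoly (k + 2 - l) (j + l + 1))"
  proof (rule sum.reindex_bij_witness[where i = Suc and j = "\<lambda>l. l - 1"])
    fix l assume "l \<in> {2..k + 3}"
    then obtain i where "l = Suc i" "1 \<le> i" by (cases l) auto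
    then show "of_int (?b (Suc (l - 1))) * fpoly (k + 2 - (l - 1)) (j + (l - 1) + 1) = of_int (?b l) * fpoly (k + 3 - l) (j + l)"
      by (simp add: numeral_3_eq_3 numeral_2_eq_2 del: acoef.simps fpoly.simps)
  qed auto
  also have "\<dots> = (\<Sum>l = 1..k + 1. of_int (?b (Suc l)) * fpoly (k + 2 - l) (j + l + 1)) + of_int (?b (k + 3)) * fpoly 0 (j + k + 3)"
    by (simp del: acoef.simps fpoly.simps add: add_ac numeral_3_eq_3)
  also have "(\<Sum>l = 1..k + 1. of_int (?b (Suc l)) * fpoly (k + 2 - l) (j + l + 1))
     = (\<Sum>l = 1..k + 1. of_int (?a (l - 1) + ?a l + ?a (l + 1)) * fpoly (k + 2 - l) (j + l + 1))"
    by (rule sum.cong) (auto simp: Let_def simp del: fpoly.simps acoef.simps(3))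
  finally have s: "(\<Sum>l = 1..k + 3. of_int (?b l) * fpoly (k + 3 - l) (j + l))
     = of_int (?b 1) * fpoly (k + 2) (j + 1)
      + ((\<Sum>l = 1..k + 1. of_int (?a (l - 1) + ?a l + ?a (l + 1)) * fpoly (k + 2 - l) (j + l + 1))
      + of_int (?b (k + 3)) * fpoly 0 (j + k + 3))" .
  have b1: "?b 1 = 1 + ?a 1" and bl: "?b (k + 3) = ?a (Suc k)"
    by (simp_all add: Let_def del: acoef.simps(3))
  have "fpoly (Suc (Suc m)) j = xvar ^ (k + 3) * gvar ^ (j mod 2) - of_int (1 + ?a 1) * fpoly (k + 2) (j + 1)
      - (\<Sum>l = 1..k + 1. of_int (?a (l - 1) + ?a l + ?a (l + 1)) * fpoly (k + 2 - l) (j + l + 1))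
      - of_int (?a (Suc k)) * fpoly 0 (j + k + 3)"
    unfolding Suc fpoly.simps(4) Let_def by (simp add: numeral_3_eq_3 del: fpoly.simps acoef.simps)
  then show ?thesis
    using s unfolding b1 bl by (simp add: Suc numeral_3_eq_3 algebra_simps del: fpoly.simps acoef.simps)
qed

text \<open>Summation by parts: the left side is sorted by h, the right side by a. The coefficients
  on the left are those of the recursion for \<open>acoef\<close>.\<close>

lemma coef_shift_sum:
  fixes a h :: "nat \<Rightarrow> 'a::comm_ring_1"
  shows "(a 0 + a 1) * h 1 + (\<Sum>l = 2..Suc M. (a (l - 2) + a (l - 1) + a l) * h l) + a M * h (Suc (Suc M))
    = (\<Sum>l = 1..M. a l * (h l + h (l + 1) + h (l + 2))) + a (Suc M) * h (Suc M) + a 0 * (h 1 + h 2)"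
proof (induction M)
  case 0
  then show ?case by (simp add: algebra_simps numeral_2_eq_2)
next
  case (Suc M)
  have "(\<Sum>l = 2..Suc (Suc M). (a (l - 2) + a (l - 1) + a l) * h l)
    = (\<Sum>l = 2..Suc M. (a (l - 2) + a (l - 1) + a l) * h l) + (a M + a (Suc M) + a (Suc (Suc M))) * h (Suc (Suc M))"
    by simp
  moreover have "(\<Sum>l = 1..Suc M. a l * (h l + h (l + 1) + h (l + 2)))
    = (\<Sum>l = 1..M. a l * (h l + h (l + 1) + h (l + 2))) + a (Suc M) * (h (Suc M) + h (Suc (Suc M)) + h (Suc (Suc (Suc M))))"
    by simp
  ultimately show ?case using Suc by (simp add: algebra_simps)
qed

lemma acoef_0: "acoef (Suc (Suc k)) 0 = 1"
  by (cases k) (auto simp: Let_def)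

text \<open>Multiply the expansion of one polynomial by x and apply the rule inductively to all
  lower ones. The recursion of \<open>acoef\<close> is exactly what this multiplication produces, so
  by \<open>coef_shift_sum\<close> the result differs from the expansion of the next polynomial only
  by the two terms \<open>h 1\<close> and \<open>h 2\<close>.\<close>

lemma fpoly_rec: "fpoly (Suc (Suc m)) j = xvar * fpoly (Suc m) j - fpoly (Suc m) (j + 1) - fpoly m j"
proof (induction m arbitrary: j rule: less_induct)
  case (less m)
  show ?case
  proof (cases m)
    case 0
    then show ?thesis by (cases "even j") (auto simp: power2_eq_square algebra_simps)
  next
    case (Suc k)
    define M where "M = Suc k"
    define a where "a = (\<lambda>l. of_int (acoef (Suc M) l) :: int poly poly)"
    define h where "h = (\<lambda>l. fpoly (M + 2 - l) (j + l))"
    have xf: "xvar * fpoly (M + 1 - l) (j + l) = h l + h (l + 1) + h (l + 2)" if "l \<in> {1..M}" for l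
    proof -
      have "M - l < m" "M + 2 - l = Suc (Suc (M - l))" "M + 1 - l = Suc (M - l)" using that by (auto simp: Suc M_def)
      then show ?thesis using less(1)[of "M - l" "j + l"] fpoly_mod2[of "M - l" "j + l"] by (simp add: h_def algebra_simps del: fpoly.simps)
    qed
    \<comment> \<open>The three-term rule stops at the bottom, where x f_0 = f_2 in the doubled
      indexing; this produces the irregular last coefficients.\<close>
    have xf0: "xvar * fpoly 0 (j + Suc M) = h (Suc M)" by (auto simp: h_def)
    have "xvar * fpoly (Suc M) j = xvar ^ (M + 2) * gvar ^ (j mod 2)
        - (\<Sum>l = 1..Suc M. a l * (xvar * fpoly (M + 1 - l) (j + l)))"
      using fpoly_expand[of k j] by (simp add: M_def a_def right_diff_distrib sum_distrib_left mult_ac del: fpoly.simps acoef.simps sum.cl_ivl_Suc)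
    also have "(\<Sum>l = 1..Suc M. a l * (xvar * fpoly (M + 1 - l) (j + l)))
      = (\<Sum>l = 1..M. a l * (xvar * fpoly (M + 1 - l) (j + l))) + a (Suc M) * h (Suc M)"
      using xf0 by (simp del: fpoly.simps)
    also have "(\<Sum>l = 1..M. a l * (xvar * fpoly (M + 1 - l) (j + l))) = (\<Sum>l = 1..M. a l * (h l + h (l + 1) + h (l + 2)))"
      by (rule sum.cong) (simp_all only: xf)
    finally have 1: "xvar * fpoly (Suc M) j = xvar ^ (M + 2) * gvar ^ (j mod 2)
       - ((\<Sum>l = 1..M. a l * (h l + h (l + 1) + h (l + 2))) + a (Suc M) * h (Suc M))" .
    have a': "of_int (acoef (Suc (Suc M)) l) = (if l = 1 then a 0 + a 1 else if l \<le> Suc M then a (l - 2) + a (l - 1) + a l else a M)"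
      if "l \<in> {1..M + 2}" for l
      using that by (auto simp: a_def M_def Let_def acoef_0)
    have a0: "a 0 = 1" by (cases k) (auto simp: a_def M_def Let_def)
    have "fpoly (Suc (Suc M)) j = xvar ^ (M + 2) * gvar ^ (j mod 2) - (\<Sum>l = 1..M + 2. of_int (acoef (Suc (Suc M)) l) * h l)"
      using fpoly_expand[of M j] by (simp add: h_def del: fpoly.simps acoef.simps)
    also have "(\<Sum>l = 1..M + 2. of_int (acoef (Suc (Suc M)) l) * h l)
      = (\<Sum>l = 1..M + 2. (if l = 1 then a 0 + a 1 else if l \<le> Suc M then a (l - 2) + a (l - 1) + a l else a M) * h l)"
      by (rule sum.cong) (simp_all only: a')
    also have "\<dots> = (a 0 + a 1) * h 1 + (\<Sum>l = 2..Suc M. (a (l - 2) + a (l - 1) + a l) * h l) + a M * h (Suc (Suc M))"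
    proof -
      have "{1..M + 2} = insert 1 (insert (Suc (Suc M)) {2..Suc M})" by auto
      moreover have "(\<Sum>l = 2..Suc M. (if l = 1 then a 0 + a 1 else if l \<le> Suc M then a (l - 2) + a (l - 1) + a l else a M) * h l)
        = (\<Sum>l = 2..Suc M. (a (l - 2) + a (l - 1) + a l) * h l)"
        by (rule sum.cong) auto
      ultimately show ?thesis by (simp add: add_ac del: sum.cl_ivl_Suc)
    qed
    also have "\<dots> = (\<Sum>l = 1..M. a l * (h l + h (l + 1) + h (l + 2))) + a (Suc M) * h (Suc M) + a 0 * (h 1 + h 2)"
      by (rule coef_shift_sum)
    finally have "fpoly (Suc (Suc M)) j = xvar * fpoly (Suc M) j - (h 1 + h 2)"
      unfolding 1 a0 by (simp add: algebra_simps)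
    moreover have "h 1 = fpoly (Suc M) (j + 1)" "h 2 = fpoly M j"
      using fpoly_mod2[of M j] by (simp_all add: h_def del: fpoly.simps)
    ultimately show ?thesis by (simp add: Suc M_def algebra_simps del: fpoly.simps)
  qed
qed

lemma gvar_even_power: "(gvar ^ 2 - 1) dvd (1 - gvar ^ (2 * k))"
proof (induction k)
  case (Suc k)
  have "1 - gvar ^ (2 * Suc k) = gvar ^ 2 * (1 - gvar ^ (2 * k)) - (gvar ^ 2 - 1)"
    by (simp add: algebra_simps power2_eq_square)
  then show ?case using Suc by (simp only: dvd_diff dvd_mult dvd_refl)
qed simp

text \<open>With y = gx, substituting g^(m+j) U_m into \<open>fpoly_rec\<close> gives the recursion
  of \<open>U_poly\<close> up to a multiple of g^2 - 1.\<close>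

lemma fpoly_dvd: "(gvar ^ 2 - 1) dvd (fpoly m j - gvar ^ (m + j) * U_poly m)"
proof (induction m arbitrary: j rule: U_poly.induct)
  case (1 j)
  show ?case
  proof (cases "even j")
    case True
    then obtain k where "j = 2 * k" by (auto elim: evenE)
    then show ?thesis using gvar_even_power[of k] by simp
  next
    case False
    then obtain k where "j = 2 * k + 1" by (auto elim: oddE)
    then have "fpoly 0 j - gvar ^ (0 + j) * U_poly 0 = gvar * (1 - gvar ^ (2 * k))" by (simp add: algebra_simps)
    then show ?thesis using gvar_even_power[of k] by simp
  qed
next
  case (2 j)
  show ?case
  proof (cases "even j")
    case True
    then obtain k where "j = 2 * k" by (auto elim: evenE)
    then have "fpoly (Suc 0) j - gvar ^ (Suc 0 + j) * U_poly (Suc 0) = xvar * (1 - gvar ^ (2 * (k + 1)))" by (simp add: yvar_def algebra_simps)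
    then show ?thesis using gvar_even_power[of "k + 1"] by (simp only: dvd_mult)
  next
    case False
    then obtain k where "j = 2 * k + 1" by (auto elim: oddE)
    then have "fpoly (Suc 0) j - gvar ^ (Suc 0 + j) * U_poly (Suc 0) = xvar * gvar * (1 - gvar ^ (2 * (k + 1)))" by (simp add: yvar_def algebra_simps)
    then show ?thesis using gvar_even_power[of "k + 1"] by (simp only: dvd_mult)
  qed
next
  case (3 m j)
  have "fpoly (Suc (Suc m)) j - gvar ^ (Suc (Suc m) + j) * U_poly (Suc (Suc m))
    = xvar * (fpoly (Suc m) j - gvar ^ (Suc m + j) * U_poly (Suc m)) - (fpoly (Suc m) (j + 1) - gvar ^ (Suc m + (j + 1)) * U_poly (Suc m))
      - (fpoly m j - gvar ^ (m + j) * U_poly m) + (gvar ^ 2 - 1) * (gvar ^ (m + j) * U_poly m - xvar * gvar ^ (Suc m + j) * U_poly (Suc m))"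
    unfolding fpoly_rec U_poly.simps yvar_def by (simp add: algebra_simps power2_eq_square del: fpoly.simps U_poly.simps)
  then show ?case using "3.IH" by (simp only: dvd_add dvd_diff dvd_mult dvd_triv_left)
qed

section \<open>The ideal and congruences modulo it\<close>

locale quot_poly =
  fixes N :: nat
  assumes N_even: "even N" and N_ge: "N \<ge> 2"
begin

definition "P_poly = fpoly (N - 1) 0 * xvar - 2 * fpoly (N - 1) 1 - fpoly (N - 2) 0 - 2"

text \<open>Explicit combinations over the type of polynomials keep the calculations free of carrier
  conditions; \<open>Idl_eq\<close> identifies the set with the generated ideal.\<close>

definition I_set :: "int poly poly set" where
  "I_set = {a * (gvar ^ 2 - 1) + b * P_poly | a b. True}"

lemma I_add: "p \<in> I_set \<Longrightarrow> p' \<in> I_set \<Longrightarrow> p + p' \<in> I_set"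
proof -
  assume "p \<in> I_set" "p' \<in> I_set"
  then obtain a b a' b' where "p = a * (gvar ^ 2 - 1) + b * P_poly" "p' = a' * (gvar ^ 2 - 1) + b' * P_poly"
    by (auto simp: I_set_def)
  then have "p + p' = (a + a') * (gvar ^ 2 - 1) + (b + b') * P_poly" by (simp only: distrib_right add_ac)
  then show ?thesis unfolding I_set_def by blast
qed

lemma I_mult: "p \<in> I_set \<Longrightarrow> c * p \<in> I_set"
proof -
  assume "p \<in> I_set"
  then obtain a b where "p = a * (gvar ^ 2 - 1) + b * P_poly" by (auto simp: I_set_def)
  then have "c * p = (c * a) * (gvar ^ 2 - 1) + (c * b) * P_poly" by (simp only: distrib_left mult.assoc)
  then show ?thesis unfolding I_set_def by blast
qed

lemma I_zero: "0 \<in> I_set"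
  using I_mult[of P_poly 0] unfolding I_set_def by (force intro: exI[of _ 0])

lemma I_minus: "p \<in> I_set \<Longrightarrow> - p \<in> I_set"
  using I_mult[of p "- 1"] by simp

lemma I_diff: "p \<in> I_set \<Longrightarrow> p' \<in> I_set \<Longrightarrow> p - p' \<in> I_set"
  using I_add[of p "- p'"] I_minus[of p'] by simp

lemma I_dvd: assumes "(gvar ^ 2 - 1) dvd p" shows "p \<in> I_set"
proof -
  obtain k where "p = (gvar ^ 2 - 1) * k" using assms by (rule dvdE)
  then have "p = k * (gvar ^ 2 - 1) + 0 * P_poly" by (simp add: mult.commute)
  then show ?thesis unfolding I_set_def by blast
qed

lemma I_P: "P_poly \<in> I_set"
proof -
  have "P_poly = 0 * (gvar ^ 2 - 1) + 1 * P_poly" by simp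
  then show ?thesis unfolding I_set_def by blast
qed

definition cong_I :: "int poly poly \<Rightarrow> int poly poly \<Rightarrow> bool" (infix \<open>\<approx>I\<close> 50) where
  "p \<approx>I p' \<longleftrightarrow> p - p' \<in> I_set"

lemma cong_refl [simp]: "p \<approx>I p" by (simp add: cong_I_def I_zero)
lemma cong_sym: "p \<approx>I p' \<Longrightarrow> p' \<approx>I p" using I_minus[of "p - p'"] by (simp add: cong_I_def)
lemma cong_trans: "p \<approx>I p' \<Longrightarrow> p' \<approx>I p'' \<Longrightarrow> p \<approx>I p''"
  using I_add[of "p - p'" "p' - p''"] by (simp add: cong_I_def)
lemma cong_add: "p \<approx>I p' \<Longrightarrow> r \<approx>I r' \<Longrightarrow> p + r \<approx>I p' + r'"
  using I_add[of "p - p'" "r - r'"] by (simp add: cong_I_def algebra_simps)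
lemma cong_minus: "p \<approx>I p' \<Longrightarrow> r \<approx>I r' \<Longrightarrow> p - r \<approx>I p' - r'"
  using I_diff[of "p - p'" "r - r'"] by (simp add: cong_I_def algebra_simps)
lemma cong_mult_left: "p \<approx>I p' \<Longrightarrow> c * p \<approx>I c * p'"
  using I_mult[of "p - p'" c] by (simp add: cong_I_def algebra_simps)
lemma cong_mult: assumes "p \<approx>I p'" "r \<approx>I r'" shows "p * r \<approx>I p' * r'"
  using cong_trans[OF cong_mult_left[OF assms(2), of p] cong_mult_left[OF assms(1), of r', unfolded mult.commute[of r']]] .
declare cong_trans [trans]

lemma cong_g2: "gvar ^ 2 \<approx>I 1"
  unfolding cong_I_def by (rule I_dvd) simp

lemma cong_g_even: "gvar ^ (2 * k) \<approx>I 1"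
  using I_dvd[OF gvar_even_power[of k]] by (rule_tac cong_sym) (simp add: cong_I_def)

text \<open>As N is even, g^(N-1) and g^(N-2) reduce to g and 1 modulo g^2 - 1. What remains is y
  U_{N-1} - 2 U_{N-1} - U_{N-2} - 2, and the recursion turns this into U_N - U_{N-1} - 2.\<close>

lemma P_dvd: "(gvar ^ 2 - 1) dvd (P_poly - (U_poly N - U_poly (N - 1) - 2))"
proof -
  obtain M where M: "N = 2 * M + 2"
  proof -
    obtain t where "N = 2 * t" using N_even by (auto elim: evenE)
    then show thesis using that[of "t - 1"] N_ge by simp
  qed
  let ?u = "U_poly (2 * M + 1)" let ?v = "U_poly (2 * M)"
  have N1: "N - 1 = Suc (2 * M)" and N2: "N - 2 = 2 * M" by (simp_all add: M)
  have "P_poly - (U_poly N - U_poly (N - 1) - 2)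
    = xvar * (fpoly (N - 1) 0 - gvar ^ (N - 1 + 0) * U_poly (N - 1)) - 2 * (fpoly (N - 1) 1 - gvar ^ (N - 1 + 1) * U_poly (N - 1))
      - (fpoly (N - 2) 0 - gvar ^ (N - 2 + 0) * U_poly (N - 2))
      + (1 - gvar ^ (2 * M)) * (?v - gvar * xvar * ?u) + 2 * (1 - gvar ^ (2 * (M + 1))) * ?u"
  proof -
    have "U_poly N = (gvar * xvar - 1) * ?u - ?v" using U_poly.simps(3)[of "2 * M"] by (simp add: M yvar_def del: U_poly.simps)
    then show ?thesis unfolding P_poly_def N1 N2 by (simp add: algebra_simps del: fpoly.simps U_poly.simps)
  qed
  then show ?thesis
    using fpoly_dvd gvar_even_power by (simp only: dvd_add dvd_diff dvd_mult dvd_mult2)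
qed

lemma cong_U_N: "U_poly N - U_poly (N - 1) - 2 \<in> I_set"
proof -
  have "U_poly N - U_poly (N - 1) - 2 = P_poly - (P_poly - (U_poly N - U_poly (N - 1) - 2))" by (simp only: diff_diff_eq2 add_diff_cancel_left')
  then show ?thesis using I_diff[OF I_P I_dvd[OF P_dvd]] by (simp only:)
qed

text \<open>The relation t^N + t^-N = 2 multiplied by U_r. The defect e satisfies the recursion and
  the reflection of U, and at r = 0 it is the relation itself.\<close>

lemma cong_wrap: "U_int (int N + r) + U_int (r - int N) \<approx>I 2 * U_int r"
proof -
  define e where "e = (\<lambda>r. U_int (int N + r) + U_int (r - int N) - 2 * U_int r)"
  have refl: "e (- r - 1) = - e r" for r
    using U_int_reflect[of "r - int N"] U_int_reflect[of "int N + r"] U_int_reflect[of r] by (simp add: e_def algebra_simps)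
  have rec: "e (r + 1) = (yvar - 1) * e r - e (r - 1)" for r
    using U_int_rec[of "int N + r"] U_int_rec[of "r - int N"] U_int_rec[of r]
    by (simp add: e_def algebra_simps)
  have e0: "e 0 \<in> I_set"
  proof -
    have "U_int (- int N) = - U_poly (N - 1)"
      using U_int_reflect[of "int N - 1"] U_int_of_nat[of "N - 1"] N_ge by (simp add: of_nat_diff)
    then show ?thesis using cong_U_N by (simp add: e_def U_int_def[of 0] algebra_simps)
  qed
  have "e (int k) \<in> I_set \<and> e (int k - 1) \<in> I_set" for k
  proof (induction k)
    case 0
    then show ?case using e0 refl[of 0] I_minus by simp
  next
    case (Suc k)
    have "e (int k + 1) \<in> I_set" unfolding rec using Suc I_mult I_diff by blast
    then show ?case using Suc by (simp add: add.commute)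
  qed
  then have nn: "e r \<in> I_set" if "r \<ge> 0" for r using that by (metis nonneg_int_cases)
  have "e r \<in> I_set"
  proof (cases "r \<ge> 0")
    case False
    then have "e (- r - 1) \<in> I_set" by (intro nn) simp
    then show ?thesis unfolding refl using I_minus by force
  qed (rule nn)
  then show ?thesis by (simp add: cong_I_def e_def)
qed

text \<open>The values a(k) = t^(Nk) + t^(-Nk) obey a(k+2) = 2 a(k+1) - a(k) modulo the ideal, hence
  all equal 2.\<close>

lemma cong_wrap_nat: "U_int (r + int (N * k)) + U_int (r - int (N * k)) \<approx>I 2 * U_int r"
proof (induction k rule: induct_nat_012)
  case 1
  then show ?case using cong_wrap[of r] by (simp add: add.commute)
next
  case (ge2 k)
  have 1: "U_int (r + int (N * Suc (Suc k))) + U_int (r + int (N * k)) \<approx>I 2 * U_int (r + int (N * Suc k))"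
    using cong_wrap[of "r + int (N * Suc k)"] by (simp add: algebra_simps)
  have 2: "U_int (r - int (N * k)) + U_int (r - int (N * Suc (Suc k))) \<approx>I 2 * U_int (r - int (N * Suc k))"
    using cong_wrap[of "r - int (N * Suc k)"] by (simp add: algebra_simps)
  have "U_int (r + int (N * Suc (Suc k))) + U_int (r - int (N * Suc (Suc k)))
     = (U_int (r + int (N * Suc (Suc k))) + U_int (r + int (N * k))) + (U_int (r - int (N * k)) + U_int (r - int (N * Suc (Suc k))))
       - (U_int (r + int (N * k)) + U_int (r - int (N * k)))" by simp
  also have "\<dots> \<approx>I 2 * U_int (r + int (N * Suc k)) + 2 * U_int (r - int (N * Suc k)) - 2 * U_int r"
    by (intro cong_minus cong_add 1 2 ge2)
  also have "2 * U_int (r + int (N * Suc k)) + 2 * U_int (r - int (N * Suc k)) - 2 * U_int r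
    = 2 * (U_int (r + int (N * Suc k)) + U_int (r - int (N * Suc k))) - 2 * U_int r" by simp
  also have "\<dots> \<approx>I 2 * (2 * U_int r) - 2 * U_int r"
    by (intro cong_minus cong_mult_left ge2 cong_refl)
  finally show ?case by simp
qed simp

text \<open>Write \<gamma> = m + Nk. The sum telescopes, and reflection turns its lower end into
  U_{m-Nk}; wrapping then removes k. So a composition factor counts the same at every degree
  congruent to m.\<close>

lemma cong_string:
  assumes "\<gamma> mod int N = int m"
  shows "(\<Sum>r<2 * m + 1. wt_poly (\<gamma> - int r)) \<approx>I 2 * U_poly m"
proof -
  define k where "k = \<gamma> div int N"
  have \<gamma>: "\<gamma> = int N * k + int m" using assms by (simp add: k_def flip: assms)
  have "(\<Sum>r<2 * m + 1. wt_poly (\<gamma> - int r)) = U_int (int m + int N * k) - U_int (int N * k - int m - 1)"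
    unfolding sum_wt_poly by (simp add: \<gamma> algebra_simps)
  also have "\<dots> = U_int (int m + int N * k) + U_int (int m - int N * k)"
    using U_int_reflect[of "int m - int N * k"] by (simp add: algebra_simps)
  also have "\<dots> \<approx>I 2 * U_int (int m)"
  proof (cases "k \<ge> 0")
    case True
    then show ?thesis using cong_wrap_nat[of "int m" "nat k"] by simp
  next
    case False
    then show ?thesis using cong_wrap_nat[of "int m" "nat (- k)"] by (simp add: add.commute)
  qed
  finally show ?thesis by simp
qed

end

section \<open>Specialising g to an integer\<close>

definition eval_g :: "int \<Rightarrow> int poly poly \<Rightarrow> int poly" where
  "eval_g e p = map_poly (\<lambda>c. poly c e) p"

lemma coeff_eval_g: "coeff (eval_g e p) i = poly (coeff p i) e"
  by (simp add: eval_g_def coeff_map_poly)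

lemma eval_g_add: "eval_g e (p + p') = eval_g e p + eval_g e p'"
  by (rule poly_eqI) (simp add: coeff_eval_g)

lemma eval_g_diff: "eval_g e (p - p') = eval_g e p - eval_g e p'"
  by (rule poly_eqI) (simp add: coeff_eval_g)

lemma eval_g_mult: "eval_g e (p * p') = eval_g e p * eval_g e p'"
  by (rule poly_eqI) (simp add: coeff_eval_g coeff_mult poly_sum)

lemma eval_g_of_int: "eval_g e (of_int z) = of_int z"
  by (rule poly_eqI) (simp add: coeff_eval_g of_int_poly coeff_pCons split: nat.splits)

lemma eval_g_1: "eval_g e 1 = 1"
  using eval_g_of_int[of e 1] by simp

lemma eval_g_sum: "eval_g e (sum f A) = (\<Sum>i\<in>A. eval_g e (f i))"
  by (rule poly_eqI) (simp add: coeff_eval_g coeff_sum poly_sum)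

lemma eval_g_power: "eval_g e (p ^ i) = eval_g e p ^ i"
  by (induction i) (simp_all add: eval_g_1 eval_g_mult)

lemma eval_g_gvar: "eval_g e gvar = [:e:]"
  by (rule poly_eqI) (simp add: coeff_eval_g gvar_def coeff_pCons split: nat.splits)

lemma eval_g_xvar: "eval_g e xvar = [:0, 1:]"
  by (rule poly_eqI) (simp add: coeff_eval_g xvar_def coeff_pCons split: nat.splits)

lemma eval_g_U_rec: "eval_g e (U_poly (Suc (Suc m))) = [:-1, e:] * eval_g e (U_poly (Suc m)) - eval_g e (U_poly m)"
proof -
  have "[:-1, e:] = [:0, e:] - 1" by (simp add: one_pCons)
  then show ?thesis by (simp add: yvar_def eval_g_diff eval_g_mult eval_g_gvar eval_g_xvar eval_g_1)
qed

lemma of_int_mult_smult: "of_int z * p = smult z p" "p * of_int z = smult z p"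
  by (simp_all add: of_int_poly)

lemma degree_eval_g_U:
  assumes "e \<noteq> 0"
  shows "eval_g e (U_poly m) \<noteq> 0 \<and> degree (eval_g e (U_poly m)) = m"
proof (induction m rule: U_poly.induct)
  case 1
  then show ?case by (simp add: eval_g_1)
next
  case 2
  then show ?case using assms by (simp add: yvar_def eval_g_mult eval_g_gvar eval_g_xvar)
next
  case (3 m)
  have 1: "degree ([:-1, e:] * eval_g e (U_poly (Suc m))) = Suc (Suc m)"
    using 3 assms by (subst degree_mult_eq) auto
  have "degree (eval_g e (U_poly (Suc (Suc m)))) = Suc (Suc m)"
    unfolding eval_g_U_rec using 1 3 degree_add_eq_left[of "- eval_g e (U_poly m)" "[:-1, e:] * eval_g e (U_poly (Suc m))"]
    by simp
  then show ?case using degree_0 by (metis nat.distinct(1))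
qed

lemma eval_g_U_independent:
  assumes "e \<noteq> 0" and "(\<Sum>m<N. smult (b m) (eval_g e (U_poly m))) = 0" and "m < N"
  shows "b m = 0"
  using assms(2,3)
proof (induction N arbitrary: m)
  case (Suc N)
  have "coeff (\<Sum>m<N. smult (b m) (eval_g e (U_poly m))) N = 0"
    unfolding coeff_sum using degree_eval_g_U[OF assms(1)] by (intro sum.neutral) (auto simp: coeff_eq_0)
  moreover have "coeff (\<Sum>m<Suc N. smult (b m) (eval_g e (U_poly m))) N = 0" unfolding Suc.prems(1) by simp
  ultimately have "b N * coeff (eval_g e (U_poly N)) N = 0" by simp
  moreover have "coeff (eval_g e (U_poly N)) N \<noteq> 0"
    using degree_eval_g_U[OF assms(1), of N] leading_coeff_neq_0 by metis
  ultimately have b: "b N = 0" by simp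
  show ?case
  proof (cases "m = N")
    case False
    then show ?thesis using Suc b by simp
  qed (simp add: b)
qed simp

context quot_poly
begin

definition comb :: "(nat \<Rightarrow> nat \<Rightarrow> int) \<Rightarrow> int poly poly" where
  "comb c = (\<Sum>m<N. \<Sum>j<2. of_int (c m j) * gvar ^ j * U_poly m)"

lemma comb_add: "comb (\<lambda>m j. c m j + c' m j) = comb c + comb c'"
  by (simp add: comb_def sum.distrib distrib_right)

lemma comb_scale: "comb (\<lambda>m j. z * c m j) = of_int z * comb c"
  by (simp add: comb_def sum_distrib_left mult.assoc)

lemma eval_g_comb:
  "eval_g e (comb c) = (\<Sum>m<N. smult (c m 0 + e * c m 1) (eval_g e (U_poly m)))"
  by (simp add: comb_def eval_g_sum eval_g_mult eval_g_add eval_g_of_int eval_g_gvar of_int_mult_smult numeral_2_eq_2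
      smult_add_left mult_ac)

text \<open>The specialisation kills g^2 - 1 and sends \<open>P_poly\<close> to a polynomial of
  degree N, so a nonzero image of an element of the ideal has degree at least N.\<close>

lemma eval_g_I:
  assumes "e ^ 2 = 1" and "p \<in> I_set" and "degree (eval_g e p) < N"
  shows "eval_g e p = 0"
proof -
  have e0: "e \<noteq> 0" using assms(1) by auto
  have g: "eval_g e (gvar ^ 2 - 1) = 0"
    unfolding eval_g_diff eval_g_power eval_g_gvar eval_g_1 using assms(1) by (simp add: power2_eq_square one_pCons)
  let ?V = "\<lambda>m. eval_g e (U_poly m)"
  obtain k where k: "P_poly - (U_poly N - U_poly (N - 1) - 2) = (gvar ^ 2 - 1) * k"
    using P_dvd by (rule dvdE)
  have "eval_g e (P_poly - (U_poly N - U_poly (N - 1) - 2)) = 0"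
    unfolding k eval_g_mult g by simp
  then have P: "eval_g e P_poly = ?V N - (?V (N - 1) + 2)"
    using eval_g_of_int[of e 2] by (simp add: eval_g_diff)
  have "degree (?V (N - 1) + 2) < N"
    using degree_eval_g_U[OF e0, of "N - 1"] N_ge by (intro degree_add_less) auto
  then have dP: "degree (eval_g e P_poly) = N" unfolding P
    using degree_eval_g_U[OF e0, of N] degree_add_eq_left[of "- (?V (N - 1) + 2)" "?V N"] by (simp del: minus_add_distrib)
  obtain a b where p: "p = a * (gvar ^ 2 - 1) + b * P_poly" using assms(2) by (auto simp: I_set_def)
  have ep: "eval_g e p = eval_g e b * eval_g e P_poly" unfolding p eval_g_add eval_g_mult g by simp
  show ?thesis
  proof (rule ccontr)
    assume "eval_g e p \<noteq> 0"
    then have "degree (eval_g e p) = degree (eval_g e b) + N" unfolding ep using dP by (subst degree_mult_eq) auto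
    then show False using assms(3) by simp
  qed
qed

text \<open>Since the U_m specialise to polynomials of distinct degrees, g = 1 and g = -1 give a
  vanishing sum and a vanishing difference of the two coefficients at each m.\<close>

lemma comb_independent:
  assumes "comb c \<in> I_set" and "m < N" and "j < 2"
  shows "c m j = 0"
proof -
  have key: "c m 0 + e * c m 1 = 0" if e: "e ^ 2 = 1" for e :: int
  proof -
    have e0: "e \<noteq> 0" using e by auto
    have "degree (eval_g e (comb c)) \<le> N - 1"
      unfolding eval_g_comb
    proof (rule degree_sum_le)
      fix i assume "i \<in> {..<N}"
      then have "degree (eval_g e (U_poly i)) \<le> N - 1" using degree_eval_g_U[OF e0, of i] by simp
      then show "degree (smult (c i 0 + e * c i 1) (eval_g e (U_poly i))) \<le> N - 1"
        using degree_smult_le order_trans by blast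
    qed simp
    then have "eval_g e (comb c) = 0" using eval_g_I[OF e assms(1)] N_ge by simp
    then show ?thesis unfolding eval_g_comb by (rule eval_g_U_independent[OF e0 _ assms(2)])
  qed
  have "c m 0 + c m 1 = 0" "c m 0 - c m 1 = 0" using key[of 1] key[of "- 1"] by simp_all
  then show ?thesis using assms(3) by (cases j) auto
qed

section \<open>The quotient ring as a free abelian group\<close>

definition spanned :: "int poly poly \<Rightarrow> bool" where
  "spanned p \<longleftrightarrow> (\<exists>c. p \<approx>I comb c)"

lemma spanned_cong: "p \<approx>I p' \<Longrightarrow> spanned p' \<Longrightarrow> spanned p"
  unfolding spanned_def using cong_trans by blast

lemma spanned_add: "spanned p \<Longrightarrow> spanned p' \<Longrightarrow> spanned (p + p')"
  unfolding spanned_def using cong_add comb_add by metis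

lemma spanned_of_int_mult: "spanned p \<Longrightarrow> spanned (of_int z * p)"
  unfolding spanned_def using cong_mult_left comb_scale by metis

lemma spanned_0: "spanned 0"
  unfolding spanned_def comb_def by (rule exI[of _ "\<lambda>_ _. 0"]) simp

lemma spanned_sum: "(\<And>i. i \<in> A \<Longrightarrow> spanned (f i)) \<Longrightarrow> spanned (sum f A)"
  by (induction A rule: infinite_finite_induct) (auto intro: spanned_add spanned_0)

lemma cong_g_mod_2: "gvar ^ j \<approx>I gvar ^ (j mod 2)"
  using cong_mult_left[OF cong_g_even[of "j div 2"], of "gvar ^ (j mod 2)"]
  by (simp flip: power_add)

lemma comb_single:
  assumes "m < N" "j < 2"
  shows "comb (\<lambda>m' j'. if m' = m \<and> j' = j then 1 else 0) = gvar ^ j * U_poly m"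
proof -
  have "comb (\<lambda>m' j'. if m' = m \<and> j' = j then 1 else 0)
    = (\<Sum>m'<N. if m' = m then \<Sum>j'<2. (if j' = j then gvar ^ j' * U_poly m' else 0) else 0)"
    unfolding comb_def
  proof (intro sum.cong refl)
    fix m'
    show "(\<Sum>j'<2. of_int (if m' = m \<and> j' = j then 1 else 0) * gvar ^ j' * U_poly m')
      = (if m' = m then \<Sum>j'<2. (if j' = j then gvar ^ j' * U_poly m' else 0) else 0)"
      using assms(2) by (cases "m' = m") (auto simp: numeral_2_eq_2 less_Suc_eq)
  qed
  then show ?thesis using assms by simp
qed

lemma spanned_gen: "m < N \<Longrightarrow> spanned (gvar ^ j * U_poly m)"
proof -
  assume m: "m < N"
  have "gvar ^ j * U_poly m \<approx>I gvar ^ (j mod 2) * U_poly m"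
    by (rule cong_mult[OF cong_g_mod_2 cong_refl])
  then show ?thesis using comb_single[OF m, of "j mod 2"] unfolding spanned_def by (metis pos2 mod_less_divisor)
qed

text \<open>Only m = N lies beyond the basis, and there the relation replaces U_N by U_{N-1} + 2.
  This suffices for multiplication by y, which raises the index by at most one.\<close>

lemma spanned_U_le: "m \<le> N \<Longrightarrow> spanned (gvar ^ j * U_poly m)"
proof (cases "m < N")
  case False
  assume "m \<le> N"
  then have m: "m = N" using False by simp
  have "U_poly N \<approx>I U_poly (N - 1) + of_int 2" using cong_U_N by (simp add: cong_I_def algebra_simps)
  then have "gvar ^ j * U_poly N \<approx>I gvar ^ j * (U_poly (N - 1) + of_int 2)" by (rule cong_mult_left)
  also have "gvar ^ j * (U_poly (N - 1) + of_int 2) = gvar ^ j * U_poly (N - 1) + of_int 2 * (gvar ^ j * U_poly 0)"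
    by (simp add: algebra_simps)
  finally show ?thesis unfolding m
    by (rule spanned_cong) (intro spanned_add spanned_of_int_mult spanned_gen, use N_ge in auto)
qed (rule spanned_gen)

lemma spanned_mult:
  assumes "\<And>m j. m < N \<Longrightarrow> spanned (h * (gvar ^ j * U_poly m))" and "spanned p"
  shows "spanned (h * p)"
proof -
  obtain c where "p \<approx>I comb c" using assms(2) by (auto simp: spanned_def)
  then have "h * p \<approx>I h * comb c" by (rule cong_mult_left)
  also have "h * comb c = (\<Sum>m<N. \<Sum>j<2. of_int (c m j) * (h * (gvar ^ j * U_poly m)))"
    by (simp only: comb_def sum_distrib_left mult_ac)
  finally show ?thesis
    by (rule spanned_cong) (intro spanned_sum spanned_of_int_mult assms(1), simp)
qed

lemma spanned_gvar: "spanned p \<Longrightarrow> spanned (gvar * p)"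
proof (rule spanned_mult)
  fix m j assume "m < N"
  then show "spanned (gvar * (gvar ^ j * U_poly m))" using spanned_gen[of m "Suc j"] by (simp add: mult.assoc)
qed

lemma spanned_yvar: "spanned p \<Longrightarrow> spanned (yvar * p)"
proof (rule spanned_mult)
  fix m j assume m: "m < N"
  show "spanned (yvar * (gvar ^ j * U_poly m))"
  proof (cases m)
    case 0
    then show ?thesis using spanned_U_le[of 1 j] N_ge by (simp add: mult_ac)
  next
    case (Suc k)
    have "yvar * (gvar ^ j * U_poly m) = gvar ^ j * U_poly (Suc m) + gvar ^ j * U_poly m + gvar ^ j * U_poly k"
      unfolding Suc by (simp add: algebra_simps)
    then show ?thesis using m Suc by (simp only:) (intro spanned_add spanned_U_le, auto)
  qed
qed

text \<open>Modulo g^2 - 1 the variable x equals g y, so multiplication by x is multiplication by y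
  followed by g.\<close>

lemma spanned_xvar: "spanned p \<Longrightarrow> spanned (xvar * p)"
proof -
  assume p: "spanned p"
  have "xvar * p \<approx>I gvar * (yvar * p)"
    using cong_sym[OF cong_mult[OF cong_g2 cong_refl[of "xvar * p"]]] by (simp add: yvar_def power2_eq_square mult.assoc)
  then show ?thesis by (rule spanned_cong) (intro spanned_gvar spanned_yvar p)
qed

lemma spanned_const: "spanned [:a:]"
proof (induction a)
  case 0
  then show ?case using spanned_0 by simp
next
  case (pCons b a)
  have e: "[:pCons b a:] = of_int b * (gvar ^ 0 * U_poly 0) + gvar * [:a:]"
    by (simp add: gvar_def of_int_poly)
  show ?case unfolding e
    by (intro spanned_add spanned_of_int_mult spanned_gen spanned_gvar pCons.IH) (use N_ge in simp)
qed

lemma spanned_all: "spanned p"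
proof (induction p)
  case 0
  then show ?case by (rule spanned_0)
next
  case (pCons a p)
  have "pCons a p = [:a:] + xvar * p" by (simp add: xvar_def)
  then show ?case using spanned_add[OF spanned_const spanned_xvar[OF pCons.IH]] by (simp only:)
qed

lemma comb_surj: "\<exists>c. p \<approx>I comb c"
  using spanned_all by (simp add: spanned_def)

text \<open>Coefficients with respect to the basis are integers, and doubling an integer is
  injective.\<close>

lemma torsion_free:
  assumes "2 * p \<approx>I 2 * p'" shows "p \<approx>I p'"
proof -
  obtain c where c: "p - p' \<approx>I comb c" using comb_surj by blast
  have "2 * (p - p') \<in> I_set" using assms by (simp add: cong_I_def algebra_simps)
  moreover have "2 * (p - p') \<approx>I 2 * comb c" by (rule cong_mult_left[OF c])
  ultimately have "2 * comb c \<in> I_set" using I_diff by (fastforce simp: cong_I_def)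
  then have "comb (\<lambda>m j. 2 * c m j) \<in> I_set" by (simp add: comb_scale)
  then have "c m j = 0" if "m < N" "j < 2" for m j using comb_independent that by fastforce
  then have "comb c = 0" unfolding comb_def by (simp add: sum.neutral)
  then show ?thesis using c by (simp add: cong_I_def)
qed

lemma ideal_I: "ideal I_set ring_of_type_algebra"
proof (rule idealI)
  show "ring (ring_of_type_algebra :: int poly poly ring)" by (rule ring_from_type_algebra)
  interpret R: ring "ring_of_type_algebra :: int poly poly ring" by (rule ring_from_type_algebra)
  show "subgroup I_set (add_monoid (ring_of_type_algebra :: int poly poly ring))"
  proof (rule R.add.subgroupI)
    fix a assume a: "a \<in> I_set"
    have "\<ominus>\<^bsub>ring_of_type_algebra\<^esub> a = - a"
      by (rule R.minus_equality) (simp_all add: ring_of_type_algebra_def)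
    then show "\<ominus>\<^bsub>ring_of_type_algebra\<^esub> a \<in> I_set" using I_minus[OF a] by simp
  qed (use I_zero I_add in \<open>auto simp: ring_of_type_algebra_def\<close>)
qed (use I_mult in \<open>auto simp: ring_of_type_algebra_def mult.commute\<close>)

lemma Idl_eq: "Idl\<^bsub>ring_of_type_algebra\<^esub> {gvar ^ 2 - 1, P_poly} = I_set"
proof
  interpret R: ring "ring_of_type_algebra :: int poly poly ring" by (rule ring_from_type_algebra)
  let ?J = "Idl\<^bsub>ring_of_type_algebra\<^esub> {gvar ^ 2 - 1, P_poly}"
  have gens: "{gvar ^ 2 - 1, P_poly} \<subseteq> carrier (ring_of_type_algebra :: int poly poly ring)" by (simp add: ring_of_type_algebra_def)
  show "?J \<subseteq> I_set"
    using I_dvd[of "gvar ^ 2 - 1"] I_P by (intro R.genideal_minimal ideal_I) auto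
  interpret J: ideal ?J "ring_of_type_algebra" by (rule R.genideal_ideal[OF gens])
  have m: "gvar ^ 2 - 1 \<in> ?J" "P_poly \<in> ?J" using R.genideal_self[OF gens] by auto
  show "I_set \<subseteq> ?J"
  proof
    fix p assume "p \<in> I_set"
    then obtain a b where p: "p = a * (gvar ^ 2 - 1) + b * P_poly" by (auto simp: I_set_def)
    have "a \<otimes>\<^bsub>ring_of_type_algebra\<^esub> (gvar ^ 2 - 1) \<oplus>\<^bsub>ring_of_type_algebra\<^esub> b \<otimes>\<^bsub>ring_of_type_algebra\<^esub> P_poly \<in> ?J"
      by (intro J.a_closed J.I_l_closed m) (simp_all add: ring_of_type_algebra_def)
    then show "p \<in> ?J" by (simp add: p ring_of_type_algebra_def)
  qed
qed

end

lemma sum_by_fibres: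
  fixes F :: "'b \<Rightarrow> 'c::semiring_1" and f :: "nat \<Rightarrow> 'b"
  assumes "finite S" "f ` {..<k} \<subseteq> S"
  shows "(\<Sum>i<k. F (f i)) = (\<Sum>\<delta>\<in>S. of_nat (card {i. i < k \<and> f i = \<delta>}) * F \<delta>)"
proof -
  have "(\<Sum>i<k. F (f i)) = (\<Sum>\<delta>\<in>S. \<Sum>i\<in>{i \<in> {..<k}. f i = \<delta>}. F (f i))"
    using assms by (intro sum.group[symmetric]) auto
  also have "\<dots> = (\<Sum>\<delta>\<in>S. of_nat (card {i. i < k \<and> f i = \<delta>}) * F \<delta>)"
  proof (intro sum.cong refl)
    fix \<delta>
    have "(\<Sum>i\<in>{i \<in> {..<k}. f i = \<delta>}. F (f i)) = (\<Sum>i\<in>{i \<in> {..<k}. f i = \<delta>}. F \<delta>)"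
      by (intro sum.cong) auto
    then show "(\<Sum>i\<in>{i \<in> {..<k}. f i = \<delta>}. F (f i)) = of_nat (card {i. i < k \<and> f i = \<delta>}) * F \<delta>" by simp
  qed
  finally show ?thesis .
qed

text \<open>A composition step controls only how often each degree occurs; that determines every sum
  over basis vectors of a function of the degree.\<close>

lemma sum_of_fibre_counts:
  fixes F :: "'b \<Rightarrow> 'c::semiring_1" and f g h :: "nat \<Rightarrow> 'b"
  assumes "\<And>\<delta>. card {i. i < a \<and> f i = \<delta>} = card {r. r < b \<and> g r = \<delta>} + card {i. i < c \<and> h i = \<delta>}"
  shows "(\<Sum>i<a. F (f i)) = (\<Sum>r<b. F (g r)) + (\<Sum>i<c. F (h i))"
proof -
  define S where "S = f ` {..<a} \<union> g ` {..<b} \<union> h ` {..<c}"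
  have S: "finite S" "f ` {..<a} \<subseteq> S" "g ` {..<b} \<subseteq> S" "h ` {..<c} \<subseteq> S" by (auto simp: S_def)
  show ?thesis
    unfolding sum_by_fibres[OF S(1,2)] sum_by_fibres[OF S(1,3)] sum_by_fibres[OF S(1,4)] assms
    by (simp add: distrib_right sum.distrib)
qed

lemma hom_mat_kronecker:
  assumes A: "A \<in> carrier_mat a b" and B: "B \<in> carrier_mat c d"
    and hA: "hom_mat d1 d2 s A" and hB: "hom_mat d3 d4 t B"
  shows "hom_mat (\<lambda>i. d1 (i div c) + d3 (i mod c)) (\<lambda>j. d2 (j div d) + d4 (j mod d)) (s + t) (kronecker A B)"
  unfolding hom_mat_def
proof (intro allI impI)
  fix i j assume "i < dim_row (kronecker A B)" "j < dim_col (kronecker A B)" and nz: "kronecker A B $$ (i, j) \<noteq> 0"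
  then have ij: "i < a * c" "j < b * d" using A B by (auto simp: kronecker_def)
  have b: "i div c < a" "i mod c < c" "j div d < b" "j mod d < d"
    using div_mod_bounds[OF ij(1)] div_mod_bounds[OF ij(2)] by auto
  have "A $$ (i div c, j div d) \<noteq> 0" "B $$ (i mod c, j mod d) \<noteq> 0"
    using nz unfolding kronecker_index[OF A B ij] by auto
  then have "d1 (i div c) = d2 (j div d) + s" "d3 (i mod c) = d4 (j mod d) + t"
    using hom_matD[OF hA] hom_matD[OF hB] b A B by auto
  then show "d1 (i div c) + d3 (i mod c) = d2 (j div d) + d4 (j mod d) + (s + t)" by simp
qed

lemma kronecker_diag_fun:
  "kronecker (diag_fun a f) (diag_fun b g) = diag_fun (a * b) (\<lambda>i. f (i div b) * g (i mod b))"
proof (rule eq_matI)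
  fix i j assume "i < dim_row (diag_fun (a * b) (\<lambda>i. f (i div b) * g (i mod b)))" "j < dim_col (diag_fun (a * b) (\<lambda>i. f (i div b) * g (i mod b)))"
  then have ij: "i < a * b" "j < a * b" by auto
  have e: "i = j \<longleftrightarrow> i div b = j div b \<and> i mod b = j mod b" by (metis div_mult_mod_eq)
  show "kronecker (diag_fun a f) (diag_fun b g) $$ (i, j) = diag_fun (a * b) (\<lambda>i. f (i div b) * g (i mod b)) $$ (i, j)"
    unfolding kronecker_index[OF diag_fun_carrier diag_fun_carrier ij] diag_fun_index[OF ij]
    using div_mod_bounds[OF ij(1)] div_mod_bounds[OF ij(2)] e by (auto simp: diag_fun_index)
qed (auto simp: kronecker_def)

section \<open>The polynomial attached to a class\<close>

context qu_setup
begin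

sublocale quot_poly NN
  by unfold_locales (rule NN_even NN_ge)+

notation cong_I (infix \<open>\<approx>I\<close> 50)

definition class_poly :: "('k qu_module \<Rightarrow>\<^sub>0 int) \<Rightarrow> int poly poly" where
  "class_poly x = comb (SOME c. x - simple_frag c \<in> ses_subgroup n q)"

text \<open>The coefficients are unique for m < N and j < 2, so the polynomial itself, and not
  merely its residue, is independent of the choice.\<close>

lemma class_poly_eq: "x - simple_frag c \<in> ses_subgroup n q \<Longrightarrow> class_poly x = comb c"
proof -
  assume c: "x - simple_frag c \<in> ses_subgroup n q"
  define c' where "c' = (SOME c. x - simple_frag c \<in> ses_subgroup n q)"
  have c': "x - simple_frag c' \<in> ses_subgroup n q" unfolding c'_def using c by (rule someI[of "\<lambda>c. x - simple_frag c \<in> ses_subgroup n q"])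
  have "(x - simple_frag c') - (x - simple_frag c) \<in> ses_subgroup n q" by (rule ses_diff[OF c' c])
  then have "simple_frag (\<lambda>m j. c m j - c' m j) \<in> ses_subgroup n q" by (simp add: simple_frag_diff)
  then have "c m j - c' m j = 0" if "m < NN" "j < 2" for m j using simple_frag_independent that by blast
  then have "comb c' = comb c" unfolding comb_def by (intro sum.cong) auto
  then show ?thesis by (simp add: class_poly_def c'_def)
qed

lemma class_poly_diff:
  assumes "Poly_Mapping.keys x \<subseteq> qu_modules n q" "Poly_Mapping.keys y \<subseteq> qu_modules n q"
  shows "class_poly (x - y) = class_poly x - class_poly y"
proof -
  obtain c where c: "x - simple_frag c \<in> ses_subgroup n q" using simple_frag_span[OF assms(1)] by blast
  obtain c' where c': "y - simple_frag c' \<in> ses_subgroup n q" using simple_frag_span[OF assms(2)] by blast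
  have "(x - simple_frag c) - (y - simple_frag c') \<in> ses_subgroup n q" by (rule ses_diff[OF c c'])
  then have "x - y - simple_frag (\<lambda>m j. c m j - c' m j) \<in> ses_subgroup n q"
    unfolding simple_frag_diff by (simp add: algebra_simps)
  then have "class_poly (x - y) = comb (\<lambda>m j. c m j - c' m j)" by (rule class_poly_eq)
  also have "\<dots> = comb c - comb c'"
    by (simp add: comb_def left_diff_distrib sum_subtractf)
  finally show ?thesis using class_poly_eq[OF c] class_poly_eq[OF c'] by simp
qed

lemma class_poly_0: "class_poly 0 = 0"
proof -
  have "0 - simple_frag (\<lambda>m j. 0) \<in> ses_subgroup n q" using ses_0 by (simp add: simple_frag_0)
  then have "class_poly 0 = comb (\<lambda>m j. 0)" by (rule class_poly_eq)
  then show ?thesis by (simp add: comb_def)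
qed

lemma class_poly_add:
  assumes "Poly_Mapping.keys x \<subseteq> qu_modules n q" "Poly_Mapping.keys y \<subseteq> qu_modules n q"
  shows "class_poly (x + y) = class_poly x + class_poly y"
proof -
  have k: "Poly_Mapping.keys (- y) \<subseteq> qu_modules n q" using assms(2) by simp
  have "class_poly (- y) = - class_poly y" using class_poly_diff[OF _ assms(2), of 0] by (simp add: class_poly_0)
  moreover have "x + y = x - (- y)" by simp
  ultimately show ?thesis using class_poly_diff[OF assms(1) k] by (simp only: diff_minus_eq_add)
qed

text \<open>A combination \<open>comb c\<close> lies in the ideal only if its coefficients vanish,
  so nothing but relations is sent to zero. Conversely, a relation has the zero
  coefficients.\<close>

lemma class_poly_ses_iff:
  assumes "Poly_Mapping.keys x \<subseteq> qu_modules n q"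
  shows "class_poly x \<in> I_set \<longleftrightarrow> x \<in> ses_subgroup n q"
proof
  assume x: "x \<in> ses_subgroup n q"
  then have "x - simple_frag (\<lambda>m j. 0) \<in> ses_subgroup n q" by (simp add: simple_frag_0)
  then have "class_poly x = comb (\<lambda>m j. 0)" by (rule class_poly_eq)
  then show "class_poly x \<in> I_set" using I_zero by (simp add: comb_def)
next
  assume x: "class_poly x \<in> I_set"
  obtain c where c: "x - simple_frag c \<in> ses_subgroup n q" using simple_frag_span[OF assms] by blast
  then have "comb c \<in> I_set" using x class_poly_eq[OF c] by simp
  then have "c m j = 0" if "m < NN" "j < 2" for m j using comb_independent that by blast
  then have "simple_frag c = 0" unfolding simple_frag_def by (simp add: sum.neutral)
  then show "x \<in> ses_subgroup n q" using c by simp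
qed

lemma class_poly_simple: "m < NN \<Longrightarrow> j < 2 \<Longrightarrow> class_poly (frag_of (qu_simple m j)) = gvar ^ j * U_poly m"
  using class_poly_eq[of "frag_of (qu_simple m j)" "\<lambda>m' j'. if m' = m \<and> j' = j then 1 else 0"]
  by (simp add: simple_frag_single comb_single ses_0)

lemma class_poly_short_exact:
  assumes L: "L \<in> qu_modules n q" and M: "M \<in> qu_modules n q" and N: "N \<in> qu_modules n q"
    and ex: "qu_short_exact n q L M N"
  shows "class_poly (frag_of M) \<approx>I class_poly (frag_of L) + class_poly (frag_of N)"
proof -
  have s: "frag_of M - frag_of L - frag_of N \<in> ses_subgroup n q" by (rule ses_short_exact[OF L M N ex])
  have k: "Poly_Mapping.keys (frag_of M - frag_of L) \<subseteq> qu_modules n q"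
    using L M keys_diff[of "frag_of M" "frag_of L"] by auto
  have "class_poly (frag_of M - frag_of L - frag_of N) \<in> I_set"
    using class_poly_ses_iff[OF ses_subgroup_keys[OF s]] s by simp
  moreover have "class_poly (frag_of M - frag_of L - frag_of N) = class_poly (frag_of M) - class_poly (frag_of L) - class_poly (frag_of N)"
    using class_poly_diff[OF k, of "frag_of N"] class_poly_diff[of "frag_of M" "frag_of L"] L M N by simp
  ultimately show ?thesis by (simp add: cong_I_def diff_diff_eq)
qed

lemma class_poly_zero_module: "M \<in> qu_modules n q \<Longrightarrow> fst M = 0 \<Longrightarrow> class_poly (frag_of M) \<approx>I 0"
  using class_poly_ses_iff[of "frag_of M"] ses_zero_module[of M n q] by (simp add: cong_I_def)

text \<open>In S_{m,j} the vector E^r v gets degree m - r. With this centring both eigenvalues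
  depend on the degree by a formula common to all m, apart from the sign, and the formula is
  multiplicative when degrees add.\<close>

definition graded :: "nat \<Rightarrow> (nat \<Rightarrow> int) \<Rightarrow> 'k qu_module \<Rightarrow> bool" where
  "graded s dg M \<longleftrightarrow> homogeneous 1 dg M \<and>
     mod_gen n q M gen_kappa = diag_fun (fst M) (\<lambda>i. (- 1) ^ s * inverse (q ^ n) powi dg i) \<and>
     mod_gen n q M gen_kappa_hat = diag_fun (fst M) (\<lambda>i. (- 1) ^ s * inverse (q ^ n) powi dg i * q powi (2 * dg i))"

text \<open>The ratio of the two eigenvalues is q^(2 \<gamma>) = q^(2m), which fixes \<gamma> modulo
  N. As the N-th power of q^n is one, the eigenvalue of kappa then yields the sign.\<close>

lemma weight_mod_NN:
  assumes m: "m < NN" and j: "j < 2" "s < 2"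
    and k: "kap_val m j = (- 1) ^ s * inverse (q ^ n) powi \<gamma>"
    and kh: "kap_val m j * q ^ (2 * m) = (- 1) ^ s * inverse (q ^ n) powi \<gamma> * q powi (2 * \<gamma>)"
  shows "\<gamma> mod int NN = int m" and "j = s"
proof -
  define t where "t = nat (\<gamma> mod int NN)"
  define u where "u = \<gamma> div int NN"
  have t: "t < NN" "int t = \<gamma> mod int NN" using NN_pos by (simp_all add: t_def nat_less_iff)
  have \<gamma>: "\<gamma> = int NN * u + int t" unfolding t(2) u_def by simp
  have q2: "q powi (int (2 * NN)) = 1" using q_pow_eq_1_iff[of "2 * NN"] unfolding power_int_of_nat by simp
  have "kap_val m j * q ^ (2 * m) = kap_val m j * q powi (2 * \<gamma>)" using kh unfolding k .
  then have "q ^ (2 * m) = q powi (2 * \<gamma>)" by simp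
  also have "2 * \<gamma> = int (2 * NN) * u + int (2 * t)" unfolding \<gamma> by (simp add: algebra_simps)
  also have "q powi (int (2 * NN) * u + int (2 * t)) = q powi (int (2 * NN) * u) * q powi (int (2 * t))"
    by (rule power_int_add) simp
  also have "q powi (int (2 * NN) * u) = 1" unfolding power_int_mult q2 by simp
  finally have "q ^ (2 * m) = q ^ (2 * t)" unfolding power_int_of_nat by simp
  then have mt: "t = m" using q_pow_inj[of "2 * m" "2 * t"] m t by simp
  then show "\<gamma> mod int NN = int m" using t by simp
  have Q1: "inverse (q ^ n) powi (int NN) = 1" unfolding power_int_of_nat power_inverse Q_NN by simp
  have "inverse (q ^ n) powi \<gamma> = inverse (q ^ n) powi (int NN * u) * inverse (q ^ n) powi (int t)"
    unfolding \<gamma> by (rule power_int_add) simp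
  also have "inverse (q ^ n) powi (int NN * u) = 1" unfolding power_int_mult Q1 by simp
  finally have "inverse (q ^ n) powi \<gamma> = inverse (q ^ n) ^ m" unfolding power_int_of_nat mt by simp
  then have "(- 1) ^ j = ((- 1) ^ s :: 'k)" using k by (simp add: kap_val_def)
  then show "j = s" using j by (cases j; cases s) auto
qed

text \<open>
  The action of $\kappa$ and $\hat\kappa$ determines the degrees only modulo \<open>NN\<close>. This loses nothing for
  twice the class because $U_{r+N} + U_{r-N}$ is congruent to $2U_r$, and the quotient has no $2$-torsion.
\<close>

lemma graded_class:
  "M \<in> qu_modules n q \<Longrightarrow> s < 2 \<Longrightarrow> graded s dg M \<Longrightarrow>
    2 * class_poly (frag_of M) \<approx>I gvar ^ s * (\<Sum>i<fst M. wt_poly (dg i))"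
proof (induction "fst M" arbitrary: M dg rule: less_induct)
  case less
  note M = less.prems(1) and s = less.prems(2)
  show ?case
  proof (cases "fst M = 0")
    case True
    then show ?thesis using cong_mult_left[OF class_poly_zero_module[OF M True], of 2] by simp
  next
    case False
    then have d: "fst M > 0" by simp
    have h: "homogeneous 1 dg M" using less.prems(3) by (simp add: graded_def)
    let ?\<chi> = "\<lambda>t. (- 1) ^ s * inverse (q ^ n) powi t" let ?\<chi>' = "\<lambda>t. (- 1) ^ s * inverse (q ^ n) powi t * q powi (2 * t)"
    have kap: "mod_gen n q M gen_kappa = diag_fun (fst M) (\<lambda>i. ?\<chi> (dg i))"
      and kaph: "mod_gen n q M gen_kappa_hat = diag_fun (fst M) (\<lambda>i. ?\<chi>' (dg i))"
      using less.prems(3) by (simp_all add: graded_def)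
    show ?thesis
    proof (rule composition_step[OF M d h])
      fix m j \<gamma> M' dg'
      assume m: "m < NN" "j < 2" and M': "M' \<in> qu_modules n q" and dims: "fst M = 2 * m + 1 + fst M'"
        and ex: "qu_short_exact n q (qu_simple m j) M M'" and h': "homogeneous 1 dg' M'"
        and cnt: "\<And>\<delta>. card {i. i < fst M \<and> dg i = \<delta>} = card {r. r < 2 * m + 1 \<and> \<gamma> - 1 * int r = \<delta>} + card {i. i < fst M' \<and> dg' i = \<delta>}"
        and k1: "\<And>\<chi>. mod_gen n q M gen_kappa = diag_fun (fst M) (\<lambda>i. \<chi> (dg i)) \<Longrightarrow>
           kap_val m j = \<chi> \<gamma> \<and> mod_gen n q M' gen_kappa = diag_fun (fst M') (\<lambda>i. \<chi> (dg' i))"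
        and k2: "\<And>\<chi>. mod_gen n q M gen_kappa_hat = diag_fun (fst M) (\<lambda>i. \<chi> (dg i)) \<Longrightarrow>
           kap_val m j * q ^ (2 * m) = \<chi> \<gamma> \<and> mod_gen n q M' gen_kappa_hat = diag_fun (fst M') (\<lambda>i. \<chi> (dg' i))"
      note k1' = k1[of ?\<chi>, OF kap] and k2' = k2[of ?\<chi>', OF kaph]
      have w: "\<gamma> mod int NN = int m" "j = s"
        using weight_mod_NN[OF m s] k1' k2' by blast+
      have "graded s dg' M'" using h' k1' k2' by (simp add: graded_def)
      then have IH: "2 * class_poly (frag_of M') \<approx>I gvar ^ s * (\<Sum>i<fst M'. wt_poly (dg' i))"
        using less.hyps[OF _ M' s] dims by simp
      \<comment> \<open>Here \<gamma> may differ from m by a multiple of N, which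
        \<open>cong_string\<close> makes invisible.\<close>
      have S: "2 * class_poly (frag_of (qu_simple m j)) \<approx>I gvar ^ s * (\<Sum>r<2 * m + 1. wt_poly (\<gamma> - int r))"
        using cong_sym[OF cong_mult_left[OF cong_string[OF w(1)], of "gvar ^ s"]]
        unfolding class_poly_simple[OF m] unfolding w(2) by (simp only: mult_ac)
      have "2 * class_poly (frag_of M) \<approx>I 2 * (class_poly (frag_of (qu_simple m j)) + class_poly (frag_of M'))"
        by (rule cong_mult_left[OF class_poly_short_exact[OF qu_simple_in[OF m(1)] M M' ex]])
      also have "2 * (class_poly (frag_of (qu_simple m j)) + class_poly (frag_of M'))
        = 2 * class_poly (frag_of (qu_simple m j)) + 2 * class_poly (frag_of M')" by (rule distrib_left)
      also have "\<dots> \<approx>I gvar ^ s * (\<Sum>r<2 * m + 1. wt_poly (\<gamma> - int r)) + gvar ^ s * (\<Sum>i<fst M'. wt_poly (dg' i))"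
        by (rule cong_add[OF S IH])
      also have "\<dots> = gvar ^ s * (\<Sum>i<fst M. wt_poly (dg i))"
        using sum_of_fibre_counts[OF cnt, of wt_poly] by (simp add: distrib_left)
      finally show ?thesis .
    qed
  qed
qed

lemma graded_simple:
  assumes m: "m < NN"
  shows "graded j (\<lambda>r. int m - int r) (qu_simple m j)"
proof -
  have Q: "inverse (q ^ n) powi (int m - int r) = inverse (q ^ n) ^ m * (q ^ n) ^ r" for r
    by (simp add: power_int_diff power_int_of_nat power_inverse field_simps)
  have q2: "q powi (2 * (int m - int r)) = q ^ (2 * m) * inverse q ^ (2 * r)" for r
  proof -
    have "2 * (int m - int r) = int (2 * m) - int (2 * r)" by simp
    then show ?thesis by (simp only: power_int_diff[OF disjI1[OF q_nonzero]] power_int_of_nat power_inverse divide_inverse)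
  qed
  show ?thesis
    unfolding graded_def homogeneous_def mod_gen_qu_simple[OF m] fst_qu_simple Q q2
    by (auto simp: hom_mat_def diag_fun_index kap_val_def mult_ac split: if_splits)
qed

section \<open>Tensor products of graded modules\<close>

context
  fixes M N :: "'k qu_module" and d1 d2 :: "nat \<Rightarrow> int" and s1 s2 :: nat
  assumes M: "M \<in> qu_modules n q" and N: "N \<in> qu_modules n q"
    and gM: "graded s1 d1 M" and gN: "graded s2 d2 N"
begin

text \<open>The idempotents 1_i and the elements flat are polynomials in kappa, which has degree
  zero. Hence they do not disturb the degrees of the terms in the comultiplication of E and
  F.\<close>

definition "deg0 x \<longleftrightarrow> x \<in> carrier (qu_alg n q) \<and> hom_mat d2 d2 0 (snd N x)"

lemma deg0_scal: "deg0 (qu_scal n q c)"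
  unfolding deg0_def qu_modules_scal[OF N] by (auto intro: hom_mat_smult hom_mat_one)

lemma deg0_mult: "deg0 x \<Longrightarrow> deg0 y \<Longrightarrow> deg0 (x \<otimes>\<^bsub>qu_alg n q\<^esub> y)"
  unfolding deg0_def
  using hom_mat_mult[OF qu_modules_carrier[OF N] qu_modules_carrier[OF N], of x y d2 d2 0 d2 0]
  by (auto simp: qu_modules_mult[OF N])

lemma deg0_kappa_pow: "deg0 (qu_gen n q gen_kappa [^]\<^bsub>qu_alg n q\<^esub> (r::nat))"
proof -
  have "hom_mat d2 d2 0 (mod_gen n q N gen_kappa)" using gN unfolding graded_def homogeneous_def by blast
  from hom_mat_pow[OF mod_gen_carrier[OF N] this, of r] show ?thesis
    by (simp add: deg0_def snd_module_pow[OF N] mod_gen_def)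
qed

lemma deg0_finsum: "finite I \<Longrightarrow> (\<And>i. i \<in> I \<Longrightarrow> deg0 (f i)) \<Longrightarrow> deg0 (finsum (qu_alg n q) f I)"
proof (rule A.finsum_pred)
  show "deg0 \<zero>\<^bsub>qu_alg n q\<^esub>"
  proof -
    have "snd N (\<zero>\<^bsub>qu_alg n q\<^esub> \<oplus>\<^bsub>qu_alg n q\<^esub> \<zero>\<^bsub>qu_alg n q\<^esub>) = snd N \<zero>\<^bsub>qu_alg n q\<^esub> + snd N \<zero>\<^bsub>qu_alg n q\<^esub>"
      by (rule qu_modules_add[OF N]) auto
    moreover have c: "snd N \<zero>\<^bsub>qu_alg n q\<^esub> \<in> carrier_mat (fst N) (fst N)" by (rule qu_modules_carrier[OF N]) simp
    ultimately have e: "snd N \<zero>\<^bsub>qu_alg n q\<^esub> + snd N \<zero>\<^bsub>qu_alg n q\<^esub> = snd N \<zero>\<^bsub>qu_alg n q\<^esub>" by simp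
    have "snd N \<zero>\<^bsub>qu_alg n q\<^esub> $$ (i, j) = 0" if "i < fst N" "j < fst N" for i j
      using arg_cong[OF e, of "\<lambda>A. A $$ (i, j)"] c that by simp
    then show ?thesis using c by (auto simp: deg0_def hom_mat_def)
  qed
  fix x y assume "x \<in> carrier (qu_alg n q)" "y \<in> carrier (qu_alg n q)" "deg0 x" "deg0 y"
  then show "deg0 (x \<oplus>\<^bsub>qu_alg n q\<^esub> y)"
    unfolding deg0_def using hom_mat_add[OF qu_modules_carrier[OF N] qu_modules_carrier[OF N], of x y d2 d2 0]
    by (auto simp: qu_modules_add[OF N])
qed (auto simp: deg0_def)

lemma deg0_idem: "deg0 (qu_idem n q i)"
  unfolding qu_idem_def by (intro deg0_mult deg0_scal deg0_finsum deg0_kappa_pow) simp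

lemma deg0_snd:
  shows "hom_mat d2 d2 0 (snd N (qu_idem n q 0))" "hom_mat d2 d2 0 (snd N flat_inv)"
    "hom_mat d2 d2 0 (snd N (qu_flat n q))" "hom_mat d2 d2 0 (snd N nonzero_idem)"
proof -
  have "deg0 (qu_idem n q 0)" by (rule deg0_idem)
  moreover have "deg0 flat_inv" unfolding flat_inv_def by (intro deg0_finsum deg0_mult deg0_scal deg0_idem) simp
  moreover have "deg0 (qu_flat n q)" unfolding qu_flat_def by (intro deg0_finsum deg0_mult deg0_scal deg0_idem) simp
  moreover have "deg0 nonzero_idem" unfolding nonzero_idem_def[OF M N] by (intro deg0_finsum deg0_idem) simp
  ultimately show "hom_mat d2 d2 0 (snd N (qu_idem n q 0))" "hom_mat d2 d2 0 (snd N flat_inv)"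
    "hom_mat d2 d2 0 (snd N (qu_flat n q))" "hom_mat d2 d2 0 (snd N nonzero_idem)" by (auto simp: deg0_def)
qed

text \<open>The basis index of a Kronecker product encodes a pair by quotient and remainder. Every
  term in the comultiplication of E lowers the total degree by exactly one and every term for F
  raises it by one, while the eigenvalues of the two group-like generators multiply.\<close>

lemma graded_tensor: "graded (s1 + s2) (\<lambda>i. d1 (i div fst N) + d2 (i mod fst N)) (qu_tensor n q M N)"
proof -
  let ?dg = "\<lambda>i. d1 (i div fst N) + d2 (i mod fst N)" let ?D = "fst M * fst N"
  let ?GM = "mod_gen n q M" let ?GN = "mod_gen n q N"
  have cM: "?GM s \<in> carrier_mat (fst M) (fst M)" and cN: "?GN s \<in> carrier_mat (fst N) (fst N)" for s
    using mod_gen_carrier[OF M] mod_gen_carrier[OF N] by auto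
  have cA: "snd N x \<in> carrier_mat (fst N) (fst N)" if "x \<in> carrier (qu_alg n q)" for x by (rule qu_modules_carrier[OF N that])
  have hM: "hom_mat d1 d1 (- 1) (?GM gen_E)" "hom_mat d1 d1 1 (?GM gen_F)" "hom_mat d1 d1 0 (?GM gen_kappa)" "hom_mat d1 d1 0 (?GM gen_kappa_hat)"
    and hN: "hom_mat d2 d2 (- 1) (?GN gen_E)" "hom_mat d2 d2 1 (?GN gen_F)" "hom_mat d2 d2 0 (?GN gen_kappa)" "hom_mat d2 d2 0 (?GN gen_kappa_hat)"
    using gM gN by (auto simp: graded_def homogeneous_def)
  have kM: "?GM gen_kappa = diag_fun (fst M) (\<lambda>i. (- 1) ^ s1 * inverse (q ^ n) powi d1 i)"
    "?GM gen_kappa_hat = diag_fun (fst M) (\<lambda>i. (- 1) ^ s1 * inverse (q ^ n) powi d1 i * q powi (2 * d1 i))"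
    and kN: "?GN gen_kappa = diag_fun (fst N) (\<lambda>i. (- 1) ^ s2 * inverse (q ^ n) powi d2 i)"
    "?GN gen_kappa_hat = diag_fun (fst N) (\<lambda>i. (- 1) ^ s2 * inverse (q ^ n) powi d2 i * q powi (2 * d2 i))"
    using gM gN by (auto simp: graded_def)
  have pw: "hom_mat d1 d1 0 (?GM gen_kappa ^\<^sub>m (n - 1))" using hom_mat_pow[OF cM hM(3), of "n - 1"] by simp
  have cpw: "?GM gen_kappa ^\<^sub>m (n - 1) \<in> carrier_mat (fst M) (fst M)" using cM by simp
  have nzc: "nonzero_idem \<in> carrier (qu_alg n q)" by (rule nonzero_idem_carrier[OF M N])
  have kr: "hom_mat ?dg ?dg (s + t) (kronecker A B)"
    if "A \<in> carrier_mat (fst M) (fst M)" "B \<in> carrier_mat (fst N) (fst N)" "hom_mat d1 d1 s A" "hom_mat d2 d2 t B" for A B s t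
    by (rule hom_mat_kronecker[OF that])
  have kc: "kronecker A B \<in> carrier_mat ?D ?D" if "A \<in> carrier_mat (fst M) (fst M)" "B \<in> carrier_mat (fst N) (fst N)" for A B
    by (rule kronecker_carrier[OF that])
  note TT = mod_gen_qu_tensor[OF M N]
  have kap: "mod_gen n q (qu_tensor n q M N) gen_kappa = diag_fun ?D (\<lambda>i. (- 1) ^ (s1 + s2) * inverse (q ^ n) powi ?dg i)"
    unfolding TT TT_kappa[OF M N] kM kN kronecker_diag_fun by (simp add: power_int_add power_add mult_ac)
  have kaph: "mod_gen n q (qu_tensor n q M N) gen_kappa_hat = diag_fun ?D (\<lambda>i. (- 1) ^ (s1 + s2) * inverse (q ^ n) powi ?dg i * q powi (2 * ?dg i))"
    unfolding TT TT_kappa_hat[OF M N] kM kN kronecker_diag_fun by (simp add: power_int_add power_add distrib_left mult_ac)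
  have dh: "hom_mat ?dg ?dg 0 (diag_fun ?D f)" for f :: "nat \<Rightarrow> 'k"
    by (auto simp: hom_mat_def diag_fun_index)
  have E: "hom_mat ?dg ?dg (- 1) (mod_gen n q (qu_tensor n q M N) gen_E)"
  proof -
    have 1: "hom_mat ?dg ?dg (- 1) (XE M N)"
      unfolding XE_def[OF M N] using kr[OF cM cA[OF flat_inv_carrier] hM(1) deg0_snd(2)] by simp
    have p0: "hom_mat d2 d2 (- 1) (snd N (qu_idem n q 0) * ?GN gen_E)" "hom_mat d2 d2 (- 1) (snd N nonzero_idem * ?GN gen_E)"
      using hom_mat_mult[OF cA cN deg0_snd(1) hN(1)] hom_mat_mult[OF cA[OF nzc] cN deg0_snd(4) hN(1)] by simp_all
    have c0: "snd N (qu_idem n q 0) * ?GN gen_E \<in> carrier_mat (fst N) (fst N)" "snd N nonzero_idem * ?GN gen_E \<in> carrier_mat (fst N) (fst N)"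
      by (rule mult_carrier_mat[OF cA cN], simp) (rule mult_carrier_mat[OF cA[OF nzc] cN])
    have 2: "hom_mat ?dg ?dg (- 1) (YE M N)"
      unfolding YE_def[OF M N]
      using hom_mat_add[OF kc[OF cpw c0(1)] kc[OF one_carrier_mat c0(2)], of ?dg ?dg "- 1"]
        kr[OF cpw c0(1) pw p0(1)] kr[OF one_carrier_mat c0(2) hom_mat_one p0(2)] by simp
    show ?thesis unfolding TT TT_E[OF M N]
      by (rule hom_mat_add[OF XY_carrier(1)[OF M N] XY_carrier(2)[OF M N] 1 2])
  qed
  have F: "hom_mat ?dg ?dg 1 (mod_gen n q (qu_tensor n q M N) gen_F)"
  proof -
    have 1: "hom_mat ?dg ?dg 1 (XF M N)"
      unfolding XF_def[OF M N] using kr[OF cM cA[OF qu_flat_carrier] hM(2) deg0_snd(3)] by simp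
    have p0: "hom_mat d2 d2 1 (?GN gen_F * snd N nonzero_idem)" "hom_mat d2 d2 1 (?GN gen_F * snd N (qu_idem n q 0))"
      using hom_mat_mult[OF cN cA hN(2) deg0_snd(1)] hom_mat_mult[OF cN cA[OF nzc] hN(2) deg0_snd(4)] by simp_all
    have c0: "?GN gen_F * snd N nonzero_idem \<in> carrier_mat (fst N) (fst N)" "?GN gen_F * snd N (qu_idem n q 0) \<in> carrier_mat (fst N) (fst N)"
      by (rule mult_carrier_mat[OF cN cA[OF nzc]]) (rule mult_carrier_mat[OF cN cA], simp)
    have pk: "hom_mat d1 d1 0 (?GM gen_kappa ^\<^sub>m (n - 1) * ?GM gen_kappa_hat)"
      using hom_mat_mult[OF cpw cM pw hM(4)] by simp
    have 2: "hom_mat ?dg ?dg 1 (YF M N)"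
      unfolding YF_def[OF M N]
      using hom_mat_add[OF kc[OF mult_carrier_mat[OF cpw cM] c0(1)] kc[OF cM c0(2)], of ?dg ?dg 1]
        kr[OF mult_carrier_mat[OF cpw cM] c0(1) pk p0(1)] kr[OF cM c0(2) hM(4) p0(2)] by simp
    show ?thesis unfolding TT TT_F[OF M N]
      by (rule hom_mat_add[OF XY_carrier(3)[OF M N] XY_carrier(4)[OF M N] 1 2])
  qed
  show ?thesis
    unfolding graded_def homogeneous_def fst_qu_tensor[OF M N] kap kaph using E F dh by (simp add: kap kaph)
qed

end

lemma graded_sign_mod: "graded s dg M \<Longrightarrow> graded (s mod 2) dg M"
proof -
  have "(- 1) ^ (s mod 2) = ((- 1) ^ s :: 'k)" by (cases "even s") (auto simp: even_iff_mod_2_eq_zero odd_iff_mod_2_eq_one)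
  then show "graded s dg M \<Longrightarrow> graded (s mod 2) dg M" by (simp add: graded_def)
qed

text \<open>The product is graded with degrees (m - r) + (l - t). \<open>graded_class\<close>
  expresses twice its class as a double sum, which \<open>sum_wt_poly_product\<close> evaluates to
  twice the product; \<open>torsion_free\<close> cancels the factor 2.\<close>

lemma class_poly_tensor_simple:
  assumes m: "m < NN" "j < 2" and l: "l < NN" "i < 2"
  shows "class_poly (frag_of (qu_tensor n q (qu_simple m j) (qu_simple l i)))
    \<approx>I class_poly (frag_of (qu_simple m j)) * class_poly (frag_of (qu_simple l i))"
proof -
  let ?S = "qu_simple m j" let ?T = "qu_simple l i"
  note S = qu_simple_in[OF m(1), of j] and T = qu_simple_in[OF l(1), of i]
  have g: "graded ((j + i) mod 2) (\<lambda>k. (int m - int (k div (2 * l + 1))) + (int l - int (k mod (2 * l + 1)))) (qu_tensor n q ?S ?T)"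
    using graded_sign_mod[OF graded_tensor[OF S T graded_simple[OF m(1)] graded_simple[OF l(1)]]] by simp
  have "2 * class_poly (frag_of (qu_tensor n q ?S ?T))
    \<approx>I gvar ^ ((j + i) mod 2) * (\<Sum>k<(2 * m + 1) * (2 * l + 1). wt_poly (int m - int (k div (2 * l + 1)) + (int l - int (k mod (2 * l + 1)))))"
    using graded_class[OF qu_tensor_in[OF S T] _ g] fst_qu_tensor[OF S T] by simp
  also have "(\<Sum>k<(2 * m + 1) * (2 * l + 1). wt_poly (int m - int (k div (2 * l + 1)) + (int l - int (k mod (2 * l + 1)))))
    = 2 * (U_poly m * U_poly l)"
    using sum_div_mod[where f = "\<lambda>a b. wt_poly (int m - int a + (int l - int b))" and a = "2 * m + 1" and b = "2 * l + 1"] sum_wt_poly_product[of m l]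
    by (simp only:)
  also have "gvar ^ ((j + i) mod 2) * (2 * (U_poly m * U_poly l)) \<approx>I gvar ^ (j + i) * (2 * (U_poly m * U_poly l))"
    by (rule cong_mult[OF cong_sym[OF cong_g_mod_2] cong_refl])
  also have "gvar ^ (j + i) * (2 * (U_poly m * U_poly l)) = 2 * ((gvar ^ j * U_poly m) * (gvar ^ i * U_poly l))"
    by (simp add: power_add mult_ac)
  finally show ?thesis unfolding class_poly_simple[OF m] class_poly_simple[OF l] by (rule torsion_free)
qed

text \<open>Both sides are additive on short exact sequences in each argument, so composition series
  reduce the claim to simple modules.\<close>

lemma class_poly_tensor:
  assumes M: "M \<in> qu_modules n q" and N: "N \<in> qu_modules n q"
  shows "class_poly (frag_of (qu_tensor n q M N)) \<approx>I class_poly (frag_of M) * class_poly (frag_of N)"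
  using M
proof (induction M rule: qu_module_induct)
  case (zero M)
  then have 1: "class_poly (frag_of (qu_tensor n q M N)) \<approx>I 0"
    using fst_qu_tensor[OF zero(1) N] by (intro class_poly_zero_module qu_tensor_in N) auto
  have "class_poly (frag_of M) * class_poly (frag_of N) \<approx>I 0 * class_poly (frag_of N)"
    by (rule cong_mult[OF class_poly_zero_module[OF zero] cong_refl])
  from cong_trans[OF 1 cong_sym[OF this[unfolded mult_zero_left]]] show ?case .
next
  case (simple m j)
  note S = qu_simple_in[OF simple(1), of j]
  show ?case using N
  proof (induction N rule: qu_module_induct)
    case (zero N)
    then have 1: "class_poly (frag_of (qu_tensor n q (qu_simple m j) N)) \<approx>I 0"
      using fst_qu_tensor[OF S zero(1)] by (intro class_poly_zero_module qu_tensor_in S) auto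
    have "class_poly (frag_of (qu_simple m j)) * class_poly (frag_of N) \<approx>I class_poly (frag_of (qu_simple m j)) * 0"
      by (rule cong_mult_left[OF class_poly_zero_module[OF zero]])
    from cong_trans[OF 1 cong_sym[OF this[unfolded mult_zero_right]]] show ?case .
  next
    case (simple l i)
    then show ?case using class_poly_tensor_simple \<open>m < NN\<close> \<open>j < 2\<close> by blast
  next
    case (extension L M N)
    note t = qu_short_exact_tensor(2)[OF extension(1-3) S extension(4)]
    have "class_poly (frag_of (qu_tensor n q (qu_simple m j) M))
      \<approx>I class_poly (frag_of (qu_tensor n q (qu_simple m j) L)) + class_poly (frag_of (qu_tensor n q (qu_simple m j) N))"
      by (intro class_poly_short_exact qu_tensor_in S extension t)
    also have "\<dots> \<approx>I class_poly (frag_of (qu_simple m j)) * class_poly (frag_of L) + class_poly (frag_of (qu_simple m j)) * class_poly (frag_of N)"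
      by (intro cong_add extension)
    also have "\<dots> = class_poly (frag_of (qu_simple m j)) * (class_poly (frag_of L) + class_poly (frag_of N))"
      by (rule distrib_left[symmetric])
    also have "\<dots> \<approx>I class_poly (frag_of (qu_simple m j)) * class_poly (frag_of M)"
      by (intro cong_mult_left cong_sym[OF class_poly_short_exact] extension)
    finally show ?case .
  qed
next
  case (extension L M K)
  note t = qu_short_exact_tensor(1)[OF extension(1-3) N extension(4)]
  have "class_poly (frag_of (qu_tensor n q M N))
    \<approx>I class_poly (frag_of (qu_tensor n q L N)) + class_poly (frag_of (qu_tensor n q K N))"
    by (intro class_poly_short_exact qu_tensor_in N extension t)
  also have "\<dots> \<approx>I class_poly (frag_of L) * class_poly (frag_of N) + class_poly (frag_of K) * class_poly (frag_of N)"
    by (intro cong_add extension)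
  also have "\<dots> = (class_poly (frag_of L) + class_poly (frag_of K)) * class_poly (frag_of N)"
    by (rule distrib_right[symmetric])
  also have "\<dots> \<approx>I class_poly (frag_of M) * class_poly (frag_of N)"
    by (intro cong_mult cong_refl cong_sym[OF class_poly_short_exact] extension)
  finally show ?case .
qed

lemma qu_trivial_simple: "qu_trivial = qu_simple 0 0"
proof -
  have "(\<lambda>s. qu_counit s \<cdot>\<^sub>m 1\<^sub>m 1) = (simple_gen 0 0 :: gen \<Rightarrow> 'k mat)"
  proof
    fix s show "qu_counit s \<cdot>\<^sub>m 1\<^sub>m 1 = (simple_gen 0 0 s :: 'k mat)"
      by (cases s) (auto intro!: eq_matI simp: diag_fun_index kap_val_def)
  qed
  then show ?thesis by (simp add: qu_trivial_def qu_simple_def)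
qed

lemma groth_mult_class:
  assumes x: "Poly_Mapping.keys x \<subseteq> qu_modules n q" and y: "Poly_Mapping.keys y \<subseteq> qu_modules n q"
  defines "xy \<equiv> frag_extend (\<lambda>M. frag_extend (\<lambda>N. frag_of (qu_tensor n q M N)) y) x"
  shows "Poly_Mapping.keys xy \<subseteq> qu_modules n q \<and> class_poly xy \<approx>I class_poly x * class_poly y"
proof -
  let ?r = "\<lambda>M. frag_extend (\<lambda>N. frag_of (qu_tensor n q M N))"
  have 1: "Poly_Mapping.keys y \<subseteq> qu_modules n q \<and> Poly_Mapping.keys (?r M y) \<subseteq> qu_modules n q \<and>
    class_poly (?r M y) \<approx>I class_poly (frag_of M) * class_poly y" if M: "M \<in> qu_modules n q" for M
    using y
  proof (induction y rule: frag_induction)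
    case zero
    then show ?case by (simp add: class_poly_0)
  next
    case (one N)
    then show ?case using qu_tensor_in[OF M one] class_poly_tensor[OF M one] by simp
  next
    case (diff a b)
    have k: "Poly_Mapping.keys (a - b) \<subseteq> qu_modules n q" "Poly_Mapping.keys (?r M a - ?r M b) \<subseteq> qu_modules n q"
      using diff keys_diff[of a b] keys_diff[of "?r M a" "?r M b"] by blast+
    have "class_poly (?r M a - ?r M b) = class_poly (?r M a) - class_poly (?r M b)" using diff by (intro class_poly_diff) auto
    also have "\<dots> \<approx>I class_poly (frag_of M) * class_poly a - class_poly (frag_of M) * class_poly b"
      using diff by (intro cong_minus) auto
    also have "\<dots> = class_poly (frag_of M) * class_poly (a - b)" using diff class_poly_diff[of a b] by (simp add: right_diff_distrib)
    finally show ?case using k unfolding frag_extend_diff by blast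
  qed
  let ?e = "frag_extend (\<lambda>M. ?r M y)"
  have "Poly_Mapping.keys x \<subseteq> qu_modules n q \<and> Poly_Mapping.keys (?e x) \<subseteq> qu_modules n q \<and> class_poly (?e x) \<approx>I class_poly x * class_poly y"
    using x
  proof (induction x rule: frag_induction)
    case zero
    then show ?case by (simp add: class_poly_0)
  next
    case (one M)
    then show ?case using 1[OF one] by simp
  next
    case (diff a b)
    have k: "Poly_Mapping.keys (a - b) \<subseteq> qu_modules n q" "Poly_Mapping.keys (?e a - ?e b) \<subseteq> qu_modules n q"
      using diff keys_diff[of a b] keys_diff[of "?e a" "?e b"] by blast+
    have "class_poly (?e a - ?e b) = class_poly (?e a) - class_poly (?e b)" using diff by (intro class_poly_diff) auto
    also have "\<dots> \<approx>I class_poly a * class_poly y - class_poly b * class_poly y"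
      using diff by (intro cong_minus) auto
    also have "\<dots> = class_poly (a - b) * class_poly y" using diff class_poly_diff[of a b] by (simp add: left_diff_distrib)
    finally show ?case using k unfolding frag_extend_diff by blast
  qed
  then show ?thesis by (simp add: xy_def)
qed

definition fibre :: "int poly poly \<Rightarrow> ('k qu_module \<Rightarrow>\<^sub>0 int) set" where
  "fibre p = {x. Poly_Mapping.keys x \<subseteq> qu_modules n q \<and> class_poly x \<approx>I p}"

lemma fibre_cong: "p \<approx>I p' \<Longrightarrow> fibre p = fibre p'"
  unfolding fibre_def using cong_trans cong_sym by blast

lemma simple_frag_keys: "Poly_Mapping.keys (simple_frag c) \<subseteq> qu_modules n q"
proof -
  have "simple_frag c \<in> carrier (free_Abelian_group (qu_modules n q))"
    unfolding simple_frag_def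
  proof (intro sum_closed_free_Abelian_group)
    fix m j assume "m \<in> {..<NN}" "j \<in> {..<2::nat}"
    then show "frag_cmul (c m j) (frag_of (qu_simple m j)) \<in> carrier (free_Abelian_group (qu_modules n q))"
      using keys_cmul[of "c m j" "frag_of (qu_simple m j)"] qu_simple_in by auto
  qed
  then show ?thesis by (simp only: carrier_free_Abelian_group_iff)
qed

lemma fibre_nonempty: "\<exists>x. x \<in> fibre p"
proof -
  obtain c where c: "p \<approx>I comb c" using comb_surj by blast
  have "class_poly (simple_frag c) = comb c" by (rule class_poly_eq) (simp add: ses_0)
  then have "simple_frag c \<in> fibre p" using cong_sym[OF c] simple_frag_keys by (simp add: fibre_def)
  then show ?thesis by blast
qed

section \<open>Transport of the ring structure to K_0\<close>

abbreviation "GR \<equiv> groth_free n q"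
abbreviation "KR \<equiv> grothendieck_ring n q"

lemma carrier_groth_iff: "x \<in> carrier GR \<longleftrightarrow> Poly_Mapping.keys x \<subseteq> qu_modules n q"
  by (simp add: groth_free_def)

lemma coset_fibre:
  assumes x: "Poly_Mapping.keys x \<subseteq> qu_modules n q"
  shows "ses_subgroup n q +>\<^bsub>GR\<^esub> x = fibre (class_poly x)"
proof -
  have "y \<in> ses_subgroup n q +>\<^bsub>GR\<^esub> x \<longleftrightarrow> y \<in> fibre (class_poly x)" for y
  proof -
    have 1: "y \<in> ses_subgroup n q +>\<^bsub>GR\<^esub> x \<longleftrightarrow> y - x \<in> ses_subgroup n q"
      unfolding a_r_coset_def' by (auto simp: groth_free_def intro: bexI[of _ "y - x"])
    have 2: "Poly_Mapping.keys y \<subseteq> qu_modules n q" if "y - x \<in> ses_subgroup n q"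
      using keys_add[of "y - x" x] ses_subgroup_keys[OF that] x by auto
    have 3: "y - x \<in> ses_subgroup n q \<longleftrightarrow> class_poly y \<approx>I class_poly x" if y: "Poly_Mapping.keys y \<subseteq> qu_modules n q"
    proof -
      have "Poly_Mapping.keys (y - x) \<subseteq> qu_modules n q" using keys_diff[of y x] x y by blast
      from class_poly_ses_iff[OF this] show ?thesis using class_poly_diff[OF y x] by (simp add: cong_I_def)
    qed
    show ?thesis unfolding 1 using 2 3 by (auto simp: fibre_def)
  qed
  then show ?thesis by blast
qed

lemma carrier_KR: "carrier KR = range fibre"
proof
  have "carrier KR = (\<Union>x\<in>carrier GR. {ses_subgroup n q +>\<^bsub>GR\<^esub> x})"
    unfolding grothendieck_ring_def FactRing_def A_RCOSETS_def' by simp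
  then have KR: "carrier KR = (\<lambda>x. fibre (class_poly x)) ` {x. Poly_Mapping.keys x \<subseteq> qu_modules n q}"
    using coset_fibre by (auto simp: carrier_groth_iff)
  then show "carrier KR \<subseteq> range fibre" by auto
  show "range fibre \<subseteq> carrier KR"
  proof (rule image_subsetI)
    fix p
    obtain x where "x \<in> fibre p" using fibre_nonempty by blast
    then have "Poly_Mapping.keys x \<subseteq> qu_modules n q" "fibre p = fibre (class_poly x)"
      using fibre_cong[of "class_poly x" p] by (auto simp: fibre_def)
    then show "fibre p \<in> carrier KR" unfolding KR by blast
  qed
qed

lemma fibre_add: "fibre p \<oplus>\<^bsub>KR\<^esub> fibre p' = fibre (p + p')"
proof -
  have e: "fibre p \<oplus>\<^bsub>KR\<^esub> fibre p' = {x + y | x y. x \<in> fibre p \<and> y \<in> fibre p'}"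
    unfolding grothendieck_ring_def FactRing_def by (auto simp: set_add_def' groth_free_def)
  have sub: "x + y \<in> fibre (p + p')" if "x \<in> fibre p" "y \<in> fibre p'" for x y
    using that keys_add[of x y] by (auto simp: fibre_def class_poly_add intro: cong_add)
  have "z \<in> fibre p \<oplus>\<^bsub>KR\<^esub> fibre p'" if z: "z \<in> fibre (p + p')" for z
  proof -
    obtain x where x: "x \<in> fibre p" using fibre_nonempty by blast
    have kx: "Poly_Mapping.keys x \<subseteq> qu_modules n q" and kz: "Poly_Mapping.keys z \<subseteq> qu_modules n q" using x z by (auto simp: fibre_def)
    have "class_poly z - class_poly x \<approx>I (p + p') - p" using x z by (intro cong_minus) (auto simp: fibre_def)
    then have "z - x \<in> fibre p'" using kx kz keys_diff[of z x] class_poly_diff[OF kz kx] by (auto simp: fibre_def)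
    moreover have "z = x + (z - x)" by simp
    ultimately show ?thesis unfolding e using x by blast
  qed
  then show ?thesis using sub unfolding e by blast
qed

text \<open>In the quotient record the product of two cosets is a union over all pairs of
  representatives. By multiplicativity of \<open>class_poly\<close> every pair gives the same coset,
  and since fibres are nonempty the union is that coset.\<close>

lemma fibre_mult: "fibre p \<otimes>\<^bsub>KR\<^esub> fibre p' = fibre (p * p')"
proof -
  have e: "fibre p \<otimes>\<^bsub>KR\<^esub> fibre p' = (\<Union>x\<in>fibre p. \<Union>y\<in>fibre p'. ses_subgroup n q +>\<^bsub>GR\<^esub> (x \<otimes>\<^bsub>GR\<^esub> y))"
    unfolding grothendieck_ring_def FactRing_def by (simp add: rcoset_mult_def)
  have "ses_subgroup n q +>\<^bsub>GR\<^esub> (x \<otimes>\<^bsub>GR\<^esub> y) = fibre (p * p')" if "x \<in> fibre p" "y \<in> fibre p'" for x y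
  proof -
    have x: "Poly_Mapping.keys x \<subseteq> qu_modules n q" "class_poly x \<approx>I p" and y: "Poly_Mapping.keys y \<subseteq> qu_modules n q" "class_poly y \<approx>I p'"
      using that by (auto simp: fibre_def)
    have "x \<otimes>\<^bsub>GR\<^esub> y = frag_extend (\<lambda>M. frag_extend (\<lambda>N. frag_of (qu_tensor n q M N)) y) x" by (simp add: groth_free_def)
    then have k: "Poly_Mapping.keys (x \<otimes>\<^bsub>GR\<^esub> y) \<subseteq> qu_modules n q" and c: "class_poly (x \<otimes>\<^bsub>GR\<^esub> y) \<approx>I class_poly x * class_poly y"
      using groth_mult_class[OF x(1) y(1)] by simp_all
    show ?thesis unfolding coset_fibre[OF k] by (rule fibre_cong[OF cong_trans[OF c cong_mult[OF x(2) y(2)]]])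
  qed
  moreover obtain x y where "x \<in> fibre p" "y \<in> fibre p'" using fibre_nonempty by blast
  ultimately show ?thesis unfolding e by blast
qed

lemma fibre_one: "\<one>\<^bsub>KR\<^esub> = fibre 1"
proof -
  have t: "qu_trivial \<in> qu_modules n q" "class_poly (frag_of qu_trivial) = 1"
    using qu_simple_in[OF NN_pos] class_poly_simple[OF NN_pos, of 0] by (simp_all add: qu_trivial_simple)
  have "\<one>\<^bsub>KR\<^esub> = ses_subgroup n q +>\<^bsub>GR\<^esub> frag_of qu_trivial"
    unfolding grothendieck_ring_def FactRing_def by (simp add: groth_free_def)
  also have "\<dots> = fibre 1" using coset_fibre[of "frag_of qu_trivial"] t by simp
  finally show ?thesis .
qed

lemma fibre_zero: "\<zero>\<^bsub>KR\<^esub> = fibre 0"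
proof -
  have "\<zero>\<^bsub>KR\<^esub> = ses_subgroup n q" unfolding grothendieck_ring_def FactRing_def by simp
  also have "\<dots> = fibre 0"
  proof (rule Set.set_eqI)
    fix x
    show "x \<in> ses_subgroup n q \<longleftrightarrow> x \<in> fibre 0"
      unfolding fibre_def cong_I_def diff_0_right mem_Collect_eq
      using class_poly_ses_iff[of x] ses_subgroup_keys[of x n q] by blast
  qed
  finally show ?thesis .
qed

abbreviation "ZZ \<equiv> ring_of_type_algebra :: int poly poly ring"

lemma fibre_hom: "fibre \<in> Ring.ring_hom ZZ KR"
  by (rule ring_hom_memI) (auto simp: ring_of_type_algebra_def carrier_KR fibre_add fibre_mult fibre_one)

text \<open>The image of a ring under a homomorphism is a ring, and replacing carrier and zero by
  those of the image leaves \<open>KR\<close> as it is.\<close>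

lemma ring_KR: "ring KR"
proof -
  interpret Z: ring ZZ by (rule ring_from_type_algebra)
  have "ring (KR \<lparr>carrier := fibre ` carrier ZZ, zero := fibre \<zero>\<^bsub>ZZ\<^esub>\<rparr>)"
    by (rule Z.ring_hom_imp_img_ring[OF fibre_hom])
  moreover have "KR \<lparr>carrier := fibre ` carrier ZZ, zero := fibre \<zero>\<^bsub>ZZ\<^esub>\<rparr> = KR"
    using carrier_KR fibre_zero by (simp add: ring_of_type_algebra_def)
  ultimately show ?thesis by simp
qed

lemma grothendieck_ring_iso:
  "KR \<simeq> ring_of_type_algebra Quot (Idl\<^bsub>ring_of_type_algebra\<^esub> {gvar ^ 2 - 1, P_poly})"
proof -
  interpret h: ring_hom_ring ZZ KR fibre
    by (intro ring_hom_ringI2 ring_from_type_algebra ring_KR fibre_hom)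
  have "fibre p = fibre 0 \<longleftrightarrow> p \<in> I_set" for p
  proof
    assume e: "fibre p = fibre 0"
    obtain x where "x \<in> fibre p" using fibre_nonempty by blast
    then have "class_poly x \<approx>I p" "class_poly x \<approx>I 0" using e by (auto simp: fibre_def)
    then have "p \<approx>I 0" using cong_trans cong_sym by blast
    then show "p \<in> I_set" by (simp add: cong_I_def)
  next
    assume "p \<in> I_set"
    then show "fibre p = fibre 0" by (intro fibre_cong) (simp add: cong_I_def)
  qed
  then have ker: "a_kernel ZZ KR fibre = I_set"
    unfolding a_kernel_def' fibre_zero by (auto simp: ring_of_type_algebra_def)
  have "ZZ Quot (a_kernel ZZ KR fibre) \<simeq> KR"
    by (rule h.FactRing_iso) (simp add: carrier_KR ring_of_type_algebra_def)
  then have "ZZ Quot I_set \<simeq> KR" unfolding ker .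
  then have "KR \<simeq> ZZ Quot I_set"
    by (rule ring_iso_sym[OF ideal.quotient_is_ring[OF ideal_I]])
  then show ?thesis unfolding Idl_eq .
qed

end

theorem theorem4p9:
  fixes n :: nat and q :: "'k::{alg_closed_field, field_char_0}"
  assumes "n > 0" and "4 dvd n"
    and "q ^ (n ^ 2) = 1" and "\<forall>m. 0 < m \<and> m < n ^ 2 \<longrightarrow> q ^ m \<noteq> 1"
  shows "ring (grothendieck_ring n q) \<and>
    grothendieck_ring n q \<simeq>
      ring_of_type_algebra Quot
        (Idl\<^bsub>ring_of_type_algebra\<^esub>
          {gvar ^ 2 - 1,
           fpoly (n ^ 2 div 2 - 1) 0 * xvar - 2 * fpoly (n ^ 2 div 2 - 1) 1
             - fpoly (n ^ 2 div 2 - 2) 0 - 2})"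
proof -
  interpret qu_setup n q
    using assms by unfold_locales auto
  show ?thesis
    using ring_KR grothendieck_ring_iso unfolding P_poly_def unfolding NN_def by blast
qed

end
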